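(* Let $f$ be a nondegenerate and convenient Laurent polynomial on $(\mathbb{C}^* )^2$ with spectrum at infinity $\alpha_1,\dots,\alpha_\mu$. Assume that the Newton polytope $P$ of $f$ is Fano. Then $$\sum_{i=1}^{\mu}(\alpha_i-1)^2=\frac{\mu_P}{6}+\frac{\mu_{P^\circ}}{6},$$ where $P^\circ$ is the polar polytope of $P$. In particular, $\frac{1}{\mu}\sum_{i=1}^{\mu}(\alpha_i-1)^2\ge\frac16$.
   Context: Let $N=\mathbb{Z}^2$ with dual lattice $M$. For $f(\underline{u})=\sum_{a\in\mathbb{Z}^2}c_a\underline{u}^a$ on $U=(\mathbb{C}^* )^2$, the Newton polytope $P\subset N_{\mathbb{R}}=\mathbb{R}^2$ is the convex hull of the $a$ with $c_a\neq0$. $f$ is convenient if $0\in\mathrm{Int}\,P$, and nondegenerate if for every proper face $F$ of $P$ the system $u_1\partial f_F/\partial u_1=u_2\partial f_F/\partial u_2=0$ has no solution in $(\mathbb{C}^* )^2$, where $f_F=\sum_{a\in F}c_a\underline{u}^a$. The global Milnor number $\mu$ is the number of critical points of $f$ counted with multiplicities. $P$ (full dimensional lattice polytope with the origin in its interior) is Fano if its vertices are primitive lattice points of $N$ (it is not required to be smooth). $P^\circ=\{m\in M_{\mathbb{R}}:\langle m,x\rangle\le1\ \text{for all } x\in P\}$. $\mu_P=2!\,\mathrm{vol}(P)$, $\mu_{P^\circ}=2!\,\mathrm{vol}(P^\circ)$, volumes normalized so that the unit lattice square has volume $1$. Newton function: for each facet $F$ of $P$ let $u_F\in M_{\mathbb{Q}}$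 be such that $P\subset\{\langle u_F,\cdot\rangle\le1\}$ and $F=P\cap\{\langle u_F,\cdot\rangle=1\}$; $\nu(v)=\max_F\langle u_F,v\rangle$. Spectrum at infinity. Let $G=\Omega^2(U)[\theta,\theta^{-1}]/(\theta d-df\wedge)\Omega^{1}(U)[\theta,\theta^{-1}]$, $G_0$ the image of $\Omega^2(U)[\theta]$, $\tau=\theta^{-1}$, where $\partial_\tau$ acts on classes of forms $\omega\in\Omega^2(U)$ by $\partial_\tau[\omega]=-[f\omega]$. Let $V_\bullet G$ be the increasing $V$-filtration along $\tau=0$ ($\tau V_\alpha=V_{\alpha-1}$ and $\tau\partial_\tau+\alpha$ nilpotent on $\mathrm{Gr}^V_\alpha G$). It induces a filtration on the $\mu$-dimensional space $\Omega_f:=\Omega^2(U)/df\wedge\Omega^{1}(U)=G_0/\theta G_0$, and the spectrum at infinity is the sequence $\alpha_1\le\dots\le\alpha_\mu$ in which $\alpha$ occurs $\dim_{\mathbb{C}}\mathrm{Gr}^V_\alpha\Omega_f$ times. For convenient nondegenerate $f$ it is known (Douai-Sabbah) that this filtration may be replaced by the one induced on $\Omega_f$ by the Newton filtration $\mathcal{N}_\alpha\Omega^2(U)=\mathrm{span}\{\underline{u}^c\frac{du_1\wedge du_2}{u_1u_2}:\ c\in N,\ \nu(c)\le\alpha\}$. *)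

theory Defs
  imports
    "HOL-Analysis.Analysis"
    "HOL-Library.Poly_Mapping"
    "HOL-Computational_Algebra.Formal_Power_Series"
begin

section \<open>Laurent polynomials on the torus\<close>

text \<open>
  The Laurent polynomial \<open>\<Sum>\<^sub>a c\<^sub>a u\<^sup>a\<close> is the finitely supported function
  \<open>a \<mapsto> c\<^sub>a\<close> on \<open>\<int>\<^sup>2\<close>; the ring structure is the convolution product.
\<close>

type_synonym laurent = "(int \<times> int) \<Rightarrow>\<^sub>0 complex"

definition torus :: "(complex \<times> complex) set" where
  "torus = {u. fst u \<noteq> 0 \<and> snd u \<noteq> 0}"

definition laurent_eval :: "laurent \<Rightarrow> complex \<times> complex \<Rightarrow> complex" where
  "laurent_eval g u =
     (\<Sum>a\<in>Poly_Mapping.keys g. Poly_Mapping.lookup g a * fst u powi fst a * snd u powi snd a)"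

definition pderiv1 :: "laurent \<Rightarrow> laurent" where
  "pderiv1 g = (\<Sum>a\<in>Poly_Mapping.keys g.
     Poly_Mapping.single (fst a - 1, snd a) (of_int (fst a) * Poly_Mapping.lookup g a))"

definition pderiv2 :: "laurent \<Rightarrow> laurent" where
  "pderiv2 g = (\<Sum>a\<in>Poly_Mapping.keys g.
     Poly_Mapping.single (fst a, snd a - 1) (of_int (snd a) * Poly_Mapping.lookup g a))"

text \<open>The logarithmic derivatives \<open>u\<^sub>i \<partial>/\<partial>u\<^sub>i\<close>.\<close>

definition euler1 :: "laurent \<Rightarrow> laurent" where
  "euler1 g = Poly_Mapping.single (1, 0) 1 * pderiv1 g"

definition euler2 :: "laurent \<Rightarrow> laurent" where
  "euler2 g = Poly_Mapping.single (0, 1) 1 * pderiv2 g"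


section \<open>Newton polytopes\<close>

definition lattice_point :: "int \<times> int \<Rightarrow> real \<times> real" where
  "lattice_point a = (of_int (fst a), of_int (snd a))"

definition newton_polytope :: "laurent \<Rightarrow> (real \<times> real) set" where
  "newton_polytope f = convex hull (lattice_point ` Poly_Mapping.keys f)"

definition convenient :: "laurent \<Rightarrow> bool" where
  "convenient f \<longleftrightarrow> 0 \<in> interior (newton_polytope f)"

definition face_part :: "laurent \<Rightarrow> (real \<times> real) set \<Rightarrow> laurent" where
  "face_part f F = (\<Sum>a | a \<in> Poly_Mapping.keys f \<and> lattice_point a \<in> F.
     Poly_Mapping.single a (Poly_Mapping.lookup f a))"

text \<open>The library's \<open>face_of\<close> admits the empty face, which has to be excluded here.\<close>

definition nondegenerate :: "laurent \<Rightarrow> bool" where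
  "nondegenerate f \<longleftrightarrow>
     (\<forall>F. F face_of newton_polytope f \<longrightarrow> F \<noteq> {} \<longrightarrow> F \<noteq> newton_polytope f \<longrightarrow>
        \<not> (\<exists>u\<in>torus. laurent_eval (euler1 (face_part f F)) u = 0 \<and>
                     laurent_eval (euler2 (face_part f F)) u = 0))"

definition fano_polytope :: "(real \<times> real) set \<Rightarrow> bool" where
  "fano_polytope P \<longleftrightarrow>
     (\<exists>A. finite A \<and> P = convex hull (lattice_point ` A)) \<and> 0 \<in> interior P \<and>
     (\<forall>v. v extreme_point_of P \<longrightarrow> (\<exists>a. v = lattice_point a \<and> coprime (fst a) (snd a)))"

text \<open>\<open>M\<^sub>\<real>\<close> is identified with \<open>\<real>\<^sup>2\<close> by means of the standard inner product.\<close>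

definition polar_polytope :: "(real \<times> real) set \<Rightarrow> (real \<times> real) set" where
  "polar_polytope P = {m. \<forall>x\<in>P. m \<bullet> x \<le> 1}"

definition normalized_volume :: "(real \<times> real) set \<Rightarrow> real" where
  "normalized_volume P = fact 2 * measure lborel P"


section \<open>Dimension of a quotient space\<close>

text \<open>
  \<open>quot_dim s V W\<close> is the dimension of \<open>V / W\<close> for linear subspaces \<open>W \<subseteq> V\<close>, with \<open>s\<close> the
  scalar multiplication: the cardinality of a basis of a complement of \<open>W\<close> in \<open>V\<close>.
  As usual for \<open>card\<close>, it is \<open>0\<close> if the quotient is infinite-dimensional.
\<close>

definition quot_dim :: "(complex \<Rightarrow> 'a::ab_group_add \<Rightarrow> 'a) \<Rightarrow> 'a set \<Rightarrow> 'a set \<Rightarrow> nat" where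
  "quot_dim s V W = card (SOME B. B \<subseteq> V \<and> \<not> module.dependent s B \<and>
     module.span s B \<inter> W = {0} \<and> (\<forall>v\<in>V. \<exists>b\<in>module.span s B. v - b \<in> W))"


section \<open>Global Milnor number\<close>

text \<open>
  Taylor expansion of a Laurent polynomial at a point \<open>p\<close> of the torus: the coefficient of
  \<open>x\<^sup>i y\<^sup>j\<close> in \<open>g (fst p + x, snd p + y)\<close>, where \<open>x\<close> is the variable of the outer and \<open>y\<close> the
  variable of the inner power series.
\<close>

definition taylor_at :: "complex \<times> complex \<Rightarrow> laurent \<Rightarrow> complex fps fps" where
  "taylor_at p g = Abs_fps (\<lambda>i. Abs_fps (\<lambda>j. \<Sum>a\<in>Poly_Mapping.keys g.
      Poly_Mapping.lookup g a
        * (of_int (fst a) gchoose i) * fst p powi (fst a - int i)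
        * (of_int (snd a) gchoose j) * snd p powi (snd a - int j)))"

definition scale_series :: "complex \<Rightarrow> complex fps fps \<Rightarrow> complex fps fps" where
  "scale_series c x = fps_const (fps_const c) * x"

text \<open>
  The multiplicity of a critical point \<open>p\<close> is the local Milnor number
  \<open>dim \<complex>[[x,y]] / (\<partial>f/\<partial>u\<^sub>1, \<partial>f/\<partial>u\<^sub>2)\<close> at \<open>p\<close>.
\<close>

definition critical_points :: "laurent \<Rightarrow> (complex \<times> complex) set" where
  "critical_points f =
     {p \<in> torus. laurent_eval (pderiv1 f) p = 0 \<and> laurent_eval (pderiv2 f) p = 0}"

definition critical_multiplicity :: "laurent \<Rightarrow> complex \<times> complex \<Rightarrow> nat" where
  "critical_multiplicity f p = quot_dim scale_series UNIV
     {g * taylor_at p (pderiv1 f) + h * taylor_at p (pderiv2 f) | g h. True}"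

definition milnor_number :: "laurent \<Rightarrow> nat" where
  "milnor_number f = (\<Sum>p\<in>critical_points f. critical_multiplicity f p)"


section \<open>The Gauss-Manin module and its V-filtration\<close>

text \<open>
  \<open>\<Omega>\<^sup>2(U)\<close> is identified with the Laurent polynomials through the generator
  \<open>du\<^sub>1 \<and> du\<^sub>2 / (u\<^sub>1 u\<^sub>2)\<close>, and \<open>\<Omega>\<^sup>1(U)\<close> with pairs \<open>(g\<^sub>1, g\<^sub>2)\<close> through
  \<open>g\<^sub>1 du\<^sub>1/u\<^sub>1 + g\<^sub>2 du\<^sub>2/u\<^sub>2\<close>. A \<open>theta_laurent\<close> is an element of \<open>\<Omega>\<^sup>2(U)[\<theta>, \<theta>\<^sup>-\<^sup>1]\<close>, its value
  at \<open>k\<close> being the coefficient of \<open>\<theta>\<^sup>k\<close>.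
\<close>

type_synonym theta_laurent = "int \<Rightarrow>\<^sub>0 laurent"

definition scale_forms :: "complex \<Rightarrow> theta_laurent \<Rightarrow> theta_laurent" where
  "scale_forms c x = Poly_Mapping.single 0 (Poly_Mapping.single 0 c) * x"

definition theta :: theta_laurent where
  "theta = Poly_Mapping.single 1 1"

definition tau :: theta_laurent where
  "tau = Poly_Mapping.single (- 1) 1"

text \<open>The \<open>\<theta>\<close>-linear extensions of \<open>d\<close> and \<open>df\<and>\<close> from \<open>\<Omega>\<^sup>1(U)\<close> to \<open>\<Omega>\<^sup>2(U)\<close>.\<close>

definition ext_deriv :: "theta_laurent \<times> theta_laurent \<Rightarrow> theta_laurent" where
  "ext_deriv \<eta> = Poly_Mapping.map euler1 (snd \<eta>) - Poly_Mapping.map euler2 (fst \<eta>)"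

definition df_wedge :: "laurent \<Rightarrow> theta_laurent \<times> theta_laurent \<Rightarrow> theta_laurent" where
  "df_wedge f \<eta> = Poly_Mapping.single 0 (euler1 f) * snd \<eta> - Poly_Mapping.single 0 (euler2 f) * fst \<eta>"

text \<open>
  \<open>G = \<Omega>\<^sup>2(U)[\<theta>, \<theta>\<^sup>-\<^sup>1] / gm_relations f\<close>. Below, subspaces of \<open>G\<close> are represented by their
  full preimages in \<open>\<Omega>\<^sup>2(U)[\<theta>, \<theta>\<^sup>-\<^sup>1]\<close>, that is, by subspaces containing \<open>gm_relations f\<close>.
\<close>

definition gm_relations :: "laurent \<Rightarrow> theta_laurent set" where
  "gm_relations f = {theta * ext_deriv \<eta> - df_wedge f \<eta> | \<eta>. True}"

definition brieskorn_lattice :: "laurent \<Rightarrow> theta_laurent set" where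
  "brieskorn_lattice f =
     {x + y | x y. (\<forall>k\<in>Poly_Mapping.keys x. 0 \<le> k) \<and> y \<in> gm_relations f}"

text \<open>
  \<open>\<partial>\<^sub>\<tau>\<close> is determined by \<open>\<partial>\<^sub>\<tau>[\<omega>] = -[f\<omega>]\<close> for \<open>\<omega> \<in> \<Omega>\<^sup>2(U)\<close> and the Leibniz rule; as
  \<open>\<theta>\<^sup>k = \<tau>\<^sup>-\<^sup>k\<close>, this gives \<open>\<partial>\<^sub>\<tau>(\<theta>\<^sup>k \<omega>) = -k \<theta>\<^sup>k\<^sup>+\<^sup>1 \<omega> - \<theta>\<^sup>k f \<omega>\<close>. The operator preserves
  \<open>gm_relations f\<close>.
\<close>

definition deriv_tau :: "laurent \<Rightarrow> theta_laurent \<Rightarrow> theta_laurent" where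
  "deriv_tau f x =
     (\<Sum>k\<in>Poly_Mapping.keys x. Poly_Mapping.single (k + 1) (of_int (- k) * Poly_Mapping.lookup x k))
     - Poly_Mapping.single 0 f * x"

definition below :: "(real \<Rightarrow> 'a set) \<Rightarrow> real \<Rightarrow> 'a set" where
  "below V \<alpha> = (\<Union>\<beta>\<in>{..<\<alpha>}. V \<beta>)"

text \<open>
  The V-filtration consists of \<open>\<complex>[\<tau>]\<close>-lattices of \<open>G\<close> (stability under \<open>\<tau>\<close> follows from the
  third and the fifth clause). As it is indexed by all real numbers, continuity from the
  right has to be imposed; otherwise \<open>below V\<close> would be admissible together with \<open>V\<close>.
\<close>

definition is_V_filtration :: "laurent \<Rightarrow> (real \<Rightarrow> theta_laurent set) \<Rightarrow> bool" where
  "is_V_filtration f V \<longleftrightarrow>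
     (\<forall>\<alpha>. module.subspace scale_forms (V \<alpha>) \<and> gm_relations f \<subseteq> V \<alpha>) \<and>
     (\<forall>\<alpha>. \<exists>S. finite S \<and>
        V \<alpha> = module.span scale_forms ({tau ^ k * x | k x. x \<in> S} \<union> gm_relations f)) \<and>
     mono V \<and>
     (\<Union>\<alpha>. V \<alpha>) = UNIV \<and>
     (\<forall>\<alpha>. (\<lambda>x. tau * x) ` V \<alpha> = V (\<alpha> - 1)) \<and>
     (\<forall>\<alpha>. V \<alpha> = (\<Inter>\<beta>\<in>{\<alpha><..}. V \<beta>)) \<and>
     (\<forall>\<alpha>. \<forall>x\<in>V \<alpha>. tau * deriv_tau f x \<in> V \<alpha>) \<and>
     (\<forall>\<alpha>. \<exists>n. \<forall>x\<in>V \<alpha>.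
        ((\<lambda>y. tau * deriv_tau f y + scale_forms (of_real \<alpha>) y) ^^ n) x \<in> below V \<alpha>)"

definition V_filtration :: "laurent \<Rightarrow> real \<Rightarrow> theta_laurent set" where
  "V_filtration f = (THE V. is_V_filtration f V)"


section \<open>Spectrum at infinity\<close>

text \<open>
  The preimage in \<open>G\<^sub>0\<close> of the subspace that a subspace \<open>X\<close> of \<open>G\<close> induces on
  \<open>\<Omega>\<^sub>f = G\<^sub>0 / \<theta>G\<^sub>0\<close>.
\<close>

definition induced_on_Omega :: "laurent \<Rightarrow> theta_laurent set \<Rightarrow> theta_laurent set" where
  "induced_on_Omega f X =
     {x + theta * y | x y. x \<in> X \<inter> brieskorn_lattice f \<and> y \<in> brieskorn_lattice f}"

definition spectral_multiplicity :: "laurent \<Rightarrow> real \<Rightarrow> nat" where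
  "spectral_multiplicity f \<alpha> = quot_dim scale_forms
     (induced_on_Omega f (V_filtration f \<alpha>))
     (induced_on_Omega f (below (V_filtration f) \<alpha>))"

definition is_spectrum_at_infinity :: "laurent \<Rightarrow> (nat \<Rightarrow> real) \<Rightarrow> bool" where
  "is_spectrum_at_infinity f \<alpha> \<longleftrightarrow>
     mono_on {1..milnor_number f} \<alpha> \<and>
     (\<forall>a. card {i \<in> {1..milnor_number f}. \<alpha> i = a} = spectral_multiplicity f a)"

lemma vector_space_scale_series: "vector_space scale_series"
  by unfold_locales
    (simp_all add: scale_series_def distrib_left distrib_right mult.assoc
      flip: fps_const_add fps_const_mult)

lemma vector_space_scale_forms: "vector_space scale_forms"
proof
  fix a b :: complex and x y :: theta_laurent
  show "scale_forms a (x + y) = scale_forms a x + scale_forms a y"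
    by (simp add: scale_forms_def distrib_left)
  show "scale_forms (a + b) x = scale_forms a x + scale_forms b x"
    by (simp add: scale_forms_def distrib_right single_add)
  show "scale_forms a (scale_forms b x) = scale_forms (a * b) x"
    by (simp add: scale_forms_def mult_single flip: mult.assoc)
  show "scale_forms 1 x = x"
    by (simp add: scale_forms_def)
qed

end

theory Submission
  imports
    Defs
    "HOL-Real_Asymp.Real_Asymp"
    "HOL-Computational_Algebra.Field_as_Ring"
    "HOL-Computational_Algebra.Polynomial_Factorial"
    "HOL-Computational_Algebra.Fundamental_Theorem_Algebra"
begin

text \<open>
  Let \<open>N \<alpha>\<close> be the number of lattice points \<open>v\<close> with \<open>\<nu> v = \<alpha>\<close>. On a facet, nondegeneracy means that
  the leading parts of \<open>u\<^sub>1 \<partial>f/\<partial>u\<^sub>1\<close> and \<open>u\<^sub>2 \<partial>f/\<partial>u\<^sub>2\<close> have no common zero on the torus; gluing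
  the facets, the Koszul complex of the leading parts is exact for the Newton grading. Hence \<open>df\<and>\<close> is strict for the Newton filtration, the \<open>\<theta>\<close>-extension of the Newton filtration
  is the V-filtration, and the multiplicity of \<open>\<alpha>\<close> in the spectrum is \<open>N \<alpha> - 2 N (\<alpha> - 1) + N (\<alpha> - 2)\<close>.
  In terms of exponential sums, \<open>\<Sum>\<^sub>i exp (- t \<alpha>\<^sub>i) = (1 - exp (- t))\<^sup>2 L t\<close> with \<open>L t = \<Sum>\<^sub>v exp (- t \<nu> v)\<close>.

  Splitting the quadrants repeatedly along mediants gives unimodular cones on which \<open>\<nu>\<close> is linear, so
  \<open>L t\<close> is a finite sum of products of geometric series. Its expansion at \<open>t = 0\<close> is
  \<open>\<mu>\<^sub>P / t\<^sup>2 + \<mu>\<^sub>P\<^sub>\<circ> / 12 + o(1)\<close>: splitting the cone of \<open>v\<close> and \<open>w\<close> cuts off a triangle of area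
  \<open>(\<nu> v + \<nu> w - \<nu> (v + w))\<^sup>2 / 2\<close> from a corner of the outer approximation of \<open>P\<^sup>\<circ>\<close> by the half planes of the
  rays, and the terms caused by a bend of \<open>\<nu>\<close> at a ray \<open>v\<close> have the factor \<open>1 / \<nu> v - \<nu> v\<close>, which is
  \<open>0\<close> because the vertices of \<open>P\<close> are primitive. Comparing the coefficients of
  \<open>\<Sum>\<^sub>i exp (- t (\<alpha>\<^sub>i - 1)) = (exp (t / 2) - exp (- t / 2))\<^sup>2 L t\<close> gives \<open>\<mu> = \<mu>\<^sub>P\<close> and the variance.
\<close>

section \<open>Lattice polygons\<close>

text \<open>\<open>V_filtration\<close> is a definite description, so the Newton filtration has to
  satisfy all clauses and to be the only solution. The delicate clause is finite generation: it
  needs the graded Jacobian ring to vanish in large degrees. This is obtained analytically: its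
  dimensions \<open>N \<alpha> - 2 N (\<alpha> - 1) + N (\<alpha> - 2)\<close> are natural numbers
  whose exponential sum stays bounded as t tends to 0, so only finitely many are nonzero. The
  lattice sum is therefore used before the V-filtration is identified. The number \<mu> enters
  through the definition of the spectrum: the range \<open>{1..milnor_number f}\<close> carries
  every value with its multiplicity, so \<mu> is the sum of the multiplicities, the leading
  coefficient of the expansion. Both terms with 1/6 are twice 1/12: for the polar volume this is the
  coefficient of s in 1/(e^s - 1), for the volume of \<open>P\<close> the coefficient of t^4 in
  \<open>(exp (t / 2) - exp (- t / 2))\<^sup>2\<close>. The factor 2 is the 2! of the second
  moment.\<close>

definition crs :: "real \<times> real \<Rightarrow> real \<times> real \<Rightarrow> real" where
  "crs x y = fst x * snd y - snd x * fst y"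

lemma crs_simps [simp]:
  "crs x x = 0" "crs (x + y) z = crs x z + crs y z" "crs x (y + z) = crs x y + crs x z"
  "crs (r *\<^sub>R x) z = r * crs x z" "crs x (r *\<^sub>R z) = r * crs x z" "crs 0 x = 0" "crs x 0 = 0"
  "crs (x - y) z = crs x z - crs y z" "crs x (y - z) = crs x y - crs x z"
  "crs (- x) z = - crs x z" "crs x (- z) = - crs x z"
  by (simp_all add: crs_def algebra_simps)

lemma crs_commute: "crs x y = - crs y x"
  by (simp add: crs_def)

text \<open>The Pluecker relation between the minors of four plane vectors; it transports signs of
  determinants when the order of rays around the origin is determined.\<close>

lemma crs_plucker: "crs p v * crs y q - crs p y * crs v q + crs p q * crs v y = 0"
  by (simp add: crs_def algebra_simps)

text \<open>Cramer's rule with the denominator cleared, so that dependent \<open>p\<close> and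
  \<open>q\<close> are covered too.\<close>

lemma crs_expand: "crs p q *\<^sub>R x = crs x q *\<^sub>R p + crs p x *\<^sub>R q"
  by (rule prod_eqI) (simp_all add: crs_def algebra_simps)

lemma crs_expand_div: "crs p q \<noteq> 0 \<Longrightarrow> x = (crs x q / crs p q) *\<^sub>R p + (crs p x / crs p q) *\<^sub>R q"
  using crs_expand[of p q x]
  by (metis (no_types, lifting) divideR_right divide_inverse_commute scaleR_scaleR scaleR_right_distrib)

lemma inner_crs: "crs p q * (m \<bullet> x) = crs x q * (m \<bullet> p) + crs p x * (m \<bullet> q)"
  by (metis crs_expand inner_add_right inner_scaleR_right)

text \<open>A line that misses the origin meets a line through the origin in at most one
  point.\<close>

lemma collinear_eq:
  fixes x y x' y' a b :: real
  assumes "x * y' = y * x'" "a * x + b * y = 1" "a * x' + b * y' = 1"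
  shows "x = x'" "y = y'"
proof -
  have "x * (a * x' + b * y') = x' * (a * x) + b * (x * y')" by (simp add: algebra_simps)
  also have "\<dots> = x' * (a * x + b * y)" unfolding assms(1) by (simp add: algebra_simps)
  finally show "x = x'" using assms by simp
  have "y * (a * x' + b * y') = a * (y * x') + b * y * y'" by (simp add: algebra_simps)
  also have "\<dots> = y' * (a * x + b * y)" unfolding assms(1)[symmetric] by (simp add: algebra_simps)
  finally show "y = y'" using assms by simp
qed

lemma open_segmentI:
  "a \<noteq> b \<Longrightarrow> 0 < u \<Longrightarrow> u < 1 \<Longrightarrow> x = (1 - u) *\<^sub>R a + u *\<^sub>R b \<Longrightarrow> x \<in> open_segment a b"
  by (auto simp: in_segment)

definition icr :: "int \<times> int \<Rightarrow> int \<times> int \<Rightarrow> int" where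
  "icr v w = fst v * snd w - snd v * fst w"

lemma crs_lattice_point: "crs (lattice_point v) (lattice_point w) = of_int (icr v w)"
  by (simp add: crs_def icr_def lattice_point_def)

lemma lattice_point_add: "lattice_point (v + w) = lattice_point v + lattice_point w"
  by (simp add: lattice_point_def)

lemma lattice_point_0 [simp]: "lattice_point 0 = 0"
  by (simp add: lattice_point_def zero_prod_def)

lemma lattice_point_eq_iff [simp]: "lattice_point v = lattice_point w \<longleftrightarrow> v = w"
  by (auto simp: lattice_point_def prod_eq_iff)

lemma icr_add: "icr (u + v) w = icr u w + icr v w" "icr u (v + w) = icr u v + icr u w" "icr u u = 0"
  by (simp_all add: icr_def algebra_simps)

lemma icr_anti: "icr u v = - icr v u"
  by (simp add: icr_def)

lemma icr_expand:
  assumes "icr v w = 1"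
  shows "lattice_point p = of_int (icr p w) *\<^sub>R lattice_point v + of_int (icr v p) *\<^sub>R lattice_point w"
  using crs_expand[of "lattice_point v" "lattice_point w" "lattice_point p"] assms
  by (simp add: crs_lattice_point)

text \<open>With the last assumption \<open>E\<close> is exactly the set of vertices, since extreme
  points of a hull belong to the generators. This is what makes a facet carry just two elements of
  \<open>E\<close>.\<close>

locale polygon =
  fixes E :: "(int \<times> int) set" and P :: "(real \<times> real) set"
  assumes finite_E: "finite E"
    and P_hull: "P = convex hull (lattice_point ` E)"
    and zero_int: "0 \<in> interior P"
    and extreme_E: "e \<in> E \<Longrightarrow> lattice_point e extreme_point_of P"
begin

abbreviation "lp \<equiv> lattice_point"

text \<open>The support function of the polar polytope. It is the gauge of \<open>P\<close>
  (\<open>mem_P_iff\<close>) and agrees with the facet functional on each facet cone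
  (\<open>nu_cone\<close>), hence it is the Newton function. In this form subadditivity and
  homogeneity are immediate.\<close>

definition nu :: "real \<times> real \<Rightarrow> real" where
  "nu x = Sup ((\<lambda>m. m \<bullet> x) ` polar_polytope P)"

text \<open>A facet is recorded by its end points in counterclockwise order together with its
  functional; membership in the polar polytope says that \<open>P\<close> lies on the correct
  side.\<close>

definition facet :: "int \<times> int \<Rightarrow> int \<times> int \<Rightarrow> real \<times> real \<Rightarrow> bool" where
  "facet p q m \<longleftrightarrow> p \<in> E \<and> q \<in> E \<and> crs (lp p) (lp q) > 0 \<and> m \<bullet> lp p = 1 \<and> m \<bullet> lp q = 1 \<and> m \<in> polar_polytope P"

lemma E_in_P: "e \<in> E \<Longrightarrow> lp e \<in> P"
  unfolding P_hull by (simp add: hull_inc)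

lemma compact_P: "compact P" and closed_P: "closed P" and convex_P: "convex P" and zero_P: "0 \<in> P"
proof -
  show "compact P" unfolding P_hull by (intro finite_imp_compact_convex_hull finite_imageI finite_E)
  then show "closed P" by (rule compact_imp_closed)
  show "convex P" by (simp add: P_hull)
  show "0 \<in> P" using zero_int interior_subset by blast
qed

lemma mem_polar_iff_E: "m \<in> polar_polytope P \<longleftrightarrow> (\<forall>e\<in>E. m \<bullet> lp e \<le> 1)"
proof
  assume *: "\<forall>e\<in>E. m \<bullet> lp e \<le> 1"
  have "P \<subseteq> {x. m \<bullet> x \<le> 1}"
    unfolding P_hull by (rule hull_minimal) (use * in \<open>auto simp: convex_halfspace_le\<close>)
  then show "m \<in> polar_polytope P" by (auto simp: polar_polytope_def)
qed (auto simp: polar_polytope_def E_in_P)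

lemma compact_polar: "compact (polar_polytope P)"
proof -
  have "polar_polytope P = (\<Inter>x\<in>P. {m. m \<bullet> x \<le> 1})" by (auto simp: polar_polytope_def)
  also have "closed \<dots>" by (auto intro!: closed_INT closed_Collect_le continuous_intros)
  finally have "closed (polar_polytope P)" .
  moreover obtain r where r: "r > 0" "cball 0 r \<subseteq> P"
    using zero_int mem_interior_cball by blast
  have "norm m \<le> 1 / r" if m: "m \<in> polar_polytope P" for m
  proof (cases "m = 0")
    case False
    \<comment> \<open>The multiple of \<open>m\<close> of length \<open>r\<close> lies in the ball
      inside \<open>P\<close>; testing \<open>m\<close> on it bounds the norm of
      \<open>m\<close>.\<close>
    have "(r / norm m) *\<^sub>R m \<in> P" using r False by (intro set_mp[OF r(2)]) (simp add: dist_norm)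
    then have "m \<bullet> ((r / norm m) *\<^sub>R m) \<le> 1" using m by (auto simp: polar_polytope_def)
    then have "r * norm m \<le> 1" using False by (simp add: dot_square_norm power2_eq_square)
    then show ?thesis using r(1) by (simp add: field_simps)
  qed (use r in simp)
  then have "bounded (polar_polytope P)" unfolding bounded_iff by blast
  ultimately show ?thesis by (simp add: compact_eq_bounded_closed)
qed

lemma zero_polar: "0 \<in> polar_polytope P" by (simp add: polar_polytope_def)

lemma bdd_nu: "bdd_above ((\<lambda>m. m \<bullet> x) ` polar_polytope P)"
  by (intro bounded_imp_bdd_above compact_imp_bounded compact_continuous_image compact_polar continuous_intros)

lemma nu_ge: "m \<in> polar_polytope P \<Longrightarrow> m \<bullet> x \<le> nu x"
  unfolding nu_def by (rule cSUP_upper[OF _ bdd_nu])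

lemma nu_attained: obtains m where "m \<in> polar_polytope P" "m \<bullet> x = nu x"
proof -
  have "\<exists>m\<in>polar_polytope P. \<forall>m'\<in>polar_polytope P. m' \<bullet> x \<le> m \<bullet> x"
    by (intro continuous_attains_sup compact_polar continuous_intros) (use zero_polar in blast)
  then obtain m where m: "m \<in> polar_polytope P" "\<And>m'. m' \<in> polar_polytope P \<Longrightarrow> m' \<bullet> x \<le> m \<bullet> x" by blast
  have "nu x \<le> m \<bullet> x" unfolding nu_def using zero_polar m(2) by (intro cSUP_least) auto
  then show ?thesis using that m(1) nu_ge[OF m(1), of x] by auto
qed

lemma nu_add: "nu (x + y) \<le> nu x + nu y"
proof -
  obtain m where m: "m \<in> polar_polytope P" "m \<bullet> (x + y) = nu (x + y)" by (rule nu_attained)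
  show ?thesis using nu_ge[OF m(1), of x] nu_ge[OF m(1), of y] m(2) by (simp add: inner_add_right)
qed

lemma nu_scale: assumes "t \<ge> 0" shows "nu (t *\<^sub>R x) = t * nu x"
proof (rule antisym)
  obtain m where m: "m \<in> polar_polytope P" "m \<bullet> (t *\<^sub>R x) = nu (t *\<^sub>R x)" by (rule nu_attained)
  have "m \<bullet> (t *\<^sub>R x) \<le> t * nu x" using nu_ge[OF m(1), of x] assms by (simp add: mult_left_mono)
  then show "nu (t *\<^sub>R x) \<le> t * nu x" using m(2) by simp
  obtain m where m: "m \<in> polar_polytope P" "m \<bullet> x = nu x" by (rule nu_attained)
  show "t * nu x \<le> nu (t *\<^sub>R x)" using nu_ge[OF m(1), of "t *\<^sub>R x"] m(2) by simp
qed

lemma nu_0 [simp]: "nu 0 = 0" using nu_scale[of 0 0] by simp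

lemma nu_pos: assumes "x \<noteq> 0" shows "nu x > 0"
proof -
  obtain B where B: "B > 0" "\<forall>y\<in>P. norm y \<le> B" using compact_imp_bounded[OF compact_P] bounded_pos by blast
  \<comment> \<open>Since \<open>P\<close> lies in the ball of radius \<open>B\<close>, this scaling
    puts a positive multiple of \<open>x\<close> into the polar polytope.\<close>
  define m where "m = (1 / (B * norm x)) *\<^sub>R x"
  have "m \<bullet> y \<le> 1" if "y \<in> P" for y
  proof -
    have "m \<bullet> y \<le> norm m * norm y" by (rule norm_cauchy_schwarz)
    also have "\<dots> \<le> norm m * B" using B(2) that by (intro mult_left_mono) auto
    also have "\<dots> = 1" using B(1) assms by (simp add: m_def)
    finally show ?thesis .
  qed
  then have "m \<in> polar_polytope P" by (simp add: polar_polytope_def)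
  moreover have "m \<bullet> x = norm x / B" using assms B(1) by (simp add: m_def dot_square_norm power2_eq_square)
  then have "m \<bullet> x > 0" using assms B(1) by simp
  ultimately show ?thesis using nu_ge[of m x] by linarith
qed

lemma nu_nonneg: "nu x \<ge> 0" using nu_pos[of x] by (cases "x = 0") auto

abbreviation "n v \<equiv> nu (lp v)"

lemma n_pos: "a \<noteq> 0 \<Longrightarrow> n a > 0"
  using nu_pos[of "lp a"] lattice_point_eq_iff[of a 0] by (auto simp del: lattice_point_eq_iff)

text \<open>The bipolar theorem: a point outside \<open>P\<close> is separated from it by a line,
  which can be normalised because 0 lies in \<open>P\<close>.\<close>

lemma mem_P_iff: "x \<in> P \<longleftrightarrow> nu x \<le> 1"
proof
  assume x: "x \<in> P"
  obtain m where "m \<in> polar_polytope P" "m \<bullet> x = nu x" by (rule nu_attained)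
  then show "nu x \<le> 1" using x unfolding polar_polytope_def by fastforce
next
  assume nu: "nu x \<le> 1"
  show "x \<in> P"
  proof (rule ccontr)
    assume "x \<notin> P"
    then obtain a b where ab: "a \<bullet> x < b" "\<forall>y\<in>P. a \<bullet> y > b"
      using separating_hyperplane_closed_point[OF convex_P closed_P] by blast
    have b: "b < 0" using ab(2) zero_P by force
    \<comment> \<open>\<open>b\<close> is negative, so dividing by it turns the lower bound
      \<open>b\<close> on \<open>P\<close> into the upper bound 1.\<close>
    define m where "m = (1 / b) *\<^sub>R a"
    have "m \<bullet> y \<le> 1" if "y \<in> P" for y
    proof -
      have "a \<bullet> y > b" using ab(2) that by blast
      then have "(a \<bullet> y) / b \<le> 1" using b by (simp add: divide_le_eq)
      then show ?thesis by (simp add: m_def)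
    qed
    then have "m \<in> polar_polytope P" by (simp add: polar_polytope_def)
    moreover have "m \<bullet> x > 1"
    proof -
      have "(a \<bullet> x) / b > 1" using ab(1) b by (simp add: less_divide_eq)
      then show ?thesis by (simp add: m_def)
    qed
    ultimately show False using nu nu_ge[of m x] by linarith
  qed
qed

lemma mem_polar_iff: "m \<in> polar_polytope P \<longleftrightarrow> (\<forall>x. m \<bullet> x \<le> nu x)"
proof
  assume *: "\<forall>x. m \<bullet> x \<le> nu x"
  have "m \<bullet> x \<le> 1" if "x \<in> P" for x
  proof -
    have "nu x \<le> 1" using that by (simp only: mem_P_iff)
    then show ?thesis using *[rule_format, of x] by (rule order_trans[rotated])
  qed
  then show "m \<in> polar_polytope P" by (simp add: polar_polytope_def)
qed (simp add: nu_ge)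

lemma normalize_mem_P: assumes "x \<noteq> 0" shows "(1 / nu x) *\<^sub>R x \<in> P"
  using nu_pos[OF assms] by (simp add: mem_P_iff nu_scale)

lemma zero_not_E: assumes "e \<in> E" shows "lp e \<noteq> 0"
proof
  assume "lp e = 0"
  then have "0 extreme_point_of P" using extreme_E[OF assms] by simp
  then show False using zero_int extreme_point_not_in_interior by blast
qed

text \<open>If \<open>nu\<close> were smaller than 1 at a vertex, the vertex would lie strictly
  between the origin and its multiple of gauge 1, which is a point of \<open>P\<close>.\<close>

lemma nu_E: assumes "e \<in> E" shows "nu (lp e) = 1"
proof (rule ccontr)
  assume "nu (lp e) \<noteq> 1"
  then have lt: "nu (lp e) < 1" using E_in_P[OF assms] by (simp add: mem_P_iff)
  have pos: "nu (lp e) > 0" using nu_pos zero_not_E[OF assms] by blast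
  have "lp e \<in> open_segment 0 ((1 / nu (lp e)) *\<^sub>R lp e)"
    unfolding in_segment using lt pos zero_not_E[OF assms] by (auto intro!: exI[of _ "nu (lp e)"])
  then show False using extreme_E[OF assms] zero_P normalize_mem_P[OF zero_not_E[OF assms]]
    by (auto simp: extreme_point_of_def)
qed

section \<open>Facets and the cones over them\<close>

lemma facet_expand:
  assumes "facet p q m"
  shows "x = (crs x (lp q) / crs (lp p) (lp q)) *\<^sub>R lp p + (crs (lp p) x / crs (lp p) (lp q)) *\<^sub>R lp q"
  using assms by (intro crs_expand_div) (simp add: facet_def)

lemma facet_inner:
  assumes "facet p q m"
  shows "m \<bullet> x = (crs x (lp q) + crs (lp p) x) / crs (lp p) (lp q)"
  using inner_crs[of "lp p" "lp q" m x] assms by (simp add: facet_def field_simps)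

text \<open>The functional \<open>m\<close> bounds \<open>nu\<close> from below everywhere;
  subadditivity and the value 1 at both vertices give the matching upper bound on their
  cone.\<close>

lemma nu_cone:
  assumes F: "facet p q m" and x: "crs (lp p) x \<ge> 0" "crs x (lp q) \<ge> 0"
  shows "nu x = m \<bullet> x"
proof (rule antisym)
  show "m \<bullet> x \<le> nu x" using F nu_ge by (simp add: facet_def)
  let ?a = "crs x (lp q) / crs (lp p) (lp q)" and ?b = "crs (lp p) x / crs (lp p) (lp q)"
  have ab: "?a \<ge> 0" "?b \<ge> 0" using F x by (simp_all add: facet_def)
  have "nu x \<le> nu (?a *\<^sub>R lp p) + nu (?b *\<^sub>R lp q)" using facet_expand[OF F, of x] nu_add by metis
  also have "\<dots> = ?a + ?b" using ab F by (simp add: nu_scale nu_E facet_def)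
  also have "\<dots> = m \<bullet> x" using facet_inner[OF F, of x] by (simp add: add_divide_distrib)
  finally show "nu x \<le> m \<bullet> x" .
qed

text \<open>An element of \<open>E\<close> on the supporting line is an affine combination of
  \<open>p\<close> and \<open>q\<close>; of three distinct collinear points one lies strictly
  between the others and is not extreme.\<close>

lemma facet_E_only:
  assumes F: "facet p q m" and e: "e \<in> E" "m \<bullet> lp e = 1"
  shows "e = p \<or> e = q"
proof (rule ccontr)
  assume neq: "\<not> (e = p \<or> e = q)"
  have inj: "lp x = lp y \<longleftrightarrow> x = y" for x y by (auto simp: lattice_point_def prod_eq_iff)
  let ?D = "crs (lp p) (lp q)"
  define b where "b = crs (lp p) (lp e) / ?D"
  have D: "?D > 0" using F by (simp add: facet_def)
  have "crs (lp e) (lp q) / ?D = 1 - b"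
    using facet_inner[OF F, of "lp e"] e D by (simp add: b_def field_simps)
  then have eq: "lp e = (1 - b) *\<^sub>R lp p + b *\<^sub>R lp q" using facet_expand[OF F, of "lp e"] by (simp add: b_def)
  have pq: "p \<in> E" "q \<in> E" "lp p \<noteq> lp q" using F D by (auto simp: facet_def)
  have b01: "b \<noteq> 0" "b \<noteq> 1" using eq neq inj[of e p] inj[of e q] by fastforce+
  have ext: "lp x \<notin> open_segment (lp y) (lp z)" if "x \<in> E" "y \<in> E" "z \<in> E" for x y z
    using extreme_E[OF that(1)] E_in_P that by (auto simp: extreme_point_of_def)
  consider "b < 0" | "0 < b" "b < 1" | "b > 1" using b01 by linarith
  then show False
  proof cases
    case 1
    \<comment> \<open>Solves the affine relation for \<open>p\<close>, which lies between
      \<open>e\<close> and \<open>q\<close> when \<open>b\<close> is negative.\<close>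
    define c where "c = 1 / (1 - b)"
    have c: "c * (1 - b) = 1" "0 < c" "c < 1" using 1 by (simp_all add: c_def)
    have *: "c * ((1 - b) * x + b * y) + (1 - c) * y = x" for x y
    proof -
      have "c * ((1 - b) * x + b * y) + (1 - c) * y = (c * (1 - b)) * x + y - (c * (1 - b)) * y"
        by (simp only: algebra_simps mult_1_left mult_1_right)
      then show ?thesis unfolding c(1) by simp
    qed
    have "lp p = (1 - (1 - c)) *\<^sub>R lp e + (1 - c) *\<^sub>R lp q"
      unfolding eq using *[of "fst (lp p)" "fst (lp q)"] *[of "snd (lp p)" "snd (lp q)"]
      by (intro prod_eqI) simp_all
    then have "lp p \<in> open_segment (lp e) (lp q)"
      by (rule open_segmentI[rotated 3]) (use c neq inj[of e q] in simp_all)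
    then show False using ext[of p e q] pq e by simp
  next
    case 2
    have "lp e \<in> open_segment (lp p) (lp q)"
      by (rule open_segmentI[OF _ _ _ eq]) (use 2 pq in simp_all)
    then show False using ext[of e p q] pq e by simp
  next
    case 3
    define c where "c = 1 / b"
    have c: "c * b = 1" "0 < c" "c < 1" using 3 by (simp_all add: c_def)
    have *: "(1 - c) * x + c * ((1 - b) * x + b * y) = y" for x y
    proof -
      have "(1 - c) * x + c * ((1 - b) * x + b * y) = x - (c * b) * x + (c * b) * y"
        by (simp only: algebra_simps mult_1_left mult_1_right)
      then show ?thesis unfolding c(1) by simp
    qed
    have "lp q = (1 - c) *\<^sub>R lp p + c *\<^sub>R lp e"
      unfolding eq using *[of "fst (lp p)" "fst (lp q)"] *[of "snd (lp p)" "snd (lp q)"]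
      by (intro prod_eqI) simp_all
    then have "lp q \<in> open_segment (lp p) (lp e)"
      by (rule open_segmentI[rotated 3]) (use c neq inj[of e p] in auto)
    then show False using ext[of q p e] pq e by simp
  qed
qed

text \<open>In a convex combination of vertices for a point of the supporting line, the defects
  \<open>1 - m \<bullet> lp e\<close> are nonnegative with weighted sum 0, so each vertex that is
  used lies on that line.\<close>

lemma P_face_combination:
  assumes "x \<in> P" "m \<in> polar_polytope P" "m \<bullet> x = 1"
  obtains u where "\<And>e. e \<in> E \<Longrightarrow> u e \<ge> (0::real)" "sum u E = 1" "x = (\<Sum>e\<in>E. u e *\<^sub>R lp e)"
    "\<And>e. e \<in> E \<Longrightarrow> u e \<noteq> 0 \<Longrightarrow> m \<bullet> lp e = 1"
proof -
  have inj: "inj_on lp E" by (auto simp: inj_on_def lattice_point_def prod_eq_iff)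
  obtain w where w: "\<forall>y\<in>lp ` E. 0 \<le> w y" "sum w (lp ` E) = 1" "(\<Sum>y\<in>lp ` E. w y *\<^sub>R y) = x"
    using assms(1) unfolding P_hull convex_hull_finite[OF finite_imageI[OF finite_E]] by blast
  define u where "u = w \<circ> lp"
  have u: "\<And>e. e \<in> E \<Longrightarrow> u e \<ge> 0" "sum u E = 1" "x = (\<Sum>e\<in>E. u e *\<^sub>R lp e)"
    using w by (simp_all add: u_def sum.reindex[OF inj])
  have le: "m \<bullet> lp e \<le> 1" if "e \<in> E" for e using assms(2) that mem_polar_iff_E by blast
  have "(\<Sum>e\<in>E. u e * (1 - m \<bullet> lp e)) = sum u E - m \<bullet> x"
    by (simp add: u(3) inner_sum_right algebra_simps sum_subtractf)
  then have "(\<Sum>e\<in>E. u e * (1 - m \<bullet> lp e)) = 0" using u(2) assms(3) by simp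
  then have "\<forall>e\<in>E. u e * (1 - m \<bullet> lp e) = 0"
    using u(1) le by (subst (asm) sum_nonneg_eq_0_iff) (auto simp: finite_E)
  then show ?thesis using u by (intro that[of u]) auto
qed

text \<open>Converse of \<open>nu_cone\<close>: after scaling, \<open>x\<close> lies on the face cut
  out by \<open>m\<close>, whose only vertices are \<open>p\<close> and \<open>q\<close>.\<close>

lemma cone_if_nu_eq:
  assumes F: "facet p q m" and x: "nu x = m \<bullet> x"
  shows "crs (lp p) x \<ge> 0 \<and> crs x (lp q) \<ge> 0"
proof (cases "x = 0")
  case False
  let ?y = "(1 / nu x) *\<^sub>R x"
  have c: "nu x > 0" using nu_pos[OF False] .
  have "m \<bullet> ?y = 1" using x c by simp
  then obtain u where u: "\<And>e. e \<in> E \<Longrightarrow> u e \<ge> (0::real)" "?y = (\<Sum>e\<in>E. u e *\<^sub>R lp e)"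
    "\<And>e. e \<in> E \<Longrightarrow> u e \<noteq> 0 \<Longrightarrow> m \<bullet> lp e = 1"
    using P_face_combination[OF normalize_mem_P[OF False], of m] F unfolding facet_def by metis
  have D: "crs (lp p) (lp q) > 0" "p \<in> E" "q \<in> E" using F by (auto simp: facet_def)
  then have pq: "p \<noteq> q" by auto
  have "(\<Sum>e\<in>E. u e *\<^sub>R lp e) = (\<Sum>e\<in>{p,q}. u e *\<^sub>R lp e)"
    by (rule sum.mono_neutral_right) (use u(3) facet_E_only[OF F] D finite_E in auto)
  then have y: "?y = u p *\<^sub>R lp p + u q *\<^sub>R lp q" using u(2) pq by simp
  have "crs (lp p) ?y \<ge> 0" "crs ?y (lp q) \<ge> 0" unfolding y using D u(1) by auto
  then show ?thesis using c by (simp add: zero_le_divide_iff)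
qed simp

text \<open>Otherwise all vertices, and with them \<open>P\<close>, would lie in a closed half plane
  bounded by the line through the origin and \<open>x\<close>, and the origin could not be
  interior.\<close>

lemma exists_E_left:
  assumes "x \<noteq> 0" shows "\<exists>e\<in>E. crs x (lp e) > 0"
proof (rule ccontr)
  assume "\<not> ?thesis"
  then have *: "\<And>e. e \<in> E \<Longrightarrow> crs x (lp e) \<le> 0" by force
  define j where "j = (- snd x, fst x)"
  have j: "crs x y = j \<bullet> y" for y by (simp add: j_def crs_def inner_prod_def)
  have "j \<noteq> 0" using assms by (auto simp: j_def zero_prod_def prod_eq_iff)
  have "P \<subseteq> {y. j \<bullet> y \<le> 0}"
    unfolding P_hull by (rule hull_minimal) (use * in \<open>auto simp: convex_halfspace_le simp flip: j\<close>, simp add: j convex_halfspace_le)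
  then have "interior P \<subseteq> {y. j \<bullet> y < 0}" using interior_mono interior_halfspace_le[OF \<open>j \<noteq> 0\<close>] by metis
  then show False using zero_int by auto
qed

text \<open>A supporting line through \<open>p\<close> is turned about \<open>p\<close> until it
  hits the next vertex counterclockwise.\<close>

lemma facet_from:
  assumes "p \<in> E" obtains q m where "facet p q m"
proof -
  obtain m0 where m0: "m0 \<in> polar_polytope P" "m0 \<bullet> lp p = 1" using nu_attained nu_E[OF assms] by metis
  define j where "j = (- snd (lp p), fst (lp p))"
  have j: "j \<bullet> y = crs (lp p) y" for y by (simp add: j_def crs_def inner_prod_def)
  define R where "R = {e \<in> E. crs (lp p) (lp e) > 0}"
  \<comment> \<open>The amount by which \<open>m0\<close> can be turned before the vertex
    \<open>e\<close> reaches the supporting line; the minimum over the vertices to the left of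
    \<open>p\<close> is admissible for all of them.\<close>
  define h where "h = (\<lambda>e. (1 - m0 \<bullet> lp e) / crs (lp p) (lp e))"
  have R: "finite R" "R \<noteq> {}" using exists_E_left[OF zero_not_E[OF assms]] finite_E by (auto simp: R_def)
  obtain q where q: "q \<in> R" "\<And>e. e \<in> R \<Longrightarrow> h q \<le> h e"
    using arg_min_if_finite[OF R, of h] by (metis not_le)
  define m where "m = m0 + h q *\<^sub>R j"
  have le: "m0 \<bullet> lp e \<le> 1" if "e \<in> E" for e using m0(1) that mem_polar_iff_E by blast
  have hq: "h q \<ge> 0" using q(1) le by (simp add: h_def R_def)
  have me: "m \<bullet> lp e = m0 \<bullet> lp e + h q * crs (lp p) (lp e)" for e by (simp add: m_def inner_add_left j)
  have "m \<bullet> lp e \<le> 1" if e: "e \<in> E" for e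
  proof (cases "e \<in> R")
    case True
    then have "h q * crs (lp p) (lp e) \<le> h e * crs (lp p) (lp e)"
      using q(2) by (intro mult_right_mono) (auto simp: R_def)
    also have "\<dots> = 1 - m0 \<bullet> lp e" using True by (simp add: h_def R_def)
    finally show ?thesis by (simp add: me)
  next
    case False
    then have "h q * crs (lp p) (lp e) \<le> 0" using hq e by (simp add: R_def mult_nonneg_nonpos)
    then show ?thesis using le[OF e] by (simp add: me)
  qed
  then have "m \<in> polar_polytope P" by (simp add: mem_polar_iff_E)
  moreover have "m \<bullet> lp q = 1" using q(1) by (simp add: me R_def h_def)
  moreover have "m \<bullet> lp p = 1" using m0 by (simp add: me)
  ultimately have "facet p q m" using q(1) assms by (simp add: facet_def R_def)
  then show ?thesis by (rule that)
qed

text \<open>A functional supporting \<open>P\<close> in direction \<open>x\<close> attains 1 either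
  at two vertices that are the ends of a facet or at a single vertex; in the second case
  \<open>x\<close> is on the ray of that vertex, and any facet starting there will do.\<close>

lemma facet_cover:
  assumes "x \<noteq> 0"
  obtains p q m where "facet p q m" "crs (lp p) x \<ge> 0" "crs x (lp q) \<ge> 0"
proof -
  obtain m where m: "m \<in> polar_polytope P" "m \<bullet> x = nu x" by (rule nu_attained)
  have c: "nu x > 0" by (rule nu_pos[OF assms])
  let ?y = "(1 / nu x) *\<^sub>R x"
  have "m \<bullet> ?y = 1" using m c by simp
  then obtain u where u: "\<And>e. e \<in> E \<Longrightarrow> u e \<ge> (0::real)" "sum u E = 1" "?y = (\<Sum>e\<in>E. u e *\<^sub>R lp e)"
    "\<And>e. e \<in> E \<Longrightarrow> u e \<noteq> 0 \<Longrightarrow> m \<bullet> lp e = 1"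
    using P_face_combination[OF normalize_mem_P[OF assms] m(1)] by metis
  show ?thesis
  proof (cases "\<exists>e\<in>E. \<exists>e'\<in>E. m \<bullet> lp e = 1 \<and> m \<bullet> lp e' = 1 \<and> crs (lp e) (lp e') > 0")
    case True
    then obtain p q where "facet p q m" using m(1) by (auto simp: facet_def)
    then show ?thesis using that cone_if_nu_eq m(2) by metis
  next
    case False
    obtain e0 where e0: "e0 \<in> E" "u e0 \<noteq> 0" using u(2) by (metis sum.neutral zero_neq_one)
    have only: "e = e0" if e: "e \<in> E" "u e \<noteq> 0" for e
    proof -
      have mm: "m \<bullet> lp e = 1" "m \<bullet> lp e0 = 1" using u(4) e e0 by auto
      have "crs (lp e) (lp e0) = 0"
      proof -
        have *: "\<not> crs (lp a) (lp b) > 0" if "a \<in> E" "b \<in> E" "m \<bullet> lp a = 1" "m \<bullet> lp b = 1" for a b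
          using False that by simp
        have "\<not> crs (lp e) (lp e0) > 0" "\<not> crs (lp e0) (lp e) > 0"
          by (rule *[OF e(1) e0(1) mm], rule *[OF e0(1) e(1) mm(2,1)])
        then show ?thesis using crs_commute[of "lp e" "lp e0"] by linarith
      qed
      then have "fst (lp e) * snd (lp e0) = snd (lp e) * fst (lp e0)" by (simp add: crs_def)
      moreover have "fst m * fst (lp e) + snd m * snd (lp e) = 1" "fst m * fst (lp e0) + snd m * snd (lp e0) = 1"
        using mm by (simp_all add: inner_prod_def)
      ultimately have "lp e = lp e0" by (intro prod_eqI) (rule collinear_eq; assumption)+
      then show ?thesis by (auto simp: lattice_point_def prod_eq_iff)
    qed
    have "u e = 0" if "e \<in> E - {e0}" for e using only[of e] that by blast
    then have "(\<Sum>e\<in>E. u e *\<^sub>R lp e) = (\<Sum>e\<in>{e0}. u e *\<^sub>R lp e)"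
      using e0 finite_E by (intro sum.mono_neutral_right) simp_all
    then have y: "?y = u e0 *\<^sub>R lp e0" using u(3) by simp
    have x: "x = (nu x * u e0) *\<^sub>R lp e0"
    proof -
      have "x = nu x *\<^sub>R ?y" using c by simp
      also have "\<dots> = nu x *\<^sub>R (u e0 *\<^sub>R lp e0)" by (simp only: y)
      also have "\<dots> = (nu x * u e0) *\<^sub>R lp e0" by (rule scaleR_scaleR)
      finally show ?thesis .
    qed
    obtain q m' where F: "facet e0 q m'" using facet_from[OF e0(1)] .
    have "crs (lp e0) x = (nu x * u e0) * crs (lp e0) (lp e0)" by (metis x crs_simps(5))
    then have "crs (lp e0) x \<ge> 0" by simp
    moreover have "crs x (lp q) = (nu x * u e0) * crs (lp e0) (lp q)" by (metis x crs_simps(4))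
    then have "crs x (lp q) \<ge> 0" using c u(1)[OF e0(1)] F by (simp add: facet_def)
    ultimately show ?thesis using that[OF F] by blast
  qed
qed

text \<open>The facet cone containing \<open>v + w\<close> contains \<open>v\<close> and
  \<open>w\<close> too: a boundary ray that separated one of them from \<open>v + w\<close> would
  pass through a vertex strictly inside the cone of \<open>v\<close> and \<open>w\<close>.\<close>

lemma nu_linear_on_empty_cone:
  assumes vw: "crs v w > 0" and empty: "\<And>e. e \<in> E \<Longrightarrow> \<not> (crs v (lp e) > 0 \<and> crs (lp e) w > 0)"
  obtains p q m where "facet p q m" "nu v = m \<bullet> v" "nu w = m \<bullet> w"
proof -
  define y where "y = v + w"
  have y: "crs v y = crs v w" "crs y w = crs v w" by (simp_all add: y_def)
  then have "y \<noteq> 0" using vw by auto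
  then obtain p q m where F: "facet p q m" and yc: "crs (lp p) y \<ge> 0" "crs y (lp q) \<ge> 0" by (rule facet_cover)
  let ?p = "lp p" and ?q = "lp q"
  have D: "crs ?p ?q > 0" "p \<in> E" "q \<in> E" using F by (auto simp: facet_def)
  have py: "crs ?p y > 0"
  proof (rule ccontr)
    assume "\<not> crs ?p y > 0"
    then have z: "crs ?p y = 0" using yc by simp
    then have *: "crs ?p ?q *\<^sub>R y = crs y ?q *\<^sub>R ?p" using crs_expand[of ?p ?q y] by simp
    have pos: "crs y ?q > 0" using * D \<open>y \<noteq> 0\<close> yc by (cases "crs y ?q = 0") auto
    have "crs y ?q * crs v ?p = crs ?p ?q * crs v y" using * by (metis crs_simps(5))
    then have "crs v ?p > 0" using pos D vw y by (metis mult_pos_pos zero_less_mult_pos)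
    moreover have "crs y ?q * crs ?p w = crs ?p ?q * crs y w" using * by (metis crs_simps(4))
    then have "crs ?p w > 0" using pos D vw y by (metis mult_pos_pos zero_less_mult_pos)
    ultimately show False using empty D by blast
  qed
  have yq: "crs y ?q > 0"
  proof (rule ccontr)
    assume "\<not> crs y ?q > 0"
    then have z: "crs y ?q = 0" using yc by simp
    then have *: "crs ?p ?q *\<^sub>R y = crs ?p y *\<^sub>R ?q" using crs_expand[of ?p ?q y] by simp
    have "crs ?p y * crs v ?q = crs ?p ?q * crs v y" using * by (metis crs_simps(5))
    then have "crs v ?q > 0" using py D vw y by (metis mult_pos_pos zero_less_mult_pos)
    moreover have "crs ?p y * crs ?q w = crs ?p ?q * crs y w" using * by (metis crs_simps(4))
    then have "crs ?q w > 0" using py D vw y by (metis mult_pos_pos zero_less_mult_pos)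
    ultimately show False using empty D by blast
  qed
  have pv: "crs ?p v \<ge> 0" using empty[OF D(2)] py crs_commute[of v ?p] by (auto simp: y_def)
  have wq: "crs w ?q \<ge> 0" using empty[OF D(3)] yq crs_commute[of w ?q] by (auto simp: y_def)
  have vq: "crs v ?q > 0"
  proof -
    have "crs ?p y * crs v ?q = crs ?p v * crs y ?q + crs ?p ?q * crs v y" using crs_plucker[of ?p v y ?q] by simp
    also have "\<dots> > 0" using pv yq D vw y by (intro add_nonneg_pos) auto
    finally show ?thesis using py by (metis zero_less_mult_pos)
  qed
  have pw: "crs ?p w > 0"
  proof -
    have "crs y ?q * crs ?p w = crs w ?q * crs ?p y + crs ?p ?q * crs y w"
      using crs_plucker[of ?p y w ?q] by (simp add: algebra_simps)
    also have "\<dots> > 0" using wq py D vw y by (intro add_nonneg_pos) auto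
    finally show ?thesis using yq by (metis zero_less_mult_pos)
  qed
  show ?thesis using that[OF F] nu_cone[OF F] pv vq wq pw by simp
qed

end

section \<open>Areas of triangles\<close>

lemma sets_lborel_pair: "sets (lborel \<Otimes>\<^sub>M (lborel :: real measure)) = sets (borel :: (real\<times>real) measure)"
  by (simp only: lborel_prod sets_lborel)

text \<open>By Fubini, since the shear only translates each vertical slice.\<close>

lemma distr_shear1: "distr lborel borel (\<lambda>p::real\<times>real. (fst p, snd p + k * fst p)) = lborel"
proof (rule measure_eqI)
  fix A assume "A \<in> sets (distr lborel borel (\<lambda>p::real\<times>real. (fst p, snd p + k * fst p)))"
  then have A: "A \<in> sets (borel :: (real\<times>real) measure)" by simp
  have A': "A \<in> sets (lborel \<Otimes>\<^sub>M (lborel :: real measure))" using A by (simp only: sets_lborel_pair)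
  let ?T = "\<lambda>p::real\<times>real. (fst p, snd p + k * fst p)"
  have T: "?T \<in> borel_measurable borel" by (simp add: borel_prod[symmetric])
  have TA: "?T -` A \<in> sets (lborel \<Otimes>\<^sub>M (lborel :: real measure))"
    using measurable_sets[OF T A] by (simp only: sets_lborel_pair space_borel Int_UNIV_right)
  have "emeasure (distr lborel borel ?T) A = emeasure (lborel \<Otimes>\<^sub>M lborel) (?T -` A)"
    using T A by (simp add: emeasure_distr lborel_prod)
  also have "\<dots> = (\<integral>\<^sup>+x. emeasure lborel (Pair x -` (?T -` A)) \<partial>lborel)"
    by (rule lborel.emeasure_pair_measure_alt[OF TA])
  also have "\<dots> = (\<integral>\<^sup>+x. emeasure lborel (Pair x -` A) \<partial>lborel)"
  proof (rule nn_integral_cong)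
    fix x :: real
    have s: "Pair x -` A \<in> sets borel" using sets_Pair1[OF A', of x] by simp
    have "emeasure lborel (Pair x -` A) = emeasure (distr lborel borel ((+) (k * x))) (Pair x -` A)"
      by (simp add: lborel_distr_plus)
    also have "\<dots> = emeasure lborel ((+) (k * x) -` (Pair x -` A))"
      using s by (subst emeasure_distr) auto
    also have "(+) (k * x) -` (Pair x -` A) = Pair x -` (?T -` A)" by (auto simp: add.commute)
    finally show "emeasure lborel (Pair x -` (?T -` A)) = emeasure lborel (Pair x -` A)" by simp
  qed
  also have "\<dots> = emeasure lborel A"
    using lborel.emeasure_pair_measure_alt[OF A'] by (simp add: lborel_prod)
  finally show "emeasure (distr lborel borel ?T) A = emeasure lborel A" .
qed simp

lemma distr_shear2: "distr lborel borel (\<lambda>p::real\<times>real. (fst p + k * snd p, snd p)) = lborel"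
proof (rule measure_eqI)
  fix A assume "A \<in> sets (distr lborel borel (\<lambda>p::real\<times>real. (fst p + k * snd p, snd p)))"
  then have A: "A \<in> sets (borel :: (real\<times>real) measure)" by simp
  have A': "A \<in> sets (lborel \<Otimes>\<^sub>M (lborel :: real measure))" using A by (simp only: sets_lborel_pair)
  let ?T = "\<lambda>p::real\<times>real. (fst p + k * snd p, snd p)"
  have T: "?T \<in> borel_measurable borel" by (simp add: borel_prod[symmetric])
  have TA: "?T -` A \<in> sets (lborel \<Otimes>\<^sub>M (lborel :: real measure))"
    using measurable_sets[OF T A] by (simp only: sets_lborel_pair space_borel Int_UNIV_right)
  have "emeasure (distr lborel borel ?T) A = emeasure (lborel \<Otimes>\<^sub>M lborel) (?T -` A)"
    using T A by (simp add: emeasure_distr lborel_prod)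
  also have "\<dots> = (\<integral>\<^sup>+y. emeasure lborel ((\<lambda>x. (x, y)) -` (?T -` A)) \<partial>lborel)"
    by (rule lborel_pair.emeasure_pair_measure_alt2[OF TA])
  also have "\<dots> = (\<integral>\<^sup>+y. emeasure lborel ((\<lambda>x. (x, y)) -` A) \<partial>lborel)"
  proof (rule nn_integral_cong)
    fix y :: real
    have s: "(\<lambda>x. (x, y)) -` A \<in> sets borel" using sets_Pair2[OF A', of y] by simp
    have "emeasure lborel ((\<lambda>x. (x, y)) -` A) = emeasure (distr lborel borel ((+) (k * y))) ((\<lambda>x. (x, y)) -` A)"
      by (simp add: lborel_distr_plus)
    also have "\<dots> = emeasure lborel ((+) (k * y) -` ((\<lambda>x. (x, y)) -` A))"
      using s by (subst emeasure_distr) auto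
    also have "(+) (k * y) -` ((\<lambda>x. (x, y)) -` A) = (\<lambda>x. (x, y)) -` (?T -` A)" by (auto simp: add.commute)
    finally show "emeasure lborel ((\<lambda>x. (x, y)) -` (?T -` A)) = emeasure lborel ((\<lambda>x. (x, y)) -` A)" by simp
  qed
  also have "\<dots> = emeasure lborel A"
    using lborel_pair.emeasure_pair_measure_alt2[OF A'] by (simp add: lborel_prod)
  finally show "emeasure (distr lborel borel ?T) A = emeasure lborel A" .
qed simp

definition lin_map :: "real \<Rightarrow> real \<Rightarrow> real \<Rightarrow> real \<Rightarrow> real \<times> real \<Rightarrow> real \<times> real" where
  "lin_map a b c d p = (a * fst p + b * snd p, c * fst p + d * snd p)"

lemma lin_map_measurable [measurable]: "lin_map a b c d \<in> borel_measurable borel"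
  unfolding lin_map_def by (simp add: borel_prod[symmetric])

lemma distr_comp:
  assumes "distr lborel borel f = lborel" "distr lborel borel g = lborel"
    "f \<in> borel_measurable borel" "g \<in> borel_measurable borel"
  shows "distr lborel borel (f \<circ> g) = (lborel :: (real\<times>real) measure)"
proof -
  have "distr lborel borel (f \<circ> g) = distr (distr lborel borel g) borel f"
    using assms by (subst distr_distr) auto
  then show ?thesis using assms by simp
qed

text \<open>Shears generate the matrices of determinant 1: for nonzero \<open>c\<close> the matrix
  is a product upper times lower times upper triangular. If \<open>c = 0\<close>, adding the first
  row to the second makes this entry nonzero.\<close>

lemma distr_lin_map:
  fixes a b c d :: real
  assumes "a * d - b * c = 1"
  shows "distr lborel borel (lin_map a b c d) = lborel"
proof -
  have U: "distr lborel borel (lin_map 1 k 0 1) = lborel" for k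
    using distr_shear2[of k] by (simp add: lin_map_def[abs_def])
  have L: "distr lborel borel (lin_map 1 0 k 1) = lborel" for k
    using distr_shear1[of k] by (simp add: lin_map_def[abs_def] add.commute)
  have *: "distr lborel borel (lin_map a b c d) = lborel"
    if "a * d - b * c = 1" "c \<noteq> 0" for a b c d
  proof -
    have b: "b = (a * d - 1) / c" using that by (simp add: field_simps)
    have "lin_map a b c d = lin_map 1 ((a - 1) / c) 0 1 \<circ> (lin_map 1 0 c 1 \<circ> lin_map 1 ((d - 1) / c) 0 1)"
      using \<open>c \<noteq> 0\<close> by (auto simp: fun_eq_iff lin_map_def b field_simps)
    then show ?thesis by (simp only:) (intro distr_comp U L; measurable)
  qed
  show ?thesis
  proof (cases "c = 0")
    case True
    then have "a \<noteq> 0" using assms by auto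
    have "lin_map a b c d = lin_map 1 0 (-1) 1 \<circ> lin_map a b (a + c) (b + d)"
      by (auto simp: fun_eq_iff lin_map_def algebra_simps)
    moreover have "distr lborel borel (lin_map a b (a + c) (b + d)) = lborel"
      by (rule *) (use assms True \<open>a \<noteq> 0\<close> in \<open>simp_all add: algebra_simps\<close>)
    ultimately show ?thesis by (simp only:) (intro distr_comp L; measurable)
  qed (use assms * in auto)
qed

lemma emeasure_affine_vimage:
  fixes a b c d s t :: real
  assumes "a * d - b * c = 1" "K \<in> sets borel"
  shows "emeasure lborel {p. (s + (a * fst p + b * snd p), t + (c * fst p + d * snd p)) \<in> K} = emeasure lborel K"
proof -
  have "distr lborel borel ((+) (s, t) \<circ> lin_map a b c d) = lborel"
    by (intro distr_comp distr_lin_map assms lborel_distr_plus) (measurable)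
  then have "emeasure lborel K = emeasure (distr lborel borel ((+) (s, t) \<circ> lin_map a b c d)) K" by simp
  also have "\<dots> = emeasure lborel (((+) (s, t) \<circ> lin_map a b c d) -` K \<inter> space lborel)"
  proof (rule emeasure_distr)
    show "(+) (s, t) \<circ> lin_map a b c d \<in> measurable lborel borel"
      using measurable_comp[of "lin_map a b c d" borel borel "(+) (s, t)" borel] by simp
  qed (use assms in simp)
  also have "((+) (s, t) \<circ> lin_map a b c d) -` K \<inter> space lborel =
     {p. (s + (a * fst p + b * snd p), t + (c * fst p + d * snd p)) \<in> K}"
    by (auto simp: lin_map_def)
  finally show ?thesis by simp
qed

lemma sets_std_triangle: "{p::real\<times>real. fst p \<ge> 0 \<and> snd p > 0 \<and> a * fst p + b * snd p \<le> 1} \<in> sets borel"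
proof -
  have "{p::real\<times>real. fst p \<ge> 0 \<and> snd p > 0 \<and> a * fst p + b * snd p \<le> 1} =
     {p. 0 \<le> fst p} \<inter> {p. 0 < snd p} \<inter> {p. a * fst p + b * snd p \<le> 1}" by auto
  moreover have "{p::real\<times>real. 0 \<le> fst p} \<in> sets borel"
    by (intro borel_closed closed_Collect_le continuous_intros)
  moreover have "{p::real\<times>real. 0 < snd p} \<in> sets borel"
    by (intro borel_open open_Collect_less continuous_intros)
  moreover have "{p::real\<times>real. a * fst p + b * snd p \<le> 1} \<in> sets borel"
    by (intro borel_closed closed_Collect_le continuous_intros)
  ultimately show ?thesis by (simp only: sets.Int)
qed

lemma sets_corner_triangle: "{p::real\<times>real. fst p \<ge> 0 \<and> snd p \<ge> 0 \<and> fst p + snd p < h} \<in> sets borel"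
proof -
  have "{p::real\<times>real. fst p \<ge> 0 \<and> snd p \<ge> 0 \<and> fst p + snd p < h} =
     {p. 0 \<le> fst p} \<inter> {p. 0 \<le> snd p} \<inter> {p. fst p + snd p < h}" by auto
  moreover have "{p::real\<times>real. 0 \<le> fst p} \<in> sets borel"
    by (intro borel_closed closed_Collect_le continuous_intros)
  moreover have "{p::real\<times>real. 0 \<le> snd p} \<in> sets borel"
    by (intro borel_closed closed_Collect_le continuous_intros)
  moreover have "{p::real\<times>real. fst p + snd p < h} \<in> sets borel"
    by (intro borel_open open_Collect_less continuous_intros)
  ultimately show ?thesis by (simp only: sets.Int)
qed

text \<open>Only the lengths of the vertical slices enter, so one computation serves triangles that
  include different boundary edges.\<close>

lemma emeasure_under_line:
  fixes h k :: real and S :: "real \<Rightarrow> real set"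
  assumes K: "{p. fst p \<ge> 0 \<and> snd p \<in> S (fst p)} \<in> sets borel" (is "?K \<in> _")
    and h: "h \<ge> 0" "k \<ge> 0"
    and S: "\<And>x. 0 \<le> x \<Longrightarrow> x \<le> h \<Longrightarrow> emeasure lborel (S x) = ennreal (k * (h - x))"
    and S0: "\<And>x. x > h \<Longrightarrow> S x = {}"
  shows "emeasure lborel {p. fst p \<ge> 0 \<and> snd p \<in> S (fst p)} = ennreal (k * h\<^sup>2 / 2)"
proof -
  have K': "?K \<in> sets (lborel \<Otimes>\<^sub>M (lborel :: real measure))"
    unfolding sets_lborel_pair by (rule K)
  have "emeasure lborel ?K = (\<integral>\<^sup>+x. emeasure lborel (Pair x -` ?K) \<partial>lborel)"
    using lborel.emeasure_pair_measure_alt[OF K'] by (simp only: lborel_prod)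
  also have "\<dots> = (\<integral>\<^sup>+x. ennreal (k * (h - x)) * indicator {0..h} x \<partial>lborel)"
  proof (rule nn_integral_cong)
    fix x :: real
    have *: "Pair x -` ?K = (if 0 \<le> x then S x else {})" by auto
    show "emeasure lborel (Pair x -` ?K) = ennreal (k * (h - x)) * indicator {0..h} x"
      unfolding * using S[of x] S0[of x] by (cases "0 \<le> x"; cases "x \<le> h") simp_all
  qed
  also have "\<dots> = ennreal (k * (h * h - h\<^sup>2 / 2) - k * (h * 0 - 0\<^sup>2 / 2))"
  proof (rule nn_integral_FTC_Icc[where F = "\<lambda>x. k * (h * x - x\<^sup>2 / 2)"])
    fix x assume x: "x \<in> {0..h}"
    show "((\<lambda>x. k * (h * x - x\<^sup>2 / 2)) has_real_derivative k * (h - x)) (at x)"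
      by (rule derivative_eq_intros refl | simp)+
    show "0 \<le> k * (h - x)" using h x by simp
  qed (use h in simp_all)
  also have "k * (h * h - h\<^sup>2 / 2) - k * (h * 0 - 0\<^sup>2 / 2) = k * h\<^sup>2 / 2"
    by (simp add: power2_eq_square)
  finally show ?thesis .
qed

lemma emeasure_std_triangle:
  fixes a b :: real assumes ab: "a > 0" "b > 0"
  shows "emeasure lborel {p::real\<times>real. fst p \<ge> 0 \<and> snd p > 0 \<and> a * fst p + b * snd p \<le> 1} = ennreal (1 / (2 * a * b))"
proof -
  have le: "a * x + b * y \<le> 1 \<longleftrightarrow> y \<le> (a / b) * (1 / a - x)" for x y
  proof -
    have "(a / b) * (1 / a - x) = (1 - a * x) / b" using ab by (simp add: field_simps)
    then show ?thesis using ab by (simp add: pos_le_divide_eq algebra_simps)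
  qed
  let ?S = "\<lambda>x. {0 <.. (a / b) * (1 / a - x)}"
  have eq: "{p::real\<times>real. fst p \<ge> 0 \<and> snd p > 0 \<and> a * fst p + b * snd p \<le> 1} =
      {p. fst p \<ge> 0 \<and> snd p \<in> ?S (fst p)}"
    unfolding le by (simp only: greaterThanAtMost_iff)
  have "emeasure lborel {p. fst p \<ge> 0 \<and> snd p \<in> ?S (fst p)} = ennreal ((a / b) * (1 / a)\<^sup>2 / 2)"
  proof (rule emeasure_under_line)
    show "{p. 0 \<le> fst p \<and> snd p \<in> ?S (fst p)} \<in> sets borel"
      using sets_std_triangle[of a b] unfolding eq .
    show "emeasure lborel (?S x) = ennreal ((a / b) * (1 / a - x))" if "0 \<le> x" "x \<le> 1 / a" for x
    proof -
      have "0 \<le> (a / b) * (1 / a - x)" using ab that by (intro mult_nonneg_nonneg) simp_all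
      then show ?thesis by simp
    qed
    show "?S x = {}" if "x > 1 / a" for x
    proof -
      have "(a / b) * (1 / a - x) < 0" using ab that by (intro mult_pos_neg) simp_all
      then show ?thesis by simp
    qed
  qed (use ab in simp_all)
  also have "(a / b) * (1 / a)\<^sup>2 / 2 = 1 / (2 * a * b)" using ab by (simp add: power2_eq_square)
  finally show ?thesis unfolding eq .
qed

lemma emeasure_corner_triangle:
  fixes h :: real assumes "h \<ge> 0"
  shows "emeasure lborel {p::real\<times>real. fst p \<ge> 0 \<and> snd p \<ge> 0 \<and> fst p + snd p < h} = ennreal (h\<^sup>2 / 2)"
proof -
  let ?S = "\<lambda>x. {0 ..< h - x}"
  have eq: "{p::real\<times>real. fst p \<ge> 0 \<and> snd p \<ge> 0 \<and> fst p + snd p < h} =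
      {p. fst p \<ge> 0 \<and> snd p \<in> ?S (fst p)}"
    by auto
  have "emeasure lborel {p. fst p \<ge> 0 \<and> snd p \<in> ?S (fst p)} = ennreal (1 * h\<^sup>2 / 2)"
  proof (rule emeasure_under_line)
    show "{p. 0 \<le> fst p \<and> snd p \<in> ?S (fst p)} \<in> sets borel"
      using sets_corner_triangle[of h] unfolding eq .
  qed (use assms in simp_all)
  then show ?thesis unfolding eq by simp
qed

section \<open>The exponential lattice sum of a Fano polygon\<close>

text \<open>A tree records a subdivision of the cone of two vectors: a node inserts the ray of their
  sum. If the pair has determinant 1, so have both new pairs. The functions below pass the current
  pair as arguments.\<close>

datatype cone_tree = Lf | Nd cone_tree cone_tree

text \<open>For \<open>s > 0\<close> the sum of \<open>exp (- s * j)\<close> over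
  \<open>j \<ge> 1\<close>; the coefficients 1, -1/2 and 1/12 of its expansion come from the
  Bernoulli numbers.\<close>

definition bose :: "real \<Rightarrow> real" where "bose s = 1 / (exp s - 1)"

lemma bose_expansion: "((\<lambda>t. (bose t - 1 / t + 1 / 2 - t / 12) / t\<^sup>2) \<longlongrightarrow> 0) (at_right 0)"
  unfolding bose_def by real_asymp

lemma filterlim_mult_at_right_0: "a > 0 \<Longrightarrow> filterlim (\<lambda>t::real. t * a) (at_right 0) (at_right 0)"
  unfolding filterlim_at by (auto intro!: tendsto_eq_intros simp: eventually_at_filter)

text \<open>\<open>x\<close> and \<open>y\<close> stand for the remainders of the two expansions,
  divided by the square of the argument. The first bracket survives when \<open>A\<close> and
  \<open>B\<close> tend to 0 at the same rate, the second one vanishes in the limit.\<close>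

lemma bose_product_identity:
  fixes A B x y :: real
  assumes "A \<noteq> 0" "B \<noteq> 0"
  shows "(1 + (1 / A - 1 / 2 + A / 12 + A\<^sup>2 * x)) * (1 / B - 1 / 2 + B / 12 + B\<^sup>2 * y) =
     (1 / (A * B) + (1 / B - 1 / A) / 2 + (-1/4 + (A / B + B / A) / 12)) +
     (A * B / 144 - A / 24 + B / 24
     + B\<^sup>2 / A * y + B\<^sup>2 / 2 * y + A / 12 * B\<^sup>2 * y
     + A\<^sup>2 / B * x - A\<^sup>2 / 2 * x + B / 12 * A\<^sup>2 * x
     + A\<^sup>2 * x * (B\<^sup>2 * y))"
proof -
  have *: "(1 + (p - 1 / 2 + A / 12 + A\<^sup>2 * x)) * (q - 1 / 2 + B / 12 + B\<^sup>2 * y) =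
     (p * q + (q - p) / 2 + (-1/4 + (A * q + B * p) / 12)) +
     (A * B / 144 - A / 24 + B / 24
     + B * B * p * y + B\<^sup>2 / 2 * y + A / 12 * B\<^sup>2 * y
     + A * A * q * x - A\<^sup>2 / 2 * x + B / 12 * A\<^sup>2 * x
     + A\<^sup>2 * x * (B\<^sup>2 * y))" for p q :: real
    by (simp add: field_simps power2_eq_square)
  show ?thesis using *[of "1 / A" "1 / B"] by (simp add: power2_eq_square)
qed

text \<open>The factors are the geometric series over exponents from 0 and from 1. Their constant
  terms 1/2 and -1/2 give the -1/4.\<close>

lemma bose_product_expansion:
  assumes a: "a > 0" and b: "b > 0"
  shows "((\<lambda>t. (1 + bose (t * a)) * bose (t * b) - ((1 / (a * b)) / t\<^sup>2 + (1 / b - 1 / a) / 2 / t +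
            (-1/4 + (a / b + b / a) / 12))) \<longlongrightarrow> 0) (at_right 0)"
proof -
  define e where "e = (\<lambda>t. (bose t - 1 / t + 1 / 2 - t / 12) / t\<^sup>2)"
  have ea: "((\<lambda>t. e (t * a)) \<longlongrightarrow> 0) (at_right 0)" and eb: "((\<lambda>t. e (t * b)) \<longlongrightarrow> 0) (at_right 0)"
    using filterlim_compose[OF bose_expansion filterlim_mult_at_right_0] a b by (simp_all add: e_def)
  have eq: "bose s = 1 / s - 1 / 2 + s / 12 + s\<^sup>2 * e s" if "s \<noteq> 0" for s
    using that by (simp add: e_def)
  define R where "R = (\<lambda>t. (t * a) * (t * b) / 144 - t * a / 24 + t * b / 24
     + t * b\<^sup>2 / a * e (t * b) + (t * b)\<^sup>2 / 2 * e (t * b) + (t * a) / 12 * (t * b)\<^sup>2 * e (t * b)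
     + t * a\<^sup>2 / b * e (t * a) - (t * a)\<^sup>2 / 2 * e (t * a) + (t * b) / 12 * (t * a)\<^sup>2 * e (t * a)
     + (t * a)\<^sup>2 * e (t * a) * ((t * b)\<^sup>2 * e (t * b)))"
  have "(R \<longlongrightarrow> 0) (at_right 0)"
    unfolding R_def by (rule tendsto_eq_intros ea eb refl | use a b in simp)+
  moreover have "eventually (\<lambda>t. R t = (1 + bose (t * a)) * bose (t * b) - ((1 / (a * b)) / t\<^sup>2 + (1 / b - 1 / a) / 2 / t +
            (-1/4 + (a / b + b / a) / 12))) (at_right 0)"
    unfolding eventually_at_filter
  proof (intro always_eventually allI impI)
    fix t :: real assume t: "t \<noteq> 0" "t \<in> {0<..}"
    define A B where "A = t * a" and "B = t * b"
    have AB: "A \<noteq> 0" "B \<noteq> 0" using t a b by (simp_all add: A_def B_def)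
    have conv: "(1 / (a * b)) / t\<^sup>2 = 1 / (A * B)" "(1 / b - 1 / a) / 2 / t = (1 / B - 1 / A) / 2"
      "a / b = A / B" "b / a = B / A" "t * b\<^sup>2 / a = B\<^sup>2 / A" "t * a\<^sup>2 / b = A\<^sup>2 / B"
      using t a b by (simp_all add: A_def B_def field_simps power2_eq_square)
    show "R t = (1 + bose (t * a)) * bose (t * b) - ((1 / (a * b)) / t\<^sup>2 + (1 / b - 1 / a) / 2 / t +
            (-1/4 + (a / b + b / a) / 12))"
      unfolding R_def conv unfolding A_def[symmetric] B_def[symmetric] eq[OF AB(1)] eq[OF AB(2)]
        bose_product_identity[OF AB] by simp
  qed
  ultimately show ?thesis by (rule Lim_transform_eventually)
qed

locale fano_polygon = polygon +
  assumes primitive_E: "e \<in> E \<Longrightarrow> coprime (fst e) (snd e)"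
begin

section \<open>Subdivision of unimodular cones until \<open>nu\<close> is linear on the
  pieces\<close>

lemma icr_1_pos: assumes "icr v w = 1" shows "n v > 0" "n w > 0"
  using assms by (auto intro!: n_pos simp: icr_def)

primrec good :: "cone_tree \<Rightarrow> int \<times> int \<Rightarrow> int \<times> int \<Rightarrow> bool" where
  "good Lf v w \<longleftrightarrow> (\<forall>e\<in>E. \<not> (crs (lp v) (lp e) > 0 \<and> crs (lp e) (lp w) > 0))"
| "good (Nd l r) v w \<longleftrightarrow> good l v (v + w) \<and> good r (v + w) w"

text \<open>Termination: \<open>icr v e + icr e w\<close> is the sum of the coordinates of a vertex
  \<open>e\<close> in the basis \<open>v\<close>, \<open>w\<close>. Replacing one basis vector by
  \<open>v + w\<close> lowers it for every vertex that is still inside the cone.\<close>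

lemma ex_good: "icr v w = 1 \<Longrightarrow> \<exists>T. good T v w"
proof (induction "\<Sum>e | e \<in> E \<and> icr v e > 0 \<and> icr e w > 0. nat (icr v e + icr e w)" arbitrary: v w rule: less_induct)
  case less
  define S where "S = (\<lambda>v w. {e. e \<in> E \<and> icr v e > 0 \<and> icr e w > 0})"
  define s where "s = (\<lambda>v w. \<Sum>e\<in>S v w. nat (icr v e + icr e w))"
  have fin: "finite (S v w)" for v w using finite_E by (simp add: S_def)
  show ?case
  proof (cases "S v w = {}")
    case True
    then have "good Lf v w" by (auto simp: S_def crs_lattice_point)
    then show ?thesis by blast
  next
    case False
    have anti: "icr e u = - icr u e" for e u by (simp add: icr_def)
    have l: "s v (v + w) < s v w"
    proof -
      have "s v (v + w) \<le> (\<Sum>e\<in>S v w. nat (icr v e + icr e (v + w)))"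
        unfolding s_def by (rule sum_mono2[OF fin]) (auto simp: S_def icr_add anti[of _ v])
      also have "\<dots> < s v w"
        unfolding s_def by (rule sum_strict_mono[OF fin False]) (auto simp: S_def icr_add anti[of _ v])
      finally show ?thesis .
    qed
    have r: "s (v + w) w < s v w"
    proof -
      have "s (v + w) w \<le> (\<Sum>e\<in>S v w. nat (icr (v + w) e + icr e w))"
        unfolding s_def by (rule sum_mono2[OF fin]) (auto simp: S_def icr_add anti[of w])
      also have "\<dots> < s v w"
        unfolding s_def by (rule sum_strict_mono[OF fin False]) (auto simp: S_def icr_add anti[of w])
      finally show ?thesis .
    qed
    have "icr v (v + w) = 1" "icr (v + w) w = 1" using less.prems by (simp_all add: icr_add)
    then obtain l' r' where "good l' v (v + w)" "good r' (v + w) w"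
      using less.hyps[of v "v + w"] less.hyps[of "v + w" w] l r unfolding s_def S_def by blast
    then have "good (Nd l' r') v w" by simp
    then show ?thesis by blast
  qed
qed

lemma nu_sum_ge: "s \<ge> 0 \<Longrightarrow> t \<ge> 0 \<Longrightarrow> nu (s *\<^sub>R v + t *\<^sub>R w) \<le> s * nu v + t * nu w"
  using nu_add[of "s *\<^sub>R v" "t *\<^sub>R w"] by (simp add: nu_scale)

lemma nu_linear_empty:
  assumes "crs v w > 0" "\<forall>e\<in>E. \<not> (crs v (lp e) > 0 \<and> crs (lp e) w > 0)" "s \<ge> 0" "t \<ge> 0"
  shows "nu (s *\<^sub>R v + t *\<^sub>R w) = s * nu v + t * nu w"
proof (rule antisym)
  obtain p q m where m: "facet p q m" "nu v = m \<bullet> v" "nu w = m \<bullet> w"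
    using nu_linear_on_empty_cone[of v w] assms(1,2) by blast
  have "m \<bullet> (s *\<^sub>R v + t *\<^sub>R w) \<le> nu (s *\<^sub>R v + t *\<^sub>R w)"
    using m(1) by (intro nu_ge) (simp add: facet_def)
  then show "s * nu v + t * nu w \<le> nu (s *\<^sub>R v + t *\<^sub>R w)" using m(2,3) by (simp add: inner_add_right)
qed (rule nu_sum_ge[OF assms(3,4)])

lemma good_Lf_linear:
  assumes "good Lf v w" "icr v w = 1" "s \<ge> 0" "t \<ge> 0"
  shows "nu (s *\<^sub>R lp v + t *\<^sub>R lp w) = s * n v + t * n w"
  by (rule nu_linear_empty) (use assms in \<open>simp_all add: crs_lattice_point\<close>)

text \<open>The value at \<open>w\<close> of the linear function that agrees with \<open>nu\<close>
  on the leaf cone adjacent to the ray of \<open>v\<close>: subtracting \<open>n v\<close> undoes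
  the replacement of \<open>w\<close> by \<open>v + w\<close>.\<close>

primrec left_slope :: "cone_tree \<Rightarrow> int \<times> int \<Rightarrow> int \<times> int \<Rightarrow> real" where
  "left_slope Lf v w = n w"
| "left_slope (Nd l r) v w = left_slope l v (v + w) - n v"

text \<open>Mirror image: the value at \<open>v\<close> of the linear piece of \<open>nu\<close>
  adjacent to the ray of \<open>w\<close>.\<close>

primrec right_slope :: "cone_tree \<Rightarrow> int \<times> int \<Rightarrow> int \<times> int \<Rightarrow> real" where
  "right_slope Lf v w = n v"
| "right_slope (Nd l r) v w = right_slope r (v + w) w - n w"

text \<open>\<open>k\<close> counts the left turns to the leaf adjacent to \<open>v\<close>; that
  leaf is the cone of \<open>v\<close> and \<open>w + k v\<close>.\<close>

lemma left_slope_witness: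
  "good T v w \<Longrightarrow> icr v w = 1 \<Longrightarrow> \<exists>k::nat. left_slope T v w = nu (lp w + real k *\<^sub>R lp v) - real k * n v \<and>
     (\<forall>e\<in>E. \<not> (crs (lp v) (lp e) > 0 \<and> crs (lp e) (lp w + real k *\<^sub>R lp v) > 0)) \<and> (T \<noteq> Lf \<longrightarrow> k > 0)"
proof (induction T arbitrary: w)
  case Lf
  then show ?case by (intro exI[of _ 0]) simp
next
  case (Nd l r)
  have "icr v (v + w) = 1" using Nd.prems by (simp add: icr_add)
  then obtain k :: nat where k: "left_slope l v (v + w) = nu (lp (v + w) + real k *\<^sub>R lp v) - real k * n v"
     "\<forall>e\<in>E. \<not> (crs (lp v) (lp e) > 0 \<and> crs (lp e) (lp (v + w) + real k *\<^sub>R lp v) > 0)"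
    using Nd.IH(1)[of "v + w"] Nd.prems by auto
  have "lp (v + w) + real k *\<^sub>R lp v = lp w + real (Suc k) *\<^sub>R lp v"
    by (simp add: lattice_point_add algebra_simps)
  then show ?case using k by (intro exI[of _ "Suc k"]) (simp add: algebra_simps)
qed

lemma right_slope_witness:
  "good T v w \<Longrightarrow> icr v w = 1 \<Longrightarrow> \<exists>k::nat. right_slope T v w = nu (lp v + real k *\<^sub>R lp w) - real k * n w \<and>
     (\<forall>e\<in>E. \<not> (crs (lp v + real k *\<^sub>R lp w) (lp e) > 0 \<and> crs (lp e) (lp w) > 0)) \<and> (T \<noteq> Lf \<longrightarrow> k > 0)"
proof (induction T arbitrary: v)
  case Lf
  then show ?case by (intro exI[of _ 0]) simp
next
  case (Nd l r)
  have "icr (v + w) w = 1" using Nd.prems by (simp add: icr_add)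
  then obtain k :: nat where k: "right_slope r (v + w) w = nu (lp (v + w) + real k *\<^sub>R lp w) - real k * n w"
     "\<forall>e\<in>E. \<not> (crs (lp (v + w) + real k *\<^sub>R lp w) (lp e) > 0 \<and> crs (lp e) (lp w) > 0)"
    using Nd.IH(2)[of "v + w"] Nd.prems by auto
  have "lp (v + w) + real k *\<^sub>R lp w = lp v + real (Suc k) *\<^sub>R lp w"
    by (simp add: lattice_point_add algebra_simps)
  then show ?case using k by (intro exI[of _ "Suc k"]) (simp add: algebra_simps)
qed

text \<open>Here \<open>v + w\<close> is \<open>icr v w\<close> times \<open>x\<close>. If the
  linear pieces of \<open>nu\<close> on both sides of \<open>x\<close> agree, their values at
  \<open>v\<close> and \<open>w\<close> add up to \<open>icr v w * n x\<close>. They can differ only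
  if a vertex lies on the ray of \<open>x\<close>; primitivity makes this vertex \<open>x\<close>
  itself, and \<open>nu\<close> is 1 there.\<close>

lemma kink:
  assumes l: "good l v x" "icr v x = 1" and r: "good r x w" "icr x w = 1"
    and b: "icr v w \<ge> 0" "icr v w > 0 \<or> l \<noteq> Lf"
  shows "right_slope l v x + left_slope r x w = of_int (icr v w) * n x \<or> n x = 1"
proof -
  obtain k :: nat where k: "right_slope l v x = nu (lp v + real k *\<^sub>R lp x) - real k * n x"
    "\<forall>e\<in>E. \<not> (crs (lp v + real k *\<^sub>R lp x) (lp e) > 0 \<and> crs (lp e) (lp x) > 0)" "l \<noteq> Lf \<longrightarrow> k > 0"
    using right_slope_witness[OF l] by blast
  obtain j :: nat where j: "left_slope r x w = nu (lp w + real j *\<^sub>R lp x) - real j * n x"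
    "\<forall>e\<in>E. \<not> (crs (lp x) (lp e) > 0 \<and> crs (lp e) (lp w + real j *\<^sub>R lp x) > 0)"
    using left_slope_witness[OF r] by blast
  \<comment> \<open>The leaf cones on the two sides of \<open>x\<close> are those of
    \<open>y\<close>, \<open>x\<close> and of \<open>x\<close>, \<open>z\<close>; assumption
    \<open>b\<close> makes the determinant of \<open>y\<close> and \<open>z\<close>
    positive.\<close>
  define y z where "y = lp v + real k *\<^sub>R lp x" and "z = lp w + real j *\<^sub>R lp x"
  define b where "b = real_of_int (icr v w)"
  have vx: "crs (lp v) (lp x) = 1" "crs (lp x) (lp w) = 1" "crs (lp v) (lp w) = b"
    using l r by (simp_all add: crs_lattice_point b_def)
  have yx: "crs y (lp x) = 1" "crs (lp x) z = 1" using vx by (simp_all add: y_def z_def)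
  have yz: "crs y z = b + real j + real k" using vx by (simp add: y_def z_def)
  have pos: "b + real j + real k > 0"
  proof -
    have "b \<ge> 0" "b > 0 \<or> k > 0" using b k(3) by (auto simp: b_def)
    then show ?thesis by auto
  qed
  have sum: "y + z = (b + real j + real k) *\<^sub>R lp x"
    using crs_expand[of y "lp x" "y + z"] yx yz by (simp add: crs_commute[of z "lp x"])
  show ?thesis
  proof (cases "\<exists>e\<in>E. crs y (lp e) > 0 \<and> crs (lp e) z > 0")
    case True
    then obtain e where e: "e \<in> E" "crs y (lp e) > 0" "crs (lp e) z > 0" by blast
    have "\<not> crs (lp x) (lp e) > 0" using j(2) e unfolding z_def by blast
    moreover have "\<not> crs (lp e) (lp x) > 0" using k(2) e unfolding y_def by blast
    ultimately have "crs (lp e) (lp x) = 0" using crs_commute[of "lp e" "lp x"] by linarith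
    then have z0: "icr e x = 0" by (simp add: crs_lattice_point)
    define d where "d = icr v e"
    have eq: "lp e = of_int d *\<^sub>R lp x"
      using icr_expand[OF l(2), of e] z0 by (simp add: d_def)
    have "fst e = d * fst x \<and> snd e = d * snd x"
      using arg_cong[OF eq, of fst] arg_cong[OF eq, of snd]
      by (simp add: lattice_point_def flip: of_int_mult)
    \<comment> \<open>\<open>d\<close> divides both coordinates of the primitive vector
      \<open>e\<close>.\<close>
    then have "is_unit d" using primitive_E[OF e(1)] by (metis coprime_common_divisor dvd_triv_left)
    moreover have "d > 0" using e(2) unfolding eq by (simp add: yx)
    ultimately have "d = 1" by simp
    then show ?thesis using eq nu_E[OF e(1)] by simp
  next
    case False
    then have "nu (1 *\<^sub>R y + 1 *\<^sub>R z) = 1 * nu y + 1 * nu z"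
      by (intro nu_linear_empty) (use yz pos in auto)
    then have "nu y + nu z = (b + real j + real k) * n x"
      unfolding scaleR_one sum using pos by (simp add: nu_scale)
    then show ?thesis using k(1) j(1) by (simp add: y_def z_def b_def algebra_simps)
  qed
qed

text \<open>Twice the area of the part of \<open>P\<close> in the cone; on a leaf this is the
  triangle with vertices 0, \<open>v / n v\<close> and \<open>w / n w\<close>.\<close>

primrec area_sum :: "cone_tree \<Rightarrow> int \<times> int \<Rightarrow> int \<times> int \<Rightarrow> real" where
  "area_sum Lf v w = 1 / (n v * n w)"
| "area_sum (Nd l r) v w = area_sum l v (v + w) + area_sum r (v + w) w"

primrec const_term :: "cone_tree \<Rightarrow> int \<times> int \<Rightarrow> int \<times> int \<Rightarrow> real" where
  "const_term Lf v w = -1/4 + (n v / n w + n w / n v) / 12"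
| "const_term (Nd l r) v w = const_term l v (v + w) + const_term r (v + w) w"

text \<open>Twice the area of \<open>cut_region\<close>, as shown in
  \<open>cut_region_borel\<close>.\<close>

primrec cut_sum :: "cone_tree \<Rightarrow> int \<times> int \<Rightarrow> int \<times> int \<Rightarrow> real" where
  "cut_sum Lf v w = 0"
| "cut_sum (Nd l r) v w = (n v + n w - n (v + w))\<^sup>2 + cut_sum l v (v + w) + cut_sum r (v + w) w"

primrec cone_series :: "real \<Rightarrow> cone_tree \<Rightarrow> int \<times> int \<Rightarrow> int \<times> int \<Rightarrow> real" where
  "cone_series t Lf v w = (1 + bose (t * n v)) * bose (t * n w)"
| "cone_series t (Nd l r) v w = cone_series t l v (v + w) + cone_series t r (v + w) w"

text \<open>Induction on the tree. At a new ray \<open>x = v + w\<close> the slopes from both sides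
  contribute \<open>1 - (n x)\<^sup>2\<close> by \<open>kink\<close>, and the quadratic terms
  complete to \<open>2 * n v * n w - (n v + n w - n x)\<^sup>2\<close>; the constants combine as -6
  + 3 = -3.\<close>

lemma const_term_eq:
  "good T v w \<Longrightarrow> icr v w = 1 \<Longrightarrow> 12 * const_term T v w = -3 + left_slope T v w * (1 / n v - n v)
     + right_slope T v w * (1 / n w - n w) + 2 * n v * n w - cut_sum T v w"
proof (induction T arbitrary: v w)
  case Lf
  then show ?case by (simp add: algebra_simps add_divide_distrib)
next
  case (Nd l r)
  define x where "x = v + w"
  have i: "icr v x = 1" "icr x w = 1" using Nd.prems by (simp_all add: icr_add x_def)
  have g: "good l v x" "good r x w" using Nd.prems by (simp_all add: x_def)
  have c: "n x > 0" "n v > 0" "n w > 0" using icr_1_pos[OF i(2)] icr_1_pos[OF i(1)] by auto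
  \<comment> \<open>If \<open>n x = 1\<close>, both sides are 0 whatever the slopes are.\<close>
  have K: "(right_slope l v x + left_slope r x w) * (1 / n x - n x) = 1 - (n x)\<^sup>2"
  proof -
    have "right_slope l v x + left_slope r x w = n x \<or> n x = 1"
      using kink[OF g(1) i(1) g(2) i(2)] Nd.prems by simp
    moreover have "n x * (1 / n x - n x) = 1 - (n x)\<^sup>2"
      using c by (simp add: right_diff_distrib power2_eq_square)
    ultimately show ?thesis by auto
  qed
  have v: "n v * (1 / n v - n v) = 1 - (n v)\<^sup>2" "n w * (1 / n w - n w) = 1 - (n w)\<^sup>2"
    using c by (simp_all add: field_simps power2_eq_square)
  have "12 * const_term (Nd l r) v w =
      12 * const_term l v x + 12 * const_term r x w" by (simp add: x_def)
  also have "\<dots> = -6 + (left_slope l v x - n v) * (1 / n v - n v) + (right_slope r x w - n w) * (1 / n w - n w)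
      + n v * (1 / n v - n v) + n w * (1 / n w - n w)
      + (right_slope l v x + left_slope r x w) * (1 / n x - n x)
      + 2 * n v * n x + 2 * n x * n w - cut_sum l v x - cut_sum r x w"
    unfolding Nd.IH(1)[OF g(1) i(1)] Nd.IH(2)[OF g(2) i(2)] by (simp add: algebra_simps)
  also have "\<dots> = -3 + left_slope (Nd l r) v w * (1 / n v - n v)
     + right_slope (Nd l r) v w * (1 / n w - n w) + 2 * n v * n w - cut_sum (Nd l r) v w"
    unfolding K v by (simp add: x_def[symmetric]) (simp add: algebra_simps power2_eq_square)
  finally show ?case .
qed

text \<open>The coefficients of \<open>1 / t\<close> telescope along the rays of the subdivision, so
  only those of the two boundary rays remain.\<close>

lemma cone_series_expansion:
  "icr v w = 1 \<Longrightarrow> ((\<lambda>t. cone_series t T v w -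
     (area_sum T v w / t\<^sup>2 + (1 / n w - 1 / n v) / 2 / t + const_term T v w)) \<longlongrightarrow> 0) (at_right 0)"
proof (induction T arbitrary: v w)
  case Lf
  then show ?case using bose_product_expansion[OF icr_1_pos] by simp
next
  case (Nd l r)
  have i: "icr v (v + w) = 1" "icr (v + w) w = 1" using Nd.prems by (simp_all add: icr_add)
  show ?case
    using tendsto_add[OF Nd.IH(1)[OF i(1)] Nd.IH(2)[OF i(2)]]
    by (simp add: add_divide_distrib diff_divide_distrib algebra_simps)
qed

text \<open>The ray of \<open>w\<close> is included, the ray of \<open>v\<close> and the origin are
  not; thus the two parts of a subdivided cone are disjoint, and the four quadrants partition the
  nonzero lattice points.\<close>

definition half_open_lattice :: "int \<times> int \<Rightarrow> int \<times> int \<Rightarrow> (int \<times> int) set" where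
  "half_open_lattice v w = {p. icr v p > 0 \<and> icr p w \<ge> 0}"

lemma half_open_lattice_split:
  assumes "icr v w = 1"
  shows "half_open_lattice v w = half_open_lattice v (v + w) \<union> half_open_lattice (v + w) w"
    and "half_open_lattice v (v + w) \<inter> half_open_lattice (v + w) w = {}"
  by (auto simp: half_open_lattice_def icr_add icr_anti[of _ v] icr_anti[of w])

lemma has_sum_exp_from_1:
  assumes "s > 0" shows "((\<lambda>j::nat. exp (- s * real j)) has_sum bose s) {1..}"
proof -
  have "((\<lambda>j. exp (- s) ^ j) has_sum (exp (- s) / (1 - exp (- s)))) {1..}"
    by (rule has_sum_geometric_from_1) (use assms in simp)
  moreover have "exp (- s) / (1 - exp (- s)) = bose s"
    using assms by (simp add: bose_def exp_minus field_simps)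
  moreover have "exp (- s) ^ j = exp (- s * real j)" for j :: nat
    by (simp add: exp_of_nat_mult[symmetric] mult.commute)
  ultimately show ?thesis by simp
qed

lemma has_sum_exp_from_0:
  assumes "s > 0" shows "((\<lambda>j::nat. exp (- s * real j)) has_sum (1 + bose s)) UNIV"
proof -
  have "((\<lambda>j::nat. exp (- s * real j)) has_sum (exp (- s * real 0) + bose s)) (insert 0 {1..})"
    by (intro has_sum_insert has_sum_exp_from_1 assms) simp
  moreover have "insert 0 {1..} = (UNIV :: nat set)" by auto
  ultimately show ?thesis by simp
qed

text \<open>On a leaf the points are \<open>i v + j w\<close> with \<open>i \<ge> 0\<close> and
  \<open>j \<ge> 1\<close>, and \<open>nu\<close> is linear, so the sum is a product of two
  geometric series.\<close>

lemma cone_series_has_sum: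
  "good T v w \<Longrightarrow> icr v w = 1 \<Longrightarrow> t > 0 \<Longrightarrow>
     ((\<lambda>p. exp (- t * n p)) has_sum cone_series t T v w) (half_open_lattice v w)"
proof (induction T arbitrary: v w)
  case Lf
  define a b where "a = t * n v" and "b = t * n w"
  have ab: "a > 0" "b > 0" using icr_1_pos[OF Lf(2)] Lf(3) by (simp_all add: a_def b_def)
  let ?f = "\<lambda>(i::nat, j::nat). exp (- a * real i) * exp (- b * real j)"
  have inner: "((\<lambda>j. ?f (i, j)) has_sum (exp (- a * real i) * bose b)) {1..}" for i
    using has_sum_cmult_right[OF has_sum_exp_from_1[OF ab(2)], of "exp (- a * real i)"] by simp
  have outer: "((\<lambda>i. exp (- a * real i) * bose b) has_sum ((1 + bose a) * bose b)) UNIV"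
    by (rule has_sum_cmult_left[OF has_sum_exp_from_0[OF ab(1)]])
  have "?f summable_on UNIV \<times> {1..}"
    by (rule summable_on_SigmaI[OF inner]) (use outer in \<open>auto simp: summable_on_def\<close>)
  then have S: "(?f has_sum ((1 + bose a) * bose b)) (UNIV \<times> {1..})"
    by (intro has_sum_SigmaI[OF inner outer])
  let ?j = "\<lambda>(i::nat, j::nat). (int i * fst v + int j * fst w, int i * snd v + int j * snd w)"
  have ic: "icr p (?j (i, j)) = int i * icr p v + int j * icr p w" "icr (?j (i, j)) p = int i * icr v p + int j * icr w p"
    for p i j by (simp_all add: icr_def algebra_simps)
  have vw: "icr v w = 1" "icr w v = -1" "icr v v = 0" "icr w w = 0"
    using Lf(2) icr_anti[of w v] by (simp_all add: icr_add(3))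
  have lpj: "lp (?j (i, j)) = real i *\<^sub>R lp v + real j *\<^sub>R lp w" for i j by (simp add: lattice_point_def)
  have "((\<lambda>p. exp (- t * n p)) has_sum ((1 + bose a) * bose b)) (half_open_lattice v w)"
  proof (subst has_sum_reindex_bij_witness[of _ ?j "\<lambda>p. (nat (icr p w), nat (icr v p))" "UNIV \<times> {1..}" ?f])
    fix p assume p: "p \<in> half_open_lattice v w"
    then have "lp (?j (nat (icr p w), nat (icr v p))) = lp p"
      unfolding lpj using icr_expand[OF Lf(2), of p] by (simp add: half_open_lattice_def)
    then show "?j (nat (icr p w), nat (icr v p)) = p" by (simp only: lattice_point_eq_iff)
    show "(nat (icr p w), nat (icr v p)) \<in> UNIV \<times> {1..}" using p by (simp add: half_open_lattice_def Suc_le_eq)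
    have "n p = real (nat (icr p w)) * n v + real (nat (icr v p)) * n w"
      using good_Lf_linear[OF Lf(1,2), of "of_int (icr p w)" "of_int (icr v p)"] p icr_expand[OF Lf(2), of p]
      by (simp add: half_open_lattice_def)
    then show "?f (nat (icr p w), nat (icr v p)) = exp (- t * n p)"
      by (simp add: a_def b_def algebra_simps flip: exp_add)
  next
    fix ij :: "nat \<times> nat" assume ij: "ij \<in> UNIV \<times> {1..}"
    obtain i j where [simp]: "ij = (i, j)" by (cases ij)
    show "?j ij \<in> half_open_lattice v w" using ij unfolding half_open_lattice_def by (simp only: mem_Collect_eq ic \<open>ij = (i, j)\<close> vw) simp
    show "(nat (icr (?j ij) w), nat (icr v (?j ij))) = ij"
      by (simp only: ic \<open>ij = (i, j)\<close> vw) simp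
  qed (use S in simp_all)
  then show ?case by (simp add: a_def b_def)
next
  case (Nd l r)
  have i: "icr v (v + w) = 1" "icr (v + w) w = 1" using Nd.prems by (simp_all add: icr_add)
  show ?case
    unfolding half_open_lattice_split(1)[OF Nd.prems(2)] cone_series.simps
    by (rule has_sum_Un_disjoint) (use Nd i half_open_lattice_split(2) in auto)
qed

section \<open>Areas of the polygon and of its polar over a subdivision\<close>

lemma inner_pair: "(m :: real \<times> real) \<bullet> x = fst m * fst x + snd m * snd x"
  by (simp add: inner_prod_def)

definition half_open_cone :: "real \<times> real \<Rightarrow> real \<times> real \<Rightarrow> (real \<times> real) set" where
  "half_open_cone v w = {p. crs v p > 0 \<and> crs p w \<ge> 0}"

lemma half_open_cone_split:
  assumes "crs v w = 1"
  shows "half_open_cone v w = half_open_cone v (v + w) \<union> half_open_cone (v + w) w"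
    and "half_open_cone v (v + w) \<inter> half_open_cone (v + w) w = {}"
  by (auto simp: half_open_cone_def crs_commute[of _ v] crs_commute[of w])

lemma half_open_cone_borel: "half_open_cone v w \<in> sets borel"
proof -
  have "{p. 0 < crs v p} \<in> sets borel" unfolding crs_def
    by (intro borel_open open_Collect_less continuous_intros)
  moreover have "{p. 0 \<le> crs p w} \<in> sets borel" unfolding crs_def
    by (intro borel_closed closed_Collect_le continuous_intros)
  moreover have "half_open_cone v w = {p. 0 < crs v p} \<inter> {p. 0 \<le> crs p w}"
    by (auto simp: half_open_cone_def)
  ultimately show ?thesis by (simp only: sets.Int)
qed

lemma P_borel: "P \<in> sets borel" by (rule borel_closed[OF closed_P])

lemma area_sum_nonneg: "icr v w = 1 \<Longrightarrow> area_sum T v w \<ge> 0"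
proof (induction T arbitrary: v w)
  case Lf then show ?case using icr_1_pos[of v w] by simp
next
  case (Nd l r)
  then have "icr v (v + w) = 1" "icr (v + w) w = 1" by (simp_all add: icr_add)
  then show ?case using Nd by simp
qed

text \<open>Coordinates in the unimodular basis \<open>v\<close>, \<open>w\<close> preserve area,
  and in them the leaf part of \<open>P\<close> is the triangle given by
  \<open>n v * a + n w * b \<le> 1\<close>.\<close>

lemma emeasure_P_cone:
  "good T v w \<Longrightarrow> icr v w = 1 \<Longrightarrow>
     emeasure lborel (P \<inter> half_open_cone (lp v) (lp w)) = ennreal (area_sum T v w / 2)"
proof (induction T arbitrary: v w)
  case Lf
  have d: "crs (lp v) (lp w) = 1" using Lf(2) by (simp add: crs_lattice_point)
  let ?K = "{p::real\<times>real. fst p \<ge> 0 \<and> snd p > 0 \<and> n v * fst p + n w * snd p \<le> 1}"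
  have ab: "n v > 0" "n w > 0" using icr_1_pos[OF Lf(2)] by auto
  have eq1: "P \<inter> half_open_cone (lp v) (lp w) = {p. (crs p (lp w), crs (lp v) p) \<in> ?K}"
  proof -
    have "nu p = n v * crs p (lp w) + n w * crs (lp v) p" if "crs (lp v) p > 0" "crs p (lp w) \<ge> 0" for p
      using good_Lf_linear[OF Lf, of "crs p (lp w)" "crs (lp v) p"] that crs_expand[of "lp v" "lp w" p] d
      by (simp add: mult.commute)
    then show ?thesis by (auto simp: half_open_cone_def mem_P_iff)
  qed
  have eq2: "{p. (crs p (lp w), crs (lp v) p) \<in> ?K} = {p. (0 + (snd (lp w) * fst p + (- fst (lp w)) * snd p), 0 + ((- snd (lp v)) * fst p + fst (lp v) * snd p)) \<in> ?K}"
    by (simp add: crs_def mult.commute)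
  have "emeasure lborel (P \<inter> half_open_cone (lp v) (lp w)) = emeasure lborel ?K"
    unfolding eq1 eq2
    by (rule emeasure_affine_vimage[OF _ sets_std_triangle]) (use d in \<open>simp add: crs_def mult.commute\<close>)
  also have "\<dots> = ennreal (area_sum Lf v w / 2)" using emeasure_std_triangle[OF ab] by (simp add: mult.assoc mult.left_commute mult.commute)
  finally show ?case .
next
  case (Nd l r)
  have i: "icr v (v + w) = 1" "icr (v + w) w = 1" using Nd.prems by (simp_all add: icr_add)
  have d: "crs (lp v) (lp w) = 1" using Nd(4) by (simp add: crs_lattice_point)
  note sp = half_open_cone_split[OF d, folded lattice_point_add]
  have eq: "P \<inter> half_open_cone (lp v) (lp w) = (P \<inter> half_open_cone (lp v) (lp (v + w))) \<union> (P \<inter> half_open_cone (lp (v + w)) (lp w))"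
    using sp(1) by blast
  have "emeasure lborel (P \<inter> half_open_cone (lp v) (lp w)) = emeasure lborel (P \<inter> half_open_cone (lp v) (lp (v + w))) + emeasure lborel (P \<inter> half_open_cone (lp (v + w)) (lp w))"
    unfolding eq using sp(2) P_borel half_open_cone_borel by (intro plus_emeasure[symmetric]) auto
  also have "\<dots> = ennreal (area_sum l v (v + w) / 2) + ennreal (area_sum r (v + w) w / 2)"
    using Nd i by simp
  also have "\<dots> = ennreal (area_sum (Nd l r) v w / 2)"
    using area_sum_nonneg[OF i(1)] area_sum_nonneg[OF i(2)] by (simp add: add_divide_distrib flip: ennreal_plus)
  finally show ?case .
qed

text \<open>What the half planes of the directions inside the cone remove from the corner formed by
  the half planes of the two boundary rays.\<close>

definition cut_region :: "real \<times> real \<Rightarrow> real \<times> real \<Rightarrow> (real \<times> real) set" where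
  "cut_region v w = {m. m \<bullet> v \<le> nu v \<and> m \<bullet> w \<le> nu w \<and>
     (\<exists>s\<ge>0. \<exists>t\<ge>0. m \<bullet> (s *\<^sub>R v + t *\<^sub>R w) > nu (s *\<^sub>R v + t *\<^sub>R w))}"

text \<open>Subadditivity of \<open>nu\<close> makes violated directions closed under addition. The
  disjointness statements below combine violated directions into one in which the constraint is
  known to hold.\<close>

lemma violated_combination:
  assumes "m \<bullet> y > nu y" "m \<bullet> z \<ge> nu z" "s > 0" "t \<ge> 0"
  shows "m \<bullet> (s *\<^sub>R y + t *\<^sub>R z) > nu (s *\<^sub>R y + t *\<^sub>R z)"
proof -
  have "nu (s *\<^sub>R y + t *\<^sub>R z) \<le> s * nu y + t * nu z" using assms by (intro nu_sum_ge) auto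
  also have "\<dots> < s * (m \<bullet> y) + t * (m \<bullet> z)"
    using assms by (intro add_less_le_mono mult_strict_left_mono mult_left_mono) auto
  finally show ?thesis by (simp add: inner_add_right)
qed

lemma not_violated_scale: "m \<bullet> v \<le> nu v \<Longrightarrow> s \<ge> 0 \<Longrightarrow> \<not> m \<bullet> (s *\<^sub>R v) > nu (s *\<^sub>R v)"
  by (simp add: nu_scale mult_left_mono not_less)

lemma cut_regionE:
  assumes "m \<in> cut_region v w"
  obtains s t where "s > 0" "t > 0" "m \<bullet> (s *\<^sub>R v + t *\<^sub>R w) > nu (s *\<^sub>R v + t *\<^sub>R w)"
    "m \<bullet> v \<le> nu v" "m \<bullet> w \<le> nu w"
proof -
  obtain s t where st: "s \<ge> 0" "t \<ge> 0" "m \<bullet> (s *\<^sub>R v + t *\<^sub>R w) > nu (s *\<^sub>R v + t *\<^sub>R w)"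
    and b: "m \<bullet> v \<le> nu v" "m \<bullet> w \<le> nu w" using assms by (auto simp: cut_region_def)
  have "s \<noteq> 0" using st b(2) not_violated_scale[of m w t] by auto
  moreover have "t \<noteq> 0" using st b(1) not_violated_scale[of m v s] by auto
  ultimately show ?thesis using that[of s t] st b by simp
qed

lemma cut_regionI:
  assumes "m \<bullet> v \<le> nu v" "m \<bullet> w \<le> nu w" "s \<ge> 0" "t \<ge> 0"
    "m \<bullet> (s *\<^sub>R v + t *\<^sub>R w) > nu (s *\<^sub>R v + t *\<^sub>R w)"
  shows "m \<in> cut_region v w"
  using assms unfolding cut_region_def by blast

text \<open>Were \<open>w\<close> violated as well, adding a multiple of it to the violated
  direction would give a violated multiple of \<open>v + w\<close>.\<close>

lemma cut_region_upper_left: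
  assumes "m \<in> cut_region v (v + w)" shows "m \<bullet> w \<le> nu w"
proof (rule ccontr)
  assume w: "\<not> m \<bullet> w \<le> nu w"
  obtain s t where st: "s > 0" "t > 0" "m \<bullet> (s *\<^sub>R v + t *\<^sub>R (v + w)) > nu (s *\<^sub>R v + t *\<^sub>R (v + w))"
    and b: "m \<bullet> (v + w) \<le> nu (v + w)" using assms by (rule cut_regionE)
  have "m \<bullet> (1 *\<^sub>R (s *\<^sub>R v + t *\<^sub>R (v + w)) + s *\<^sub>R w) > nu (1 *\<^sub>R (s *\<^sub>R v + t *\<^sub>R (v + w)) + s *\<^sub>R w)"
    by (rule violated_combination) (use st w in auto)
  moreover have "1 *\<^sub>R (s *\<^sub>R v + t *\<^sub>R (v + w)) + s *\<^sub>R w = (s + t) *\<^sub>R (v + w)"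
    by (simp add: algebra_simps)
  ultimately show False using not_violated_scale[OF b, of "s + t"] st by simp
qed

lemma cut_region_upper_right:
  assumes "m \<in> cut_region (v + w) w" shows "m \<bullet> v \<le> nu v"
proof (rule ccontr)
  assume v: "\<not> m \<bullet> v \<le> nu v"
  obtain s t where st: "s > 0" "t > 0" "m \<bullet> (s *\<^sub>R (v + w) + t *\<^sub>R w) > nu (s *\<^sub>R (v + w) + t *\<^sub>R w)"
    and b: "m \<bullet> (v + w) \<le> nu (v + w)" using assms by (rule cut_regionE)
  have "m \<bullet> (1 *\<^sub>R (s *\<^sub>R (v + w) + t *\<^sub>R w) + t *\<^sub>R v) > nu (1 *\<^sub>R (s *\<^sub>R (v + w) + t *\<^sub>R w) + t *\<^sub>R v)"
    by (rule violated_combination) (use st v in auto)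
  moreover have "1 *\<^sub>R (s *\<^sub>R (v + w) + t *\<^sub>R w) + t *\<^sub>R v = (s + t) *\<^sub>R (v + w)"
    by (simp add: algebra_simps)
  ultimately show False using not_violated_scale[OF b, of "s + t"] st by simp
qed

definition cut_triangle :: "real \<times> real \<Rightarrow> real \<times> real \<Rightarrow> (real \<times> real) set" where
  "cut_triangle v w = {m. m \<bullet> v \<le> nu v \<and> m \<bullet> w \<le> nu w \<and> m \<bullet> (v + w) > nu (v + w)}"

text \<open>If the constraint of \<open>v + w\<close> holds, a violated direction
  \<open>s v + t w\<close> lies on one side of this ray, according to whether
  \<open>t \<le> s\<close>.\<close>

lemma cut_region_split:
  "cut_region v w = cut_triangle v w \<union> (cut_region v (v + w) \<union> cut_region (v + w) w)"
proof (intro equalityI subsetI)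
  fix m assume m: "m \<in> cut_region v w"
  then obtain s t where st: "s > 0" "t > 0" "m \<bullet> (s *\<^sub>R v + t *\<^sub>R w) > nu (s *\<^sub>R v + t *\<^sub>R w)"
    and b: "m \<bullet> v \<le> nu v" "m \<bullet> w \<le> nu w" by (rule cut_regionE)
  show "m \<in> cut_triangle v w \<union> (cut_region v (v + w) \<union> cut_region (v + w) w)"
  proof (cases "m \<bullet> (v + w) > nu (v + w)")
    case True
    then show ?thesis using b by (simp add: cut_triangle_def)
  next
    case False
    then have x: "m \<bullet> (v + w) \<le> nu (v + w)" by simp
    have e1: "(s - t) *\<^sub>R v + t *\<^sub>R (v + w) = s *\<^sub>R v + t *\<^sub>R w"
      and e2: "s *\<^sub>R (v + w) + (t - s) *\<^sub>R w = s *\<^sub>R v + t *\<^sub>R w" by (simp_all add: algebra_simps)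
    show ?thesis
    proof (cases "t \<le> s")
      case True
      have "m \<in> cut_region v (v + w)"
        using cut_regionI[OF b(1) x, of "s - t" t] True st unfolding e1 by simp
      then show ?thesis by simp
    next
      case False
      have "m \<in> cut_region (v + w) w"
        using cut_regionI[OF x b(2), of s "t - s"] False st unfolding e2 by simp
      then show ?thesis by simp
    qed
  qed
next
  fix m assume "m \<in> cut_triangle v w \<union> (cut_region v (v + w) \<union> cut_region (v + w) w)"
  then consider "m \<in> cut_triangle v w" | "m \<in> cut_region v (v + w)" | "m \<in> cut_region (v + w) w" by blast
  then show "m \<in> cut_region v w"
  proof cases
    case 1
    show ?thesis by (rule cut_regionI[of _ _ _ 1 1]) (use 1 in \<open>simp_all add: cut_triangle_def\<close>)
  next
    case 2
    then obtain s t where st: "s > 0" "t > 0" "m \<bullet> (s *\<^sub>R v + t *\<^sub>R (v + w)) > nu (s *\<^sub>R v + t *\<^sub>R (v + w))"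
      and b: "m \<bullet> v \<le> nu v" by (rule cut_regionE)
    have e: "s *\<^sub>R v + t *\<^sub>R (v + w) = (s + t) *\<^sub>R v + t *\<^sub>R w" by (simp add: algebra_simps)
    show ?thesis
      using cut_regionI[OF b cut_region_upper_left[OF 2], of "s + t" t] st unfolding e by simp
  next
    case 3
    then obtain s t where st: "s > 0" "t > 0" "m \<bullet> (s *\<^sub>R (v + w) + t *\<^sub>R w) > nu (s *\<^sub>R (v + w) + t *\<^sub>R w)"
      and b: "m \<bullet> w \<le> nu w" by (rule cut_regionE)
    have e: "s *\<^sub>R (v + w) + t *\<^sub>R w = s *\<^sub>R v + (s + t) *\<^sub>R w" by (simp add: algebra_simps)
    show ?thesis
      using cut_regionI[OF cut_region_upper_right[OF 3] b, of s "s + t"] st unfolding e by simp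
  qed
qed

lemma cut_triangle_disjoint:
  "cut_triangle v w \<inter> (cut_region v (v + w) \<union> cut_region (v + w) w) = {}"
  by (auto simp: cut_triangle_def cut_region_def)

text \<open>Violations on both sides of the ray of \<open>v + w\<close> have a positive combination
  on that ray, where none is allowed.\<close>

lemma cut_region_disjoint: "cut_region v (v + w) \<inter> cut_region (v + w) w = {}"
proof (rule ccontr)
  assume "\<not> ?thesis"
  then obtain m where m: "m \<in> cut_region v (v + w)" "m \<in> cut_region (v + w) w" by blast
  obtain s t where st: "s > 0" "t > 0" "m \<bullet> (s *\<^sub>R v + t *\<^sub>R (v + w)) > nu (s *\<^sub>R v + t *\<^sub>R (v + w))"
    and b: "m \<bullet> (v + w) \<le> nu (v + w)" using m(1) by (rule cut_regionE)
  obtain s' t' where st': "s' > 0" "t' > 0" "m \<bullet> (s' *\<^sub>R (v + w) + t' *\<^sub>R w) > nu (s' *\<^sub>R (v + w) + t' *\<^sub>R w)"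
    using m(2) by (rule cut_regionE)
  have "m \<bullet> (t' *\<^sub>R (s *\<^sub>R v + t *\<^sub>R (v + w)) + s *\<^sub>R (s' *\<^sub>R (v + w) + t' *\<^sub>R w)) >
     nu (t' *\<^sub>R (s *\<^sub>R v + t *\<^sub>R (v + w)) + s *\<^sub>R (s' *\<^sub>R (v + w) + t' *\<^sub>R w))"
    by (rule violated_combination) (use st st' in auto)
  moreover have "t' *\<^sub>R (s *\<^sub>R v + t *\<^sub>R (v + w)) + s *\<^sub>R (s' *\<^sub>R (v + w) + t' *\<^sub>R w) =
     (t' * s + t' * t + s * s') *\<^sub>R (v + w)" by (simp add: algebra_simps)
  ultimately show False using not_violated_scale[OF b, of "t' * s + t' * t + s * s'"] st st' by simp
qed

text \<open>The affine coordinates \<open>n v - m \<bullet> lp v\<close> and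
  \<open>n w - m \<bullet> lp w\<close> preserve area and turn the cut triangle into a right
  triangle with legs \<open>h\<close>; on a leaf the linearity of \<open>nu\<close> leaves nothing
  to cut.\<close>

lemma cut_region_borel: "icr v w = 1 \<Longrightarrow> good T v w \<Longrightarrow>
   cut_region (lp v) (lp w) \<in> sets borel \<and> emeasure lborel (cut_region (lp v) (lp w)) = ennreal (cut_sum T v w / 2) \<and> cut_sum T v w \<ge> 0"
proof (induction T arbitrary: v w)
  case Lf
  have "cut_region (lp v) (lp w) = {}"
  proof (rule ccontr)
    assume "cut_region (lp v) (lp w) \<noteq> {}"
    then obtain m where "m \<in> cut_region (lp v) (lp w)" by blast
    then obtain s t where st: "s > 0" "t > 0" "m \<bullet> (s *\<^sub>R lp v + t *\<^sub>R lp w) > nu (s *\<^sub>R lp v + t *\<^sub>R lp w)"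
      and b: "m \<bullet> lp v \<le> n v" "m \<bullet> lp w \<le> n w" by (rule cut_regionE)
    have "m \<bullet> (s *\<^sub>R lp v + t *\<^sub>R lp w) \<le> s * n v + t * n w"
      using b st by (simp add: inner_add_right add_mono mult_left_mono)
    then show False using st good_Lf_linear[OF Lf(2,1), of s t] by simp
  qed
  then show ?case by simp
next
  case (Nd l r)
  have i: "icr v (v + w) = 1" "icr (v + w) w = 1" using Nd.prems by (simp_all add: icr_add)
  have d: "crs (lp v) (lp w) = 1" using Nd(3) by (simp add: crs_lattice_point)
  have g: "good l v (v + w)" "good r (v + w) w" using Nd.prems by simp_all
  note L = Nd.IH(1)[OF i(1) g(1)] and R = Nd.IH(2)[OF i(2) g(2)]
  let ?v = "lp v" and ?w = "lp w"
  let ?L = "cut_region ?v (lp (v + w))" and ?R = "cut_region (lp (v + w)) ?w"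
  define h where "h = n v + n w - n (v + w)"
  have h: "h \<ge> 0" using nu_add[of ?v ?w] by (simp add: h_def lattice_point_add)
  let ?K = "{p::real\<times>real. fst p \<ge> 0 \<and> snd p \<ge> 0 \<and> fst p + snd p < h}"
  have T: "cut_triangle ?v ?w = {m. (n v + ((- fst ?v) * fst m + (- snd ?v) * snd m), n w + ((- fst ?w) * fst m + (- snd ?w) * snd m)) \<in> ?K}"
    by (auto simp: cut_triangle_def inner_pair h_def lattice_point_add algebra_simps)
  have Tm: "emeasure lborel (cut_triangle ?v ?w) = ennreal (h\<^sup>2 / 2)"
    unfolding T emeasure_corner_triangle[OF h, symmetric]
    by (rule emeasure_affine_vimage[OF _ sets_corner_triangle]) (use d in \<open>simp add: crs_def algebra_simps\<close>)
  have Tb: "cut_triangle ?v ?w \<in> sets borel"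
  proof -
    have "{m. m \<bullet> ?v \<le> n v} \<in> sets borel" "{m. m \<bullet> ?w \<le> n w} \<in> sets borel"
      by (intro borel_closed closed_Collect_le continuous_intros)+
    moreover have "{m. nu (?v + ?w) < m \<bullet> (?v + ?w)} \<in> sets borel"
      by (intro borel_open open_Collect_less continuous_intros)
    moreover have "cut_triangle ?v ?w = {m. m \<bullet> ?v \<le> n v} \<inter> {m. m \<bullet> ?w \<le> n w} \<inter> {m. nu (?v + ?w) < m \<bullet> (?v + ?w)}"
      by (auto simp: cut_triangle_def)
    ultimately show ?thesis by (simp only: sets.Int)
  qed
  have sp: "cut_region ?v ?w = cut_triangle ?v ?w \<union> (?L \<union> ?R)"
    and dj: "cut_triangle ?v ?w \<inter> (?L \<union> ?R) = {}" "?L \<inter> ?R = {}"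
    unfolding lattice_point_add by (rule cut_region_split cut_triangle_disjoint cut_region_disjoint)+
  have "emeasure lborel (cut_region ?v ?w) = emeasure lborel (cut_triangle ?v ?w) + (emeasure lborel ?L + emeasure lborel ?R)"
  proof -
    have "emeasure lborel (?L \<union> ?R) = emeasure lborel ?L + emeasure lborel ?R"
      using L R dj by (intro plus_emeasure[symmetric]) auto
    moreover have "emeasure lborel (cut_region ?v ?w) = emeasure lborel (cut_triangle ?v ?w) + emeasure lborel (?L \<union> ?R)"
      unfolding sp using L R Tb dj by (intro plus_emeasure[symmetric]) auto
    ultimately show ?thesis by simp
  qed
  also have "\<dots> = ennreal (cut_sum (Nd l r) v w / 2)"
    using L R Tm h by (simp add: add_divide_distrib h_def[symmetric] add.assoc flip: ennreal_plus)
  finally have "emeasure lborel (cut_region ?v ?w) = ennreal (cut_sum (Nd l r) v w / 2)" .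
  moreover have "cut_region ?v ?w \<in> sets borel" unfolding sp using L R Tb by (intro sets.Un) simp_all
  ultimately show ?case using L R by simp
qed

text \<open>Adding a multiple of \<open>- v\<close> to a violated direction leaves a multiple of
  \<open>w\<close>, which is not violated. This puts the cut regions of the quadrants into the
  rectangle of the four axis constraints.\<close>

lemma cut_region_bound_neg:
  assumes "m \<in> cut_region v w" shows "m \<bullet> (- v) \<le> nu (- v)" "m \<bullet> (- w) \<le> nu (- w)"
proof -
  obtain s t where st: "s > 0" "t > 0" "m \<bullet> (s *\<^sub>R v + t *\<^sub>R w) > nu (s *\<^sub>R v + t *\<^sub>R w)"
    and b: "m \<bullet> v \<le> nu v" "m \<bullet> w \<le> nu w" using assms by (rule cut_regionE)
  show "m \<bullet> (- v) \<le> nu (- v)"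
  proof (rule ccontr)
    assume neg: "\<not> m \<bullet> (- v) \<le> nu (- v)"
    have "m \<bullet> (1 *\<^sub>R (s *\<^sub>R v + t *\<^sub>R w) + s *\<^sub>R (- v)) > nu (1 *\<^sub>R (s *\<^sub>R v + t *\<^sub>R w) + s *\<^sub>R (- v))"
      by (rule violated_combination) (use st neg in auto)
    then show False using not_violated_scale[OF b(2), of t] st by simp
  qed
  show "m \<bullet> (- w) \<le> nu (- w)"
  proof (rule ccontr)
    assume neg: "\<not> m \<bullet> (- w) \<le> nu (- w)"
    have "m \<bullet> (1 *\<^sub>R (s *\<^sub>R v + t *\<^sub>R w) + t *\<^sub>R (- w)) > nu (1 *\<^sub>R (s *\<^sub>R v + t *\<^sub>R w) + t *\<^sub>R (- w))"
      by (rule violated_combination) (use st neg in auto)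
    then show False using not_violated_scale[OF b(1), of s] st by simp
  qed
qed

lemma cut_region_disjoint_adjacent: "cut_region v w \<inter> cut_region w (- v) = {}"
proof (rule ccontr)
  assume "\<not> ?thesis"
  then obtain m where m: "m \<in> cut_region v w" "m \<in> cut_region w (- v)" by blast
  obtain s t where st: "s > 0" "t > 0" "m \<bullet> (s *\<^sub>R v + t *\<^sub>R w) > nu (s *\<^sub>R v + t *\<^sub>R w)"
    and b: "m \<bullet> w \<le> nu w" using m(1) by (rule cut_regionE)
  obtain s' t' where st': "s' > 0" "t' > 0" "m \<bullet> (s' *\<^sub>R w + t' *\<^sub>R (- v)) > nu (s' *\<^sub>R w + t' *\<^sub>R (- v))"
    using m(2) by (rule cut_regionE)
  have "m \<bullet> (t' *\<^sub>R (s *\<^sub>R v + t *\<^sub>R w) + s *\<^sub>R (s' *\<^sub>R w + t' *\<^sub>R (- v))) >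
     nu (t' *\<^sub>R (s *\<^sub>R v + t *\<^sub>R w) + s *\<^sub>R (s' *\<^sub>R w + t' *\<^sub>R (- v)))"
    by (rule violated_combination) (use st st' in auto)
  moreover have "t' *\<^sub>R (s *\<^sub>R v + t *\<^sub>R w) + s *\<^sub>R (s' *\<^sub>R w + t' *\<^sub>R (- v)) = (t' * t + s * s') *\<^sub>R w"
    by (simp add: algebra_simps)
  ultimately show False using not_violated_scale[OF b, of "t' * t + s * s'"] st st' by simp
qed

lemma cut_region_disjoint_opposite: "cut_region v w \<inter> cut_region (- v) (- w) = {}"
proof (rule ccontr)
  assume "\<not> ?thesis"
  then obtain m where m: "m \<in> cut_region v w" "m \<in> cut_region (- v) (- w)" by blast
  obtain s t where st: "s > 0" "t > 0" "m \<bullet> (s *\<^sub>R v + t *\<^sub>R w) > nu (s *\<^sub>R v + t *\<^sub>R w)"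
    and b: "m \<bullet> w \<le> nu w" using m(1) by (rule cut_regionE)
  obtain s' t' where st': "s' > 0" "t' > 0" "m \<bullet> (s' *\<^sub>R (- v) + t' *\<^sub>R (- w)) > nu (s' *\<^sub>R (- v) + t' *\<^sub>R (- w))"
    and b': "m \<bullet> (- w) \<le> nu (- w)" using m(2) by (rule cut_regionE)
  have "m \<bullet> (s' *\<^sub>R (s *\<^sub>R v + t *\<^sub>R w) + s *\<^sub>R (s' *\<^sub>R (- v) + t' *\<^sub>R (- w))) >
     nu (s' *\<^sub>R (s *\<^sub>R v + t *\<^sub>R w) + s *\<^sub>R (s' *\<^sub>R (- v) + t' *\<^sub>R (- w)))"
    by (rule violated_combination) (use st st' in auto)
  moreover have "s' *\<^sub>R (s *\<^sub>R v + t *\<^sub>R w) + s *\<^sub>R (s' *\<^sub>R (- v) + t' *\<^sub>R (- w)) = (s' * t - s * t') *\<^sub>R w"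
    "(s' * t - s * t') *\<^sub>R w = (s * t' - s' * t) *\<^sub>R (- w)"
    by (simp_all add: algebra_simps)
  ultimately show False
    using not_violated_scale[OF b, of "s' * t - s * t'"] not_violated_scale[OF b', of "s * t' - s' * t"]
    by (cases "s' * t \<ge> s * t'") simp_all
qed

text \<open>One subdivision is forced because \<open>kink\<close> is applied at the axes too, where
  the neighbouring axis vectors are opposite and \<open>icr v w = 0\<close>.\<close>

lemma ex_good_Nd:
  assumes "icr v w = 1" obtains T where "good T v w" "T \<noteq> Lf"
proof -
  have "icr v (v + w) = 1" "icr (v + w) w = 1" using assms by (simp_all add: icr_add)
  then obtain l r where "good l v (v + w)" "good r (v + w) w" using ex_good by blast
  then show ?thesis by (intro that[of "Nd l r"]) simp_all
qed

section \<open>Assembling the four quadrants\<close>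

lemma emeasure_Un4:
  assumes "A \<in> sets M" "B \<in> sets M" "C \<in> sets M" "D \<in> sets M"
    "A \<inter> B = {}" "A \<inter> C = {}" "A \<inter> D = {}" "B \<inter> C = {}" "B \<inter> D = {}" "C \<inter> D = {}"
  shows "emeasure M (A \<union> B \<union> C \<union> D) = emeasure M A + emeasure M B + emeasure M C + emeasure M D"
proof -
  have "emeasure M ((A \<union> B \<union> C) \<union> D) = emeasure M (A \<union> B \<union> C) + emeasure M D"
    using assms by (intro plus_emeasure[symmetric]) auto
  also have "emeasure M (A \<union> B \<union> C) = emeasure M (A \<union> B) + emeasure M C"
    using assms by (intro plus_emeasure[symmetric]) auto
  also have "emeasure M (A \<union> B) = emeasure M A + emeasure M B"
    using assms by (intro plus_emeasure[symmetric]) auto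
  finally show ?thesis .
qed

lemma polar_borel: "polar_polytope P \<in> sets borel"
  by (rule borel_closed[OF compact_imp_closed[OF compact_polar]])

theorem lattice_sum_expansion:
  shows "t > 0 \<Longrightarrow> (\<lambda>p. exp (- t * n p)) summable_on UNIV"
    and "((\<lambda>t. (\<Sum>\<^sub>\<infinity>p. exp (- t * n p)) -
        (normalized_volume P / t\<^sup>2 + normalized_volume (polar_polytope P) / 12)) \<longlongrightarrow> 0) (at_right 0)"
proof -
  define e1 e2 e3 e4 :: "int \<times> int" where "e1 = (1, 0)" and "e2 = (0, 1)" and "e3 = (-1, 0)" and "e4 = (0, -1)"
  note e_def = e1_def e2_def e3_def e4_def
  have ic: "icr e1 e2 = 1" "icr e2 e3 = 1" "icr e3 e4 = 1" "icr e4 e1 = 1"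
    and ic0: "icr e1 e3 = 0" "icr e2 e4 = 0" "icr e3 e1 = 0" "icr e4 e2 = 0"
    by (simp_all add: icr_def e_def)
  obtain T1 where T1: "good T1 e1 e2" "T1 \<noteq> Lf" using ex_good_Nd[OF ic(1)] .
  obtain T2 where T2: "good T2 e2 e3" "T2 \<noteq> Lf" using ex_good_Nd[OF ic(2)] .
  obtain T3 where T3: "good T3 e3 e4" "T3 \<noteq> Lf" using ex_good_Nd[OF ic(3)] .
  obtain T4 where T4: "good T4 e4 e1" "T4 \<noteq> Lf" using ex_good_Nd[OF ic(4)] .
  define A where "A = area_sum T1 e1 e2 + area_sum T2 e2 e3 + area_sum T3 e3 e4 + area_sum T4 e4 e1"
  define C where "C = const_term T1 e1 e2 + const_term T2 e2 e3 + const_term T3 e3 e4 + const_term T4 e4 e1"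
  define X where "X = cut_sum T1 e1 e2 + cut_sum T2 e2 e3 + cut_sum T3 e3 e4 + cut_sum T4 e4 e1"
  define S where "S = (\<lambda>t. cone_series t T1 e1 e2 + cone_series t T2 e2 e3 + cone_series t T3 e3 e4 + cone_series t T4 e4 e1)"
  have pos: "n e1 > 0" "n e2 > 0" "n e3 > 0" "n e4 > 0"
    by (rule n_pos; simp add: e_def zero_prod_def)+
  have lpe: "lp e1 = (1, 0)" "lp e2 = (0, 1)" "lp e3 = (-1, 0)" "lp e4 = (0, -1)"
    by (simp_all add: e_def lattice_point_def)
  have lp3: "lp e3 = - lp e1" and lp4: "lp e4 = - lp e2" by (simp_all add: lpe)

  have sums: "((\<lambda>p. exp (- t * n p)) has_sum (1 + S t)) UNIV" if t: "t > 0" for t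
  proof -
    let ?f = "\<lambda>p. exp (- t * n p)"
    let ?H1 = "half_open_lattice e1 e2" and ?H2 = "half_open_lattice e2 e3"
      and ?H3 = "half_open_lattice e3 e4" and ?H4 = "half_open_lattice e4 e1"
    have H: "?H1 = {p. snd p > 0 \<and> fst p \<ge> 0}" "?H2 = {p. - fst p > 0 \<and> snd p \<ge> 0}"
      "?H3 = {p. - snd p > 0 \<and> - fst p \<ge> 0}" "?H4 = {p. fst p > 0 \<and> - snd p \<ge> 0}"
      by (auto simp: half_open_lattice_def icr_def e_def)
    have "(?f has_sum (((cone_series t T1 e1 e2 + cone_series t T2 e2 e3) + cone_series t T3 e3 e4) + cone_series t T4 e4 e1))
       (((?H1 \<union> ?H2) \<union> ?H3) \<union> ?H4)"
      by (intro has_sum_Un_disjoint cone_series_has_sum T1(1) T2(1) T3(1) T4(1) ic t) (auto simp: H)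
    \<comment> \<open>The quadrants omit the origin, which contributes 1.\<close>
    then have "(?f has_sum (?f 0 + S t)) (insert 0 (((?H1 \<union> ?H2) \<union> ?H3) \<union> ?H4))"
      unfolding S_def by (intro has_sum_insert) (auto simp: H)
    moreover have "insert 0 (((?H1 \<union> ?H2) \<union> ?H3) \<union> ?H4) = UNIV"
      unfolding H by (auto simp: prod_eq_iff)
    ultimately show ?thesis by simp
  qed
  show "(\<lambda>p. exp (- t * n p)) summable_on UNIV" if "t > 0" for t
    using sums[OF that] by (auto simp: summable_on_def)

  have exp: "((\<lambda>t. 1 + S t - (A / t\<^sup>2 + (1 + C))) \<longlongrightarrow> 0) (at_right 0)"
  proof -
    note ex = cone_series_expansion[OF ic(1), of T1] cone_series_expansion[OF ic(2), of T2]
      cone_series_expansion[OF ic(3), of T3] cone_series_expansion[OF ic(4), of T4]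
    show ?thesis using tendsto_add[OF tendsto_add[OF tendsto_add[OF ex(1) ex(2)] ex(3)] ex(4)]
      by (simp add: S_def A_def C_def add_divide_distrib diff_divide_distrib algebra_simps)
  qed

  have vol: "normalized_volume P = A"
  proof -
    let ?H1 = "half_open_cone (lp e1) (lp e2)" and ?H2 = "half_open_cone (lp e2) (lp e3)"
      and ?H3 = "half_open_cone (lp e3) (lp e4)" and ?H4 = "half_open_cone (lp e4) (lp e1)"
    have H: "?H1 = {p. snd p > 0 \<and> fst p \<ge> 0}" "?H2 = {p. - fst p > 0 \<and> snd p \<ge> 0}"
      "?H3 = {p. - snd p > 0 \<and> - fst p \<ge> 0}" "?H4 = {p. fst p > 0 \<and> - snd p \<ge> 0}"
      unfolding half_open_cone_def crs_def lpe by auto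
    have P: "P = insert 0 ((P \<inter> ?H1) \<union> (P \<inter> ?H2) \<union> (P \<inter> ?H3) \<union> (P \<inter> ?H4))"
      unfolding H using zero_P by (auto simp: prod_eq_iff zero_prod_def)
    have "emeasure lborel P = emeasure lborel ({0} \<union> ((P \<inter> ?H1) \<union> (P \<inter> ?H2) \<union> (P \<inter> ?H3) \<union> (P \<inter> ?H4)))"
      using P by simp
    also have "\<dots> = emeasure lborel {0::real\<times>real} + emeasure lborel ((P \<inter> ?H1) \<union> (P \<inter> ?H2) \<union> (P \<inter> ?H3) \<union> (P \<inter> ?H4))"
      by (intro plus_emeasure[symmetric]) (use P_borel half_open_cone_borel in \<open>auto simp: half_open_cone_def\<close>)
    also have "emeasure lborel ((P \<inter> ?H1) \<union> (P \<inter> ?H2) \<union> (P \<inter> ?H3) \<union> (P \<inter> ?H4)) =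
       emeasure lborel (P \<inter> ?H1) + emeasure lborel (P \<inter> ?H2) + emeasure lborel (P \<inter> ?H3) + emeasure lborel (P \<inter> ?H4)"
      by (rule emeasure_Un4, (simp only: sets_lborel sets.Int P_borel half_open_cone_borel)+, auto simp: H)
    also have "\<dots> = ennreal (A / 2)"
      using emeasure_P_cone T1(1) T2(1) T3(1) T4(1) ic area_sum_nonneg
      by (simp add: A_def add_divide_distrib flip: ennreal_plus)
    finally have "measure lborel P = A / 2"
      using area_sum_nonneg ic by (simp add: measure_def A_def)
    then show ?thesis by (simp add: normalized_volume_def)
  qed

  have pvol: "normalized_volume (polar_polytope P) = 2 * (n e1 + n e3) * (n e2 + n e4) - X"
  proof -
    let ?D1 = "cut_region (lp e1) (lp e2)" and ?D2 = "cut_region (lp e2) (lp e3)"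
      and ?D3 = "cut_region (lp e3) (lp e4)" and ?D4 = "cut_region (lp e4) (lp e1)"
    define R where "R = {m. m \<bullet> lp e1 \<le> n e1 \<and> m \<bullet> lp e2 \<le> n e2 \<and> m \<bullet> lp e3 \<le> n e3 \<and> m \<bullet> lp e4 \<le> n e4}"
    have DR: "?D1 \<union> ?D2 \<union> ?D3 \<union> ?D4 \<subseteq> R"
    proof -
      have neg: "lp e1 = - lp e3" "lp e2 = - lp e4" "lp e3 = - lp e1" "lp e4 = - lp e2"
        by (simp_all add: lpe)
      have "m \<in> R" if "m \<in> ?D1" for m
        using that cut_region_bound_neg[OF that] unfolding R_def cut_region_def neg(3,4) by blast
      moreover have "m \<in> R" if "m \<in> ?D2" for m
      proof -
        have "m \<bullet> lp e4 \<le> n e4" "m \<bullet> lp e1 \<le> n e1" using cut_region_bound_neg[OF that] neg by metis+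
        then show ?thesis using that unfolding R_def cut_region_def by blast
      qed
      moreover have "m \<in> R" if "m \<in> ?D3" for m
      proof -
        have "m \<bullet> lp e1 \<le> n e1" "m \<bullet> lp e2 \<le> n e2" using cut_region_bound_neg[OF that] neg by metis+
        then show ?thesis using that unfolding R_def cut_region_def by blast
      qed
      moreover have "m \<in> R" if "m \<in> ?D4" for m
      proof -
        have "m \<bullet> lp e2 \<le> n e2" "m \<bullet> lp e3 \<le> n e3" using cut_region_bound_neg[OF that] neg by metis+
        then show ?thesis using that unfolding R_def cut_region_def by blast
      qed
      ultimately show ?thesis by blast
    qed
    have quad: "\<exists>s\<ge>0. \<exists>t\<ge>0. y = s *\<^sub>R lp e1 + t *\<^sub>R lp e2 \<or> y = s *\<^sub>R lp e2 + t *\<^sub>R lp e3 \<or>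
        y = s *\<^sub>R lp e3 + t *\<^sub>R lp e4 \<or> y = s *\<^sub>R lp e4 + t *\<^sub>R lp e1" for y :: "real \<times> real"
    proof -
      have "y = fst y *\<^sub>R lp e1 + snd y *\<^sub>R lp e2" "y = snd y *\<^sub>R lp e2 + (- fst y) *\<^sub>R lp e3"
        "y = (- fst y) *\<^sub>R lp e3 + (- snd y) *\<^sub>R lp e4" "y = (- snd y) *\<^sub>R lp e4 + fst y *\<^sub>R lp e1"
        by (simp_all add: lpe)
      then show ?thesis by (metis neg_0_le_iff_le linear)
    qed
    \<comment> \<open>A direction violated by a point of the rectangle lies in some quadrant, whose
      axes are not violated.\<close>
    have RD: "R = polar_polytope P \<union> (?D1 \<union> ?D2 \<union> ?D3 \<union> ?D4)"
    proof (intro equalityI subsetI)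
      fix m assume m: "m \<in> R"
      show "m \<in> polar_polytope P \<union> (?D1 \<union> ?D2 \<union> ?D3 \<union> ?D4)"
      proof (cases "m \<in> polar_polytope P")
        case False
        then obtain y where y: "m \<bullet> y > nu y" unfolding mem_polar_iff by (auto simp: not_le)
        obtain s t where st: "s \<ge> 0" "t \<ge> 0" and cs: "y = s *\<^sub>R lp e1 + t *\<^sub>R lp e2 \<or> y = s *\<^sub>R lp e2 + t *\<^sub>R lp e3 \<or>
          y = s *\<^sub>R lp e3 + t *\<^sub>R lp e4 \<or> y = s *\<^sub>R lp e4 + t *\<^sub>R lp e1" using quad by blast
        have "m \<bullet> lp e1 \<le> n e1" "m \<bullet> lp e2 \<le> n e2" "m \<bullet> lp e3 \<le> n e3" "m \<bullet> lp e4 \<le> n e4"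
          using m by (simp_all add: R_def)
        then have "m \<in> ?D1 \<or> m \<in> ?D2 \<or> m \<in> ?D3 \<or> m \<in> ?D4"
          using cs y st by (metis cut_regionI)
        then show ?thesis by blast
      qed simp
    next
      fix m assume "m \<in> polar_polytope P \<union> (?D1 \<union> ?D2 \<union> ?D3 \<union> ?D4)"
      then show "m \<in> R" using DR by (auto simp: R_def nu_ge)
    qed
    have PD: "polar_polytope P \<inter> cut_region v w = {}" for v w
    proof -
      have "m \<notin> cut_region v w" if "m \<in> polar_polytope P" for m
        unfolding cut_region_def using nu_ge[OF that] by (simp add: not_less)
      then show ?thesis by blast
    qed
    have "emeasure lborel R = emeasure lborel (polar_polytope P) + emeasure lborel (?D1 \<union> ?D2 \<union> ?D3 \<union> ?D4)"
      unfolding RD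
    proof (rule plus_emeasure[symmetric])
      show "polar_polytope P \<inter> (?D1 \<union> ?D2 \<union> ?D3 \<union> ?D4) = {}" by (simp add: Int_Un_distrib PD)
    qed (use polar_borel cut_region_borel[OF ic(1) T1(1)] cut_region_borel[OF ic(2) T2(1)]
        cut_region_borel[OF ic(3) T3(1)] cut_region_borel[OF ic(4) T4(1)] in auto)
    also have "emeasure lborel (?D1 \<union> ?D2 \<union> ?D3 \<union> ?D4) =
        emeasure lborel ?D1 + emeasure lborel ?D2 + emeasure lborel ?D3 + emeasure lborel ?D4"
    proof (rule emeasure_Un4)
      show "?D1 \<inter> ?D2 = {}" using cut_region_disjoint_adjacent[of "lp e1" "lp e2"] by (simp add: lpe)
      show "?D2 \<inter> ?D3 = {}" using cut_region_disjoint_adjacent[of "lp e2" "lp e3"] by (simp add: lpe)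
      show "?D3 \<inter> ?D4 = {}" using cut_region_disjoint_adjacent[of "lp e3" "lp e4"] by (simp add: lpe)
      show "?D1 \<inter> ?D4 = {}" using cut_region_disjoint_adjacent[of "lp e4" "lp e1"] by (simp add: lpe Int_commute)
      show "?D1 \<inter> ?D3 = {}" using cut_region_disjoint_opposite[of "lp e1" "lp e2"] by (simp add: lpe)
      show "?D2 \<inter> ?D4 = {}" using cut_region_disjoint_opposite[of "lp e2" "lp e3"] by (simp add: lpe)
    qed (use cut_region_borel[OF ic(1) T1(1)] cut_region_borel[OF ic(2) T2(1)]
        cut_region_borel[OF ic(3) T3(1)] cut_region_borel[OF ic(4) T4(1)] in auto)
    also have "\<dots> = ennreal (X / 2)"
      using cut_region_borel[OF ic(1) T1(1)] cut_region_borel[OF ic(2) T2(1)]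
        cut_region_borel[OF ic(3) T3(1)] cut_region_borel[OF ic(4) T4(1)]
      by (simp add: X_def add_divide_distrib flip: ennreal_plus)
    finally have R1: "emeasure lborel R = emeasure lborel (polar_polytope P) + ennreal (X / 2)" .
    have "R = cbox (- n e3, - n e4) (n e1, n e2)"
      by (auto simp: R_def inner_pair lpe cbox_Pair_eq)
    then have "R = {- n e3..n e1} \<times> {- n e4..n e2}" by (simp add: cbox_Pair_eq)
    then have "emeasure lborel R = emeasure (lborel \<Otimes>\<^sub>M lborel) ({- n e3..n e1} \<times> {- n e4..n e2})"
      by (simp only: lborel_prod)
    also have "\<dots> = emeasure lborel {- n e3..n e1} * emeasure lborel {- n e4..n e2}"
      by (rule lborel.emeasure_pair_measure_Times) simp_all
    also have "\<dots> = ennreal ((n e1 + n e3) * (n e2 + n e4))"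
      using pos by (simp add: ennreal_mult)
    finally have R2: "emeasure lborel R = ennreal ((n e1 + n e3) * (n e2 + n e4))" .
    have fin: "emeasure lborel (polar_polytope P) < \<infinity>"
      by (rule emeasure_bounded_finite[OF compact_imp_bounded[OF compact_polar]])
    then have m: "emeasure lborel (polar_polytope P) = ennreal (measure lborel (polar_polytope P))"
      by (intro emeasure_eq_ennreal_measure) auto
    have "X \<ge> 0" using cut_region_borel[OF ic(1) T1(1)] cut_region_borel[OF ic(2) T2(1)]
        cut_region_borel[OF ic(3) T3(1)] cut_region_borel[OF ic(4) T4(1)] by (simp add: X_def)
    then have "(n e1 + n e3) * (n e2 + n e4) = measure lborel (polar_polytope P) + X / 2"
      using R1 R2 m pos by (simp flip: ennreal_plus)
    then have "measure lborel (polar_polytope P) = (n e1 + n e3) * (n e2 + n e4) - X / 2" by simp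
    then show ?thesis by (simp only: normalized_volume_def) simp
  qed

  \<comment> \<open>At an axis the neighbours \<open>v\<close> and \<open>w\<close> are opposite, so
    by \<open>kink\<close> the slopes cancel unless \<open>n x = 1\<close>, in which case the other
    factor is 0.\<close>
  have zero: "(right_slope l v x + left_slope r x w) * (1 / n x - n x) = 0"
    if "good l v x" "icr v x = 1" "good r x w" "icr x w = 1" "icr v w = 0" "l \<noteq> Lf" for l r v x w
    using kink[OF that(1-4)] that by auto
  have "12 * C = -12 + 2 * (n e1 + n e3) * (n e2 + n e4) - X +
     ((right_slope T4 e4 e1 + left_slope T1 e1 e2) * (1 / n e1 - n e1) +
      (right_slope T1 e1 e2 + left_slope T2 e2 e3) * (1 / n e2 - n e2) +
      (right_slope T2 e2 e3 + left_slope T3 e3 e4) * (1 / n e3 - n e3) +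
      (right_slope T3 e3 e4 + left_slope T4 e4 e1) * (1 / n e4 - n e4))"
    unfolding C_def X_def distrib_left const_term_eq[OF T1(1) ic(1)] const_term_eq[OF T2(1) ic(2)]
      const_term_eq[OF T3(1) ic(3)] const_term_eq[OF T4(1) ic(4)] by (simp add: algebra_simps)
  also have "\<dots> = -12 + 2 * (n e1 + n e3) * (n e2 + n e4) - X"
    unfolding zero[OF T4(1) ic(4) T1(1) ic(1) ic0(4) T4(2)] zero[OF T1(1) ic(1) T2(1) ic(2) ic0(1) T1(2)]
      zero[OF T2(1) ic(2) T3(1) ic(3) ic0(2) T2(2)] zero[OF T3(1) ic(3) T4(1) ic(4) ic0(3) T3(2)]
    by simp
  \<comment> \<open>The four quadrants contribute -12 to \<open>12 * C\<close>, which cancels the 1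
    of the origin.\<close>
  finally have C: "1 + C = normalized_volume (polar_polytope P) / 12" unfolding pvol by simp
  have "eventually (\<lambda>t. 1 + S t - (A / t\<^sup>2 + (1 + C)) = (\<Sum>\<^sub>\<infinity>p. exp (- t * n p)) -
        (normalized_volume P / t\<^sup>2 + normalized_volume (polar_polytope P) / 12)) (at_right 0)"
    unfolding eventually_at_filter
  proof (intro always_eventually allI impI)
    fix t :: real assume "t \<noteq> 0" "t \<in> {0<..}"
    then have "(\<Sum>\<^sub>\<infinity>p. exp (- t * n p)) = 1 + S t" by (intro infsumI sums) simp
    then show "1 + S t - (A / t\<^sup>2 + (1 + C)) = (\<Sum>\<^sub>\<infinity>p. exp (- t * n p)) -
        (normalized_volume P / t\<^sup>2 + normalized_volume (polar_polytope P) / 12)"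
      by (simp only: vol C)
  qed
  with exp show "((\<lambda>t. (\<Sum>\<^sub>\<infinity>p. exp (- t * n p)) -
        (normalized_volume P / t\<^sup>2 + normalized_volume (polar_polytope P) / 12)) \<longlongrightarrow> 0) (at_right 0)"
    by (rule Lim_transform_eventually)
qed

end

section \<open>Dimensions of quotient spaces\<close>

context vector_space
begin

lemma span_Int_span_Diff:
  assumes "independent B" "C \<subseteq> B" "x \<in> span C" "x \<in> span (B - C)"
  shows "x = 0"
proof -
  have "B = C \<union> (B - C)" using assms(2) by blast
  have "representation B x = representation C x"
    using representation_extend[OF assms(1,3,2)] by simp
  moreover have "representation B x = representation (B - C) x"
    using representation_extend[OF assms(1,4)] by auto
  ultimately have "representation B x b = 0" for b
    using representation_ne_zero[of C x b] representation_ne_zero[of "B - C" x b] by (metis Diff_iff)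
  moreover have "x \<in> span B" using assms(2,3) span_mono by blast
  ultimately show ?thesis
    using sum_nonzero_representation_eq[OF assms(1), of x] by simp
qed

text \<open>Sending \<open>C\<close> into \<open>span B\<close> modulo \<open>W\<close> gives a
  linear map that moves the elements of \<open>span C\<close> only by elements of \<open>W\<close>;
  as \<open>span C\<close> meets \<open>W\<close> in 0, it is injective.\<close>

lemma complement_basis_card_le:
  assumes B: "finite B" "\<forall>v\<in>V. \<exists>b\<in>span B. v - b \<in> W"
    and C: "C \<subseteq> V" "independent C" "span C \<inter> W = {0}"
    and W: "subspace W"
  shows "finite C \<and> card C \<le> card B"
proof -
  interpret vp: vector_space_pair scale scale by unfold_locales
  obtain \<phi> where \<phi>: "\<And>c. c \<in> C \<Longrightarrow> \<phi> c \<in> span B \<and> c - \<phi> c \<in> W"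
    using B(2) C(1) by (metis subsetD)
  define g where "g = vp.construct C \<phi>"
  have lin: "Vector_Spaces.linear scale scale g"
    unfolding g_def by (rule vp.linear_construct[OF C(2)])
  interpret g: Vector_Spaces.linear scale scale g by (rule lin)
  have gc: "g c = \<phi> c" if "c \<in> C" for c
    unfolding g_def by (rule vp.construct_basis[OF C(2) that])
  have W': "x - g x \<in> W" if "x \<in> span C" for x
    using that
  proof (induction rule: span_induct_alt)
    case base show ?case using subspace_0[OF W] by (simp add: g.zero)
  next
    case (step c x y)
    have "scale c (x - g x) + (y - g y) \<in> W"
      using step \<phi>[OF step(1)] gc[OF step(1)] W by (simp add: subspace_add subspace_scale)
    then show ?case by (simp add: g.add g.scale algebra_simps)
  qed
  have inj: "inj_on g (span C)"
  proof (rule inj_onI)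
    fix x y assume "x \<in> span C" "y \<in> span C" "g x = g y"
    then have "x - y \<in> span C" "g (x - y) = 0" by (simp_all add: span_diff g.diff)
    then have "x - y \<in> span C \<inter> W" using W'[of "x - y"] by simp
    then show "x = y" using C(3) by auto
  qed
  have ind: "independent (g ` C)"
    by (rule vp.linear_independent_injective_image[OF lin C(2) inj])
  have "g ` C \<subseteq> span B" using gc \<phi> by auto
  then have "finite (g ` C) \<and> card (g ` C) \<le> card B"
    using independent_span_bound[OF B(1) ind] by blast
  moreover have "inj_on g C" using inj inj_on_subset span_superset by blast
  ultimately show ?thesis using card_image finite_imageD by metis
qed

end

text \<open>The choice operator may select any basis of any complement; comparing it with
  \<open>B\<close> in both directions shows that the cardinality does not depend on the
  choice.\<close>

lemma quot_dim_eq: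
  fixes scale :: "complex \<Rightarrow> 'a::ab_group_add \<Rightarrow> 'a"
  assumes vs: "vector_space scale"
  assumes "finite B" "B \<subseteq> V" "\<not> module.dependent scale B" "module.span scale B \<inter> W = {0}"
    and "\<forall>v\<in>V. \<exists>b\<in>module.span scale B. v - b \<in> W" and W: "module.subspace scale W"
  shows "quot_dim scale V W = card B"
proof -
  interpret vector_space scale by (rule vs)
  define Q where "Q = (\<lambda>B. B \<subseteq> V \<and> \<not> module.dependent scale B \<and> module.span scale B \<inter> W = {0} \<and>
     (\<forall>v\<in>V. \<exists>b\<in>module.span scale B. v - b \<in> W))"
  have "Q B" using assms(2-6) by (simp add: Q_def)
  then have Q: "Q (Eps Q)" by (rule someI)
  have "finite (Eps Q) \<and> card (Eps Q) \<le> card B"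
    by (rule complement_basis_card_le[OF assms(2,6) _ _ _ W]) (use Q in \<open>simp_all add: Q_def\<close>)
  moreover from this have "finite B \<and> card B \<le> card (Eps Q)"
    by (intro complement_basis_card_le[OF _ _ assms(3,4,5) W]) (use Q in \<open>simp_all add: Q_def\<close>)
  ultimately have "card (Eps Q) = card B" by simp
  then show ?thesis by (simp add: quot_dim_def Q_def)
qed

context vector_space_pair
begin

text \<open>Stated on the span of a finite set, since the spaces used later are finite-dimensional
  graded pieces of infinite-dimensional ones.\<close>

lemma rank_nullity_span:
  assumes f: "Vector_Spaces.linear s1 s2 f" and S: "finite S"
  shows "vs2.dim (f ` vs1.span S) + vs1.dim {x \<in> vs1.span S. f x = 0} = vs1.dim (vs1.span S)"
proof -
  interpret f: Vector_Spaces.linear s1 s2 f by (rule f)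
  let ?X = "vs1.span S" and ?K = "{x \<in> vs1.span S. f x = 0}"
  obtain BK where BK: "BK \<subseteq> ?K" "vs1.independent BK" "?K \<subseteq> vs1.span BK"
    using vs1.maximal_independent_subset by blast
  have "BK \<subseteq> ?X" using BK(1) by blast
  then obtain B where B: "BK \<subseteq> B" "B \<subseteq> ?X" "vs1.independent B" "?X \<subseteq> vs1.span B"
    using vs1.maximal_independent_subset_extend[OF _ BK(2)] by blast
  have fB: "finite B" using vs1.independent_span_bound[OF S B(3,2)] by simp
  have sK: "vs1.subspace ?K"
    by (rule vs1.subspaceI) (auto simp: f.add f.scale f.zero vs1.span_zero vs1.span_add vs1.span_scale)
  have "vs1.span BK = ?K" using BK(1,3) sK vs1.span_minimal by blast
  then have dK: "vs1.dim ?K = card BK" using BK by (metis vs1.dim_span_eq_card_independent)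
  have "vs1.span B = ?X" using B(2,4) vs1.span_minimal[OF B(2)] by auto
  then have dX: "vs1.dim ?X = card B" using B(3) by (metis vs1.dim_span_eq_card_independent)
  have inj: "inj_on f (vs1.span (B - BK))"
  proof (rule inj_onI)
    fix x y assume xy: "x \<in> vs1.span (B - BK)" "y \<in> vs1.span (B - BK)" "f x = f y"
    then have d: "x - y \<in> vs1.span (B - BK)" "f (x - y) = 0" by (simp_all add: vs1.span_diff f.diff)
    have "x - y \<in> vs1.span B" using d(1) vs1.span_mono[of "B - BK" B] by auto
    then have "x - y \<in> ?K" using d(2) \<open>vs1.span B = ?X\<close> by simp
    then have "x - y \<in> vs1.span BK" using BK(3) by blast
    then have "x - y = 0" using vs1.span_Int_span_Diff[OF B(3,1) _ d(1)] by simp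
    then show "x = y" by simp
  qed
  have ind: "vs2.independent (f ` (B - BK))"
    by (rule linear_independent_injective_image[OF f _ inj])
      (use B(3) vs1.independent_mono in blast)
  have "f ` ?X = vs2.span (f ` B)" using \<open>vs1.span B = ?X\<close> f.span_image by metis
  also have "f ` B \<subseteq> insert 0 (f ` (B - BK))" using BK(1) by auto
  then have "vs2.span (f ` B) = vs2.span (f ` (B - BK))"
    by (metis (no_types, lifting) Diff_subset image_mono subset_antisym vs2.span_insert_0 vs2.span_mono)
  finally have "vs2.dim (f ` ?X) = card (f ` (B - BK))"
    using ind vs2.dim_span_eq_card_independent by metis
  also have "\<dots> = card (B - BK)"
    by (rule card_image) (use inj inj_on_subset vs1.span_superset in blast)
  finally show ?thesis using dK dX B(1) fB card_Diff_subset[of BK B] card_mono[of B BK] finite_subset[of BK B]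
    by auto
qed

end

section \<open>The Koszul complex of the leading parts\<close>

abbreviation "keys \<equiv> Poly_Mapping.keys"
abbreviation "lookup \<equiv> Poly_Mapping.lookup"

lemma lookup_single_times:
  fixes a :: "'a::ab_group_add" and b :: "'b::semiring_0"
  shows "lookup (Poly_Mapping.single a b * g) k = b * lookup g (k - a)"
proof -
  have "k = l + q \<longleftrightarrow> k - l = q" for l q :: 'a by (auto simp: algebra_simps)
  then have "lookup (Poly_Mapping.single a b * g) k = (\<Sum>l. (b when a = l) * lookup g (k - l))"
    by (simp add: lookup_mult lookup_single)
  then show ?thesis by (simp add: when_mult)
qed

lemma poly_mapping_eq_sum_single:
  "x = (\<Sum>k\<in>keys x. Poly_Mapping.single k (lookup x k))"
proof (rule poly_mapping_eqI)
  fix k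
  show "lookup x k = lookup (\<Sum>k\<in>keys x. Poly_Mapping.single k (lookup x k)) k"
    by (simp add: lookup_sum lookup_single when_def in_keys_iff)
qed

lemma lookup_times_sum:
  fixes g h :: "'a::ab_group_add \<Rightarrow>\<^sub>0 'b::semiring_0"
  assumes "finite A" "keys g \<subseteq> A"
  shows "lookup (g * h) k = (\<Sum>a\<in>A. lookup g a * lookup h (k - a))"
proof -
  have "g * h = (\<Sum>a\<in>keys g. Poly_Mapping.single a (lookup g a)) * h"
    using poly_mapping_eq_sum_single[of g] by simp
  then have "lookup (g * h) k = (\<Sum>a\<in>keys g. lookup g a * lookup h (k - a))"
    by (simp add: sum_distrib_right lookup_sum lookup_single_times)
  also have "\<dots> = (\<Sum>a\<in>A. lookup g a * lookup h (k - a))"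
    by (rule sum.mono_neutral_left) (use assms in \<open>auto simp: in_keys_iff\<close>)
  finally show ?thesis .
qed

lemma lookup_euler1: "lookup (euler1 g) a = of_int (fst a) * lookup g a"
proof -
  have "euler1 g = (\<Sum>a\<in>keys g. Poly_Mapping.single a (of_int (fst a) * lookup g a))"
    by (simp add: euler1_def pderiv1_def sum_distrib_left mult_single)
  then show ?thesis by (simp add: lookup_sum lookup_single when_def in_keys_iff)
qed

lemma lookup_euler2: "lookup (euler2 g) a = of_int (snd a) * lookup g a"
proof -
  have "euler2 g = (\<Sum>a\<in>keys g. Poly_Mapping.single a (of_int (snd a) * lookup g a))"
    by (simp add: euler2_def pderiv2_def sum_distrib_left mult_single)
  then show ?thesis by (simp add: lookup_sum lookup_single when_def in_keys_iff)
qed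

lemma euler_add [simp]: "euler1 (g + h) = euler1 g + euler1 h" "euler2 (g + h) = euler2 g + euler2 h"
  by (rule poly_mapping_eqI, simp add: lookup_euler1 lookup_euler2 lookup_add algebra_simps)+

lemma euler_diff [simp]: "euler1 (g - h) = euler1 g - euler1 h" "euler2 (g - h) = euler2 g - euler2 h"
  by (rule poly_mapping_eqI, simp add: lookup_euler1 lookup_euler2 lookup_minus algebra_simps)+

lemma euler_0 [simp]: "euler1 0 = 0" "euler2 0 = 0"
  by (rule poly_mapping_eqI, simp add: lookup_euler1 lookup_euler2)+

lemma euler_commute: "euler1 (euler2 g) = euler2 (euler1 g)"
  by (rule poly_mapping_eqI) (simp add: lookup_euler1 lookup_euler2)

lemma euler_mult:
  "euler1 (g * h) = euler1 g * h + g * euler1 h" "euler2 (g * h) = euler2 g * h + g * euler2 h"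
proof -
  have k: "keys (euler1 g) \<subseteq> keys g" "keys (euler2 g) \<subseteq> keys g"
    by (auto simp: in_keys_iff lookup_euler1 lookup_euler2)
  show "euler1 (g * h) = euler1 g * h + g * euler1 h"
  proof (rule poly_mapping_eqI)
    fix k
    have 1: "lookup (euler1 g * h) k = (\<Sum>a\<in>keys g. lookup g a * lookup h (k - a) * of_int (fst a))"
      unfolding lookup_times_sum[OF finite_keys k(1)] lookup_euler1 by (simp only: mult_ac)
    have 2: "lookup (g * euler1 h) k = (\<Sum>a\<in>keys g. lookup g a * lookup h (k - a) * of_int (fst (k - a)))"
      unfolding lookup_times_sum[OF finite_keys subset_refl] lookup_euler1 by (simp only: mult_ac)
    have "lookup (euler1 g * h + g * euler1 h) k =
       (\<Sum>a\<in>keys g. lookup g a * lookup h (k - a) * of_int (fst a)) + (\<Sum>a\<in>keys g. lookup g a * lookup h (k - a) * of_int (fst (k - a)))"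
      unfolding lookup_add 1 2 ..
    also have "\<dots> = (\<Sum>a\<in>keys g. lookup g a * lookup h (k - a) * of_int (fst k))"
      by (simp add: sum.distrib[symmetric] distrib_left[symmetric] flip: of_int_add)
    also have "\<dots> = lookup (euler1 (g * h)) k"
      by (simp add: lookup_euler1 lookup_times_sum[of "keys g" g] sum_distrib_left mult_ac)
    finally show "lookup (euler1 (g * h)) k = lookup (euler1 g * h + g * euler1 h) k" by simp
  qed
  show "euler2 (g * h) = euler2 g * h + g * euler2 h"
  proof (rule poly_mapping_eqI)
    fix k
    have 1: "lookup (euler2 g * h) k = (\<Sum>a\<in>keys g. lookup g a * lookup h (k - a) * of_int (snd a))"
      unfolding lookup_times_sum[OF finite_keys k(2)] lookup_euler2 by (simp only: mult_ac)
    have 2: "lookup (g * euler2 h) k = (\<Sum>a\<in>keys g. lookup g a * lookup h (k - a) * of_int (snd (k - a)))"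
      unfolding lookup_times_sum[OF finite_keys subset_refl] lookup_euler2 by (simp only: mult_ac)
    have "lookup (euler2 g * h + g * euler2 h) k =
       (\<Sum>a\<in>keys g. lookup g a * lookup h (k - a) * of_int (snd a)) + (\<Sum>a\<in>keys g. lookup g a * lookup h (k - a) * of_int (snd (k - a)))"
      unfolding lookup_add 1 2 ..
    also have "\<dots> = (\<Sum>a\<in>keys g. lookup g a * lookup h (k - a) * of_int (snd k))"
      by (simp add: sum.distrib[symmetric] distrib_left[symmetric] flip: of_int_add)
    also have "\<dots> = lookup (euler2 (g * h)) k"
      by (simp add: lookup_euler2 lookup_times_sum[of "keys g" g] sum_distrib_left mult_ac)
    finally show "lookup (euler2 (g * h)) k = lookup (euler2 g * h + g * euler2 h) k" by simp
  qed
qed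

lemma euler_single [simp]:
  "euler1 (Poly_Mapping.single c b) = Poly_Mapping.single c (of_int (fst c) * b)"
  "euler2 (Poly_Mapping.single c b) = Poly_Mapping.single c (of_int (snd c) * b)"
  by (rule poly_mapping_eqI, simp add: lookup_euler1 lookup_euler2 lookup_single when_def)+

text \<open>A common divisor that is not a unit has a complex root.\<close>

lemma coprime_complex_poly:
  fixes p q :: "complex poly"
  assumes "p \<noteq> 0" "\<And>z. poly p z = 0 \<Longrightarrow> poly q z \<noteq> 0"
  shows "coprime p q"
proof (rule ccontr)
  assume "\<not> coprime p q"
  then obtain d where d: "d dvd p" "d dvd q" "\<not> is_unit d" by (auto simp: coprime_def)
  have "d \<noteq> 0" using d(1) assms(1) by auto
  then have "degree d \<noteq> 0" using d(3) is_unit_iff_degree by blast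
  then obtain z where "poly d z = 0"
    using fundamental_theorem_of_algebra[of d] by (auto simp: constant_degree)
  then have "poly p z = 0" "poly q z = 0" using d(1,2) by (auto elim!: dvdE)
  then show False using assms(2) by blast
qed

text \<open>The exactness of the Koszul complex on one facet, in a coordinate of that facet.\<close>

lemma squarefree_syzygy:
  fixes p u v :: "complex poly"
  assumes p: "poly p 0 \<noteq> 0" "\<And>z. z \<noteq> 0 \<Longrightarrow> poly p z = 0 \<Longrightarrow> poly (pderiv p) z \<noteq> 0"
    and uv: "p * u + pCons 0 (pderiv p) * v = 0"
  obtains k where "u = pCons 0 (pderiv p) * k" "v = - (p * k)"
proof -
  let ?p' = "pCons 0 (pderiv p)"
  have p0: "p \<noteq> 0" using p(1) by auto
  have "coprime p ?p'"
  proof (rule coprime_complex_poly[OF p0])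
    fix z assume "poly p z = 0"
    moreover from this have "z \<noteq> 0" using p(1) by auto
    ultimately show "poly ?p' z \<noteq> 0" using p(2) by simp
  qed
  have eq: "?p' * v = p * (- u)" using uv by (simp add: eq_neg_iff_add_eq_0 add.commute)
  then have "p dvd ?p' * v" by (rule dvdI)
  then have "p dvd v" by (simp only: coprime_dvd_mult_right_iff[OF \<open>coprime p ?p'\<close>])
  then obtain k where k: "v = p * k" by (elim dvdE)
  have "p * (?p' * k) = p * (- u)" using eq unfolding k by (simp only: mult_ac)
  then have "?p' * k = - u" using p0 mult_left_cancel[of p] by blast
  then have "u = ?p' * (- k)" by (simp only: mult_minus_right minus_minus)
  moreover have "v = - (p * (- k))" using k by simp
  ultimately show ?thesis by (rule that)
qed

text \<open>The coefficients of a Bezout relation for \<open>e\<close>, applied to \<open>d\<close>,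
  produce the integer factor.\<close>

lemma primitive_parallel:
  assumes "coprime (fst e) (snd e)" "icr e d = 0"
  obtains i where "d = (i * fst e, i * snd e)"
proof -
  have eq: "fst e * snd d = snd e * fst d" using assms(2) by (simp add: icr_def)
  obtain x y where xy: "x * fst e + y * snd e = 1"
    using assms(1) bezout_int[of "fst e" "snd e"] by auto
  define i where "i = x * fst d + y * snd d"
  have "i * fst e = (x * fst e + y * snd e) * fst d + y * (fst e * snd d - snd e * fst d)"
    by (simp add: i_def algebra_simps)
  moreover have "i * snd e = (x * fst e + y * snd e) * snd d - x * (fst e * snd d - snd e * fst d)"
    by (simp add: i_def algebra_simps)
  ultimately have "d = (i * fst e, i * snd e)" using xy eq by (simp add: prod_eq_iff)
  then show ?thesis by (rule that)
qed

lemma laurent_eval_superset: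
  assumes "finite A" "keys g \<subseteq> A"
  shows "laurent_eval g u = (\<Sum>a\<in>A. lookup g a * fst u powi fst a * snd u powi snd a)"
  unfolding laurent_eval_def by (rule sum.mono_neutral_left) (use assms in \<open>auto simp: in_keys_iff\<close>)

lemma lookup_face_part: "lookup (face_part f F) a = (if lattice_point a \<in> F then lookup f a else 0)"
proof -
  have "lookup (face_part f F) a = (\<Sum>b | b \<in> keys f \<and> lattice_point b \<in> F. if b = a then lookup f a else 0)"
    by (auto simp: face_part_def lookup_sum lookup_single when_def intro!: sum.cong)
  then show ?thesis by (auto simp: in_keys_iff)
qed

lemma complex_powi_surj:
  assumes "z \<noteq> 0" "k \<noteq> 0" obtains w :: complex where "w \<noteq> 0" "w powi k = z"
proof (cases "k > 0")
  case True
  obtain w where "w ^ nat k = z" using exists_complex_root[of "nat k" z] True by auto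
  then show ?thesis using True assms(1) by (intro that[of w]) (auto simp: power_int_def)
next
  case False
  then have k: "nat (- k) \<noteq> 0" using assms(2) by simp
  obtain w where w: "w ^ nat (- k) = inverse z" using exists_complex_root[OF k] by metis
  have "w \<noteq> 0"
  proof
    assume "w = 0"
    then have "inverse z = 0" using w k by (simp add: power_0_left)
    then show False using assms(1) by simp
  qed
  moreover have "w powi k = inverse (w ^ nat (- k))" using False by (simp add: power_int_def power_inverse)
  then have "w powi k = z" unfolding w by simp
  ultimately show ?thesis by (rule that)
qed

locale newton_polygon = polygon +
  fixes f :: laurent
  assumes P_newton: "P = newton_polytope f"
    and nondeg: "nondegenerate f"
begin

section \<open>Exactness on the cone over one facet\<close>

lemma keys_in_P: "a \<in> keys f \<Longrightarrow> lp a \<in> P"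
  unfolding P_newton newton_polytope_def by (simp add: hull_inc)

lemma E_keys: "e \<in> E \<Longrightarrow> e \<in> keys f"
proof -
  assume "e \<in> E"
  then have "lp e extreme_point_of (convex hull (lp ` keys f))"
    using extreme_E P_newton by (simp add: newton_polytope_def)
  then have "lp e \<in> lp ` keys f" by (rule extreme_point_of_convex_hull)
  then show ?thesis by auto
qed

lemma n_keys: "a \<in> keys f \<Longrightarrow> n a \<le> 1"
  using keys_in_P mem_P_iff by blast

lemma n_add: "n (a + b) \<le> n a + n b"
  using nu_add by (simp add: lattice_point_add)

lemma n_nonneg: "n a \<ge> 0" by (rule nu_nonneg)

definition sector :: "int \<times> int \<Rightarrow> int \<times> int \<Rightarrow> (int \<times> int) set" where
  "sector p q = {x. icr p x \<ge> 0 \<and> icr x q \<ge> 0}"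

definition facet_keys :: "real \<times> real \<Rightarrow> (int \<times> int) set" where
  "facet_keys m = {a \<in> keys f. m \<bullet> lp a = 1}"

lemma sector_iff: "facet p q m \<Longrightarrow> x \<in> sector p q \<longleftrightarrow> n x = m \<bullet> lp x"
  using nu_cone[of p q m "lp x"] cone_if_nu_eq[of p q m "lp x"]
  by (auto simp: sector_def crs_lattice_point)

lemma facet_le: "facet p q m \<Longrightarrow> m \<bullet> lp x \<le> n x"
  by (rule nu_ge) (simp add: facet_def)

lemma facet_le_keys: "facet p q m \<Longrightarrow> a \<in> keys f \<Longrightarrow> m \<bullet> lp a \<le> 1"
  using facet_le[of p q m a] n_keys[of a] by simp

lemma facet_keys_sector: "facet p q m \<Longrightarrow> a \<in> facet_keys m \<Longrightarrow> a \<in> sector p q \<and> n a = 1"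
  using facet_le[of p q m a] n_keys[of a] sector_iff[of p q m a] by (auto simp: facet_keys_def)

lemma lp_diff: "lp (a - b) = lp a - lp b" by (simp add: lattice_point_def)

lemma facet_cover_lattice: obtains p q m where "facet p q m" "x \<in> sector p q"
proof (cases "x = 0")
  case True
  have "(1, 0) \<noteq> (0 :: real \<times> real)" by (simp add: zero_prod_def)
  then obtain p q m where "facet p q m" by (rule facet_cover)
  then show ?thesis using that True by (simp add: sector_def icr_def)
next
  case False
  then obtain p q m where "facet p q m" "crs (lp p) (lp x) \<ge> 0" "crs (lp x) (lp q) \<ge> 0"
    using facet_cover[of "lp x"] lattice_point_eq_iff[of x 0] by (metis lattice_point_0)
  then show ?thesis using that by (simp add: sector_def crs_lattice_point)
qed

text \<open>Only pairs lying in a common facet cone contribute to the top degree of a product.\<close>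

lemma additive_sector:
  assumes F: "facet p q m" and b: "b \<in> sector p q" and ab: "n a + n (b - a) \<le> n b"
  shows "a \<in> sector p q" "b - a \<in> sector p q" "m \<bullet> lp a = n a" "m \<bullet> lp (b - a) = n (b - a)"
proof -
  have "m \<bullet> lp b = m \<bullet> lp a + m \<bullet> lp (b - a)" by (simp add: lp_diff inner_diff_right)
  then have "n b = m \<bullet> lp a + m \<bullet> lp (b - a)" using sector_iff[OF F] b by simp
  then show "m \<bullet> lp a = n a" "m \<bullet> lp (b - a) = n (b - a)"
    using facet_le[OF F, of a] facet_le[OF F, of "b - a"] ab by linarith+
  then show "a \<in> sector p q" "b - a \<in> sector p q" by (simp_all add: sector_iff[OF F])
qed

text \<open>If the degrees add up to the largest possible value, both factors lie in the cone of the
  facet and \<open>n a = 1\<close>; so only the terms of \<open>f\<close> on the facet act.\<close>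

lemma sum_keys_facet:
  fixes k :: "int \<times> int \<Rightarrow> complex"
  assumes F: "facet p q m" and k: "\<And>y. k y \<noteq> 0 \<Longrightarrow> n y = \<gamma>" and b: "b \<in> sector p q" "n b = \<gamma> + 1"
  shows "(\<Sum>a\<in>keys f. w a * k (b - a)) = (\<Sum>a\<in>facet_keys m. w a * k (b - a))"
proof (rule sum.mono_neutral_right)
  show "\<forall>a\<in>keys f - facet_keys m. w a * k (b - a) = 0"
  proof
    fix a assume a: "a \<in> keys f - facet_keys m"
    have "k (b - a) = 0"
    proof (rule ccontr)
      assume "k (b - a) \<noteq> 0"
      then have "n (b - a) = \<gamma>" by (rule k)
      then have le: "n a + n (b - a) \<le> n b" using b(2) n_keys a by auto
      have "n b \<le> n a + n (b - a)" using n_add[of a "b - a"] by simp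
      then have "n a = 1" using le \<open>n (b - a) = \<gamma>\<close> b(2) by linarith
      then have "m \<bullet> lp a = 1" using additive_sector(3)[OF F b(1) le] by simp
      then show False using a by (simp add: facet_keys_def)
    qed
    then show "w a * k (b - a) = 0" by simp
  qed
qed (auto simp: facet_keys_def)

text \<open>The lattice points of a fixed degree in the cone lie on one line parallel to the facet,
  so homogeneous elements become polynomials in one variable \<open>z\<close>, and the facet part of
  \<open>f\<close> becomes \<open>C\<close>. The exponents of the facet point \<open>p + j e\<close>
  are affine in \<open>j\<close>, so the two logarithmic derivatives become combinations of
  \<open>C\<close> and \<open>z C'\<close>, and \<open>squarefree_syzygy\<close> applies.\<close>

lemma facet_syzygy:
  fixes g1 g2 :: "int \<times> int \<Rightarrow> complex"
  assumes F: "facet p q m"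
    and g: "\<And>x. g1 x \<noteq> 0 \<or> g2 x \<noteq> 0 \<Longrightarrow> n x = \<gamma>"
    and syz: "\<And>b. n b = \<gamma> + 1 \<Longrightarrow>
       (\<Sum>a\<in>keys f. lookup f a * of_int (fst a) * g2 (b - a)) - (\<Sum>a\<in>keys f. lookup f a * of_int (snd a) * g1 (b - a)) = 0"
  obtains k where "\<And>y. k y \<noteq> 0 \<Longrightarrow> y \<in> sector p q \<and> n y = \<gamma> - 1"
    "\<And>b. b \<in> sector p q \<Longrightarrow> n b = \<gamma> \<Longrightarrow>
       g1 b = (\<Sum>a\<in>facet_keys m. lookup f a * of_int (fst a) * k (b - a)) \<and>
       g2 b = (\<Sum>a\<in>facet_keys m. lookup f a * of_int (snd a) * k (b - a))"
proof (cases "\<exists>x\<in>sector p q. n x = \<gamma>")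
  case False
  then show ?thesis by (intro that[of "\<lambda>_. 0"]) auto
next
  case True
  then obtain x where x: "x \<in> sector p q" "n x = \<gamma>" by blast
  have pq: "icr p q > 0" "p \<in> E" "q \<in> E" "m \<bullet> lp p = 1" "m \<bullet> lp q = 1"
    using F by (simp_all add: facet_def crs_lattice_point)
  \<comment> \<open>The lattice length of the facet; \<open>e\<close> below is the primitive vector
    from \<open>p\<close> towards \<open>q\<close>.\<close>
  define l where "l = gcd (fst q - fst p) (snd q - snd p)"
  have "l \<noteq> 0" using pq(1) by (auto simp: l_def icr_def)
  then have l: "l > 0" by (simp add: l_def)
  obtain e1 e2 where e12: "fst q - fst p = e1 * l" "snd q - snd p = e2 * l" "coprime e1 e2"
    using gcd_coprime_exists[of "fst q - fst p" "snd q - snd p"] \<open>l \<noteq> 0\<close> unfolding l_def by auto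
  define e where "e = (e1, e2)"
  define D where "D = icr p e"
  have lD: "l * D = icr p q"
  proof -
    have "fst q = fst p + e1 * l" "snd q = snd p + e2 * l" using e12 by simp_all
    then show ?thesis by (simp add: D_def e_def icr_def algebra_simps)
  qed
  then have D: "D > 0" using pq(1) l by (metis zero_less_mult_pos)
  have eq: "icr e q = - D"
  proof -
    have "fst q = fst p + e1 * l" "snd q = snd p + e2 * l" using e12 by simp_all
    then show ?thesis by (simp add: D_def e_def icr_def algebra_simps)
  qed
  have m_inner: "m \<bullet> lp y = of_int (fst y) * fst m + of_int (snd y) * snd m" for y
    by (simp add: inner_prod_def lattice_point_def mult.commute)
  have me: "of_int e1 * fst m + of_int e2 * snd m = 0"
  proof -
    have "(of_int (fst q - fst p)) * fst m + (of_int (snd q - snd p)) * snd m = 0"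
      using pq(4,5) unfolding m_inner by (simp add: algebra_simps)
    then have "of_int l * (of_int e1 * fst m + of_int e2 * snd m) = 0"
      unfolding e12 by (simp add: algebra_simps)
    then show ?thesis using l by simp
  qed
  \<comment> \<open>The point is moved along \<open>e\<close> until it is the last lattice point
    before the ray of \<open>p\<close>; so the points of this degree in the sector are among the
    \<open>pt i\<close> with natural \<open>i\<close>.\<close>
  define x0 where "x0 = (fst x - (icr p x div D) * e1, snd x - (icr p x div D) * e2)"
  define pt where "pt = (\<lambda>i::nat. (fst x0 + int i * e1, snd x0 + int i * e2))"
  define apt where "apt = (\<lambda>i::nat. (fst p + int i * e1, snd p + int i * e2))"
  have px0: "icr p x0 = icr p x mod D"
  proof -
    have "icr p x0 = icr p x - (icr p x div D) * D" by (simp add: x0_def D_def e_def icr_def algebra_simps)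
    then show ?thesis by (simp add: minus_div_mult_eq_mod)
  qed
  have ppt: "icr p (pt i) = icr p x0 + int i * D" for i
    by (simp add: pt_def D_def e_def icr_def algebra_simps)
  have ptq: "icr (pt i) q = icr x0 q - int i * D" for i
  proof -
    have "icr (pt i) q = icr x0 q + int i * icr e q" by (simp add: pt_def e_def icr_def algebra_simps)
    then show ?thesis by (simp add: eq)
  qed
  have ppt0: "icr p (pt i) \<ge> 0" for i using ppt[of i] px0 D by simp
  have mx: "m \<bullet> lp x = \<gamma>" using sector_iff[OF F] x by simp
  have mx0: "m \<bullet> lp x0 = \<gamma>"
  proof -
    have "m \<bullet> lp x0 = m \<bullet> lp x - of_int (icr p x div D) * (of_int e1 * fst m + of_int e2 * snd m)"
      unfolding m_inner by (simp add: x0_def algebra_simps)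
    then show ?thesis using me mx by simp
  qed
  have mpt: "m \<bullet> lp (pt i) = \<gamma>" for i
  proof -
    have "m \<bullet> lp (pt i) = m \<bullet> lp x0 + of_int (int i) * (of_int e1 * fst m + of_int e2 * snd m)"
      unfolding m_inner by (simp add: pt_def algebra_simps)
    then show ?thesis using me mx0 by simp
  qed
  have mapt: "m \<bullet> lp (apt i) = 1" for i
  proof -
    have "m \<bullet> lp (apt i) = m \<bullet> lp p + of_int (int i) * (of_int e1 * fst m + of_int e2 * snd m)"
      unfolding m_inner by (simp add: apt_def algebra_simps)
    then show ?thesis using me pq by simp
  qed
  have e0: "e1 \<noteq> 0 \<or> e2 \<noteq> 0" using D by (auto simp: D_def e_def icr_def)
  have par: "\<exists>i. y = (fst z + i * e1, snd z + i * e2)" if "m \<bullet> lp y = m \<bullet> lp z" for y z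
  proof -
    have "of_int (icr e (y - z)) * (m \<bullet> lp p) = crs (lp p) (lp (y - z)) * (m \<bullet> lp e) + crs (lp e) (lp p) * (m \<bullet> lp (y - z))"
      using inner_crs[of "lp e" "lp (y - z)" m "lp p"] by (simp add: crs_lattice_point)
    moreover have "m \<bullet> lp e = 0" using me by (simp add: m_inner e_def)
    moreover have "m \<bullet> lp (y - z) = 0" using that by (simp add: lp_diff inner_diff_right)
    ultimately have "icr e (y - z) = 0" using pq by simp
    then obtain i where "y - z = (i * fst e, i * snd e)"
      using primitive_parallel[of e "y - z"] e12 by (auto simp: e_def)
    then show ?thesis by (intro exI[of _ i]) (auto simp: e_def prod_eq_iff algebra_simps)
  qed
  have line: "\<exists>i. y = pt i" if y: "y \<in> sector p q" "n y = \<gamma>" for y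
  proof -
    have "m \<bullet> lp y = m \<bullet> lp x0" using y sector_iff[OF F] mx0 by simp
    then obtain i where i: "y = (fst x0 + i * e1, snd x0 + i * e2)" using par by blast
    have "icr p y = icr p x0 + i * D" by (simp add: i D_def e_def icr_def algebra_simps)
    then have "0 \<le> icr p x0 + i * D" using y(1) by (simp add: sector_def)
    moreover have "icr p x0 < D" using px0 D by simp
    ultimately have "0 < (1 + i) * D" by (simp add: algebra_simps)
    then have "i \<ge> 0" using D by (simp add: zero_less_mult_iff)
    then show ?thesis by (intro exI[of _ "nat i"]) (simp add: i pt_def)
  qed
  have g_sector: "pt i \<in> sector p q" if "g1 (pt i) \<noteq> 0 \<or> g2 (pt i) \<noteq> 0" for i
    using g[OF that] mpt sector_iff[OF F] by simp
  have g_range: "\<exists>i. y = pt i" if "g1 y \<noteq> 0 \<or> g2 y \<noteq> 0" "m \<bullet> lp y = \<gamma>" for y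
    using line g[OF that(1)] that(2) sector_iff[OF F] by simp
  have inj_line: "i = j" if "(a + i * e1, b + i * e2) = (a + j * e1, b + j * e2)" for i j a b :: int
    using that e0 by auto
  have inj_apt: "inj apt" and inj_pt: "inj pt"
    using e0 by (auto simp: apt_def pt_def inj_on_def)

  have q_apt: "q = apt (nat l)" using e12 l by (auto simp: apt_def prod_eq_iff algebra_simps)
  have fk: "facet_keys m \<subseteq> apt ` {..nat l}"
  proof
    fix a assume a: "a \<in> facet_keys m"
    then have "m \<bullet> lp a = m \<bullet> lp p" using pq by (simp add: facet_keys_def)
    then obtain i where i: "a = (fst p + i * e1, snd p + i * e2)" using par by blast
    have s: "a \<in> sector p q" using facet_keys_sector[OF F a] by simp
    have "icr p a = i * D" by (simp add: i D_def e_def icr_def algebra_simps)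
    then have "i \<ge> 0" using s D by (simp add: sector_def zero_le_mult_iff)
    have "icr a q = icr p q + i * icr e q" by (simp add: i e_def icr_def algebra_simps)
    then have "(l - i) * D \<ge> 0" using s eq lD by (simp add: sector_def algebra_simps)
    then have "i \<le> l" using D by (simp add: zero_le_mult_iff)
    then show "a \<in> apt ` {..nat l}" using \<open>i \<ge> 0\<close> by (intro image_eqI[of _ _ "nat i"]) (auto simp: i apt_def)
  qed
  have sum_facet: "(\<Sum>a\<in>facet_keys m. w a) = (\<Sum>j\<le>N. w (apt j))"
    if w: "\<And>a. lookup f a = 0 \<Longrightarrow> w a = 0" "\<And>j. j > N \<Longrightarrow> w (apt j) = 0" for w :: "int \<times> int \<Rightarrow> complex" and N
  proof -
    have "(\<Sum>a\<in>facet_keys m. w a) = (\<Sum>a\<in>apt ` {..max (nat l) N}. w a)"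
    proof (rule sum.mono_neutral_left)
      show "facet_keys m \<subseteq> apt ` {..max (nat l) N}" using fk by fastforce
      show "\<forall>a\<in>apt ` {..max (nat l) N} - facet_keys m. w a = 0"
        using w(1) mapt by (auto simp: facet_keys_def in_keys_iff)
    qed simp
    also have "\<dots> = (\<Sum>j\<le>max (nat l) N. w (apt j))"
      by (subst sum.reindex) (use inj_apt inj_on_subset in \<open>auto simp: o_def\<close>)
    also have "\<dots> = (\<Sum>j\<le>N. w (apt j))"
      by (rule sum.mono_neutral_right) (use w(2) in auto)
    finally show ?thesis .
  qed
  have c0: "lookup f (apt j) = 0" if "j > nat l" for j
  proof (rule ccontr)
    assume "lookup f (apt j) \<noteq> 0"
    then have "apt j \<in> facet_keys m" using mapt by (simp add: facet_keys_def in_keys_iff)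
    then obtain i where "i \<le> nat l" "apt j = apt i" using fk by auto
    then show False using inj_apt that by (auto dest: injD)
  qed

  define C where "C = Abs_poly (\<lambda>j. lookup f (apt j))"
  \<comment> \<open>The determinant of an exponent with the pair \<open>(g1, g2)\<close>. The syzygy
    sums it against the coefficients of \<open>f\<close>, and it is affine in the index
    \<open>j\<close> of \<open>apt j\<close>; this yields the two polynomials \<open>u\<close> and
    \<open>v\<close>.\<close>
  define wd where "wd = (\<lambda>a y. of_int (fst a) * g2 y - of_int (snd a) * g1 y :: complex)"
  define u where "u = Abs_poly (\<lambda>i. wd p (pt i))"
  define v where "v = Abs_poly (\<lambda>i. wd e (pt i))"
  have cC: "coeff C j = lookup f (apt j)" for j
    unfolding C_def by (subst coeff_Abs_poly[of "nat l"]) (use c0 in auto)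
  have wd0: "wd a (pt i) = 0" if "i > nat (icr x0 q)" for a i
  proof (rule ccontr)
    assume "wd a (pt i) \<noteq> 0"
    then have "g1 (pt i) \<noteq> 0 \<or> g2 (pt i) \<noteq> 0" by (auto simp: wd_def)
    then have "pt i \<in> sector p q" by (rule g_sector)
    then have "int i * D \<le> icr x0 q" using ptq by (simp add: sector_def)
    moreover have "int i \<le> int i * D" using D mult_left_mono[of 1 D "int i"] by simp
    ultimately have "int i \<le> icr x0 q" by linarith
    then show False using that by simp
  qed
  have cu: "coeff u i = wd p (pt i)" and cv: "coeff v i = wd e (pt i)" for i
    unfolding u_def v_def by (subst coeff_Abs_poly[of "nat (icr x0 q)"]; use wd0 in auto)+
  let ?C' = "pCons 0 (pderiv C)"
  have cC': "coeff ?C' i = of_nat i * coeff C i" for i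
    by (cases i) (simp_all add: coeff_pderiv)

  \<comment> \<open>The coefficient of index \<open>N\<close> is the syzygy at the lattice point
    \<open>p + x0 + N e\<close>.\<close>
  have "C * u + ?C' * v = 0"
  proof (rule poly_eqI)
    fix N
    define b where "b = (fst p + fst x0 + int N * e1, snd p + snd x0 + int N * e2)"
    have b_apt: "b - apt j = (fst x0 + (int N - int j) * e1, snd x0 + (int N - int j) * e2)" for j
      by (simp add: b_def apt_def algebra_simps prod_eq_iff)
    have b_pt: "b - apt j = pt (N - j)" if "j \<le> N" for j
      using that unfolding b_apt by (simp add: pt_def of_nat_diff)
    have mb: "m \<bullet> lp (b - apt j) = \<gamma>" for j
    proof -
      have "m \<bullet> lp (b - apt j) = m \<bullet> lp x0 + (of_int (int N) - of_int (int j)) * (of_int e1 * fst m + of_int e2 * snd m)"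
        unfolding m_inner b_apt by (simp add: algebra_simps)
      then show ?thesis using me mx0 by simp
    qed
    have far: "g1 (b - apt j) = 0 \<and> g2 (b - apt j) = 0" if "j > N" for j
    proof (rule ccontr)
      assume "\<not> ?thesis"
      then obtain i where "b - apt j = pt i" using g_range mb by blast
      then have "int N - int j = int i" unfolding b_apt pt_def by (rule inj_line)
      then show False using that by simp
    qed
    have "coeff (C * u + ?C' * v) N = (\<Sum>i\<le>N. coeff C i * coeff u (N - i) + coeff ?C' i * coeff v (N - i))"
      by (simp only: coeff_add coeff_mult sum.distrib)
    also have "\<dots> = (\<Sum>i\<le>N. lookup f (apt i) * wd (apt i) (b - apt i))"
    proof (rule sum.cong[OF refl])
      fix i assume "i \<in> {..N}"
      then have bi: "b - apt i = pt (N - i)" using b_pt by simp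
      have "wd (apt i) y = wd p y + of_nat i * wd e y" for y
        by (simp add: wd_def apt_def e_def algebra_simps)
      then show "coeff C i * coeff u (N - i) + coeff ?C' i * coeff v (N - i) = lookup f (apt i) * wd (apt i) (b - apt i)"
        unfolding bi cC' cC cu cv by (simp add: algebra_simps)
    qed
    also have "\<dots> = (\<Sum>a\<in>facet_keys m. lookup f a * wd a (b - a))"
      by (rule sum_facet[symmetric]) (use far in \<open>auto simp: wd_def\<close>)
    also have "\<dots> = 0"
    proof (cases "b \<in> sector p q")
      case True
      have "n b = m \<bullet> lp b" using True sector_iff[OF F] by simp
      also have "\<dots> = m \<bullet> lp (b - apt 0) + m \<bullet> lp (apt 0)" by (simp add: lp_diff inner_diff_right)
      finally have nb: "n b = \<gamma> + 1" unfolding mb mapt .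
      have "(\<Sum>a\<in>facet_keys m. lookup f a * wd a (b - a)) =
        (\<Sum>a\<in>facet_keys m. lookup f a * of_int (fst a) * g2 (b - a)) - (\<Sum>a\<in>facet_keys m. lookup f a * of_int (snd a) * g1 (b - a))"
        by (simp add: wd_def right_diff_distrib sum_subtractf mult.assoc)
      also have "\<dots> = (\<Sum>a\<in>keys f. lookup f a * of_int (fst a) * g2 (b - a)) - (\<Sum>a\<in>keys f. lookup f a * of_int (snd a) * g1 (b - a))"
        using sum_keys_facet[OF F, of g2 \<gamma> b "\<lambda>a. lookup f a * of_int (fst a)"]
          sum_keys_facet[OF F, of g1 \<gamma> b "\<lambda>a. lookup f a * of_int (snd a)"] g True nb by simp
      finally show ?thesis using syz[OF nb] by simp
    next
      case False
      \<comment> \<open>For \<open>b\<close> outside the sector no term survives, because the sector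
        is closed under addition.\<close>
      have "wd a (b - a) = 0" if a: "a \<in> facet_keys m" for a
      proof (rule ccontr)
        assume "wd a (b - a) \<noteq> 0"
        then have gba: "g1 (b - a) \<noteq> 0 \<or> g2 (b - a) \<noteq> 0" by (auto simp: wd_def)
        obtain j where "a = apt j" using a fk by auto
        then have "b - a \<in> sector p q" using g[OF gba] mb[of j] sector_iff[OF F] by simp
        moreover have "a \<in> sector p q" using facet_keys_sector[OF F a] by simp
        moreover have "icr p b = icr p a + icr p (b - a)" "icr b q = icr a q + icr (b - a) q"
          by (simp_all add: icr_def algebra_simps)
        ultimately show False using False by (simp add: sector_def)
      qed
      then show ?thesis by simp
    qed
    finally show "coeff (C * u + ?C' * v) N = coeff 0 N" by simp
  qed
  moreover have "poly C 0 \<noteq> 0"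
  proof -
    have "apt 0 = p" by (simp add: apt_def)
    then have "coeff C 0 \<noteq> 0" using cC E_keys[OF pq(2)] by (simp add: in_keys_iff)
    then show ?thesis by (simp add: poly_0_coeff_0)
  qed
  moreover have clq: "coeff C (nat l) \<noteq> 0" using cC q_apt E_keys[OF pq(3)] by (simp add: in_keys_iff)
  then have degC: "degree C = nat l"
    using c0 cC by (metis le_antisym le_degree degree_le)
  have "poly (pderiv C) z \<noteq> 0" if z: "z \<noteq> 0" "poly C z = 0" for z
  proof
    assume z': "poly (pderiv C) z = 0"
    \<comment> \<open>A multiple root would give a torus point with
      \<open>u1 powi e1 * u2 powi e2 = z\<close>, at which both logarithmic derivatives of the facet
      part of \<open>f\<close> vanish.\<close>
    obtain u1 u2 :: complex where u: "u1 \<noteq> 0" "u2 \<noteq> 0" "u1 powi e1 * u2 powi e2 = z"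
    proof (cases "e1 = 0")
      case False
      then obtain w where "w \<noteq> 0" "w powi e1 = z" using complex_powi_surj[OF z(1)] by metis
      then show ?thesis using that[of w 1] by simp
    next
      case True
      then obtain w where "w \<noteq> 0" "w powi e2 = z" using complex_powi_surj[OF z(1)] e0 by metis
      then show ?thesis using that[of 1 w] by simp
    qed
    define Fc where "Fc = P \<inter> {y. m \<bullet> y = 1}"
    have face: "Fc face_of newton_polytope f"
      unfolding Fc_def P_newton[symmetric]
      by (rule face_of_Int_supporting_hyperplane_le[OF convex_P])
        (use F in \<open>auto simp: facet_def polar_polytope_def\<close>)
    have "lp p \<in> Fc" using E_in_P pq by (simp add: Fc_def)
    then have ne: "Fc \<noteq> {}" by auto
    have "0 \<notin> Fc" by (simp add: Fc_def)
    then have proper: "Fc \<noteq> newton_polytope f" using zero_P P_newton by auto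
    let ?f = "face_part f Fc"
    have lf: "lookup ?f a = (if a \<in> facet_keys m then lookup f a else 0)" for a
      using keys_in_P by (auto simp: lookup_face_part Fc_def facet_keys_def in_keys_iff)
    have fin: "finite (facet_keys m)" by (simp add: facet_keys_def)
    have pu: "u1 powi fst (apt j) * u2 powi snd (apt j) = u1 powi fst p * u2 powi snd p * z ^ j" for j
    proof -
      have "w powi (a + int j * b) = w powi a * (w powi b) ^ j" if "w \<noteq> 0" for w :: complex and a b
        using that by (simp add: power_int_add power_int_mult mult.commute[of "int j"])
      then show ?thesis using u by (simp add: apt_def power_mult_distrib flip: u(3))
    qed
    have pC: "poly C z = (\<Sum>j\<le>nat l. lookup f (apt j) * z ^ j)"
      by (simp add: poly_altdef degC cC)
    have "degree ?C' \<le> nat l" using degC degree_pderiv[of C] l by (simp add: degree_pCons_eq_if)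
    then have "(\<Sum>j\<le>degree ?C'. coeff ?C' j * z ^ j) = (\<Sum>j\<le>nat l. coeff ?C' j * z ^ j)"
      by (intro sum.mono_neutral_left) (simp_all add: coeff_eq_0 del: coeff_pCons degree_pCons_eq_if)
    then have pC': "poly ?C' z = (\<Sum>j\<le>nat l. of_nat j * lookup f (apt j) * z ^ j)"
      unfolding poly_altdef by (simp only: cC' cC)
    have ev: "(\<Sum>a\<in>facet_keys m. of_int (A a) * lookup f a * (u1 powi fst a * u2 powi snd a)) = 0"
      if A: "\<And>j. A (apt j) = A0 + int j * A1" for A A0 A1
    proof -
      have "(\<Sum>a\<in>facet_keys m. of_int (A a) * lookup f a * (u1 powi fst a * u2 powi snd a)) =
         (\<Sum>j\<le>nat l. of_int (A (apt j)) * lookup f (apt j) * (u1 powi fst (apt j) * u2 powi snd (apt j)))"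
        by (rule sum_facet) (auto simp: c0)
      also have "\<dots> = (\<Sum>j\<le>nat l. (u1 powi fst p * u2 powi snd p) * (of_int A0 * (lookup f (apt j) * z ^ j) + of_int A1 * (of_nat j * lookup f (apt j) * z ^ j)))"
        unfolding pu A by (intro sum.cong refl) (simp add: algebra_simps)
      also have "\<dots> = (u1 powi fst p * u2 powi snd p) * (of_int A0 * poly C z + of_int A1 * poly ?C' z)"
        unfolding pC pC' by (simp add: sum_distrib_left sum.distrib distrib_left)
      also have "\<dots> = 0" using z(2) z' by simp
      finally show ?thesis .
    qed
    have "laurent_eval (euler1 ?f) (u1, u2) = 0"
      using ev[of fst "fst p" e1]
      by (subst laurent_eval_superset[OF fin]) (auto simp: lookup_euler1 lf in_keys_iff apt_def mult.assoc split: if_splits)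
    moreover have "laurent_eval (euler2 ?f) (u1, u2) = 0"
      using ev[of snd "snd p" e2]
      by (subst laurent_eval_superset[OF fin]) (auto simp: lookup_euler2 lf in_keys_iff apt_def mult.assoc split: if_splits)
    moreover have "(u1, u2) \<in> torus" using u by (simp add: torus_def)
    ultimately show False using nondeg face ne proper unfolding nondegenerate_def by blast
  qed
  ultimately obtain K where K: "u = ?C' * K" "v = - (C * K)"
    using squarefree_syzygy by metis

  \<comment> \<open>Facet monomials shift by \<open>p + j e\<close>, so the quotient
    \<open>K\<close> is placed on the line through \<open>x0 - p\<close>.\<close>
  define Y where "Y = (\<lambda>i. pt i - p)"
  have injY: "inj Y" using inj_pt by (auto simp: Y_def inj_on_def)
  define k where "k = (\<lambda>y. if y \<in> range Y then coeff K (inv Y y) / of_int D else 0)"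
  have kY: "k (Y i) = coeff K i / of_int D" for i using injY by (simp add: k_def)
  have supp: "Y i \<in> sector p q \<and> n (Y i) = \<gamma> - 1" if "coeff K i \<noteq> 0" for i
  proof -
    \<comment> \<open>The top coefficient of \<open>v = - (C * K)\<close> sits in the sector and
      \<open>C\<close> has degree \<open>l\<close>; hence the points \<open>pt i\<close> of
      \<open>K\<close> leave room for \<open>l\<close> further steps before the ray of
      \<open>q\<close>, as much as subtracting \<open>p\<close> costs.\<close>
    have K0: "K \<noteq> 0" and C0: "C \<noteq> 0" using that clq by auto
    have "coeff v (degree (C * K)) \<noteq> 0" using K0 C0 K(2) by (simp add: coeff_mult_degree_sum degree_mult_eq)
    then have "g1 (pt (degree (C * K))) \<noteq> 0 \<or> g2 (pt (degree (C * K))) \<noteq> 0" unfolding cv by (auto simp: wd_def)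
    then have "pt (degree (C * K)) \<in> sector p q" by (rule g_sector)
    then have "icr x0 q - int (degree (C * K)) * D \<ge> 0" using ptq by (simp add: sector_def)
    moreover have "degree (C * K) = nat l + degree K" using K0 C0 degC by (simp add: degree_mult_eq)
    moreover have "int i \<le> int (degree K)" using le_degree[OF that] by simp
    then have "int i * D \<le> int (degree K) * D" using D by (intro mult_right_mono) auto
    ultimately have "icr x0 q - int i * D - l * D \<ge> 0" using l by (simp add: algebra_simps)
    moreover have "icr (Y i) q = icr (pt i) q - icr p q" "icr p (Y i) = icr p (pt i)"
      by (simp_all add: Y_def icr_def algebra_simps)
    ultimately have s: "Y i \<in> sector p q" using ppt0 ptq lD by (simp add: sector_def)
    moreover have "m \<bullet> lp (Y i) = \<gamma> - 1" using mpt pq by (simp add: Y_def lp_diff inner_diff_right)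
    ultimately show ?thesis using sector_iff[OF F] by simp
  qed
  show ?thesis
  proof (rule that[of k])
    fix y assume "k y \<noteq> 0"
    then obtain i where "y = Y i" "coeff K i \<noteq> 0" using kY by (auto simp: k_def split: if_splits)
    then show "y \<in> sector p q \<and> n y = \<gamma> - 1" using supp by simp
  next
    fix b assume b: "b \<in> sector p q" "n b = \<gamma>"
    then obtain N where N: "b = pt N" using line by blast
    have bY: "b - apt j = Y (N - j)" if "j \<le> N" for j
      using that by (simp add: N Y_def pt_def apt_def of_nat_diff algebra_simps prod_eq_iff)
    have far: "k (b - apt j) = 0" if "j > N" for j
    proof -
      have "b - apt j \<noteq> Y i" for i
      proof
        assume "b - apt j = Y i"
        then have "(fst x0 + (int N - int j) * e1, snd x0 + (int N - int j) * e2) = (fst x0 + int i * e1, snd x0 + int i * e2)"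
          by (simp add: N Y_def pt_def apt_def prod_eq_iff algebra_simps)
        then have "int N - int j = int i" by (rule inj_line)
        then show False using that by simp
      qed
      then show ?thesis by (auto simp: k_def)
    qed
    have val: "(\<Sum>a\<in>facet_keys m. lookup f a * of_int (A a) * k (b - a)) =
        (of_int A1 * wd p b - of_int A0 * wd e b) / of_int D"
      if A: "\<And>j. A (apt j) = A0 + int j * A1" for A A0 A1
    proof -
      have "(\<Sum>a\<in>facet_keys m. lookup f a * of_int (A a) * k (b - a)) =
         (\<Sum>j\<le>N. lookup f (apt j) * of_int (A (apt j)) * k (b - apt j))"
        by (rule sum_facet) (auto simp: far)
      also have "\<dots> = (\<Sum>j\<le>N. (of_int A0 * (coeff C j * coeff K (N - j)) + of_int A1 * (coeff ?C' j * coeff K (N - j))) / of_int D)"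
        by (intro sum.cong refl) (simp add: bY kY A cC cC' algebra_simps add_divide_distrib)
      also have "\<dots> = (of_int A0 * coeff (C * K) N + of_int A1 * coeff (?C' * K) N) / of_int D"
        by (simp only: coeff_mult sum_divide_distrib[symmetric] sum_distrib_left sum.distrib)
      also have "coeff (C * K) N = - wd e b"
      proof -
        have "- coeff (C * K) N = wd e b" using cv[of N] K(2) N by simp
        then show ?thesis by (metis minus_minus)
      qed
      also have "coeff (?C' * K) N = wd p b" using cu[of N] K(1) N by simp
      finally show ?thesis by (simp add: algebra_simps)
    qed
    \<comment> \<open>Cramer's rule recovers \<open>g1\<close> and \<open>g2\<close> from the
      determinants with \<open>p\<close> and with \<open>e\<close>; \<open>D\<close> is the
      determinant of these two vectors.\<close>
    have D': "of_int D = (of_int (fst p) * of_int e2 - of_int (snd p) * of_int e1 :: complex)"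
      by (simp add: D_def e_def icr_def)
    have D0: "(of_int D :: complex) \<noteq> 0" using D by simp
    have "of_int e1 * wd p b - of_int (fst p) * wd e b = of_int D * g1 b"
      unfolding D' by (simp add: wd_def e_def algebra_simps)
    moreover have "of_int e2 * wd p b - of_int (snd p) * wd e b = of_int D * g2 b"
      unfolding D' by (simp add: wd_def e_def algebra_simps)
    ultimately show "g1 b = (\<Sum>a\<in>facet_keys m. lookup f a * of_int (fst a) * k (b - a)) \<and>
       g2 b = (\<Sum>a\<in>facet_keys m. lookup f a * of_int (snd a) * k (b - a))"
      using val[of fst "fst p" e1] val[of snd "snd p" e2] D0 by (simp add: apt_def)
  qed
qed

section \<open>Gluing the solutions on the facets\<close>

lemma facet_functional_unique:
  assumes F: "facet p q m" and m': "m' \<bullet> lp p = 1" "m' \<bullet> lp q = 1"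
  shows "m' = m"
proof -
  have "m' \<bullet> x = m \<bullet> x" for x
  proof -
    have "crs (lp p) (lp q) * (m' \<bullet> x) = crs (lp p) (lp q) * (m \<bullet> x)"
      using inner_crs[of "lp p" "lp q" m' x] inner_crs[of "lp p" "lp q" m x] m' F by (simp add: facet_def)
    then show ?thesis using F by (simp add: facet_def)
  qed
  then show ?thesis by (metis vector_eq_rdot)
qed

lemma finite_facets: "finite {(p, q, m). facet p q m}"
proof (rule finite_imageD)
  have "(\<lambda>(p, q, m). (p, q)) ` {(p, q, m). facet p q m} \<subseteq> E \<times> E" by (auto simp: facet_def)
  then show "finite ((\<lambda>(p, q, m). (p, q)) ` {(p, q, m). facet p q m})"
    using finite_E finite_subset by blast
  show "inj_on (\<lambda>(p, q, m). (p, q)) {(p, q, m). facet p q m}"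
  proof (rule inj_onI)
    fix x y :: "(int \<times> int) \<times> (int \<times> int) \<times> real \<times> real"
    assume a: "x \<in> {(p, q, m). facet p q m}" "y \<in> {(p, q, m). facet p q m}"
      "(case x of (p, q, m) \<Rightarrow> (p, q)) = (case y of (p, q, m) \<Rightarrow> (p, q))"
    obtain p q m where x: "x = (p, q, m)" by (cases x)
    obtain p' q' m' where y: "y = (p', q', m')" by (cases y)
    have F: "facet p q m" "facet p q m'" "p' = p" "q' = q" using a unfolding x y by simp_all
    have "m' = m" by (rule facet_functional_unique[OF F(1)]) (use F(2) in \<open>simp_all add: facet_def\<close>)
    then show "x = y" using F by (simp add: x y)
  qed
qed

lemma facet_vertices_unique:
  assumes F: "facet p q m" and F': "facet p' q' m"
  shows "p' = p \<and> q' = q"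
proof -
  have v: "p' \<in> E" "q' \<in> E" "m \<bullet> lp p' = 1" "m \<bullet> lp q' = 1" "crs (lp p') (lp q') > 0" using F' by (simp_all add: facet_def)
  have "p' = p \<or> p' = q" "q' = p \<or> q' = q"
    using facet_E_only[OF F v(1,3)] facet_E_only[OF F v(2,4)] by blast+
  moreover have "\<not> crs (lp q) (lp p) > 0" using F crs_commute[of "lp q" "lp p"] by (simp add: facet_def)
  ultimately show ?thesis using v(5) by auto
qed

text \<open>\<open>x\<close> is a nonnegative combination of \<open>p\<close> and \<open>q\<close>,
  at which \<open>m'\<close> is at most 1; equality at \<open>x\<close> forces the value 1 at each
  vertex of positive weight.\<close>

lemma supporting_at_cone_point:
  assumes F: "facet p q m" and m': "m' \<in> polar_polytope P" "m' \<bullet> x = nu x"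
    and x: "crs (lp p) x \<ge> 0" "crs x (lp q) \<ge> 0"
  shows "crs x (lp q) > 0 \<Longrightarrow> m' \<bullet> lp p = 1" "crs (lp p) x > 0 \<Longrightarrow> m' \<bullet> lp q = 1"
proof -
  have le: "m' \<bullet> lp p \<le> 1" "m' \<bullet> lp q \<le> 1" using m'(1) F by (simp_all add: mem_polar_iff_E facet_def)
  have D: "crs (lp p) (lp q) > 0" using F by (simp add: facet_def)
  have "crs (lp p) (lp q) * nu x = crs x (lp q) + crs (lp p) x"
    using nu_cone[OF F x] facet_inner[OF F, of x] D by simp
  then have "crs x (lp q) * (m' \<bullet> lp p) + crs (lp p) x * (m' \<bullet> lp q) = crs x (lp q) + crs (lp p) x"
    using inner_crs[of "lp p" "lp q" m' x] m'(2) by simp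
  then have eq: "crs x (lp q) * (1 - m' \<bullet> lp p) + crs (lp p) x * (1 - m' \<bullet> lp q) = 0"
    by (simp add: algebra_simps)
  have nn: "crs x (lp q) * (1 - m' \<bullet> lp p) \<ge> 0" "crs (lp p) x * (1 - m' \<bullet> lp q) \<ge> 0"
    using x le by simp_all
  show "m' \<bullet> lp p = 1" if "crs x (lp q) > 0"
    using eq nn that by (simp add: add_nonneg_eq_0_iff)
  show "m' \<bullet> lp q = 1" if "crs (lp p) x > 0"
    using eq nn that by (simp add: add_nonneg_eq_0_iff)
qed

text \<open>At an interior point of a facet cone the supporting functional is unique, so a shared
  point lies on a boundary ray, and the vertex on this ray belongs to both facets.\<close>

lemma common_vertex:
  assumes F: "facet p q m" and F': "facet p' q' m'" and "m \<noteq> m'" and "x \<noteq> 0"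
    and x: "crs (lp p) x \<ge> 0" "crs x (lp q) \<ge> 0" and x': "crs (lp p') x \<ge> 0" "crs x (lp q') \<ge> 0"
  obtains v where "v \<in> {p, q}" "v \<in> {p', q'}" "crs (lp v) x = 0"
proof -
  have m': "m' \<in> polar_polytope P" "m' \<bullet> x = nu x" using F' nu_cone[OF F' x'] by (simp_all add: facet_def)
  note sup = supporting_at_cone_point[OF F m' x]
  have pq: "p \<in> E" "q \<in> E" using F by (simp_all add: facet_def)
  have "\<not> (crs (lp p) x > 0 \<and> crs x (lp q) > 0)"
    using sup facet_functional_unique[OF F, of m'] \<open>m \<noteq> m'\<close> by blast
  then consider "crs (lp p) x = 0" | "crs x (lp q) = 0" using x by linarith
  then show ?thesis
  proof cases
    case 1
    have "crs x (lp q) \<noteq> 0" using facet_expand[OF F, of x] 1 \<open>x \<noteq> 0\<close> by auto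
    then have "m' \<bullet> lp p = 1" using sup(1) x by simp
    then show ?thesis using that[of p] facet_E_only[OF F' pq(1)] 1 by blast
  next
    case 2
    have "crs (lp p) x \<noteq> 0" using facet_expand[OF F, of x] 2 \<open>x \<noteq> 0\<close> by auto
    then have "m' \<bullet> lp q = 1" using sup(2) x by simp
    moreover have "crs (lp q) x = 0" using 2 crs_commute[of "lp q" x] by simp
    ultimately show ?thesis using that[of q] facet_E_only[OF F' pq(2)] by blast
  qed
qed

lemma facet_key_on_ray:
  assumes F: "facet p q m" and a: "a \<in> facet_keys m"
  shows "icr p a = 0 \<Longrightarrow> a = p" "icr a q = 0 \<Longrightarrow> a = q"
proof -
  have D: "crs (lp p) (lp q) > 0" using F by (simp add: facet_def)
  have s: "crs (lp a) (lp q) + crs (lp p) (lp a) = crs (lp p) (lp q)"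
    using a facet_inner[OF F, of "lp a"] D by (simp add: facet_keys_def)
  show "a = p" if "icr p a = 0"
  proof -
    have "crs (lp p) (lp a) = 0" using that by (simp add: crs_lattice_point)
    then have "lp a = lp p" using facet_expand[OF F, of "lp a"] s D by simp
    then show ?thesis by simp
  qed
  show "a = q" if "icr a q = 0"
  proof -
    have "crs (lp a) (lp q) = 0" using that by (simp add: crs_lattice_point)
    then have "lp a = lp q" using facet_expand[OF F, of "lp a"] s D by simp
    then show ?thesis by simp
  qed
qed

lemma facet_vertex_keys: "facet p q m \<Longrightarrow> p \<in> facet_keys m \<and> q \<in> facet_keys m"
  by (simp add: facet_def facet_keys_def E_keys)

text \<open>For \<open>y\<close> on the ray of \<open>v\<close>, subtracting from
  \<open>y + v\<close> a facet monomial other than \<open>v\<close> leaves the sector. Thus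
  \<open>k y\<close> can be read off from the product at \<open>y + v\<close>, which ties the
  solutions of adjacent facets together.\<close>

lemma vertex_coefficient:
  fixes k :: "int \<times> int \<Rightarrow> complex"
  assumes F: "facet p q m" and k: "\<And>y. k y \<noteq> 0 \<Longrightarrow> y \<in> sector p q" and v: "v \<in> {p, q}"
    and y: "y \<in> sector p q" "icr v y = 0"
  shows "(\<Sum>a\<in>facet_keys m. w a * k (y + v - a)) = w v * k y"
    and "y + v \<in> sector p q" and "n (y + v) = n y + 1"
proof -
  have vk: "v \<in> facet_keys m" using facet_vertex_keys[OF F] v by blast
  have "(\<Sum>a\<in>facet_keys m. w a * k (y + v - a)) = (\<Sum>a\<in>{v}. w a * k (y + v - a))"
  proof (rule sum.mono_neutral_right)
    show "\<forall>a\<in>facet_keys m - {v}. w a * k (y + v - a) = 0"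
    proof
      fix a assume a: "a \<in> facet_keys m - {v}"
      then have s: "icr p a \<ge> 0" "icr a q \<ge> 0" using facet_keys_sector[OF F, of a] by (simp_all add: sector_def)
      have "y + v - a \<notin> sector p q"
      proof
        assume "y + v - a \<in> sector p q"
        then have "icr p (y + v - a) \<ge> 0" "icr (y + v - a) q \<ge> 0" by (simp_all add: sector_def)
        moreover have "icr p (y + v - a) = icr p y + icr p v - icr p a" "icr (y + v - a) q = icr y q + icr v q - icr a q"
          by (simp_all add: icr_def algebra_simps)
        moreover have "icr y q = 0" if "v = q" using y(2) that icr_anti[of y q] by simp
        ultimately have "v = p \<longrightarrow> icr p a = 0" "v = q \<longrightarrow> icr a q = 0"
          using s y(2) by (auto simp: icr_add(3))
        then show False using v a facet_key_on_ray[OF F, of a] by auto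
      qed
      then have "k (y + v - a) = 0" using k[of "y + v - a"] by blast
      then show "w a * k (y + v - a) = 0" by simp
    qed
  qed (use vk in \<open>auto simp: facet_keys_def\<close>)
  then show "(\<Sum>a\<in>facet_keys m. w a * k (y + v - a)) = w v * k y" by simp
  have vs: "v \<in> sector p q" using facet_keys_sector[OF F vk] by simp
  then show yv: "y + v \<in> sector p q" using y(1) by (simp add: sector_def icr_add)
  show "n (y + v) = n y + 1"
    using yv y(1) vk sector_iff[OF F] by (simp add: lattice_point_add inner_add_right facet_keys_def)
qed

text \<open>
  The solutions on the single facets agree on common rays by \<open>vertex_coefficient\<close>; at the
  origin, which lies in all facet cones, the connectedness of the punctured plane is used.
\<close>

theorem graded_syzygy:
  fixes g1 g2 :: "int \<times> int \<Rightarrow> complex"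
  assumes g: "\<And>x. g1 x \<noteq> 0 \<or> g2 x \<noteq> 0 \<Longrightarrow> n x = \<gamma>"
    and syz: "\<And>b. n b = \<gamma> + 1 \<Longrightarrow>
       (\<Sum>a\<in>keys f. lookup f a * of_int (fst a) * g2 (b - a)) - (\<Sum>a\<in>keys f. lookup f a * of_int (snd a) * g1 (b - a)) = 0"
  obtains k where "\<And>y. k y \<noteq> 0 \<Longrightarrow> n y = \<gamma> - 1"
    "\<And>b. n b = \<gamma> \<Longrightarrow> g1 b = (\<Sum>a\<in>keys f. lookup f a * of_int (fst a) * k (b - a)) \<and>
       g2 b = (\<Sum>a\<in>keys f. lookup f a * of_int (snd a) * k (b - a))"
proof -
  define Q where "Q = (\<lambda>p q m k. (\<forall>y. k y \<noteq> 0 \<longrightarrow> y \<in> sector p q \<and> n y = \<gamma> - 1) \<and>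
    (\<forall>b. b \<in> sector p q \<longrightarrow> n b = \<gamma> \<longrightarrow>
       g1 b = (\<Sum>a\<in>facet_keys m. lookup f a * of_int (fst a) * k (b - a)) \<and>
       g2 b = (\<Sum>a\<in>facet_keys m. lookup f a * of_int (snd a) * k (b - a))))"
  define K where "K = (\<lambda>p q m. SOME k. Q p q m k)"
  have ex: "\<exists>k. Q p q m k" if F: "facet p q m" for p q m
  proof (rule facet_syzygy[OF F g syz])
    fix k assume k: "\<And>y. k y \<noteq> 0 \<Longrightarrow> y \<in> sector p q \<and> n y = \<gamma> - 1"
      "\<And>b. b \<in> sector p q \<Longrightarrow> n b = \<gamma> \<Longrightarrow>
       g1 b = (\<Sum>a\<in>facet_keys m. lookup f a * of_int (fst a) * k (b - a)) \<and>
       g2 b = (\<Sum>a\<in>facet_keys m. lookup f a * of_int (snd a) * k (b - a))"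
    show "\<exists>k. Q p q m k" unfolding Q_def
      by (rule exI[of _ k], rule conjI, (rule allI, rule impI, erule k(1)), (rule allI, rule impI, rule impI, erule k(2), assumption))
  qed
  have QK: "Q p q m (K p q m)" if "facet p q m" for p q m
    unfolding K_def using ex[OF that] by (rule someI_ex)
  have K: "y \<in> sector p q \<and> n y = \<gamma> - 1" if "facet p q m" "K p q m y \<noteq> 0" for p q m y
    using QK[OF that(1)] that(2) unfolding Q_def by blast
  have Kg: "g1 b = (\<Sum>a\<in>facet_keys m. lookup f a * of_int (fst a) * K p q m (b - a)) \<and>
       g2 b = (\<Sum>a\<in>facet_keys m. lookup f a * of_int (snd a) * K p q m (b - a))"
    if "facet p q m" "b \<in> sector p q" "n b = \<gamma>" for p q m b
    using QK[OF that(1)] that(2,3) unfolding Q_def by blast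
  have ray: "K p q m y = K p' q' m' y"
    if F: "facet p q m" "facet p' q' m'" and v: "v \<in> {p, q}" "v \<in> {p', q'}" and y: "icr v y = 0"
      "y \<in> sector p q" "y \<in> sector p' q'" "n y = \<gamma> - 1" for p q m p' q' m' v y
  proof -
    note 1 = vertex_coefficient[where k = "K p q m", OF F(1) _ v(1) y(2,1)]
    note 2 = vertex_coefficient[where k = "K p' q' m'", OF F(2) _ v(2) y(3,1)]
    have b: "n (y + v) = \<gamma>" using 1(3) K[OF F(1)] y(4) by auto
    have s: "y + v \<in> sector p q" "y + v \<in> sector p' q'" using 1(2) 2(2) K F by blast+
    have "g1 (y + v) = lookup f v * of_int (fst v) * K p q m y" "g2 (y + v) = lookup f v * of_int (snd v) * K p q m y"
      using Kg[OF F(1) s(1) b] 1(1) K[OF F(1)] by simp_all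
    moreover have "g1 (y + v) = lookup f v * of_int (fst v) * K p' q' m' y" "g2 (y + v) = lookup f v * of_int (snd v) * K p' q' m' y"
      using Kg[OF F(2) s(2) b] 2(1) K[OF F(2)] by simp_all
    moreover have "v \<in> E" using v F by (auto simp: facet_def)
    then have "lookup f v \<noteq> 0" "v \<noteq> 0" using E_keys[of v] zero_not_E[of v] by (auto simp: in_keys_iff)
    then have "lookup f v \<noteq> 0" "fst v \<noteq> 0 \<or> snd v \<noteq> 0" by (auto simp: prod_eq_iff)
    ultimately show ?thesis by auto
  qed
  have origin: "K p q m 0 = K p' q' m' 0" if F: "facet p q m" "facet p' q' m'" and \<gamma>: "\<gamma> = 1" for p q m p' q' m'
  proof (rule ccontr)
    assume neq: "K p q m 0 \<noteq> K p' q' m' 0"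
    define cone where "cone = (\<lambda>(p, q, m :: real \<times> real). {x. crs (lp p) x \<ge> 0 \<and> crs x (lp q) \<ge> 0})"
    define S where "S = {(p, q, m). facet p q m}"
    \<comment> \<open>The facets that assign to the origin the same value as the first one. By
      \<open>ray\<close>, facets with a common vertex agree, so the cones of \<open>S1\<close> and
      those of the others form closed sets that are disjoint off the origin.\<close>
    define S1 where "S1 = {t \<in> S. (case t of (a, b, c) \<Rightarrow> K a b c 0) = K p q m 0}"
    define Z1 Z2 where "Z1 = (\<Union>t\<in>S1. cone t)" and "Z2 = (\<Union>t\<in>S - S1. cone t)"
    have fin: "finite S1" "finite (S - S1)" using finite_facets by (simp_all add: S1_def S_def)
    have closed_cone: "closed (cone t)" for t
    proof -
      obtain a b c where t: "t = (a, b, c)" by (cases t)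
      have "closed {x. 0 \<le> crs (lp a) x}" "closed {x. 0 \<le> crs x (lp b)}"
        unfolding crs_def by (intro closed_Collect_le continuous_intros)+
      moreover have "cone t = {x. 0 \<le> crs (lp a) x} \<inter> {x. 0 \<le> crs x (lp b)}" by (auto simp: t cone_def)
      ultimately show ?thesis by (simp add: closed_Int)
    qed
    have cl: "closed Z1" "closed Z2" unfolding Z1_def Z2_def using fin closed_cone by (auto intro!: closed_UN)
    have "connected (- {0 :: real \<times> real})" by (rule connected_punctured_universe) simp
    moreover have "- {0} \<subseteq> Z1 \<union> Z2"
    proof
      fix x :: "real \<times> real" assume "x \<in> - {0}"
      then have "x \<noteq> 0" by simp
      then obtain a b c where "facet a b c" "crs (lp a) x \<ge> 0" "crs x (lp b) \<ge> 0" by (rule facet_cover)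
      then have "(a, b, c) \<in> S" "x \<in> cone (a, b, c)" by (simp_all add: S_def cone_def)
      then show "x \<in> Z1 \<union> Z2" unfolding Z1_def Z2_def by blast
    qed
    moreover have "Z1 \<inter> Z2 \<inter> - {0} = {}"
    proof (rule ccontr)
      assume "Z1 \<inter> Z2 \<inter> - {0} \<noteq> {}"
      then obtain x where x12: "x \<in> Z1" "x \<in> Z2" "x \<in> - {0}" by blast
      obtain t1 where t1': "t1 \<in> S1" "x \<in> cone t1" using x12(1) unfolding Z1_def by (rule UN_E)
      obtain t2 where t2': "t2 \<in> S - S1" "x \<in> cone t2" using x12(2) unfolding Z2_def by (rule UN_E)
      have x: "x \<noteq> 0" "t1 \<in> S1" "x \<in> cone t1" "t2 \<in> S - S1" "x \<in> cone t2" using x12(3) t1' t2' by simp_all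
      obtain a b c where t1: "t1 = (a, b, c)" by (cases t1)
      obtain a' b' c' where t2: "t2 = (a', b', c')" by (cases t2)
      have F12: "facet a b c" "facet a' b' c'" using x t1 t2 by (simp_all add: S1_def S_def)
      have ne: "K a b c 0 \<noteq> K a' b' c' 0" using x t1 t2 by (auto simp: S1_def)
      have "c \<noteq> c'"
      proof
        assume "c = c'"
        then have "a' = a \<and> b' = b" using facet_vertices_unique[OF F12(1)] F12(2) by simp
        then show False using ne \<open>c = c'\<close> by simp
      qed
      have c4: "crs (lp a) x \<ge> 0" "crs x (lp b) \<ge> 0" "crs (lp a') x \<ge> 0" "crs x (lp b') \<ge> 0"
        using x(3,5) unfolding t1 t2 cone_def by simp_all
      obtain v where v: "v \<in> {a, b}" "v \<in> {a', b'}"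
        by (rule common_vertex[OF F12 \<open>c \<noteq> c'\<close> x(1) c4])
      have "K a b c 0 = K a' b' c' 0"
        by (rule ray[OF F12 v]) (simp_all add: icr_def sector_def \<gamma>)
      then show False using ne by simp
    qed
    ultimately have "Z1 \<inter> - {0} = {} \<or> Z2 \<inter> - {0} = {}"
      using cl unfolding connected_closed by blast
    moreover have nz: "lp a \<in> cone (a, b, c) \<and> lp a \<noteq> 0" if "facet a b c" for a b c
      using that zero_not_E by (auto simp: cone_def facet_def)
    have "(p, q, m) \<in> S1" "(p', q', m') \<in> S - S1" using F neq by (auto simp: S1_def S_def)
    then have "lp p \<in> Z1 \<inter> - {0}" "lp p' \<in> Z2 \<inter> - {0}"
      using nz[OF F(1)] nz[OF F(2)] unfolding Z1_def Z2_def by blast+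
    ultimately show False by blast
  qed
  have consistent: "K p q m y = K p' q' m' y"
    if F: "facet p q m" "facet p' q' m'" and y: "y \<in> sector p q" "y \<in> sector p' q'" "n y = \<gamma> - 1" for p q m p' q' m' y
  proof (cases "m = m'")
    case True
    then show ?thesis using facet_vertices_unique[OF F(1)] F(2) by simp
  next
    case False
    show ?thesis
    proof (cases "y = 0")
      case True
      then show ?thesis using origin[OF F] y(3) by simp
    next
      case nz: False
      have c: "crs (lp p) (lp y) \<ge> 0" "crs (lp y) (lp q) \<ge> 0" "crs (lp p') (lp y) \<ge> 0" "crs (lp y) (lp q') \<ge> 0"
        using y by (simp_all add: sector_def crs_lattice_point)
      have "lp y \<noteq> 0" using nz lattice_point_eq_iff[of y 0] by simp
      then obtain v where v: "v \<in> {p, q}" "v \<in> {p', q'}" "crs (lp v) (lp y) = 0"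
        using common_vertex[OF F False _ c] by blast
      show ?thesis by (rule ray[OF F v(1,2)]) (use v(3) y in \<open>simp_all add: crs_lattice_point\<close>)
    qed
  qed
  define k where "k = (\<lambda>y. if n y = \<gamma> - 1 then
     (case SOME t. case t of (p, q, m) \<Rightarrow> facet p q m \<and> y \<in> sector p q of (p, q, m) \<Rightarrow> K p q m y) else 0)"
  have k: "k y = K p q m y" if F: "facet p q m" "y \<in> sector p q" "n y = \<gamma> - 1" for p q m y
  proof -
    define t where "t = (SOME t. case t of (p, q, m) \<Rightarrow> facet p q m \<and> y \<in> sector p q)"
    have "case t of (p, q, m) \<Rightarrow> facet p q m \<and> y \<in> sector p q"
      unfolding t_def by (rule someI[of _ "(p, q, m)"]) (use F in simp)
    then show ?thesis
      using consistent[OF F(1) _ F(2) _ F(3)] F(3) by (auto simp: k_def t_def[symmetric] split: prod.splits)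
  qed
  show ?thesis
  proof (rule that[of k])
    show "n y = \<gamma> - 1" if "k y \<noteq> 0" for y using that by (simp add: k_def split: if_splits)
    fix b assume b: "n b = \<gamma>"
    obtain p q m where F: "facet p q m" "b \<in> sector p q" by (rule facet_cover_lattice)
    have eq: "(\<Sum>a\<in>keys f. w a * k (b - a)) = (\<Sum>a\<in>facet_keys m. w a * K p q m (b - a))" for w
    proof -
      have "(\<Sum>a\<in>keys f. w a * k (b - a)) = (\<Sum>a\<in>facet_keys m. w a * k (b - a))"
        by (rule sum_keys_facet[OF F(1) _ F(2), of k "\<gamma> - 1"]) (use b in \<open>auto simp: k_def split: if_splits\<close>)
      also have "\<dots> = (\<Sum>a\<in>facet_keys m. w a * K p q m (b - a))"
      proof (rule sum.cong[OF refl])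
        fix a assume a: "a \<in> facet_keys m"
        show "w a * k (b - a) = w a * K p q m (b - a)"
        proof (cases "n (b - a) = \<gamma> - 1")
          case True
          then have "b - a \<in> sector p q"
            using additive_sector(2)[OF F, of a] facet_keys_sector[OF F(1) a] b by simp
          then show ?thesis using k[OF F(1) _ True] by simp
        next
          case False
          then have "k (b - a) = 0" "K p q m (b - a) = 0" using K[OF F(1), of "b - a"] by (simp add: k_def, blast)
          then show ?thesis by simp
        qed
      qed
      finally show ?thesis .
    qed
    show "g1 b = (\<Sum>a\<in>keys f. lookup f a * of_int (fst a) * k (b - a)) \<and>
       g2 b = (\<Sum>a\<in>keys f. lookup f a * of_int (snd a) * k (b - a))"
      unfolding eq by (rule Kg[OF F b])
  qed
qed

text \<open>In a facet cone, a support point of \<open>k\<close> with least \<open>icr p\<close> is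
  multiplied by the monomial \<open>p\<close> into a point that no other product reaches.\<close>

lemma graded_injective:
  fixes k :: "int \<times> int \<Rightarrow> complex"
  assumes k: "\<And>y. k y \<noteq> 0 \<Longrightarrow> n y = \<gamma> - 1"
    and zero: "\<And>b. n b = \<gamma> \<Longrightarrow> (\<Sum>a\<in>keys f. lookup f a * of_int (fst a) * k (b - a)) = 0 \<and>
       (\<Sum>a\<in>keys f. lookup f a * of_int (snd a) * k (b - a)) = 0"
  shows "k y = 0"
proof (rule ccontr)
  assume ky: "k y \<noteq> 0"
  obtain p q m where F: "facet p q m" "y \<in> sector p q" by (rule facet_cover_lattice)
  obtain z where z: "z \<in> sector p q" "k z \<noteq> 0"
    and min: "\<And>x. x \<in> sector p q \<Longrightarrow> k x \<noteq> 0 \<Longrightarrow> nat (icr p z) \<le> nat (icr p x)"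
    using ex_has_least_nat[of "\<lambda>x. x \<in> sector p q \<and> k x \<noteq> 0" y "\<lambda>x. nat (icr p x)"] F ky by blast
  have pk: "p \<in> facet_keys m" using facet_vertex_keys[OF F(1)] by simp
  have ps: "p \<in> sector p q" using facet_keys_sector[OF F(1) pk] by simp
  have bs: "z + p \<in> sector p q" using z(1) ps by (simp add: sector_def icr_add)
  have nb: "n (z + p) = \<gamma>"
    using bs z k[OF z(2)] pk sector_iff[OF F(1)] by (simp add: lattice_point_add inner_add_right facet_keys_def)
  have eq: "(\<Sum>a\<in>keys f. w a * k (z + p - a)) = w p * k z" for w
  proof -
    have "(\<Sum>a\<in>keys f. w a * k (z + p - a)) = (\<Sum>a\<in>facet_keys m. w a * k (z + p - a))"
      by (rule sum_keys_facet[OF F(1) _ bs, of k "\<gamma> - 1"]) (use k nb in auto)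
    also have "\<dots> = (\<Sum>a\<in>{p}. w a * k (z + p - a))"
    proof (rule sum.mono_neutral_right)
      show "\<forall>a\<in>facet_keys m - {p}. w a * k (z + p - a) = 0"
      proof
        fix a assume a: "a \<in> facet_keys m - {p}"
        then have s: "a \<in> sector p q" "n a = 1" using facet_keys_sector[OF F(1), of a] by simp_all
        have "icr p a > 0" using a s facet_key_on_ray(1)[OF F(1), of a] by (force simp: sector_def)
        moreover have "icr p (z + p - a) = icr p z - icr p a" by (simp add: icr_def algebra_simps)
        moreover have "icr p z \<ge> 0" using z(1) by (simp add: sector_def)
        ultimately have lt: "icr p (z + p - a) < icr p z" by simp
        have "k (z + p - a) = 0"
        proof (rule ccontr)
          assume ne: "k (z + p - a) \<noteq> 0"
          then have "z + p - a \<in> sector p q"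
            using additive_sector(2)[OF F(1) bs, of a] k[OF ne] s(2) nb by simp
          then show False using min[OF _ ne] lt by (simp add: sector_def nat_le_eq_zle)
        qed
        then show "w a * k (z + p - a) = 0" by simp
      qed
    qed (use pk in \<open>auto simp: facet_keys_def\<close>)
    finally show ?thesis by simp
  qed
  have "p \<in> E" using F(1) by (simp add: facet_def)
  then have "lookup f p \<noteq> 0" "p \<noteq> 0" using E_keys[of p] zero_not_E[of p] by (auto simp: in_keys_iff)
  then have "lookup f p \<noteq> 0" "fst p \<noteq> 0 \<or> snd p \<noteq> 0" by (auto simp: prod_eq_iff)
  then show False using zero[OF nb] z(2) unfolding eq by auto
qed

end

section \<open>The Newton filtration on the Gauss-Manin module\<close>

lemma lookup_theta_times: "lookup (theta * x) k = lookup x (k - 1)"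
  by (simp add: theta_def lookup_single_times)

lemma lookup_tau_times: "lookup (tau * x) k = lookup x (k + 1)"
  by (simp add: tau_def lookup_single_times)

lemma theta_tau: "theta * (tau * x) = x" "tau * (theta * x) = x"
  by (rule poly_mapping_eqI, simp add: lookup_theta_times lookup_tau_times)+

lemma lookup_scale_forms: "lookup (scale_forms c x) k = Poly_Mapping.single 0 c * lookup x k"
  by (simp add: scale_forms_def lookup_single_times)

lemma lookup_tau_deriv_tau:
  "lookup (tau * deriv_tau f x) k = of_int (- k) * lookup x k - f * lookup x (k + 1)"
proof -
  have "lookup (\<Sum>k\<in>keys x. Poly_Mapping.single (k + 1) (of_int (- k) * lookup x k)) (k + 1) =
      (\<Sum>i\<in>keys x. if i = k then of_int (- k) * lookup x k else 0)"
    by (auto simp: lookup_sum lookup_single when_def intro!: sum.cong)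
  also have "\<dots> = of_int (- k) * lookup x k" by (simp add: in_keys_iff)
  finally show ?thesis
    by (simp add: lookup_tau_times deriv_tau_def lookup_minus lookup_single_times)
qed

definition gm_map :: "laurent \<Rightarrow> theta_laurent \<Rightarrow> theta_laurent \<Rightarrow> theta_laurent" where
  "gm_map f \<eta>1 \<eta>2 = theta * ext_deriv (\<eta>1, \<eta>2) - df_wedge f (\<eta>1, \<eta>2)"

lemma gm_relations_eq: "gm_relations f = {gm_map f \<eta>1 \<eta>2 | \<eta>1 \<eta>2. True}"
  by (auto simp: gm_relations_def gm_map_def)

lemma gm_map_in: "gm_map f \<eta>1 \<eta>2 \<in> gm_relations f"
  by (auto simp: gm_relations_eq)

lemma gm_relationsE:
  assumes "x \<in> gm_relations f" obtains \<eta>1 \<eta>2 where "x = gm_map f \<eta>1 \<eta>2"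
  using assms by (auto simp: gm_relations_eq)

lemma lookup_gm_map:
  "lookup (gm_map f \<eta>1 \<eta>2) k = (euler1 (lookup \<eta>2 (k - 1)) - euler2 (lookup \<eta>1 (k - 1)))
     - (euler1 f * lookup \<eta>2 k - euler2 f * lookup \<eta>1 k)"
proof -
  have "lookup (Poly_Mapping.map euler1 x) i = euler1 (lookup x i)" "lookup (Poly_Mapping.map euler2 x) i = euler2 (lookup x i)"
    for x :: theta_laurent and i
    by (simp_all add: Poly_Mapping.map.rep_eq when_def)
  then show ?thesis
    by (simp add: gm_map_def ext_deriv_def df_wedge_def lookup_minus lookup_theta_times lookup_single_times)
qed

lemma euler_constant_times:
  "euler1 (Poly_Mapping.single 0 c * g) = Poly_Mapping.single 0 c * euler1 g"
  "euler2 (Poly_Mapping.single 0 c * g) = Poly_Mapping.single 0 c * euler2 g"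
  by (simp_all add: euler_mult)

lemma gm_map_add: "gm_map f \<eta>1 \<eta>2 + gm_map f \<zeta>1 \<zeta>2 = gm_map f (\<eta>1 + \<zeta>1) (\<eta>2 + \<zeta>2)"
  by (rule poly_mapping_eqI) (simp add: lookup_gm_map lookup_add algebra_simps)

lemma gm_map_diff: "gm_map f \<eta>1 \<eta>2 - gm_map f \<zeta>1 \<zeta>2 = gm_map f (\<eta>1 - \<zeta>1) (\<eta>2 - \<zeta>2)"
  by (rule poly_mapping_eqI) (simp add: lookup_gm_map lookup_minus algebra_simps)

lemma gm_map_scale: "scale_forms c (gm_map f \<eta>1 \<eta>2) = gm_map f (scale_forms c \<eta>1) (scale_forms c \<eta>2)"
  by (rule poly_mapping_eqI) (simp add: lookup_gm_map lookup_scale_forms euler_constant_times algebra_simps)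

lemma gm_map_theta: "theta * gm_map f \<eta>1 \<eta>2 = gm_map f (theta * \<eta>1) (theta * \<eta>2)"
  by (rule poly_mapping_eqI) (simp add: lookup_gm_map lookup_theta_times)

lemma gm_map_tau: "tau * gm_map f \<eta>1 \<eta>2 = gm_map f (tau * \<eta>1) (tau * \<eta>2)"
  by (rule poly_mapping_eqI) (simp add: lookup_gm_map lookup_tau_times algebra_simps)

lemma euler_uminus [simp]: "euler1 (- g) = - euler1 g" "euler2 (- g) = - euler2 g"
  by (rule poly_mapping_eqI, simp add: lookup_euler1 lookup_euler2)+

lemma euler_of_int [simp]: "euler1 (of_int i) = 0" "euler2 (of_int i) = 0"
proof -
  have "(of_int i :: laurent) = Poly_Mapping.single 0 (of_int i)" by simp
  then show "euler1 (of_int i) = 0" "euler2 (of_int i) = 0"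
    by (metis euler_single fst_zero snd_zero mult_zero_left of_int_0 single_zero)+
qed

lemma euler_of_int_times:
  "euler1 (of_int i * g) = of_int i * euler1 g" "euler2 (of_int i * g) = of_int i * euler2 g"
  by (simp_all add: euler_mult)

text \<open>With \<open>D\<close> the operator \<open>\<tau>\<partial>\<^sub>\<tau>\<close> and \<open>\<delta> = \<theta> d - df\<and>\<close>, one has \<open>D \<delta> = \<delta> (D - 1)\<close>.\<close>

lemma gm_map_tau_deriv_tau:
  "tau * deriv_tau f (gm_map f \<eta>1 \<eta>2) = gm_map f (tau * deriv_tau f \<eta>1 - \<eta>1) (tau * deriv_tau f \<eta>2 - \<eta>2)"
  by (rule poly_mapping_eqI)
    (simp add: lookup_gm_map lookup_tau_deriv_tau lookup_minus euler_of_int_times euler_mult algebra_simps)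

lemma gm_relations_closed:
  "0 \<in> gm_relations f"
  "x \<in> gm_relations f \<Longrightarrow> y \<in> gm_relations f \<Longrightarrow> x + y \<in> gm_relations f"
  "x \<in> gm_relations f \<Longrightarrow> y \<in> gm_relations f \<Longrightarrow> x - y \<in> gm_relations f"
  "x \<in> gm_relations f \<Longrightarrow> scale_forms c x \<in> gm_relations f"
  "x \<in> gm_relations f \<Longrightarrow> theta * x \<in> gm_relations f"
  "x \<in> gm_relations f \<Longrightarrow> tau * x \<in> gm_relations f"
  "x \<in> gm_relations f \<Longrightarrow> tau * deriv_tau f x \<in> gm_relations f"
proof -
  have "gm_map f 0 0 = 0" by (rule poly_mapping_eqI) (simp add: lookup_gm_map)
  then show "0 \<in> gm_relations f" using gm_map_in[of f 0 0] by simp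
qed (elim gm_relationsE; simp add: gm_map_add gm_map_diff gm_map_scale gm_map_theta gm_map_tau gm_map_tau_deriv_tau gm_map_in)+

text \<open>The pair is \<open>\<theta> d - df\<and>\<close> applied to
  \<open>\<theta>\<^sup>k \<kappa>\<close>, and this operator squares to 0.\<close>

lemma gm_map_exact:
  "gm_map f (Poly_Mapping.single (k + 1) (euler1 \<kappa>) - Poly_Mapping.single k (\<kappa> * euler1 f))
     (Poly_Mapping.single (k + 1) (euler2 \<kappa>) - Poly_Mapping.single k (\<kappa> * euler2 f)) = 0"
proof (rule poly_mapping_eqI)
  fix i
  consider "i = k" | "i = k + 1" | "i = k + 2" | "i \<noteq> k" "i \<noteq> k + 1" "i \<noteq> k + 2" by blast
  then show "lookup (gm_map f (Poly_Mapping.single (k + 1) (euler1 \<kappa>) - Poly_Mapping.single k (\<kappa> * euler1 f))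
     (Poly_Mapping.single (k + 1) (euler2 \<kappa>) - Poly_Mapping.single k (\<kappa> * euler2 f))) i = lookup 0 i"
    by cases (simp_all add: lookup_gm_map lookup_minus lookup_single when_def euler_mult euler_commute algebra_simps)
qed

section \<open>Discreteness and strictness of the Newton filtration\<close>

context newton_polygon
begin

text \<open>The norm is at most \<open>B * n c\<close>, because \<open>c / n c\<close> lies in
  \<open>P\<close>.\<close>

lemma finite_n_le: "finite {c. n c \<le> r}"
proof -
  obtain B where B: "B > 0" "\<forall>y\<in>P. norm y \<le> B" using compact_imp_bounded[OF compact_P] bounded_pos by blast
  have norm_le: "norm (lp c) \<le> B * n c" for c
  proof (cases "lp c = 0")
    case False
    have "norm ((1 / n c) *\<^sub>R lp c) \<le> B" using B(2) normalize_mem_P[OF False] by blast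
    then show ?thesis using nu_pos[OF False] by (simp add: divide_le_eq)
  qed simp
  define K where "K = \<lceil>B * r\<rceil>"
  have "{c. n c \<le> r} \<subseteq> {-K..K} \<times> {-K..K}"
  proof
    fix c assume "c \<in> {c. n c \<le> r}"
    then have "norm (lp c) \<le> B * r" using norm_le[of c] B(1) by (smt (verit) mem_Collect_eq mult_left_mono)
    then have "\<bar>of_int (fst c)\<bar> \<le> B * r" "\<bar>of_int (snd c)\<bar> \<le> B * r"
      using norm_fst_le[of "fst (lp c)" "snd (lp c)"] norm_snd_le[of "snd (lp c)" "fst (lp c)"]
      by (simp_all add: lattice_point_def)
    then have "\<bar>fst c\<bar> \<le> K" "\<bar>snd c\<bar> \<le> K" unfolding K_def by linarith+
    then show "c \<in> {-K..K} \<times> {-K..K}" by (cases c) auto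
  qed
  then show ?thesis by (rule finite_subset) simp
qed

text \<open>On the cone of a facet \<open>nu\<close> takes values in the multiples of
  \<open>1 / icr p q\<close> at lattice points; a product of these determinants is a common
  denominator. The inductions on the degree rely on this discreteness.\<close>

lemma ex_denominator: "\<exists>M::nat. M > 0 \<and> (\<forall>c. \<exists>j::int. n c = of_int j / of_nat M)"
proof -
  define S where "S = {(p, q) \<in> E \<times> E. icr p q > 0}"
  have fin: "finite S" unfolding S_def using finite_E by (auto intro: finite_subset[of _ "E \<times> E"])
  define M where "M = (\<Prod>(p, q)\<in>S. nat (icr p q))"
  have "M > 0" unfolding M_def by (rule prod_pos) (auto simp: S_def)
  moreover have "\<exists>j::int. n c = of_int j / of_nat M" for c
  proof -
    obtain p q m where F: "facet p q m" "c \<in> sector p q" by (rule facet_cover_lattice)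
    then have pq: "(p, q) \<in> S" "icr p q > 0" by (auto simp: S_def facet_def crs_lattice_point)
    then have "nat (icr p q) dvd M" unfolding M_def using dvd_prodI[OF fin pq(1), of "\<lambda>(p, q). nat (icr p q)"] by simp
    then obtain d where d: "M = nat (icr p q) * d" by (elim dvdE)
    then have "d > 0" using \<open>M > 0\<close> by simp
    have "n c = of_int (icr c q + icr p c) / of_int (icr p q)"
      using facet_inner[OF F(1), of "lp c"] sector_iff[OF F(1)] F(2) by (simp add: crs_lattice_point)
    also have "\<dots> = of_int ((icr c q + icr p c) * int d) / of_nat M"
      using d pq \<open>d > 0\<close> by (simp add: field_simps)
    finally show ?thesis by blast
  qed
  ultimately show ?thesis by blast
qed

definition den :: nat where
  "den = (SOME M. M > 0 \<and> (\<forall>c. \<exists>j::int. n c = of_int j / of_nat M))"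

lemma den_pos: "den > 0" and n_den: "\<exists>j::int. n c = of_int j / of_nat den"
  using someI_ex[OF ex_denominator] unfolding den_def by blast+

definition newton_filt :: "real \<Rightarrow> laurent set" where
  "newton_filt \<beta> = {g. \<forall>c. lookup g c \<noteq> 0 \<longrightarrow> n c \<le> \<beta>}"

lemma newton_filtI: "(\<And>c. lookup g c \<noteq> 0 \<Longrightarrow> n c \<le> \<beta>) \<Longrightarrow> g \<in> newton_filt \<beta>"
  unfolding newton_filt_def by blast

lemma newton_filtD: "g \<in> newton_filt \<beta> \<Longrightarrow> lookup g c \<noteq> 0 \<Longrightarrow> n c \<le> \<beta>"
  unfolding newton_filt_def by blast

lemma newton_filt_lookup_0: "g \<in> newton_filt \<beta> \<Longrightarrow> n c > \<beta> \<Longrightarrow> lookup g c = 0"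
  using newton_filtD[of g \<beta> c] by linarith

lemma newton_filt_0 [simp]: "0 \<in> newton_filt \<beta>" by (simp add: newton_filt_def)

lemma newton_filt_add: "g \<in> newton_filt \<beta> \<Longrightarrow> h \<in> newton_filt \<beta> \<Longrightarrow> g + h \<in> newton_filt \<beta>"
  unfolding newton_filt_def mem_Collect_eq lookup_add by (metis add.right_neutral)

lemma newton_filt_uminus: "g \<in> newton_filt \<beta> \<Longrightarrow> - g \<in> newton_filt \<beta>"
  unfolding newton_filt_def by simp

lemma newton_filt_diff: "g \<in> newton_filt \<beta> \<Longrightarrow> h \<in> newton_filt \<beta> \<Longrightarrow> g - h \<in> newton_filt \<beta>"
  using newton_filt_add[of g \<beta> "- h"] newton_filt_uminus[of h \<beta>] by simp

lemma newton_filt_mono: "g \<in> newton_filt \<beta> \<Longrightarrow> \<beta> \<le> \<beta>' \<Longrightarrow> g \<in> newton_filt \<beta>'"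
  unfolding newton_filt_def by force

lemma newton_filt_neg: "g \<in> newton_filt \<beta> \<Longrightarrow> \<beta> < 0 \<Longrightarrow> g = 0"
proof (rule poly_mapping_eqI)
  fix c assume "g \<in> newton_filt \<beta>" "\<beta> < 0"
  then show "lookup g c = lookup 0 c" using newton_filt_lookup_0[of g \<beta> c] n_nonneg[of c] by simp
qed

lemma newton_filt_mult:
  assumes "g \<in> newton_filt \<beta>" "h \<in> newton_filt \<gamma>" shows "g * h \<in> newton_filt (\<beta> + \<gamma>)"
  unfolding newton_filt_def
proof (intro CollectI allI impI)
  fix c assume "lookup (g * h) c \<noteq> 0"
  then have "c \<in> keys (g * h)" by (simp add: in_keys_iff)
  then obtain a b where "c = a + b" "a \<in> keys g" "b \<in> keys h" using keys_mult[of g h] by auto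
  then show "n c \<le> \<beta> + \<gamma>" using newton_filtD[OF assms(1), of a] newton_filtD[OF assms(2), of b] n_add[of a b]
    by (simp add: in_keys_iff)
qed

lemma newton_filt_euler: "g \<in> newton_filt \<beta> \<Longrightarrow> euler1 g \<in> newton_filt \<beta>" "g \<in> newton_filt \<beta> \<Longrightarrow> euler2 g \<in> newton_filt \<beta>"
  by (simp_all add: newton_filt_def lookup_euler1 lookup_euler2)

lemma f_newton_filt: "f \<in> newton_filt 1" "euler1 f \<in> newton_filt 1" "euler2 f \<in> newton_filt 1"
proof -
  show "f \<in> newton_filt 1" using n_keys by (intro newton_filtI) (simp add: in_keys_iff)
  then show "euler1 f \<in> newton_filt 1" "euler2 f \<in> newton_filt 1" by (rule newton_filt_euler)+
qed

lemma newton_filt_exhaust: "\<exists>j::int. g \<in> newton_filt (of_int j / of_nat den)"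
proof -
  define r where "r = Max (insert 0 (n ` keys g))"
  have "g \<in> newton_filt r"
    unfolding newton_filt_def r_def by (auto simp: in_keys_iff intro!: Max_ge)
  moreover have "r \<le> of_int \<lceil>r * den\<rceil> / of_nat den" using den_pos by (simp add: le_divide_eq)
  ultimately show ?thesis using newton_filt_mono by blast
qed

lemma newton_filt_below:
  assumes "g \<in> newton_filt (of_int j / of_nat den)" "\<And>c. n c = of_int j / of_nat den \<Longrightarrow> lookup g c = 0"
  shows "g \<in> newton_filt (of_int (j - 1) / of_nat den)"
  unfolding newton_filt_def
proof (intro CollectI allI impI)
  fix c assume c: "lookup g c \<noteq> 0"
  obtain i :: int where i: "n c = of_int i / of_nat den" using n_den by blast
  have "n c \<le> of_int j / of_nat den" "n c \<noteq> of_int j / of_nat den"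
    using newton_filtD[OF assms(1) c] assms(2)[of c] c by blast+
  then have "i < j" using den_pos by (simp add: i divide_le_cancel)
  then show "n c \<le> of_int (j - 1) / of_nat den" using den_pos by (simp add: i divide_right_mono)
qed

definition wedge :: "laurent \<Rightarrow> laurent \<Rightarrow> laurent" where
  "wedge g1 g2 = euler1 f * g2 - euler2 f * g1"

lemma wedge_newton_filt: "g1 \<in> newton_filt \<beta> \<Longrightarrow> g2 \<in> newton_filt \<beta> \<Longrightarrow> wedge g1 g2 \<in> newton_filt (\<beta> + 1)"
  unfolding wedge_def using newton_filt_mult[OF f_newton_filt(2), of g2 \<beta>] newton_filt_mult[OF f_newton_filt(3), of g1 \<beta>]
  by (simp add: newton_filt_diff add.commute)

lemma wedge_linear:
  "wedge (g1 + h1) (g2 + h2) = wedge g1 g2 + wedge h1 h2" "wedge (g1 - h1) (g2 - h2) = wedge g1 g2 - wedge h1 h2"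
  "wedge (k * euler1 f) (k * euler2 f) = 0" "wedge 0 0 = 0"
  by (simp_all add: wedge_def algebra_simps)

lemma lookup_times_euler:
  "lookup (k * euler1 f) b = (\<Sum>a\<in>keys f. lookup f a * of_int (fst a) * lookup k (b - a))"
  "lookup (k * euler2 f) b = (\<Sum>a\<in>keys f. lookup f a * of_int (snd a) * lookup k (b - a))"
proof -
  have k: "keys (euler1 f) \<subseteq> keys f" "keys (euler2 f) \<subseteq> keys f"
    by (auto simp: in_keys_iff lookup_euler1 lookup_euler2)
  show "lookup (k * euler1 f) b = (\<Sum>a\<in>keys f. lookup f a * of_int (fst a) * lookup k (b - a))"
    unfolding mult.commute[of k] lookup_times_sum[OF finite_keys k(1)] lookup_euler1 by (simp only: mult_ac)
  show "lookup (k * euler2 f) b = (\<Sum>a\<in>keys f. lookup f a * of_int (snd a) * lookup k (b - a))"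
    unfolding mult.commute[of k] lookup_times_sum[OF finite_keys k(2)] lookup_euler2 by (simp only: mult_ac)
qed

lemma lookup_wedge:
  "lookup (wedge g1 g2) b = (\<Sum>a\<in>keys f. lookup f a * of_int (fst a) * lookup g2 (b - a)) -
     (\<Sum>a\<in>keys f. lookup f a * of_int (snd a) * lookup g1 (b - a))"
  using lookup_times_euler(1)[of g2 b] lookup_times_euler(2)[of g1 b]
  by (simp add: wedge_def lookup_minus mult.commute)

lemma laurent_of_function:
  assumes "\<And>y. k y \<noteq> (0::complex) \<Longrightarrow> n y \<le> r"
  obtains \<kappa> :: laurent where "\<And>y. lookup \<kappa> y = k y"
proof -
  have "{y. k y \<noteq> 0} \<subseteq> {y. n y \<le> r}" using assms by blast
  then have "finite {y. k y \<noteq> 0}" using finite_n_le finite_subset by blast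
  then show ?thesis by (intro that[of "Abs_poly_mapping k"]) simp
qed

text \<open>A term of \<open>f\<close> raises the degree by at most 1, so a coefficient of degree
  \<open>\<gamma> + 1\<close> sees only the part of \<open>g\<close> of degree
  \<open>\<gamma>\<close>.\<close>

lemma top_lookup:
  assumes "g \<in> newton_filt \<gamma>" "n b = \<gamma> + 1" "a \<in> keys f"
  shows "lookup g (b - a) = (if n (b - a) = \<gamma> then lookup g (b - a) else 0)"
proof -
  have "n b \<le> n a + n (b - a)" using n_add[of a "b - a"] by simp
  then have "n (b - a) \<ge> \<gamma>" using assms(2) n_keys[OF assms(3)] by linarith
  then show ?thesis using newton_filt_lookup_0[OF assms(1), of "b - a"] by auto
qed

text \<open>While the degree of the pair is too large, its top part is a syzygy of the leading
  parts, hence comes from some \<open>\<kappa>\<close> by \<open>graded_syzygy\<close>; subtracting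
  \<open>\<kappa>\<close> times \<open>(euler1 f, euler2 f)\<close> lowers the degree and leaves the
  wedge unchanged.\<close>

theorem wedge_strict:
  assumes W: "wedge g1 g2 \<in> newton_filt \<beta>"
  shows "\<exists>k. g1 - k * euler1 f \<in> newton_filt (\<beta> - 1) \<and> g2 - k * euler2 f \<in> newton_filt (\<beta> - 1)"
proof -
  let ?r = "\<lambda>j::int. of_int j / of_nat den :: real"
  \<comment> \<open>The index of the largest multiple of \<open>1 / den\<close> that is at most
    \<open>\<beta> - 1\<close>; the induction runs over the distance to it.\<close>
  define j0 where "j0 = \<lfloor>(\<beta> - 1) * of_nat den\<rfloor>"
  have base: "?r j \<le> \<beta> - 1" if "j \<le> j0" for j
  proof -
    have "of_int j \<le> (\<beta> - 1) * of_nat den" using that unfolding j0_def by (simp add: le_floor_iff)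
    then show ?thesis using den_pos by (simp add: divide_le_eq)
  qed
  have step: "?r j > \<beta> - 1" if "j > j0" for j
  proof -
    have "of_int j > (\<beta> - 1) * of_nat den" using that unfolding j0_def by (simp add: floor_less_iff)
    then show ?thesis using den_pos by (simp add: less_divide_eq)
  qed
  have main: "g1 \<in> newton_filt (?r j) \<Longrightarrow> g2 \<in> newton_filt (?r j) \<Longrightarrow> wedge g1 g2 \<in> newton_filt \<beta> \<Longrightarrow>
    \<exists>k. g1 - k * euler1 f \<in> newton_filt (\<beta> - 1) \<and> g2 - k * euler2 f \<in> newton_filt (\<beta> - 1)" for j
  proof (induction "nat (j - j0)" arbitrary: j g1 g2)
    case 0
    then have "?r j \<le> \<beta> - 1" by (intro base) simp
    then show ?case using 0 newton_filt_mono by (intro exI[of _ 0]) auto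
  next
    case (Suc d)
    define \<gamma> where "\<gamma> = ?r j"
    have \<gamma>: "\<gamma> > \<beta> - 1" unfolding \<gamma>_def using Suc(2) by (intro step) simp
    have g: "g1 \<in> newton_filt \<gamma>" "g2 \<in> newton_filt \<gamma>" using Suc by (simp_all add: \<gamma>_def)
    let ?t1 = "\<lambda>x. if n x = \<gamma> then lookup g1 x else 0" and ?t2 = "\<lambda>x. if n x = \<gamma> then lookup g2 x else 0"
    obtain k where k: "\<And>y. k y \<noteq> 0 \<Longrightarrow> n y = \<gamma> - 1"
      "\<And>b. n b = \<gamma> \<Longrightarrow> ?t1 b = (\<Sum>a\<in>keys f. lookup f a * of_int (fst a) * k (b - a)) \<and>
       ?t2 b = (\<Sum>a\<in>keys f. lookup f a * of_int (snd a) * k (b - a))"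
    proof (rule graded_syzygy[of ?t1 ?t2 \<gamma>])
      fix b assume b: "n b = \<gamma> + 1"
      have "lookup (wedge g1 g2) b = 0" using b \<gamma> by (intro newton_filt_lookup_0[OF Suc.prems(3)]) simp
      moreover have "(\<Sum>a\<in>keys f. lookup f a * of_int (fst a) * lookup g2 (b - a)) = (\<Sum>a\<in>keys f. lookup f a * of_int (fst a) * ?t2 (b - a))"
        "(\<Sum>a\<in>keys f. lookup f a * of_int (snd a) * lookup g1 (b - a)) = (\<Sum>a\<in>keys f. lookup f a * of_int (snd a) * ?t1 (b - a))"
        using top_lookup[OF g(2) b] top_lookup[OF g(1) b] by (auto intro!: sum.cong)
      ultimately show "(\<Sum>a\<in>keys f. lookup f a * of_int (fst a) * ?t2 (b - a)) - (\<Sum>a\<in>keys f. lookup f a * of_int (snd a) * ?t1 (b - a)) = 0"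
        unfolding lookup_wedge by simp
    qed (auto split: if_splits)
    obtain \<kappa> :: laurent where \<kappa>: "\<And>y. lookup \<kappa> y = k y"
      using laurent_of_function[of k "\<gamma> - 1"] k(1) by force
    have "\<kappa> \<in> newton_filt (\<gamma> - 1)" using k(1) by (intro newton_filtI) (simp add: \<kappa>)
    then have kh: "\<kappa> * euler1 f \<in> newton_filt \<gamma>" "\<kappa> * euler2 f \<in> newton_filt \<gamma>"
      using newton_filt_mult[OF _ f_newton_filt(2), of \<kappa> "\<gamma> - 1"] newton_filt_mult[OF _ f_newton_filt(3), of \<kappa> "\<gamma> - 1"] by simp_all
    have lower: "g1 - \<kappa> * euler1 f \<in> newton_filt (?r (j - 1))" "g2 - \<kappa> * euler2 f \<in> newton_filt (?r (j - 1))"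
    proof -
      have "lookup (g1 - \<kappa> * euler1 f) b = 0" "lookup (g2 - \<kappa> * euler2 f) b = 0" if "n b = \<gamma>" for b
        using k(2)[OF that] that by (simp_all add: lookup_minus lookup_times_euler \<kappa>)
      then show "g1 - \<kappa> * euler1 f \<in> newton_filt (?r (j - 1))" "g2 - \<kappa> * euler2 f \<in> newton_filt (?r (j - 1))"
        using newton_filt_diff[OF g(1) kh(1)] newton_filt_diff[OF g(2) kh(2)]
        unfolding \<gamma>_def by (blast intro: newton_filt_below)+
    qed
    have "wedge (g1 - \<kappa> * euler1 f) (g2 - \<kappa> * euler2 f) \<in> newton_filt \<beta>"
      using Suc.prems(3) by (simp add: wedge_linear)
    moreover have d: "d = nat (j - 1 - j0)" using Suc.hyps(2) by arith
    ultimately obtain k' where "g1 - \<kappa> * euler1 f - k' * euler1 f \<in> newton_filt (\<beta> - 1)" "g2 - \<kappa> * euler2 f - k' * euler2 f \<in> newton_filt (\<beta> - 1)"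
      using Suc.hyps(1)[OF d lower] by auto
    then show ?case by (intro exI[of _ "\<kappa> + k'"]) (simp add: algebra_simps)
  qed
  obtain j1 j2 where j: "g1 \<in> newton_filt (?r j1)" "g2 \<in> newton_filt (?r j2)" using newton_filt_exhaust by blast
  have le: "?r j1 \<le> ?r (max j1 j2)" "?r j2 \<le> ?r (max j1 j2)" by (simp_all add: divide_right_mono)
  show ?thesis
    by (rule main[OF newton_filt_mono[OF j(1) le(1)] newton_filt_mono[OF j(2) le(2)] W])
qed

text \<open>
  A form in \<open>\<Omega>\<^sup>1(U)[\<theta>, \<theta>\<^sup>-\<^sup>1]\<close> may be corrected from the lowest power of \<open>\<theta>\<close> upwards by elements of the
  kernel of \<open>\<theta> d - df\<and>\<close> of the form \<open>(\<theta> d - df\<and>) (\<theta>\<^sup>k \<kappa>)\<close>.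
\<close>

lemma gm_map_strict:
  assumes supp: "\<And>k. k < - int N \<Longrightarrow> lookup \<eta>1 k = 0 \<and> lookup \<eta>2 k = 0"
    and filt: "\<And>k. k < 0 \<Longrightarrow> lookup (gm_map f \<eta>1 \<eta>2) k \<in> newton_filt (\<alpha> - of_int k)"
  shows "\<exists>\<zeta>1 \<zeta>2. gm_map f \<zeta>1 \<zeta>2 = gm_map f \<eta>1 \<eta>2 \<and>
    (\<forall>k. k < - int N \<longrightarrow> lookup \<zeta>1 k = 0 \<and> lookup \<zeta>2 k = 0) \<and>
    (\<forall>k. k < 0 \<longrightarrow> lookup \<zeta>1 k \<in> newton_filt (\<alpha> - of_int k - 1) \<and> lookup \<zeta>2 k \<in> newton_filt (\<alpha> - of_int k - 1))"
proof -
  have "\<exists>\<zeta>1 \<zeta>2. gm_map f \<zeta>1 \<zeta>2 = gm_map f \<eta>1 \<eta>2 \<and>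
    (\<forall>k. k < - int N \<longrightarrow> lookup \<zeta>1 k = 0 \<and> lookup \<zeta>2 k = 0) \<and>
    (\<forall>k. k < - int N + int j \<longrightarrow> lookup \<zeta>1 k \<in> newton_filt (\<alpha> - of_int k - 1) \<and> lookup \<zeta>2 k \<in> newton_filt (\<alpha> - of_int k - 1))"
    if "j \<le> N" for j
    using that
  proof (induction j)
    case 0
    show ?case by (intro exI[of _ \<eta>1] exI[of _ \<eta>2]) (use supp in simp)
  next
    case (Suc j)
    obtain \<zeta>1 \<zeta>2 where z0: "gm_map f \<zeta>1 \<zeta>2 = gm_map f \<eta>1 \<eta>2"
      "\<forall>k. k < - int N \<longrightarrow> lookup \<zeta>1 k = 0 \<and> lookup \<zeta>2 k = 0"
      "\<forall>k. k < - int N + int j \<longrightarrow> lookup \<zeta>1 k \<in> newton_filt (\<alpha> - of_int k - 1) \<and> lookup \<zeta>2 k \<in> newton_filt (\<alpha> - of_int k - 1)"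
      using Suc.IH[OF Suc_leD[OF Suc.prems]] by (elim exE conjE)
    note z = z0(1) z0(2)[rule_format] z0(3)[rule_format]
    define k0 where "k0 = - int N + int j"
    have k0: "k0 < 0" using Suc.prems by (simp add: k0_def)
    \<comment> \<open>The coefficient of index \<open>k0\<close> is this derivative minus the wedge.
      The derivative is controlled by the previous step, so the wedge is controlled too.\<close>
    have "euler1 (lookup \<zeta>2 (k0 - 1)) - euler2 (lookup \<zeta>1 (k0 - 1)) \<in> newton_filt (\<alpha> - of_int k0)"
      using z(3)[of "k0 - 1"] by (auto simp: k0_def algebra_simps intro!: newton_filt_diff newton_filt_euler)
    moreover have "lookup (gm_map f \<zeta>1 \<zeta>2) k0 \<in> newton_filt (\<alpha> - of_int k0)" using filt[OF k0] z(1) by simp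
    ultimately have "(euler1 (lookup \<zeta>2 (k0 - 1)) - euler2 (lookup \<zeta>1 (k0 - 1))) - lookup (gm_map f \<zeta>1 \<zeta>2) k0 \<in> newton_filt (\<alpha> - of_int k0)"
      by (rule newton_filt_diff)
    then have "wedge (lookup \<zeta>1 k0) (lookup \<zeta>2 k0) \<in> newton_filt (\<alpha> - of_int k0)"
      by (simp add: lookup_gm_map wedge_def)
    then obtain \<kappa> where \<kappa>: "lookup \<zeta>1 k0 - \<kappa> * euler1 f \<in> newton_filt (\<alpha> - of_int k0 - 1)"
      "lookup \<zeta>2 k0 - \<kappa> * euler2 f \<in> newton_filt (\<alpha> - of_int k0 - 1)"
      using wedge_strict by blast
    define \<xi>1 where "\<xi>1 = \<zeta>1 + (Poly_Mapping.single (k0 + 1) (euler1 \<kappa>) - Poly_Mapping.single k0 (\<kappa> * euler1 f))"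
    define \<xi>2 where "\<xi>2 = \<zeta>2 + (Poly_Mapping.single (k0 + 1) (euler2 \<kappa>) - Poly_Mapping.single k0 (\<kappa> * euler2 f))"
    have "gm_map f \<xi>1 \<xi>2 = gm_map f \<eta>1 \<eta>2"
      unfolding \<xi>1_def \<xi>2_def gm_map_add[symmetric] gm_map_exact z(1) by simp
    moreover have lt: "lookup \<xi>1 k = lookup \<zeta>1 k \<and> lookup \<xi>2 k = lookup \<zeta>2 k" if "k < k0" for k
      using that by (simp add: \<xi>1_def \<xi>2_def lookup_add lookup_minus lookup_single when_def)
    then have "\<forall>k. k < - int N \<longrightarrow> lookup \<xi>1 k = 0 \<and> lookup \<xi>2 k = 0" using z(2) by (simp add: k0_def)
    moreover have "lookup \<xi>1 k \<in> newton_filt (\<alpha> - of_int k - 1) \<and> lookup \<xi>2 k \<in> newton_filt (\<alpha> - of_int k - 1)"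
      if "k < - int N + int (Suc j)" for k
    proof (cases "k = k0")
      case True
      have "lookup \<xi>1 k0 = lookup \<zeta>1 k0 - \<kappa> * euler1 f" "lookup \<xi>2 k0 = lookup \<zeta>2 k0 - \<kappa> * euler2 f"
        by (simp_all add: \<xi>1_def \<xi>2_def lookup_add lookup_minus lookup_single when_def)
      then show ?thesis using \<kappa> True by simp
    next
      case False
      then have "k < k0" using that by (simp add: k0_def)
      then show ?thesis using lt z(3)[of k] by (simp add: k0_def)
    qed
    ultimately show ?case by blast
  qed
  from this[of N] show ?thesis by simp
qed

section \<open>Elements common to the filtration and the Brieskorn lattice\<close>

lemma theta_laurent_lower_bound: "\<exists>N. \<forall>k < - int N. lookup x k = (0::laurent)"
proof -
  define M where "M = Min (insert 0 (keys x))"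
  define N where "N = nat (- M)"
  have "lookup x k = 0" if "k < - int N" for k
  proof (rule ccontr)
    assume "lookup x k \<noteq> 0"
    then have "M \<le> k" unfolding M_def by (intro Min_le) (simp_all add: in_keys_iff)
    have "M \<le> 0" unfolding M_def by (intro Min_le) simp_all
    then have "int N = - M" by (simp add: N_def)
    then show False using that \<open>M \<le> k\<close> by simp
  qed
  then show ?thesis by blast
qed

lemma theta_laurent_lower_bound2:
  obtains N where "\<And>k. k < - int N \<Longrightarrow> lookup x k = (0::laurent) \<and> lookup y k = (0::laurent)"
proof -
  obtain N1 N2 where N: "\<And>k. k < - int N1 \<Longrightarrow> lookup x k = 0" "\<And>k. k < - int N2 \<Longrightarrow> lookup y k = 0"
    using theta_laurent_lower_bound by metis
  then show ?thesis using that[of "max N1 N2"] by simp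
qed

definition nonneg_theta :: "theta_laurent set" where
  "nonneg_theta = {x. \<forall>k<0. lookup x k = 0}"

lemma brieskorn_eq: "brieskorn_lattice f = {x + y | x y. x \<in> nonneg_theta \<and> y \<in> gm_relations f}"
proof -
  have "(\<forall>k\<in>keys x. 0 \<le> k) \<longleftrightarrow> x \<in> nonneg_theta" for x :: theta_laurent
    by (auto simp: nonneg_theta_def in_keys_iff not_le[symmetric])
  then show ?thesis unfolding brieskorn_lattice_def by simp
qed

definition form_filt :: "real \<Rightarrow> theta_laurent set" where
  "form_filt \<alpha> = {x. \<forall>k. lookup x k \<in> newton_filt (\<alpha> - of_int k)}"

definition V_newton :: "real \<Rightarrow> theta_laurent set" where
  "V_newton \<alpha> = {x + y | x y. x \<in> form_filt \<alpha> \<and> y \<in> gm_relations f}"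

text \<open>Two representatives, one of bounded degree and one without negative powers of \<theta>,
  differ by the image of a form. After \<open>gm_map_strict\<close> has normalised the form,
  subtracting the image of its negative part gives a representative with both properties.\<close>

lemma V_newton_brieskorn:
  assumes "x \<in> V_newton \<alpha>" "x \<in> brieskorn_lattice f"
  obtains x' where "x' \<in> form_filt \<alpha>" "x' \<in> nonneg_theta" "x - x' \<in> gm_relations f"
proof -
  obtain u a where u: "x = u + a" "u \<in> form_filt \<alpha>" "a \<in> gm_relations f" using assms(1) by (auto simp: V_newton_def)
  obtain v b where v: "x = v + b" "v \<in> nonneg_theta" "b \<in> gm_relations f" using assms(2) by (auto simp: brieskorn_eq)
  have "b - a \<in> gm_relations f" using u v by (simp add: gm_relations_closed)
  then obtain \<eta>1 \<eta>2 where \<eta>: "b - a = gm_map f \<eta>1 \<eta>2" by (auto simp: gm_relations_eq)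
  have uv: "u - v = gm_map f \<eta>1 \<eta>2" using u(1) v(1) \<eta> by (simp add: algebra_simps)
  obtain N where N: "\<And>k. k < - int N \<Longrightarrow> lookup \<eta>1 k = 0 \<and> lookup \<eta>2 k = 0"
    using theta_laurent_lower_bound2 by blast
  have filt: "lookup (gm_map f \<eta>1 \<eta>2) k \<in> newton_filt (\<alpha> - of_int k)" if "k < 0" for k
    unfolding uv[symmetric] using u(2) v(2) that by (simp add: lookup_minus form_filt_def nonneg_theta_def)
  obtain \<zeta>1 \<zeta>2 where z: "gm_map f \<zeta>1 \<zeta>2 = gm_map f \<eta>1 \<eta>2"
    "\<forall>k. k < - int N \<longrightarrow> lookup \<zeta>1 k = 0 \<and> lookup \<zeta>2 k = 0"
    "\<forall>k. k < 0 \<longrightarrow> lookup \<zeta>1 k \<in> newton_filt (\<alpha> - of_int k - 1) \<and> lookup \<zeta>2 k \<in> newton_filt (\<alpha> - of_int k - 1)"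
    using gm_map_strict[OF N filt] by blast
  define neg where "neg = (\<lambda>y::theta_laurent. \<Sum>k\<in>keys y \<inter> {..<0}. Poly_Mapping.single k (lookup y k))"
  have neg: "lookup (neg y) k = (if k < 0 then lookup y k else 0)" for y k
  proof -
    have "lookup (neg y) k = (\<Sum>i\<in>keys y \<inter> {..<0}. if i = k then lookup y k else 0)"
      by (auto simp: neg_def lookup_sum lookup_single when_def intro!: sum.cong)
    then show ?thesis by (auto simp: in_keys_iff)
  qed
  define x' where "x' = u - gm_map f (neg \<zeta>1) (neg \<zeta>2)"
  \<comment> \<open>Besides the deletion of negative powers, only the coefficient of index 0
    changes: it receives the differential of the part of index -1.\<close>
  have lx': "lookup x' k = (if k < 0 then 0 else if k = 0 then lookup u 0 - (euler1 (lookup \<zeta>2 (-1)) - euler2 (lookup \<zeta>1 (-1))) else lookup u k)" for k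
  proof -
    have "lookup u k = lookup (gm_map f \<zeta>1 \<zeta>2) k" if "k < 0"
    proof -
      have "lookup (u - v) k = lookup (gm_map f \<zeta>1 \<zeta>2) k" using uv z(1) by simp
      then show ?thesis using v(2) that by (simp add: lookup_minus nonneg_theta_def)
    qed
    then show ?thesis by (auto simp: x'_def lookup_minus lookup_gm_map neg)
  qed
  show ?thesis
  proof (rule that[of x'])
    show "x' \<in> nonneg_theta" by (simp add: nonneg_theta_def lx')
    have "euler1 (lookup \<zeta>2 (-1)) - euler2 (lookup \<zeta>1 (-1)) \<in> newton_filt \<alpha>"
      using z(3)[rule_format, of "-1"] by (auto intro!: newton_filt_diff newton_filt_euler)
    moreover have "lookup u k \<in> newton_filt (\<alpha> - of_int k)" for k using u(2) by (simp add: form_filt_def)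
    from this[of 0] this have "lookup u 0 \<in> newton_filt \<alpha>" "\<And>k. lookup u k \<in> newton_filt (\<alpha> - of_int k)" by simp_all
    ultimately show "x' \<in> form_filt \<alpha>" by (auto simp: form_filt_def lx' intro!: newton_filt_diff)
    have "x - x' = a + gm_map f (neg \<zeta>1) (neg \<zeta>2)" by (simp add: x'_def u(1))
    then show "x - x' \<in> gm_relations f" using gm_relations_closed(2)[OF u(3) gm_map_in] by simp
  qed
qed

text \<open>On \<open>G\<^sub>0 / \<theta>G\<^sub>0\<close> the filtration of \<open>G\<close> induces the one by the Newton degree.\<close>

lemma theta_graded_kernel:
  assumes "Poly_Mapping.single 0 g + theta * r \<in> gm_relations f" "r \<in> nonneg_theta" "g \<in> newton_filt \<alpha>"
  obtains g1 g2 where "g1 \<in> newton_filt (\<alpha> - 1)" "g2 \<in> newton_filt (\<alpha> - 1)" "g = wedge g1 g2"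
proof -
  obtain \<eta>1 \<eta>2 where \<eta>: "Poly_Mapping.single 0 g + theta * r = gm_map f \<eta>1 \<eta>2" using assms(1) by (auto simp: gm_relations_eq)
  obtain N where N: "\<And>k. k < - int N \<Longrightarrow> lookup \<eta>1 k = 0 \<and> lookup \<eta>2 k = 0"
    using theta_laurent_lower_bound2 by blast
  have low: "lookup (Poly_Mapping.single 0 g + theta * r) k = (if k = 0 then g else 0)" if "k \<le> 0" for k
    using assms(2) that by (auto simp: lookup_add lookup_theta_times lookup_single nonneg_theta_def when_def)
  \<comment> \<open>The bound is so low that after normalisation the coefficients of negative powers
    have negative Newton degree and vanish.\<close>
  have filt: "lookup (gm_map f \<eta>1 \<eta>2) k \<in> newton_filt ((- real N - 1) - of_int k)" if "k < 0" for k
    unfolding \<eta>[symmetric] using low that by simp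
  obtain \<zeta>1 \<zeta>2 where z: "gm_map f \<zeta>1 \<zeta>2 = gm_map f \<eta>1 \<eta>2"
    "\<forall>k. k < - int N \<longrightarrow> lookup \<zeta>1 k = 0 \<and> lookup \<zeta>2 k = 0"
    "\<forall>k. k < 0 \<longrightarrow> lookup \<zeta>1 k \<in> newton_filt ((- real N - 1) - of_int k - 1) \<and> lookup \<zeta>2 k \<in> newton_filt ((- real N - 1) - of_int k - 1)"
    using gm_map_strict[OF N filt] by blast
  have zero: "lookup \<zeta>1 k = 0 \<and> lookup \<zeta>2 k = 0" if "k < 0" for k
  proof (cases "k < - int N")
    case False
    then have "(- real N - 1) - of_int k - 1 < 0" by linarith
    then show ?thesis using z(3)[rule_format, OF that] newton_filt_neg by blast
  qed (use z(2) in simp)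
  have "g = lookup (gm_map f \<zeta>1 \<zeta>2) 0" using low[of 0] \<eta> z(1) by simp
  also have "\<dots> = wedge (- lookup \<zeta>1 0) (- lookup \<zeta>2 0)"
    using zero[of "-1"] by (simp add: lookup_gm_map wedge_def)
  finally have g: "g = wedge (- lookup \<zeta>1 0) (- lookup \<zeta>2 0)" .
  then obtain k where k: "- lookup \<zeta>1 0 - k * euler1 f \<in> newton_filt (\<alpha> - 1)" "- lookup \<zeta>2 0 - k * euler2 f \<in> newton_filt (\<alpha> - 1)"
    using wedge_strict assms(3) by metis
  have "g = wedge (- lookup \<zeta>1 0 - k * euler1 f) (- lookup \<zeta>2 0 - k * euler2 f)"
    using g wedge_linear(2,3) by simp
  then show ?thesis using that k by blast
qed

end

section \<open>The graded Jacobian ring\<close>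

definition scale_laurent :: "complex \<Rightarrow> laurent \<Rightarrow> laurent" where
  "scale_laurent c g = Poly_Mapping.single 0 c * g"

lemma lookup_scale_laurent: "lookup (scale_laurent c g) a = c * lookup g a"
  by (simp add: scale_laurent_def lookup_single_times)

lemma vector_space_scale_laurent: "vector_space scale_laurent"
  by unfold_locales (auto intro!: poly_mapping_eqI simp: lookup_scale_laurent lookup_add algebra_simps)

definition scale_pair :: "complex \<Rightarrow> laurent \<times> laurent \<Rightarrow> laurent \<times> laurent" where
  "scale_pair c g = (scale_laurent c (fst g), scale_laurent c (snd g))"

interpretation laurent: vector_space scale_laurent by (rule vector_space_scale_laurent)

lemma vector_space_scale_pair: "vector_space scale_pair"
  by unfold_locales
    (auto simp: scale_pair_def laurent.scale_right_distrib laurent.scale_left_distrib)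

interpretation pair: vector_space scale_pair by (rule vector_space_scale_pair)
interpretation forms: vector_space scale_forms by (rule vector_space_scale_forms)
interpretation lp_pair: vector_space_pair scale_laurent scale_pair ..
interpretation pl_pair: vector_space_pair scale_pair scale_laurent ..
interpretation lf_pair: vector_space_pair scale_laurent scale_forms ..
interpretation ll_pair: vector_space_pair scale_laurent scale_laurent ..

lemma single_scale_laurent: "scale_laurent c (Poly_Mapping.single a b) = Poly_Mapping.single a (c * b)"
  by (simp add: scale_laurent_def mult_single)

context newton_polygon
begin

definition homog :: "real \<Rightarrow> laurent set" where
  "homog \<gamma> = {g. \<forall>c. lookup g c \<noteq> 0 \<longrightarrow> n c = \<gamma>}"

lemma homogD: "g \<in> homog \<gamma> \<Longrightarrow> lookup g c \<noteq> 0 \<Longrightarrow> n c = \<gamma>"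
  unfolding homog_def by blast

definition level :: "real \<Rightarrow> (int \<times> int) set" where "level \<gamma> = {c. n c = \<gamma>}"

lemma finite_level: "finite (level \<gamma>)"
  by (rule finite_subset[OF _ finite_n_le[of \<gamma>]]) (auto simp: level_def)

lemma homog_subspace: "laurent.subspace (homog \<gamma>)"
proof (rule laurent.subspaceI)
  show "x + y \<in> homog \<gamma>" if "x \<in> homog \<gamma>" "y \<in> homog \<gamma>" for x y
    using that unfolding homog_def mem_Collect_eq lookup_add by (metis add.right_neutral)
qed (simp_all add: homog_def lookup_scale_laurent)

abbreviation (input) "monomials \<gamma> \<equiv> (\<lambda>c. Poly_Mapping.single c (1::complex)) ` level \<gamma>"

lemma laurent_in_span: "(\<And>c. lookup g c \<noteq> 0 \<Longrightarrow> c \<in> S) \<Longrightarrow> g \<in> laurent.span ((\<lambda>c. Poly_Mapping.single c 1) ` S)"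
proof -
  assume S: "\<And>c. lookup g c \<noteq> 0 \<Longrightarrow> c \<in> S"
  have "g = (\<Sum>c\<in>keys g. scale_laurent (lookup g c) (Poly_Mapping.single c 1))"
    using poly_mapping_eq_sum_single[of g] by (simp add: single_scale_laurent)
  moreover have "Poly_Mapping.single c 1 \<in> (\<lambda>c. Poly_Mapping.single c (1::complex)) ` S" if "c \<in> keys g" for c
    using that S[of c] by (simp add: in_keys_iff)
  then have "(\<Sum>c\<in>keys g. scale_laurent (lookup g c) (Poly_Mapping.single c 1)) \<in> laurent.span ((\<lambda>c. Poly_Mapping.single c 1) ` S)"
    by (intro laurent.span_sum laurent.span_scale laurent.span_base)
  ultimately show ?thesis by simp
qed

lemma span_monomials: "laurent.span (monomials \<gamma>) = homog \<gamma>"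
proof
  show "laurent.span (monomials \<gamma>) \<subseteq> homog \<gamma>"
  proof (rule laurent.span_minimal[OF _ homog_subspace])
    show "monomials \<gamma> \<subseteq> homog \<gamma>"
      by (auto simp: homog_def level_def lookup_single when_def split: if_splits)
  qed
  show "homog \<gamma> \<subseteq> laurent.span (monomials \<gamma>)"
    by (rule subsetI, rule laurent_in_span) (auto simp: homog_def level_def)
qed

lemma independent_monomials: "\<not> laurent.dependent (monomials \<gamma>)"
proof (rule laurent.independent_if_scalars_zero)
  show "finite (monomials \<gamma>)" using finite_level by simp
  fix u and x :: laurent assume *: "(\<Sum>x\<in>monomials \<gamma>. scale_laurent (u x) x) = 0" and x: "x \<in> monomials \<gamma>"
  then obtain c where c: "c \<in> level \<gamma>" "x = Poly_Mapping.single c 1" by blast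
  have inj: "inj_on (\<lambda>c. Poly_Mapping.single c (1::complex)) (level \<gamma>)"
    by (rule inj_onI) (metis keys_single singleton_inject zero_neq_one)
  have "0 = lookup (\<Sum>x\<in>monomials \<gamma>. scale_laurent (u x) x) c" using * by simp
  also have "\<dots> = (\<Sum>d\<in>level \<gamma>. if d = c then u x else 0)"
    unfolding sum.reindex[OF inj] o_def
    by (auto simp: lookup_sum single_scale_laurent lookup_single when_def c(2) intro!: sum.cong)
  also have "\<dots> = u x" using c(1) finite_level by simp
  finally show "u x = 0" by simp
qed

lemma dim_homog: "laurent.dim (homog \<gamma>) = card (level \<gamma>)"
proof -
  have inj: "inj_on (\<lambda>c. Poly_Mapping.single c (1::complex)) (level \<gamma>)"
    by (rule inj_onI) (metis keys_single singleton_inject zero_neq_one)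
  have "laurent.dim (homog \<gamma>) = card (monomials \<gamma>)"
    unfolding span_monomials[symmetric] by (rule laurent.dim_span_eq_card_independent[OF independent_monomials])
  then show ?thesis using card_image[OF inj] by simp
qed

definition top_part :: "real \<Rightarrow> laurent \<Rightarrow> laurent" where
  "top_part \<gamma> g = Abs_poly_mapping (\<lambda>c. if n c = \<gamma> then lookup g c else 0)"

lemma lookup_top_part: "lookup (top_part \<gamma> g) c = (if n c = \<gamma> then lookup g c else 0)"
proof -
  have "finite {c. (if n c = \<gamma> then lookup g c else 0) \<noteq> 0}"
    by (rule finite_subset[OF _ finite_level[of \<gamma>]]) (auto simp: level_def)
  then show ?thesis by (simp add: top_part_def)
qed

lemma top_part_homog: "top_part \<gamma> g \<in> homog \<gamma>"
  by (simp add: homog_def lookup_top_part)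

lemma homog_newton_filt: "g \<in> homog \<gamma> \<Longrightarrow> g \<in> newton_filt \<gamma>"
  by (rule newton_filtI) (simp add: homogD)

lemma top_part_linear:
  "top_part \<gamma> (g + h) = top_part \<gamma> g + top_part \<gamma> h" "top_part \<gamma> (scale_laurent c g) = scale_laurent c (top_part \<gamma> g)"
  by (rule poly_mapping_eqI, simp add: lookup_top_part lookup_add lookup_scale_laurent)+

lemma wedge_scale: "wedge (scale_laurent c g) (scale_laurent c h) = scale_laurent c (wedge g h)"
  by (simp add: wedge_def scale_laurent_def algebra_simps)

text \<open>The parts of \<open>g1\<close> and \<open>g2\<close> of lower degree cannot reach degree
  \<open>\<gamma>\<close>.\<close>

lemma top_wedge_top:
  assumes "g1 \<in> newton_filt (\<gamma> - 1)" "g2 \<in> newton_filt (\<gamma> - 1)"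
  shows "top_part \<gamma> (wedge (top_part (\<gamma> - 1) g1) (top_part (\<gamma> - 1) g2)) = top_part \<gamma> (wedge g1 g2)"
proof (rule poly_mapping_eqI)
  fix b
  have "lookup g (b - a) = lookup (top_part (\<gamma> - 1) g) (b - a)"
    if "n b = \<gamma>" "a \<in> keys f" "g \<in> newton_filt (\<gamma> - 1)" for a g
    using top_lookup[OF that(3), of b a] that by (simp add: lookup_top_part)
  then show "lookup (top_part \<gamma> (wedge (top_part (\<gamma> - 1) g1) (top_part (\<gamma> - 1) g2))) b = lookup (top_part \<gamma> (wedge g1 g2)) b"
    using assms by (simp add: lookup_top_part[of \<gamma>] lookup_wedge)
qed

text \<open>Together with \<open>graded_syz\<close> these are the differentials of the Koszul
  complex of the leading parts in degree \<open>\<gamma>\<close>; \<open>top_part\<close> discards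
  the terms of lower degree.\<close>

definition graded_wedge :: "real \<Rightarrow> laurent \<times> laurent \<Rightarrow> laurent" where
  "graded_wedge \<gamma> g = top_part \<gamma> (wedge (fst g) (snd g))"

definition graded_syz :: "real \<Rightarrow> laurent \<Rightarrow> laurent \<times> laurent" where
  "graded_syz \<gamma> k = (top_part (\<gamma> - 1) (k * euler1 f), top_part (\<gamma> - 1) (k * euler2 f))"

text \<open>The degree \<open>\<gamma>\<close> part of the ideal generated by the leading parts in
  the graded ring of the Newton filtration.\<close>

definition jacobian_part :: "real \<Rightarrow> laurent set" where
  "jacobian_part \<gamma> = graded_wedge \<gamma> ` (homog (\<gamma> - 1) \<times> homog (\<gamma> - 1))"

lemma linear_graded_wedge: "Vector_Spaces.linear scale_pair scale_laurent (graded_wedge \<gamma>)"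
  unfolding Vector_Spaces.linear_iff
  by (auto simp: graded_wedge_def scale_pair_def wedge_linear wedge_scale top_part_linear
    vector_space_scale_pair vector_space_scale_laurent)

lemma linear_graded_syz: "Vector_Spaces.linear scale_laurent scale_pair (graded_syz \<gamma>)"
  unfolding Vector_Spaces.linear_iff
  by (auto simp: graded_syz_def scale_pair_def top_part_linear distrib_right
    vector_space_scale_pair vector_space_scale_laurent simp flip: top_part_linear(2))
    (simp_all add: scale_laurent_def mult.assoc)

lemma span_homog_pairs:
  "pair.span ((\<lambda>g. (g, 0)) ` monomials \<gamma> \<union> (\<lambda>g. (0, g)) ` monomials \<gamma>) = homog \<gamma> \<times> homog \<gamma>"
proof -
  have l1: "Vector_Spaces.linear scale_laurent scale_pair (\<lambda>g. (g, 0))"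
    and l2: "Vector_Spaces.linear scale_laurent scale_pair (\<lambda>g. (0, g))"
    unfolding Vector_Spaces.linear_iff
    by (auto simp: scale_pair_def vector_space_scale_pair vector_space_scale_laurent)
  have 1: "pair.span ((\<lambda>g. (g, 0)) ` monomials \<gamma>) = (\<lambda>g. (g, 0)) ` homog \<gamma>"
    "pair.span ((\<lambda>g. (0, g)) ` monomials \<gamma>) = (\<lambda>g. (0, g)) ` homog \<gamma>"
    using lp_pair.linear_span_image[OF l1] lp_pair.linear_span_image[OF l2] span_monomials by metis+
  show ?thesis unfolding pair.span_Un 1 by (force simp: image_iff)
qed

lemma dim_homog_pairs: "pair.dim (homog \<gamma> \<times> homog \<gamma>) = 2 * card (level \<gamma>)"
proof -
  let ?S = "(\<lambda>g. (g, 0)) ` monomials \<gamma> \<union> (\<lambda>g. (0, g)) ` monomials \<gamma>"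
  have fin: "finite ?S" "finite (monomials \<gamma>)" using finite_level by simp_all
  have l1: "Vector_Spaces.linear scale_pair scale_laurent fst"
    unfolding Vector_Spaces.linear_iff by (auto simp: scale_pair_def vector_space_scale_pair vector_space_scale_laurent)
  have l2: "Vector_Spaces.linear scale_laurent scale_pair (\<lambda>g. (0, g))"
    unfolding Vector_Spaces.linear_iff by (auto simp: scale_pair_def vector_space_scale_pair vector_space_scale_laurent)
  have z: "0 \<in> homog \<gamma>" by (simp add: homog_def)
  have "laurent.dim (fst ` (homog \<gamma> \<times> homog \<gamma>)) + pair.dim {x \<in> homog \<gamma> \<times> homog \<gamma>. fst x = 0} = pair.dim (homog \<gamma> \<times> homog \<gamma>)"
    using pl_pair.rank_nullity_span[OF l1 fin(1)] unfolding span_homog_pairs .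
  moreover have "fst ` (homog \<gamma> \<times> homog \<gamma>) = homog \<gamma>" using z by force
  moreover have "{x \<in> homog \<gamma> \<times> homog \<gamma>. fst x = 0} = (\<lambda>g. (0, g)) ` homog \<gamma>" using z by force
  moreover have "pair.dim ((\<lambda>g. (0, g)) ` homog \<gamma>) + laurent.dim {g \<in> homog \<gamma>. (0, g) = (0 :: laurent \<times> laurent)} = laurent.dim (homog \<gamma>)"
    using lp_pair.rank_nullity_span[OF l2 fin(2)] unfolding span_monomials .
  moreover have "{g \<in> homog \<gamma>. (0, g) = (0 :: laurent \<times> laurent)} = {0}" using z by (auto simp: zero_prod_def)
  moreover have "laurent.dim {0} = 0" using laurent.dim_span[of "{}"] laurent.dim_eq_card_independent[of "{}"]
    by (metis card.empty laurent.independent_empty laurent.span_empty)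
  ultimately show ?thesis by (simp add: dim_homog)
qed

text \<open>Exactness in the middle: one inclusion is \<open>graded_syzygy\<close>, the other is the
  vanishing of the composed differentials.\<close>

lemma graded_kernel:
  "{x \<in> homog (\<gamma> - 1) \<times> homog (\<gamma> - 1). graded_wedge \<gamma> x = 0} = graded_syz \<gamma> ` homog (\<gamma> - 2)"
proof (intro equalityI subsetI)
  fix x assume "x \<in> {x \<in> homog (\<gamma> - 1) \<times> homog (\<gamma> - 1). graded_wedge \<gamma> x = 0}"
  then obtain g1 g2 where x: "x = (g1, g2)" "g1 \<in> homog (\<gamma> - 1)" "g2 \<in> homog (\<gamma> - 1)"
    and z: "top_part \<gamma> (wedge g1 g2) = 0" by (auto simp: graded_wedge_def)
  have supp: "n c = \<gamma> - 1" if "lookup g1 c \<noteq> 0 \<or> lookup g2 c \<noteq> 0" for c using that homogD[OF x(2)] homogD[OF x(3)] by blast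
  obtain k where k: "\<And>y. k y \<noteq> 0 \<Longrightarrow> n y = (\<gamma> - 1) - 1"
    "\<And>b. n b = \<gamma> - 1 \<Longrightarrow> lookup g1 b = (\<Sum>a\<in>keys f. lookup f a * of_int (fst a) * k (b - a)) \<and>
       lookup g2 b = (\<Sum>a\<in>keys f. lookup f a * of_int (snd a) * k (b - a))"
  proof (rule graded_syzygy[of "lookup g1" "lookup g2" "\<gamma> - 1"])
    fix b assume "n b = \<gamma> - 1 + 1"
    then have "lookup (wedge g1 g2) b = lookup (top_part \<gamma> (wedge g1 g2)) b" by (simp add: lookup_top_part)
    then show "(\<Sum>a\<in>keys f. lookup f a * of_int (fst a) * lookup g2 (b - a)) - (\<Sum>a\<in>keys f. lookup f a * of_int (snd a) * lookup g1 (b - a)) = 0"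
      unfolding lookup_wedge z by simp
  qed (use supp in blast)+
  obtain \<kappa> :: laurent where \<kappa>: "\<And>y. lookup \<kappa> y = k y" using laurent_of_function[of k "\<gamma> - 2"] k(1) by force
  have "\<kappa> \<in> homog (\<gamma> - 2)" using k(1) by (auto simp: homog_def \<kappa>)
  moreover have "graded_syz \<gamma> \<kappa> = x"
  proof -
    have "lookup (top_part (\<gamma> - 1) (\<kappa> * euler1 f)) b = lookup g1 b"
      "lookup (top_part (\<gamma> - 1) (\<kappa> * euler2 f)) b = lookup g2 b" for b
    proof -
      have "n b \<noteq> \<gamma> - 1 \<Longrightarrow> lookup g1 b = 0" "n b \<noteq> \<gamma> - 1 \<Longrightarrow> lookup g2 b = 0" using supp[of b] by blast+
      then show "lookup (top_part (\<gamma> - 1) (\<kappa> * euler1 f)) b = lookup g1 b"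
        "lookup (top_part (\<gamma> - 1) (\<kappa> * euler2 f)) b = lookup g2 b"
        using k(2)[of b] by (simp_all add: lookup_top_part lookup_times_euler \<kappa>)
    qed
    then have "top_part (\<gamma> - 1) (\<kappa> * euler1 f) = g1" "top_part (\<gamma> - 1) (\<kappa> * euler2 f) = g2"
      by (intro poly_mapping_eqI; simp)+
    then show ?thesis by (simp add: graded_syz_def x)
  qed
  ultimately show "x \<in> graded_syz \<gamma> ` homog (\<gamma> - 2)" by blast
next
  fix x assume "x \<in> graded_syz \<gamma> ` homog (\<gamma> - 2)"
  then obtain k where k: "k \<in> homog (\<gamma> - 2)" "x = graded_syz \<gamma> k" by blast
  have "k * euler1 f \<in> newton_filt (\<gamma> - 1)" "k * euler2 f \<in> newton_filt (\<gamma> - 1)"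
    using newton_filt_mult[OF homog_newton_filt[OF k(1)] f_newton_filt(2)]
      newton_filt_mult[OF homog_newton_filt[OF k(1)] f_newton_filt(3)] by simp_all
  then have "graded_wedge \<gamma> x = top_part \<gamma> (wedge (k * euler1 f) (k * euler2 f))"
    unfolding k(2) graded_wedge_def graded_syz_def by (simp add: top_wedge_top)
  also have "\<dots> = 0" unfolding wedge_linear by (rule poly_mapping_eqI) (simp add: lookup_top_part)
  finally show "x \<in> {x \<in> homog (\<gamma> - 1) \<times> homog (\<gamma> - 1). graded_wedge \<gamma> x = 0}"
    using k(2) by (simp add: graded_syz_def top_part_homog)
qed

text \<open>Rank and nullity for both differentials: the kernel of \<open>graded_wedge\<close> is
  the image of \<open>graded_syz\<close>, which is injective by
  \<open>graded_injective\<close>.\<close>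

lemma dim_jacobian_part:
  "laurent.dim (jacobian_part \<gamma>) + card (level (\<gamma> - 2)) = 2 * card (level (\<gamma> - 1))"
proof -
  let ?S = "(\<lambda>g. (g, 0)) ` monomials (\<gamma> - 1) \<union> (\<lambda>g. (0, g)) ` monomials (\<gamma> - 1)"
  have fin: "finite ?S" "finite (monomials (\<gamma> - 2))" using finite_level by simp_all
  have "laurent.dim (jacobian_part \<gamma>) + pair.dim (graded_syz \<gamma> ` homog (\<gamma> - 2)) = 2 * card (level (\<gamma> - 1))"
    using pl_pair.rank_nullity_span[OF linear_graded_wedge[of \<gamma>] fin(1)]
    unfolding span_homog_pairs graded_kernel dim_homog_pairs jacobian_part_def .
  moreover have "pair.dim (graded_syz \<gamma> ` homog (\<gamma> - 2)) + laurent.dim {k \<in> homog (\<gamma> - 2). graded_syz \<gamma> k = 0} = card (level (\<gamma> - 2))"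
    using lp_pair.rank_nullity_span[OF linear_graded_syz[of \<gamma>] fin(2)]
    unfolding span_monomials dim_homog .
  moreover have "{k \<in> homog (\<gamma> - 2). graded_syz \<gamma> k = 0} = {0}"
  proof -
    have "k = 0" if k: "k \<in> homog (\<gamma> - 2)" "graded_syz \<gamma> k = 0" for k
    proof (rule poly_mapping_eqI)
      fix y
      have z: "top_part (\<gamma> - 1) (k * euler1 f) = 0" "top_part (\<gamma> - 1) (k * euler2 f) = 0"
        using k(2) by (simp_all add: graded_syz_def zero_prod_def)
      have "lookup k y = 0"
      proof (rule graded_injective[where \<gamma> = "\<gamma> - 1"])
        show "n y = \<gamma> - 1 - 1" if "lookup k y \<noteq> 0" for y using homogD[OF k(1) that] by simp
        show "(\<Sum>a\<in>keys f. lookup f a * of_int (fst a) * lookup k (b - a)) = 0 \<and>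
          (\<Sum>a\<in>keys f. lookup f a * of_int (snd a) * lookup k (b - a)) = 0" if "n b = \<gamma> - 1" for b
          using arg_cong[OF z(1), of "\<lambda>g. lookup g b"] arg_cong[OF z(2), of "\<lambda>g. lookup g b"] that
          by (simp add: lookup_top_part lookup_times_euler)
      qed
      then show "lookup k y = lookup 0 y" by simp
    qed
    moreover have "graded_syz \<gamma> 0 = 0" by (simp add: graded_syz_def zero_prod_def poly_mapping_eq_iff fun_eq_iff lookup_top_part)
    ultimately show ?thesis by (auto simp: homog_def)
  qed
  moreover have "laurent.dim {0} = 0" by (metis card.empty laurent.dim_eq_card_independent laurent.dim_span laurent.independent_empty laurent.span_empty)
  ultimately show ?thesis by simp
qed

lemma jacobian_part_subset: "jacobian_part \<gamma> \<subseteq> homog \<gamma>"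
  by (auto simp: jacobian_part_def graded_wedge_def top_part_homog)

lemma jacobian_part_subspace: "laurent.subspace (jacobian_part \<gamma>)"
proof -
  have "pair.subspace (homog (\<gamma> - 1) \<times> homog (\<gamma> - 1))"
    unfolding span_homog_pairs[symmetric] by (rule pair.subspace_span)
  then show ?thesis unfolding jacobian_part_def by (rule pl_pair.linear_subspace_image[OF linear_graded_wedge])
qed

section \<open>The filtration induced on the quotient by \<theta>\<close>

definition newton_filt_lt :: "real \<Rightarrow> laurent set" where
  "newton_filt_lt \<beta> = {g. \<forall>c. lookup g c \<noteq> 0 \<longrightarrow> n c < \<beta>}"

lemma newton_filt_ltD: "g \<in> newton_filt_lt \<beta> \<Longrightarrow> lookup g c \<noteq> 0 \<Longrightarrow> n c < \<beta>"
  unfolding newton_filt_lt_def by blast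

lemma newton_filt_lt_subspace: "laurent.subspace (newton_filt_lt \<beta>)"
proof (rule laurent.subspaceI)
  show "x + y \<in> newton_filt_lt \<beta>" if "x \<in> newton_filt_lt \<beta>" "y \<in> newton_filt_lt \<beta>" for x y
    using that unfolding newton_filt_lt_def mem_Collect_eq lookup_add by (metis add.right_neutral)
qed (simp_all add: newton_filt_lt_def lookup_scale_laurent)

lemma newton_filt_lt_eq: "newton_filt_lt \<beta> = (\<Union>\<gamma>\<in>{..<\<beta>}. newton_filt \<gamma>)"
proof (intro equalityI subsetI)
  fix g assume g: "g \<in> newton_filt_lt \<beta>"
  define r where "r = Max (insert (\<beta> - 1) (n ` keys g))"
  have fin: "finite (insert (\<beta> - 1) (n ` keys g))" by simp
  have "r \<in> insert (\<beta> - 1) (n ` keys g)" unfolding r_def by (rule Max_in[OF fin]) simp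
  then have "r < \<beta>" using g by (auto simp: newton_filt_lt_def in_keys_iff)
  moreover have "g \<in> newton_filt r"
  proof (rule newton_filtI)
    fix c assume "lookup g c \<noteq> 0"
    then have "n c \<in> insert (\<beta> - 1) (n ` keys g)" by (simp add: in_keys_iff)
    then show "n c \<le> r" unfolding r_def by (rule Max_ge[OF fin])
  qed
  ultimately show "g \<in> (\<Union>\<gamma>\<in>{..<\<beta>}. newton_filt \<gamma>)" by blast
next
  fix g assume "g \<in> (\<Union>\<gamma>\<in>{..<\<beta>}. newton_filt \<gamma>)"
  then obtain \<gamma> where "\<gamma> < \<beta>" "g \<in> newton_filt \<gamma>" by blast
  then have "n c < \<beta>" if "lookup g c \<noteq> 0" for c using newton_filtD that by fastforce
  then show "g \<in> newton_filt_lt \<beta>" by (simp add: newton_filt_lt_def)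
qed

lemma minus_top_part: "g \<in> newton_filt \<beta> \<Longrightarrow> g - top_part \<beta> g \<in> newton_filt_lt \<beta>"
  unfolding newton_filt_lt_def
proof (intro CollectI allI impI)
  fix c assume g: "g \<in> newton_filt \<beta>" and "lookup (g - top_part \<beta> g) c \<noteq> 0"
  then have "lookup g c \<noteq> 0" "n c \<noteq> \<beta>" by (auto simp: lookup_minus lookup_top_part split: if_splits)
  then show "n c < \<beta>" using newton_filtD[OF g, of c] by (simp add: less_le)
qed

text \<open>The preimage in the Brieskorn lattice of the image of \<open>X\<close> in
  \<open>\<Omega>\<^sub>f\<close>.\<close>

definition omega_preimage :: "laurent set \<Rightarrow> theta_laurent set" where
  "omega_preimage X = {Poly_Mapping.single 0 g + theta * r + b | g r b. g \<in> X \<and> r \<in> nonneg_theta \<and> b \<in> gm_relations f}"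

lemma omega_preimageI:
  "x = Poly_Mapping.single 0 g + theta * r + b \<Longrightarrow> g \<in> X \<Longrightarrow> r \<in> nonneg_theta \<Longrightarrow> b \<in> gm_relations f \<Longrightarrow>
     x \<in> omega_preimage X"
  unfolding omega_preimage_def by blast

lemma nonneg_theta_closed:
  "0 \<in> nonneg_theta" "x \<in> nonneg_theta \<Longrightarrow> y \<in> nonneg_theta \<Longrightarrow> x + y \<in> nonneg_theta"
  "x \<in> nonneg_theta \<Longrightarrow> y \<in> nonneg_theta \<Longrightarrow> x - y \<in> nonneg_theta"
  "x \<in> nonneg_theta \<Longrightarrow> scale_forms c x \<in> nonneg_theta"
  "Poly_Mapping.single 0 g \<in> nonneg_theta"
  by (simp_all add: nonneg_theta_def lookup_add lookup_minus lookup_scale_forms lookup_single when_def)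

lemma omega_preimage_subspace:
  assumes "laurent.subspace X" shows "forms.subspace (omega_preimage X)"
proof (rule forms.subspaceI)
  have "0 = Poly_Mapping.single 0 0 + theta * 0 + (0 :: theta_laurent)" by simp
  then show "0 \<in> omega_preimage X"
    by (rule omega_preimageI[OF _ laurent.subspace_0[OF assms] nonneg_theta_closed(1) gm_relations_closed(1)])
next
  fix x y assume "x \<in> omega_preimage X" "y \<in> omega_preimage X"
  then obtain g r b h s d where x: "x = Poly_Mapping.single 0 g + theta * r + b" "g \<in> X" "r \<in> nonneg_theta" "b \<in> gm_relations f"
    and y: "y = Poly_Mapping.single 0 h + theta * s + d" "h \<in> X" "s \<in> nonneg_theta" "d \<in> gm_relations f"
    unfolding omega_preimage_def by blast
  have "x + y = Poly_Mapping.single 0 (g + h) + theta * (r + s) + (b + d)"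
    by (simp add: x y single_add algebra_simps)
  then show "x + y \<in> omega_preimage X"
    by (rule omega_preimageI) (use x y laurent.subspace_add[OF assms] nonneg_theta_closed(2) gm_relations_closed(2) in simp_all)
next
  fix c x assume "x \<in> omega_preimage X"
  then obtain g r b where x: "x = Poly_Mapping.single 0 g + theta * r + b" "g \<in> X" "r \<in> nonneg_theta" "b \<in> gm_relations f"
    unfolding omega_preimage_def by blast
  have "scale_forms c x = Poly_Mapping.single 0 (scale_laurent c g) + theta * scale_forms c r + scale_forms c b"
    by (simp add: x scale_forms_def scale_laurent_def algebra_simps mult_single)
  then show "scale_forms c x \<in> omega_preimage X"
    by (rule omega_preimageI) (use x laurent.subspace_scale[OF assms] nonneg_theta_closed(4) gm_relations_closed(4) in simp_all)
qed

lemma nonneg_theta_split: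
  assumes "x \<in> nonneg_theta"
  shows "x = Poly_Mapping.single 0 (lookup x 0) + theta * (tau * (x - Poly_Mapping.single 0 (lookup x 0)))"
    and "tau * (x - Poly_Mapping.single 0 (lookup x 0)) \<in> nonneg_theta"
  using assms by (auto simp: theta_tau nonneg_theta_def lookup_tau_times lookup_minus lookup_single when_def)

text \<open>By \<open>V_newton_brieskorn\<close> a class in the intersection has a representative of
  bounded degree without negative powers; modulo \<theta> only its coefficient of index 0
  remains.\<close>

lemma induced_V_newton: "induced_on_Omega f (V_newton \<alpha>) = omega_preimage (newton_filt \<alpha>)"
proof (intro equalityI subsetI)
  fix z assume "z \<in> induced_on_Omega f (V_newton \<alpha>)"
  then obtain x y where z: "z = x + theta * y" "x \<in> V_newton \<alpha>" "x \<in> brieskorn_lattice f" "y \<in> brieskorn_lattice f"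
    unfolding induced_on_Omega_def by blast
  obtain x' where x': "x' \<in> form_filt \<alpha>" "x' \<in> nonneg_theta" "x - x' \<in> gm_relations f"
    using V_newton_brieskorn[OF z(2,3)] .
  obtain u b where y: "y = u + b" "u \<in> nonneg_theta" "b \<in> gm_relations f" using z(4) by (auto simp: brieskorn_eq)
  define r where "r = tau * (x' - Poly_Mapping.single 0 (lookup x' 0))"
  have r: "x' = Poly_Mapping.single 0 (lookup x' 0) + theta * r" "r \<in> nonneg_theta"
    using nonneg_theta_split[OF x'(2)] by (simp_all add: r_def)
  have "z = x' + (x - x') + theta * (u + b)" using z(1) y(1) by simp
  also have "\<dots> = Poly_Mapping.single 0 (lookup x' 0) + theta * r + (x - x') + theta * (u + b)" using r(1) by simp
  also have "\<dots> = Poly_Mapping.single 0 (lookup x' 0) + theta * (r + u) + ((x - x') + theta * b)"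
    by (simp add: algebra_simps)
  finally have "z = Poly_Mapping.single 0 (lookup x' 0) + theta * (r + u) + ((x - x') + theta * b)" .
  moreover have "lookup x' 0 \<in> newton_filt (\<alpha> - of_int 0)" using x'(1) unfolding form_filt_def by blast
  then have "lookup x' 0 \<in> newton_filt \<alpha>" by simp
  moreover have "r + u \<in> nonneg_theta" by (rule nonneg_theta_closed(2)[OF r(2) y(2)])
  moreover have "(x - x') + theta * b \<in> gm_relations f"
    by (rule gm_relations_closed(2)[OF x'(3) gm_relations_closed(5)[OF y(3)]])
  ultimately show "z \<in> omega_preimage (newton_filt \<alpha>)" by (rule omega_preimageI)
next
  fix z assume "z \<in> omega_preimage (newton_filt \<alpha>)"
  then obtain g r b where z: "z = Poly_Mapping.single 0 g + theta * r + b" "g \<in> newton_filt \<alpha>" "r \<in> nonneg_theta" "b \<in> gm_relations f"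
    unfolding omega_preimage_def by blast
  let ?x = "Poly_Mapping.single 0 g + b"
  have s: "Poly_Mapping.single 0 g \<in> nonneg_theta" by (rule nonneg_theta_closed)
  have "Poly_Mapping.single 0 g \<in> form_filt \<alpha>" using z(2) by (simp add: form_filt_def lookup_single when_def)
  then have "?x \<in> V_newton \<alpha>" "?x \<in> brieskorn_lattice f" using z(4) s unfolding V_newton_def brieskorn_eq by blast+
  moreover have "r = r + 0" by simp
  then have "r \<in> brieskorn_lattice f" using z(3) gm_relations_closed(1) unfolding brieskorn_eq by blast
  moreover have "z = ?x + theta * r" using z(1) by (simp add: algebra_simps)
  ultimately show "z \<in> induced_on_Omega f (V_newton \<alpha>)" unfolding induced_on_Omega_def by blast
qed

lemma induced_below_V_newton: "induced_on_Omega f (below V_newton \<alpha>) = omega_preimage (newton_filt_lt \<alpha>)"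
proof -
  have "induced_on_Omega f (below V_newton \<alpha>) = (\<Union>\<beta>\<in>{..<\<alpha>}. induced_on_Omega f (V_newton \<beta>))"
    unfolding induced_on_Omega_def below_def by blast
  also have "\<dots> = (\<Union>\<beta>\<in>{..<\<alpha>}. omega_preimage (newton_filt \<beta>))" by (simp only: induced_V_newton)
  also have "\<dots> = omega_preimage (newton_filt_lt \<alpha>)"
    unfolding newton_filt_lt_eq omega_preimage_def by blast
  finally show ?thesis .
qed

text \<open>Modulo the relations \<open>df\<and>\<eta>\<close> equals
  \<open>\<theta> d\<eta>\<close>, so it dies in
  \<open>G\<^sub>0 / \<theta>G\<^sub>0\<close>.\<close>

lemma single_wedge_in_relations:
  "\<exists>r\<in>nonneg_theta. Poly_Mapping.single 0 (wedge u1 u2) - theta * r \<in> gm_relations f"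
proof -
  define r :: theta_laurent where "r = Poly_Mapping.single 0 (euler1 u2 - euler2 u1)"
  have "gm_map f (Poly_Mapping.single 0 u1) (Poly_Mapping.single 0 u2) = theta * r - Poly_Mapping.single 0 (wedge u1 u2)"
    by (rule poly_mapping_eqI)
      (simp add: lookup_gm_map lookup_minus lookup_theta_times r_def lookup_single when_def wedge_def)
  then have "0 - (theta * r - Poly_Mapping.single 0 (wedge u1 u2)) \<in> gm_relations f"
    using gm_relations_closed(1,3) gm_map_in by metis
  then have "Poly_Mapping.single 0 (wedge u1 u2) - theta * r \<in> gm_relations f" by simp
  then show ?thesis using nonneg_theta_closed(5) unfolding r_def by blast
qed

text \<open>A basis of the Jacobian part is extended to a basis of everything of degree
  \<open>\<alpha>\<close>; the added vectors give a basis of the graded piece. Triviality of the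
  intersection rests on \<open>theta_graded_kernel\<close>, spanning on
  \<open>single_wedge_in_relations\<close>.\<close>

theorem quot_dim_omega:
  shows "quot_dim scale_forms (omega_preimage (newton_filt \<alpha>)) (omega_preimage (newton_filt_lt \<alpha>)) =
     card (level \<alpha>) - laurent.dim (jacobian_part \<alpha>)"
    and "laurent.dim (jacobian_part \<alpha>) \<le> card (level \<alpha>)"
    and "laurent.dim (jacobian_part \<alpha>) = card (level \<alpha>) \<Longrightarrow> jacobian_part \<alpha> = homog \<alpha>"
proof -
  let ?J = "jacobian_part \<alpha>"
  obtain B0 where B0: "B0 \<subseteq> ?J" "\<not> laurent.dependent B0" "?J \<subseteq> laurent.span B0"
    using laurent.maximal_independent_subset by blast
  have sB0: "laurent.span B0 = ?J"
    using B0(1,3) laurent.span_minimal[OF B0(1) jacobian_part_subspace] by blast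
  have dJ: "laurent.dim ?J = card B0" using sB0 laurent.dim_span_eq_card_independent[OF B0(2)] by simp
  have "B0 \<subseteq> homog \<alpha>" using B0(1) jacobian_part_subset by blast
  then obtain B1 where B1: "B0 \<subseteq> B1" "B1 \<subseteq> homog \<alpha>" "\<not> laurent.dependent B1" "homog \<alpha> \<subseteq> laurent.span B1"
    using laurent.maximal_independent_subset_extend[OF _ B0(2)] by blast
  have sB1: "laurent.span B1 = homog \<alpha>" using B1(2,4) laurent.span_minimal[OF B1(2) homog_subspace] by blast
  have dB1: "card B1 = card (level \<alpha>)"
    using sB1 laurent.dim_span_eq_card_independent[OF B1(3)] dim_homog by simp
  have fin: "finite B1"
    using laurent.independent_span_bound[of "monomials \<alpha>" B1] B1(2,3) span_monomials finite_level by simp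
  have cB: "card (B1 - B0) = card (level \<alpha>) - laurent.dim ?J"
    using card_Diff_subset[OF finite_subset[OF B1(1) fin] B1(1)] dB1 dJ by simp
  show "laurent.dim ?J \<le> card (level \<alpha>)" using card_mono[OF fin B1(1)] dB1 dJ by simp
  show "jacobian_part \<alpha> = homog \<alpha>" if "laurent.dim ?J = card (level \<alpha>)"
  proof -
    have "B0 = B1" using card_subset_eq[OF fin B1(1)] that dB1 dJ by simp
    then show ?thesis using sB0 sB1 by simp
  qed
  define emb where "emb = (\<lambda>g::laurent. Poly_Mapping.single (0::int) g)"
  have lin: "Vector_Spaces.linear scale_laurent scale_forms emb"
    unfolding Vector_Spaces.linear_iff
    by (auto simp: emb_def vector_space_scale_forms vector_space_scale_laurent single_add scale_forms_def scale_laurent_def mult_single)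
  interpret emb: Vector_Spaces.linear scale_laurent scale_forms emb by (rule lin)
  have inj: "inj emb" by (simp add: emb_def inj_on_def) (metis lookup_single_eq)
  let ?B = "emb ` (B1 - B0)" and ?V = "omega_preimage (newton_filt \<alpha>)" and ?W = "omega_preimage (newton_filt_lt \<alpha>)"
  have emb_in: "emb g \<in> omega_preimage X" if "g \<in> X" for g X
  proof -
    have "emb g = Poly_Mapping.single 0 g + theta * 0 + 0" by (simp add: emb_def)
    then show ?thesis by (rule omega_preimageI[OF _ that nonneg_theta_closed(1) gm_relations_closed(1)])
  qed
  have span_B: "forms.span ?B = emb ` laurent.span (B1 - B0)" by (rule lf_pair.linear_span_image[OF lin])
  have sub: "laurent.span (B1 - B0) \<subseteq> homog \<alpha>" using sB1 laurent.span_mono[of "B1 - B0" B1] by blast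
  have "quot_dim scale_forms ?V ?W = card ?B"
  proof (rule quot_dim_eq[OF vector_space_scale_forms])
    show "finite ?B" using fin by simp
    show "?B \<subseteq> ?V" using B1(2) homog_newton_filt emb_in by blast
    show "\<not> forms.dependent ?B"
    proof (rule lf_pair.linear_independent_injective_image[OF lin])
      show "\<not> laurent.dependent (B1 - B0)" using B1(3) laurent.independent_mono[of B1 "B1 - B0"] by blast
    qed (use inj inj_on_subset in blast)
    show "forms.span ?B \<inter> ?W = {0}"
    proof (rule equalityI; rule subsetI)
      fix x assume "x \<in> forms.span ?B \<inter> ?W"
      then obtain g g' r b where x: "x = emb g" "g \<in> laurent.span (B1 - B0)" "x = Poly_Mapping.single 0 g' + theta * r + b"
        "g' \<in> newton_filt_lt \<alpha>" "r \<in> nonneg_theta" "b \<in> gm_relations f"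
        unfolding span_B omega_preimage_def by blast
      have gh: "g \<in> homog \<alpha>" using x(2) sub by blast
      have "Poly_Mapping.single 0 (g - g') + theta * (- r) = b"
        using x(1,3) by (simp add: emb_def single_diff algebra_simps)
      then have 1: "Poly_Mapping.single 0 (g - g') + theta * (- r) \<in> gm_relations f" using x(6) by simp
      have 2: "- r \<in> nonneg_theta" using nonneg_theta_closed(3)[OF nonneg_theta_closed(1) x(5)] by simp
      have "g' \<in> newton_filt \<alpha>" using newton_filt_ltD[OF x(4)] by (intro newton_filtI less_imp_le)
      then have 3: "g - g' \<in> newton_filt \<alpha>" using homog_newton_filt[OF gh] by (intro newton_filt_diff)
      obtain g1 g2 where w: "g1 \<in> newton_filt (\<alpha> - 1)" "g2 \<in> newton_filt (\<alpha> - 1)" "g - g' = wedge g1 g2"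
        using theta_graded_kernel[OF 1 2 3] .
      have "top_part \<alpha> (g - g') = g"
      proof (rule poly_mapping_eqI)
        fix c
        have "n c = \<alpha> \<Longrightarrow> lookup g' c = 0" using newton_filt_ltD[OF x(4), of c] by (metis less_irrefl)
        moreover have "n c \<noteq> \<alpha> \<Longrightarrow> lookup g c = 0" using homogD[OF gh] by blast
        ultimately show "lookup (top_part \<alpha> (g - g')) c = lookup g c" by (simp add: lookup_top_part lookup_minus)
      qed
      then have "g = graded_wedge \<alpha> (top_part (\<alpha> - 1) g1, top_part (\<alpha> - 1) g2)"
        unfolding graded_wedge_def using top_wedge_top[OF w(1,2)] w(3) by simp
      then have "g \<in> ?J" unfolding jacobian_part_def using top_part_homog by blast
      then have "g \<in> laurent.span B0" using sB0 by simp
      then have "g = 0" using laurent.span_Int_span_Diff[OF B1(3,1) _ x(2)] by simp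
      then show "x \<in> {0}" using x(1) by (simp add: emb_def)
    next
      fix x :: theta_laurent assume "x \<in> {0}"
      then show "x \<in> forms.span ?B \<inter> ?W"
        using forms.span_zero forms.subspace_0[OF omega_preimage_subspace[OF newton_filt_lt_subspace]] by simp
    qed
    show "\<forall>v\<in>?V. \<exists>b\<in>forms.span ?B. v - b \<in> ?W"
    proof
      fix v assume "v \<in> ?V"
      then obtain g r b where v: "v = Poly_Mapping.single 0 g + theta * r + b" "g \<in> newton_filt \<alpha>" "r \<in> nonneg_theta" "b \<in> gm_relations f"
        unfolding omega_preimage_def by blast
      have "top_part \<alpha> g \<in> laurent.span (B0 \<union> (B1 - B0))"
        using sB1 top_part_homog B1(1) by (simp add: Un_absorb1)
      then obtain g0 g1 where g01: "top_part \<alpha> g = g0 + g1" "g0 \<in> laurent.span B0" "g1 \<in> laurent.span (B1 - B0)"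
        unfolding laurent.span_Un by blast
      then obtain u1 u2 where u: "g0 = top_part \<alpha> (wedge u1 u2)" "u1 \<in> homog (\<alpha> - 1)" "u2 \<in> homog (\<alpha> - 1)"
        unfolding sB0 jacobian_part_def graded_wedge_def by auto
      have w: "wedge u1 u2 \<in> newton_filt \<alpha>"
        using wedge_newton_filt[OF homog_newton_filt[OF u(2)] homog_newton_filt[OF u(3)]] by simp
      obtain s where s: "s \<in> nonneg_theta" "Poly_Mapping.single 0 (wedge u1 u2) - theta * s \<in> gm_relations f"
        using single_wedge_in_relations by blast
      \<comment> \<open>The terms of degree below \<open>\<alpha>\<close> in \<open>g\<close>, minus
        those in the wedge.\<close>
      define l where "l = (g - top_part \<alpha> g) - (wedge u1 u2 - top_part \<alpha> (wedge u1 u2))"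
      have l: "l \<in> newton_filt_lt \<alpha>" unfolding l_def
        by (rule laurent.subspace_diff[OF newton_filt_lt_subspace minus_top_part[OF v(2)] minus_top_part[OF w]])
      have "g = g1 + wedge u1 u2 + l" using g01(1) u(1) by (simp add: l_def)
      then have "v - emb g1 = Poly_Mapping.single 0 l + theta * (r + s) + ((Poly_Mapping.single 0 (wedge u1 u2) - theta * s) + b)"
        unfolding v(1) emb_def by (simp add: single_add algebra_simps)
      then have "v - emb g1 \<in> ?W"
        by (rule omega_preimageI[OF _ l nonneg_theta_closed(2)[OF v(3) s(1)] gm_relations_closed(2)[OF s(2) v(4)]])
      moreover have "emb g1 \<in> forms.span ?B" unfolding span_B using g01(3) by blast
      ultimately show "\<exists>b\<in>forms.span ?B. v - b \<in> ?W" by blast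
    qed
  qed (rule omega_preimage_subspace[OF newton_filt_lt_subspace])
  also have "card ?B = card (B1 - B0)" using inj by (intro card_image) (rule inj_on_subset, auto)
  finally show "quot_dim scale_forms ?V ?W = card (level \<alpha>) - laurent.dim ?J" using cB by simp
qed

end

section \<open>The V-filtration\<close>

definition euler_shift :: "laurent \<Rightarrow> real \<Rightarrow> theta_laurent \<Rightarrow> theta_laurent" where
  "euler_shift f \<gamma> x = tau * deriv_tau f x + scale_forms (of_real \<gamma>) x"

lemma tau_deriv_tau_add: "tau * deriv_tau f (x + y) = tau * deriv_tau f x + tau * deriv_tau f y"
  by (rule poly_mapping_eqI) (simp add: lookup_tau_deriv_tau lookup_add algebra_simps)

lemma tau_deriv_tau_scale: "tau * deriv_tau f (scale_forms c x) = scale_forms c (tau * deriv_tau f x)"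
  by (rule poly_mapping_eqI) (simp add: lookup_tau_deriv_tau lookup_scale_forms algebra_simps)

lemma euler_shift_add: "euler_shift f \<gamma> (x + y) = euler_shift f \<gamma> x + euler_shift f \<gamma> y"
  by (simp add: euler_shift_def tau_deriv_tau_add forms.scale_right_distrib)

lemma euler_shift_scale: "euler_shift f \<gamma> (scale_forms c x) = scale_forms c (euler_shift f \<gamma> x)"
  by (simp add: euler_shift_def tau_deriv_tau_scale forms.scale_right_distrib mult.commute)

lemma euler_shift_commute: "euler_shift f \<gamma> (euler_shift f \<beta> x) = euler_shift f \<beta> (euler_shift f \<gamma> x)"
  unfolding euler_shift_def[of f \<beta>] euler_shift_add euler_shift_scale
  by (simp add: euler_shift_def tau_deriv_tau_add tau_deriv_tau_scale algebra_simps)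

text \<open>A product of commuting operators
  \<open>\<tau>\<partial>\<^sub>\<tau> + \<gamma>\<close>; a list keeps the factors, so that they
  can be sorted by index.\<close>

definition euler_shifts :: "laurent \<Rightarrow> real list \<Rightarrow> theta_laurent \<Rightarrow> theta_laurent" where
  "euler_shifts f gs = foldr (euler_shift f) gs"

lemma euler_shifts_simps [simp]:
  "euler_shifts f [] x = x" "euler_shifts f (g # gs) x = euler_shift f g (euler_shifts f gs x)"
  "euler_shifts f (gs @ hs) x = euler_shifts f gs (euler_shifts f hs x)"
  by (simp_all add: euler_shifts_def)

lemma euler_shifts_replicate: "euler_shifts f (replicate j \<gamma>) x = (euler_shift f \<gamma> ^^ j) x"
  by (induction j) simp_all

lemma euler_shifts_commute: "euler_shift f \<gamma> (euler_shifts f gs x) = euler_shifts f gs (euler_shift f \<gamma> x)"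
  by (induction gs) (simp_all add: euler_shift_commute[of f \<gamma>])

lemma euler_shifts_partition:
  "euler_shifts f gs x = euler_shifts f (filter Q gs) (euler_shifts f (filter (\<lambda>g. \<not> Q g) gs) x)"
  by (induction gs) (simp_all add: euler_shifts_commute)

section \<open>Uniqueness of the V-filtration\<close>

locale V_filtration_of =
  fixes f :: laurent and V :: "real \<Rightarrow> theta_laurent set"
  assumes is_V: "is_V_filtration f V"
begin

lemma V_props:
  "forms.subspace (V \<alpha>)" "gm_relations f \<subseteq> V \<alpha>"
  "\<exists>S. finite S \<and> V \<alpha> = forms.span ({tau ^ k * x | k x. x \<in> S} \<union> gm_relations f)"
  "mono V" "(\<Union>\<alpha>. V \<alpha>) = UNIV" "(\<lambda>x. tau * x) ` V \<alpha> = V (\<alpha> - 1)"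
  "V \<alpha> = (\<Inter>\<beta>\<in>{\<alpha><..}. V \<beta>)"
  "x \<in> V \<alpha> \<Longrightarrow> tau * deriv_tau f x \<in> V \<alpha>"
  "\<exists>j. \<forall>x\<in>V \<alpha>. (euler_shift f \<alpha> ^^ j) x \<in> below V \<alpha>"
proof -
  note c = is_V[unfolded is_V_filtration_def]
  note c1 = conjunct1[OF c] and d1 = conjunct2[OF c]
  note c2 = conjunct1[OF d1] and d2 = conjunct2[OF d1]
  note c3 = conjunct1[OF d2] and d3 = conjunct2[OF d2]
  note c4 = conjunct1[OF d3] and d4 = conjunct2[OF d3]
  note c5 = conjunct1[OF d4] and d5 = conjunct2[OF d4]
  note c6 = conjunct1[OF d5] and d6 = conjunct2[OF d5]
  note c7 = conjunct1[OF d6] and c8 = conjunct2[OF d6]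
  show "forms.subspace (V \<alpha>)" by (rule conjunct1[OF spec[OF c1]])
  show "gm_relations f \<subseteq> V \<alpha>" by (rule conjunct2[OF spec[OF c1]])
  show "\<exists>S. finite S \<and> V \<alpha> = forms.span ({tau ^ k * x | k x. x \<in> S} \<union> gm_relations f)" by (rule spec[OF c2])
  show "mono V" by (rule c3)
  show "(\<Union>\<alpha>. V \<alpha>) = UNIV" by (rule c4)
  show "(\<lambda>x. tau * x) ` V \<alpha> = V (\<alpha> - 1)" by (rule spec[OF c5])
  show "V \<alpha> = (\<Inter>\<beta>\<in>{\<alpha><..}. V \<beta>)" by (rule spec[OF c6])
  show "tau * deriv_tau f x \<in> V \<alpha>" if "x \<in> V \<alpha>" using c7 that by simp
  show "\<exists>j. \<forall>x\<in>V \<alpha>. (euler_shift f \<alpha> ^^ j) x \<in> below V \<alpha>"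
    unfolding euler_shift_def[abs_def] by (rule spec[OF c8])
qed

lemma V_mono: "\<alpha> \<le> \<beta> \<Longrightarrow> V \<alpha> \<subseteq> V \<beta>"
  using V_props(4) by (rule monoD)

lemma V_shift: "x \<in> V \<alpha> \<Longrightarrow> euler_shift f \<gamma> x \<in> V \<alpha>"
  unfolding euler_shift_def
  by (intro forms.subspace_add[OF V_props(1)] forms.subspace_scale[OF V_props(1)] V_props(8))

lemma V_shifts: "x \<in> V \<alpha> \<Longrightarrow> euler_shifts f gs x \<in> V \<alpha>"
  by (induction gs) (simp_all add: V_shift)

lemma below_add: assumes "x \<in> below V \<alpha>" "y \<in> below V \<alpha>" shows "x + y \<in> below V \<alpha>"
proof -
  obtain \<beta> \<gamma> where *: "\<beta> < \<alpha>" "x \<in> V \<beta>" "\<gamma> < \<alpha>" "y \<in> V \<gamma>" using assms by (auto simp: below_def)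
  have "x \<in> V (max \<beta> \<gamma>)" "y \<in> V (max \<beta> \<gamma>)" using * V_mono[of \<beta> "max \<beta> \<gamma>"] V_mono[of \<gamma> "max \<beta> \<gamma>"] by auto
  then have "x + y \<in> V (max \<beta> \<gamma>)" by (rule forms.subspace_add[OF V_props(1)])
  then show ?thesis using * by (auto simp: below_def intro!: bexI[of _ "max \<beta> \<gamma>"])
qed

lemma below_scale: "x \<in> below V \<alpha> \<Longrightarrow> scale_forms c x \<in> below V \<alpha>"
  unfolding below_def using forms.subspace_scale[OF V_props(1)] by blast

lemma below_diff: "x \<in> below V \<alpha> \<Longrightarrow> y \<in> below V \<alpha> \<Longrightarrow> x - y \<in> below V \<alpha>"
  using below_add[of x \<alpha> "scale_forms (-1) y"] below_scale[of y \<alpha> "-1"] by simp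

lemma below_shift: "x \<in> below V \<alpha> \<Longrightarrow> euler_shift f \<gamma> x \<in> below V \<alpha>"
  unfolding below_def using V_shift by blast

text \<open>On \<open>Gr\<^sub>\<beta>\<close> the operator \<open>\<tau>\<partial>\<^sub>\<tau> + \<gamma>\<close> is a nilpotent one plus the scalar \<open>\<gamma> - \<beta>\<close>, hence injective for \<open>\<gamma> \<noteq> \<beta>\<close>.\<close>

lemma shift_reflects_below:
  assumes x: "x \<in> V \<beta>" and "\<gamma> \<noteq> \<beta>" and below: "euler_shift f \<gamma> x \<in> below V \<beta>"
  shows "x \<in> below V \<beta>"
proof -
  obtain j where j: "(euler_shift f \<beta> ^^ j) x \<in> below V \<beta>" using V_props(9) x by blast
  define c :: complex where "c = of_real (\<beta> - \<gamma>)"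
  have c: "c \<noteq> 0" using \<open>\<gamma> \<noteq> \<beta>\<close> by (simp add: c_def)
  have step: "euler_shift f \<beta> x - scale_forms c x \<in> below V \<beta>"
  proof -
    have "euler_shift f \<beta> x - scale_forms c x = euler_shift f \<gamma> x"
      by (simp add: euler_shift_def c_def forms.scale_left_diff_distrib)
    then show ?thesis using below by simp
  qed
  have "(euler_shift f \<beta> ^^ i) x - scale_forms (c ^ i) x \<in> below V \<beta>" for i
  proof (induction i)
    case 0
    have "x - x = scale_forms 0 (euler_shift f \<gamma> x)" by simp
    then show ?case using below_scale[OF below, of 0] by simp
  next
    case (Suc i)
    have "euler_shift f \<beta> ((euler_shift f \<beta> ^^ i) x - scale_forms (c ^ i) x) + scale_forms (c ^ i) (euler_shift f \<beta> x - scale_forms c x)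
       \<in> below V \<beta>"
      by (intro below_add below_shift below_scale Suc step)
    moreover have "euler_shift f \<beta> ((euler_shift f \<beta> ^^ i) x - scale_forms (c ^ i) x) =
      euler_shift f \<beta> ((euler_shift f \<beta> ^^ i) x) - scale_forms (c ^ i) (euler_shift f \<beta> x)"
      using euler_shift_add[of f \<beta> "(euler_shift f \<beta> ^^ i) x - scale_forms (c ^ i) x" "scale_forms (c ^ i) x"]
      by (simp add: euler_shift_scale)
    ultimately show ?case by (simp add: forms.scale_right_diff_distrib mult.commute)
  qed
  from below_diff[OF j this[of j]] have "scale_forms (c ^ j) x \<in> below V \<beta>" by simp
  then have "scale_forms (inverse (c ^ j)) (scale_forms (c ^ j) x) \<in> below V \<beta>" by (rule below_scale)
  then show ?thesis using c by simp
qed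

lemma shifts_reflect_below:
  "x \<in> V \<beta> \<Longrightarrow> \<beta> \<notin> set gs \<Longrightarrow> euler_shifts f gs x \<in> below V \<beta> \<Longrightarrow> x \<in> below V \<beta>"
proof (induction gs)
  case (Cons g gs)
  then show ?case using shift_reflects_below[OF V_shifts[OF Cons.prems(1), of gs], of g] by auto
qed simp

text \<open>The infimum of the indices whose piece contains \<open>x\<close> is attained because the
  filtration is continuous from the right.\<close>

lemma order_exists:
  assumes "x \<in> V \<beta>" "x \<notin> V \<alpha>"
  obtains \<gamma> where "\<gamma> > \<alpha>" "x \<in> V \<gamma>" "x \<notin> below V \<gamma>"
proof -
  define A where "A = {\<gamma>. x \<in> V \<gamma>}"
  have gt: "\<gamma> > \<alpha>" if "\<gamma> \<in> A" for \<gamma>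
    using that assms(2) V_mono[of \<gamma> \<alpha>] by (force simp: A_def not_le[symmetric])
  then have bdd: "bdd_below A" by (meson bdd_belowI less_imp_le)
  have ne: "A \<noteq> {}" using assms(1) by (auto simp: A_def)
  have "x \<in> V \<gamma>" if lt: "\<gamma> > Inf A" for \<gamma>
  proof -
    obtain \<delta> where "\<delta> \<in> A" "\<delta> < \<gamma>" using cInf_lessD[OF ne lt] by blast
    then show ?thesis using V_mono[of \<delta> \<gamma>] by (auto simp: A_def)
  qed
  then have "x \<in> V (Inf A)" using V_props(7)[of "Inf A"] by blast
  moreover from this have "Inf A > \<alpha>" using gt by (simp add: A_def)
  moreover have "x \<notin> below V (Inf A)"
  proof
    assume "x \<in> below V (Inf A)"
    then obtain \<delta> where "\<delta> < Inf A" "\<delta> \<in> A" by (auto simp: below_def A_def)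
    then show False using cInf_lower[OF _ bdd, of \<delta>] by simp
  qed
  ultimately show ?thesis using that by blast
qed

lemma tau_power_V: "x \<in> V \<alpha> \<Longrightarrow> tau ^ k * x \<in> V (\<alpha> - real k)"
proof (induction k)
  case (Suc k)
  then have "tau * (tau ^ k * x) \<in> V (\<alpha> - real k - 1)" using V_props(6)[of "\<alpha> - real k"] by blast
  then show ?case by (simp add: algebra_simps)
qed simp

lemma V_shift_down: "V (\<alpha> - real k) = (\<lambda>x. tau ^ k * x) ` V \<alpha>"
proof (induction k)
  case (Suc k)
  have "V (\<alpha> - real (Suc k)) = (\<lambda>x. tau * x) ` V (\<alpha> - real k)"
    using V_props(6)[of "\<alpha> - real k"] by (simp add: algebra_simps)
  also have "\<dots> = (\<lambda>x. tau ^ Suc k * x) ` V \<alpha>" unfolding Suc by (simp add: image_image mult.assoc)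
  finally show ?case .
qed simp

lemma exhaust: obtains \<beta> where "x \<in> V \<beta>"
  using V_props(5) by blast

end

text \<open>A piece of \<open>V\<close> is generated over the powers of \<tau> by finitely many
  elements, modulo the relations; these lie in a common piece of \<open>V'\<close>, and
  multiplication by \<tau> shifts both filtrations alike.\<close>

lemma V_filtrations_comparable:
  assumes "V_filtration_of f V" "V_filtration_of f V'"
  obtains \<beta> where "\<And>k. V (\<alpha> - real k) \<subseteq> V' (\<beta> - real k)"
proof -
  interpret V: V_filtration_of f V by fact
  interpret V': V_filtration_of f V' by fact
  obtain S where S: "finite S" "V \<alpha> = forms.span ({tau ^ k * x | k x. x \<in> S} \<union> gm_relations f)"
    using V.V_props(3) by blast
  have "\<forall>x. \<exists>\<beta>. x \<in> V' \<beta>" using V'.V_props(5) by blast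
  then have "\<exists>b. \<forall>x. x \<in> V' (b x)" by (rule choice)
  then obtain b where b: "\<And>x. x \<in> V' (b x)" by blast
  define \<beta> where "\<beta> = Max (insert 0 (b ` S))"
  have "tau ^ k * x \<in> V' \<beta>" if "x \<in> S" for k x
  proof -
    have "b x \<le> \<beta>" unfolding \<beta>_def using that S(1) by (intro Max_ge) auto
    then have "b x - real k \<le> \<beta>" by simp
    then show ?thesis using V'.tau_power_V[OF b, of k x] V'.V_mono by blast
  qed
  then have sub: "V \<alpha> \<subseteq> V' \<beta>"
    unfolding S(2) using V'.V_props(1,2) by (intro forms.span_minimal) auto
  have "V (\<alpha> - real k) \<subseteq> V' (\<beta> - real k)" for k
    unfolding V.V_shift_down V'.V_shift_down using sub by blast
  then show ?thesis by (rule that)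
qed

text \<open>
  Only one of the two filtrations is required to have a discrete set of jumps; for it, the annihilating products of operators \<open>\<tau>\<partial>\<^sub>\<tau> + \<gamma>\<close> are explicit.
\<close>

lemma V_filtration_unique:
  assumes V: "V_filtration_of f V" and V': "V_filtration_of f V'" and M: "M > (0::nat)"
    and discrete: "\<And>\<alpha>. V \<alpha> = V (of_int \<lfloor>\<alpha> * real M\<rfloor> / real M)"
  shows "V' = V"
proof -
  interpret V: V_filtration_of f V by fact
  interpret V': V_filtration_of f V' by fact
  let ?r = "\<lambda>j::int. of_int j / real M"
  have below: "below V (?r j) \<subseteq> V (?r (j - 1))" for j
  proof -
    have "V \<beta> \<subseteq> V (?r (j - 1))" if "\<beta> < ?r j" for \<beta>
    proof -
      have "\<beta> * real M < of_int j" using that M by (simp add: less_divide_eq)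
      then have "\<lfloor>\<beta> * real M\<rfloor> \<le> j - 1" by linarith
      then have "?r \<lfloor>\<beta> * real M\<rfloor> \<le> ?r (j - 1)" by (intro divide_right_mono) auto
      then show ?thesis using discrete[of \<beta>] V.V_mono by simp
    qed
    then show ?thesis by (auto simp: below_def)
  qed
  \<comment> \<open>The nilpotent operator at a jump, iterated, lowers \<open>V\<close> to the next
    multiple of \<open>1 / M\<close>; the products of such powers only use indices up to the
    starting one.\<close>
  have annihilate: "\<exists>gs. (\<forall>x\<in>V (?r j). euler_shifts f gs x \<in> V (?r (j - int N))) \<and> (\<forall>g\<in>set gs. g \<le> ?r j)" for j N
  proof (induction N)
    case 0
    show ?case by (intro exI[of _ "[]"]) simp
  next
    case (Suc N)
    then obtain gs where gs: "\<forall>x\<in>V (?r j). euler_shifts f gs x \<in> V (?r (j - int N))" "\<forall>g\<in>set gs. g \<le> ?r j" by blast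
    obtain i where i: "\<forall>x\<in>V (?r (j - int N)). (euler_shift f (?r (j - int N)) ^^ i) x \<in> below V (?r (j - int N))"
      using V.V_props(9) by blast
    let ?gs = "replicate i (?r (j - int N)) @ gs"
    have "euler_shifts f ?gs x \<in> V (?r (j - int (Suc N)))" if "x \<in> V (?r j)" for x
    proof -
      have "euler_shifts f ?gs x \<in> below V (?r (j - int N))"
        using i gs(1) that by (simp add: euler_shifts_replicate del: of_int_diff)
      then show ?thesis using below[of "j - int N"] by (auto simp: algebra_simps)
    qed
    moreover have "?r (j - int N) \<le> ?r j" by (intro divide_right_mono) auto
    then have "\<forall>g\<in>set ?gs. g \<le> ?r j" using gs(2) by auto
    ultimately show ?case by blast
  qed
  have r_shift: "?r (j - int (K * M)) = ?r j - real K" for j K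
    using M by (simp add: field_simps)
  have sub1: "V \<alpha> \<subseteq> V' \<alpha>" for \<alpha>
  proof
    fix x assume x: "x \<in> V \<alpha>"
    define j where "j = \<lfloor>\<alpha> * real M\<rfloor>"
    have j: "x \<in> V (?r j)" "?r j \<le> \<alpha>" using x discrete[of \<alpha>] M by (simp_all add: j_def divide_le_eq)
    obtain \<beta> where \<beta>: "\<And>k. V (?r j - real k) \<subseteq> V' (\<beta> - real k)" using V_filtrations_comparable[OF V V'] by blast
    obtain K :: nat where K: "\<beta> - real K \<le> \<alpha>" using real_arch_simple[of "\<beta> - \<alpha>"] by (auto simp: algebra_simps)
    obtain gs where gs: "\<forall>x\<in>V (?r j). euler_shifts f gs x \<in> V (?r (j - int (K * M)))" "\<forall>g\<in>set gs. g \<le> ?r j"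
      using annihilate by blast
    have in': "euler_shifts f gs x \<in> V' \<alpha>"
    proof -
      have "euler_shifts f gs x \<in> V (?r j - real K)" using gs(1) j(1) unfolding r_shift by blast
      then show ?thesis using \<beta> V'.V_mono[OF K] by blast
    qed
    show "x \<in> V' \<alpha>"
    proof (rule ccontr)
      assume "x \<notin> V' \<alpha>"
      obtain b where "x \<in> V' b" by (rule V'.exhaust)
      then obtain \<gamma> where \<gamma>: "\<gamma> > \<alpha>" "x \<in> V' \<gamma>" "x \<notin> below V' \<gamma>" using V'.order_exists \<open>x \<notin> V' \<alpha>\<close> by blast
      \<comment> \<open>All factors have an index at most \<open>\<alpha> < \<gamma>\<close>, so
        they are injective on the graded piece of \<open>V'\<close> at \<open>\<gamma>\<close>, yet
        they send \<open>x\<close> below it.\<close>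
      have "euler_shifts f gs x \<in> below V' \<gamma>" using in' \<gamma>(1) by (auto simp: below_def)
      moreover have "\<gamma> \<notin> set gs" using gs(2) j(2) \<gamma>(1) by force
      ultimately show False using V'.shifts_reflect_below \<gamma>(2,3) by blast
    qed
  qed
  have sub2: "V' \<alpha> \<subseteq> V \<alpha>" for \<alpha>
  proof
    fix x assume x: "x \<in> V' \<alpha>"
    show "x \<in> V \<alpha>"
    proof (rule ccontr)
      assume "x \<notin> V \<alpha>"
      obtain b where "x \<in> V b" by (rule V.exhaust)
      then obtain \<beta> where \<beta>: "\<beta> > \<alpha>" "x \<in> V \<beta>" "x \<notin> below V \<beta>" using V.order_exists \<open>x \<notin> V \<alpha>\<close> by blast
      define j where "j = \<lfloor>\<beta> * real M\<rfloor>"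
      have xj: "x \<in> V (?r j)" using \<beta>(2) discrete[of \<beta>] by (simp add: j_def)
      have rj: "?r j = \<beta>"
      proof (rule ccontr)
        assume "?r j \<noteq> \<beta>"
        moreover have "?r j \<le> \<beta>" using M by (simp add: j_def divide_le_eq)
        ultimately show False using xj \<beta>(3) by (auto simp: below_def)
      qed
      obtain \<beta>' where \<beta>': "\<And>k. V' (\<beta> - real k) \<subseteq> V (\<beta>' - real k)" using V_filtrations_comparable[OF V' V] by blast
      obtain K :: nat where K: "\<beta>' - \<beta> < real K" using reals_Archimedean2 by blast
      obtain gs where gs: "\<forall>x\<in>V (?r j). euler_shifts f gs x \<in> V (?r (j - int (K * M)))" using annihilate by blast
      \<comment> \<open>The factors are sorted by index. Those up to \<open>\<alpha>\<close> differ
        from \<open>\<beta>\<close>, so \<open>y\<close> stays nonzero in the graded piece of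
        \<open>V\<close> at \<open>\<beta>\<close>. Those above \<open>\<alpha>\<close> are
        injective on the graded pieces of \<open>V'\<close> up to \<open>\<alpha>\<close>, so
        \<open>y\<close> lies as deep in \<open>V'\<close> as the full product does.\<close>
      define y where "y = euler_shifts f (filter (\<lambda>g. \<not> g > \<alpha>) gs) x"
      have y: "y \<in> V' \<alpha>" unfolding y_def by (rule V'.V_shifts[OF x])
      have y_not: "y \<notin> below V \<beta>"
        using V.shifts_reflect_below[OF \<beta>(2), of "filter (\<lambda>g. \<not> g > \<alpha>) gs"] \<beta>(1,3) by (auto simp: y_def)
      have "euler_shifts f gs x \<in> V (\<beta> - real K)" using gs xj unfolding r_shift rj by blast
      then have ys: "euler_shifts f (filter (\<lambda>g. g > \<alpha>) gs) y \<in> V' (\<beta> - real K)"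
        using sub1 euler_shifts_partition[of f gs x "\<lambda>g. g > \<alpha>"] by (auto simp: y_def)
      have "y \<in> V' (\<beta> - real K)"
      proof (rule ccontr)
        assume "y \<notin> V' (\<beta> - real K)"
        then obtain \<gamma> where \<gamma>: "\<gamma> > \<beta> - real K" "y \<in> V' \<gamma>" "y \<notin> below V' \<gamma>" using V'.order_exists[OF y] by blast
        have "\<gamma> \<le> \<alpha>" using y \<gamma>(3) by (force simp: below_def not_less[symmetric])
        then have "\<gamma> \<notin> set (filter (\<lambda>g. g > \<alpha>) gs)" by simp
        moreover have "euler_shifts f (filter (\<lambda>g. g > \<alpha>) gs) y \<in> below V' \<gamma>" using ys \<gamma>(1) by (auto simp: below_def)
        ultimately show False using V'.shifts_reflect_below[OF \<gamma>(2)] \<gamma>(3) by blast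
      qed
      then have "y \<in> V (\<beta>' - real K)" using \<beta>' by blast
      then show False using y_not K by (force simp: below_def)
    qed
  qed
  show ?thesis using sub1 sub2 by (intro ext) blast
qed

section \<open>The Newton filtration satisfies the axioms of the V-filtration\<close>

abbreviation monomial_form :: "int \<Rightarrow> int \<times> int \<Rightarrow> theta_laurent" where
  "monomial_form k c \<equiv> Poly_Mapping.single k (Poly_Mapping.single c 1)"

lemma single_form_in_subspace:
  assumes X: "forms.subspace X" and m: "\<And>c. lookup g c \<noteq> 0 \<Longrightarrow> monomial_form k c \<in> X"
  shows "Poly_Mapping.single k g \<in> X"
proof -
  have "Poly_Mapping.single k g = (\<Sum>c\<in>keys g. scale_forms (lookup g c) (monomial_form k c))"
  proof (rule poly_mapping_eqI)
    fix i
    show "lookup (Poly_Mapping.single k g) i = lookup (\<Sum>c\<in>keys g. scale_forms (lookup g c) (monomial_form k c)) i"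
      using poly_mapping_eq_sum_single[of g]
      by (cases "i = k") (simp_all add: lookup_sum lookup_scale_forms lookup_single mult_single)
  qed
  also have "\<dots> \<in> X"
    by (intro forms.subspace_sum[OF X] forms.subspace_scale[OF X] m) (simp add: in_keys_iff)
  finally show ?thesis .
qed

lemma form_in_subspace:
  assumes X: "forms.subspace X" and m: "\<And>k c. lookup (lookup x k) c \<noteq> 0 \<Longrightarrow> monomial_form k c \<in> X"
  shows "x \<in> X"
proof -
  have "(\<Sum>k\<in>keys x. Poly_Mapping.single k (lookup x k)) \<in> X"
    by (intro forms.subspace_sum[OF X] single_form_in_subspace[OF X m])
  then show ?thesis using poly_mapping_eq_sum_single[of x] by simp
qed

lemma tau_monomial_form: "tau ^ j * monomial_form k c = monomial_form (k - int j) c"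
proof (induction j)
  case (Suc j)
  have "tau ^ Suc j * monomial_form k c = tau * monomial_form (k - int j) c"
    using Suc by (simp add: mult.assoc)
  also have "\<dots> = monomial_form (k - int (Suc j)) c" unfolding tau_def mult_single by (simp add: algebra_simps)
  finally show ?case .
qed simp

context newton_polygon
begin

lemma form_filtD: "x \<in> form_filt \<alpha> \<Longrightarrow> lookup (lookup x k) c \<noteq> 0 \<Longrightarrow> of_int k + n c \<le> \<alpha>"
  unfolding form_filt_def using newton_filtD[of "lookup x k" "\<alpha> - of_int k" c] by auto

lemma form_filtI: "(\<And>k c. lookup (lookup x k) c \<noteq> 0 \<Longrightarrow> of_int k + n c \<le> \<alpha>) \<Longrightarrow> x \<in> form_filt \<alpha>"
  unfolding form_filt_def by (auto intro!: newton_filtI simp: le_diff_eq add.commute)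

lemma monomial_form_filt: "of_int k + n c \<le> \<alpha> \<Longrightarrow> monomial_form k c \<in> form_filt \<alpha>"
  by (rule form_filtI) (auto simp: lookup_single when_def split: if_splits)

lemma form_filt_subspace: "forms.subspace (form_filt \<alpha>)"
proof (rule forms.subspaceI)
  show "x + y \<in> form_filt \<alpha>" if "x \<in> form_filt \<alpha>" "y \<in> form_filt \<alpha>" for x y
    using that by (auto simp: form_filt_def lookup_add intro: newton_filt_add)
  show "scale_forms c x \<in> form_filt \<alpha>" if "x \<in> form_filt \<alpha>" for c x
    by (rule form_filtI) (auto simp: lookup_scale_forms lookup_single_times dest: form_filtD[OF that])
qed (simp add: form_filt_def)

lemma gm_relations_subspace: "forms.subspace (gm_relations f)"
  by (rule forms.subspaceI) (simp_all add: gm_relations_closed)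

lemma V_newton_subspace: "forms.subspace (V_newton \<alpha>)"
  unfolding V_newton_def by (rule forms.subspace_sums[OF form_filt_subspace gm_relations_subspace])

lemma gm_relations_V_newton: "gm_relations f \<subseteq> V_newton \<alpha>"
proof
  fix y assume "y \<in> gm_relations f"
  moreover have "y = 0 + y" by simp
  ultimately show "y \<in> V_newton \<alpha>"
    unfolding V_newton_def using forms.subspace_0[OF form_filt_subspace] by blast
qed

lemma form_filt_V_newton: "form_filt \<alpha> \<subseteq> V_newton \<alpha>"
proof
  fix y assume "y \<in> form_filt \<alpha>"
  moreover have "y = y + 0" by simp
  ultimately show "y \<in> V_newton \<alpha>" unfolding V_newton_def using gm_relations_closed(1) by blast
qed

lemma V_newton_subset:
  assumes X: "forms.subspace X" "gm_relations f \<subseteq> X" and m: "\<And>k c. of_int k + n c \<le> \<alpha> \<Longrightarrow> monomial_form k c \<in> X"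
  shows "V_newton \<alpha> \<subseteq> X"
proof
  fix z assume "z \<in> V_newton \<alpha>"
  then obtain x y where z: "z = x + y" "x \<in> form_filt \<alpha>" "y \<in> gm_relations f" unfolding V_newton_def by blast
  have "x \<in> X" by (rule form_in_subspace[OF X(1)]) (intro m form_filtD[OF z(2)])
  then show "z \<in> X" using z X by (auto intro: forms.subspace_add[OF X(1)])
qed

lemma V_newton_mono: "\<alpha> \<le> \<beta> \<Longrightarrow> V_newton \<alpha> \<subseteq> V_newton \<beta>"
  by (rule V_newton_subset[OF V_newton_subspace gm_relations_V_newton])
    (use form_filt_V_newton monomial_form_filt in fastforce)

lemma degree_le_floor: "of_int k + n c \<le> \<alpha> \<longleftrightarrow> of_int k + n c \<le> of_int \<lfloor>\<alpha> * den\<rfloor> / real den"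
proof -
  obtain j :: int where j: "n c = of_int j / of_nat den" using n_den by blast
  have "of_int k + n c = of_int (k * int den + j) / real den" unfolding j using den_pos by (simp add: add_divide_distrib)
  moreover have "of_int i / real den \<le> \<alpha> \<longleftrightarrow> i \<le> \<lfloor>\<alpha> * den\<rfloor>" for i
    using den_pos by (simp add: divide_le_eq le_floor_iff)
  moreover have "of_int i / real den \<le> of_int \<lfloor>\<alpha> * den\<rfloor> / real den \<longleftrightarrow> i \<le> \<lfloor>\<alpha> * den\<rfloor>" for i
    using den_pos by (simp add: divide_le_cancel)
  ultimately show ?thesis by (simp only:)
qed

lemma V_newton_discrete: "V_newton \<alpha> = V_newton (of_int \<lfloor>\<alpha> * den\<rfloor> / real den)"
proof -
  have "form_filt \<alpha> = form_filt (of_int \<lfloor>\<alpha> * den\<rfloor> / real den)"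
    using form_filtD form_filtI degree_le_floor by blast
  then show ?thesis by (simp add: V_newton_def)
qed

lemma V_newton_right_continuous: "V_newton \<alpha> = (\<Inter>\<beta>\<in>{\<alpha><..}. V_newton \<beta>)"
proof
  show "V_newton \<alpha> \<subseteq> (\<Inter>\<beta>\<in>{\<alpha><..}. V_newton \<beta>)"
    using V_newton_mono[OF less_imp_le] by blast
  \<comment> \<open>The next multiple of \<open>1 / den\<close> after \<open>\<alpha>\<close>;
    \<open>V_newton\<close> is constant from \<open>\<alpha>\<close> up to this jump.\<close>
  define X where "X = (of_int \<lfloor>\<alpha> * den\<rfloor> + 1) / real den"
  define \<beta> where "\<beta> = (\<alpha> + X) / 2"
  have "\<alpha> < X" unfolding X_def using den_pos by (simp add: less_divide_eq)
  then have \<beta>: "\<alpha> < \<beta>" "\<beta> < X" unfolding \<beta>_def by simp_all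
  have "\<alpha> * den \<le> \<beta> * den" "\<beta> * den < of_int \<lfloor>\<alpha> * den\<rfloor> + 1"
    using \<beta> den_pos by (simp_all add: X_def less_divide_eq)
  then have "\<lfloor>\<beta> * den\<rfloor> = \<lfloor>\<alpha> * den\<rfloor>" by linarith
  then have "V_newton \<beta> = V_newton \<alpha>" using V_newton_discrete[of \<alpha>] V_newton_discrete[of \<beta>] by simp
  then show "(\<Inter>\<beta>\<in>{\<alpha><..}. V_newton \<beta>) \<subseteq> V_newton \<alpha>" using \<beta>(1) by blast
qed

lemma V_newton_UN: "(\<Union>\<alpha>. V_newton \<alpha>) = UNIV"
proof -
  have "x \<in> (\<Union>\<alpha>. V_newton \<alpha>)" for x
  proof -
    define S where "S = (\<Union>k\<in>keys x. (\<lambda>c. of_int k + n c) ` keys (lookup x k))"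
    have fin: "finite (insert 0 S)" by (simp add: S_def)
    have "x \<in> form_filt (Max (insert 0 S))"
    proof (rule form_filtI)
      fix k c assume *: "lookup (lookup x k) c \<noteq> 0"
      then have "lookup x k \<noteq> 0" by auto
      then have "k \<in> keys x" "c \<in> keys (lookup x k)" using * by (simp_all add: in_keys_iff)
      then have "of_int k + n c \<in> insert 0 S" unfolding S_def by blast
      then show "of_int k + n c \<le> Max (insert 0 S)" by (rule Max_ge[OF fin])
    qed
    then show ?thesis using form_filt_V_newton by blast
  qed
  then show ?thesis by blast
qed

lemma tau_form_filt: "x \<in> form_filt \<alpha> \<Longrightarrow> tau * x \<in> form_filt (\<alpha> - 1)"
  by (rule form_filtI) (use form_filtD[of x \<alpha>] in \<open>fastforce simp: lookup_tau_times\<close>)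

lemma theta_form_filt: "x \<in> form_filt (\<alpha> - 1) \<Longrightarrow> theta * x \<in> form_filt \<alpha>"
  by (rule form_filtI) (use form_filtD[of x "\<alpha> - 1"] in \<open>fastforce simp: lookup_theta_times\<close>)

lemma tau_V_newton: "(\<lambda>x. tau * x) ` V_newton \<alpha> = V_newton (\<alpha> - 1)"
proof (intro equalityI subsetI)
  fix z assume "z \<in> (\<lambda>x. tau * x) ` V_newton \<alpha>"
  then obtain x y where z: "z = tau * (x + y)" "x \<in> form_filt \<alpha>" "y \<in> gm_relations f" unfolding V_newton_def by blast
  have "z = tau * x + tau * y" using z(1) by (simp add: distrib_left)
  then show "z \<in> V_newton (\<alpha> - 1)"
    unfolding V_newton_def using tau_form_filt[OF z(2)] gm_relations_closed(6)[OF z(3)] by blast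
next
  fix z assume "z \<in> V_newton (\<alpha> - 1)"
  then obtain x y where z: "z = x + y" "x \<in> form_filt (\<alpha> - 1)" "y \<in> gm_relations f" unfolding V_newton_def by blast
  have "z = tau * (theta * x + theta * y)" using z(1) by (simp add: distrib_left theta_tau)
  moreover have "theta * x + theta * y \<in> V_newton \<alpha>"
    unfolding V_newton_def using theta_form_filt[OF z(2)] gm_relations_closed(5)[OF z(3)] by blast
  ultimately show "z \<in> (\<lambda>x. tau * x) ` V_newton \<alpha>" by blast
qed

lemma deriv_form_filt: "x \<in> form_filt \<alpha> \<Longrightarrow> tau * deriv_tau f x \<in> form_filt \<alpha>"
proof -
  assume x: "x \<in> form_filt \<alpha>"
  have "of_int (- k) * lookup x k - f * lookup x (k + 1) \<in> newton_filt (\<alpha> - of_int k)" for k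
  proof (rule newton_filt_diff)
    have "lookup (of_int (- k) * lookup x k) c = of_int (- k) * lookup (lookup x k) c" for c
    proof -
      have "(of_int (- k) :: laurent) = Poly_Mapping.single 0 (of_int (- k))" by (rule single_of_int[symmetric])
      then show ?thesis by (simp only: lookup_single_times) simp
    qed
    then show "of_int (- k) * lookup x k \<in> newton_filt (\<alpha> - of_int k)"
      using x unfolding form_filt_def by (intro newton_filtI) (auto dest: newton_filtD)
    have "lookup x (k + 1) \<in> newton_filt (\<alpha> - of_int (k + 1))" using x unfolding form_filt_def by blast
    then show "f * lookup x (k + 1) \<in> newton_filt (\<alpha> - of_int k)"
      using newton_filt_mult[OF f_newton_filt(1)] by fastforce
  qed
  then show ?thesis by (simp add: form_filt_def lookup_tau_deriv_tau)
qed

lemma deriv_V_newton: "x \<in> V_newton \<alpha> \<Longrightarrow> tau * deriv_tau f x \<in> V_newton \<alpha>"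
proof -
  assume "x \<in> V_newton \<alpha>"
  then obtain u y where x: "x = u + y" "u \<in> form_filt \<alpha>" "y \<in> gm_relations f" unfolding V_newton_def by blast
  have "tau * deriv_tau f x = tau * deriv_tau f u + tau * deriv_tau f y" using x(1) by (simp only: tau_deriv_tau_add)
  then show ?thesis unfolding V_newton_def using deriv_form_filt[OF x(2)] gm_relations_closed(7)[OF x(3)] by blast
qed

lemma shift_V_newton: "x \<in> V_newton \<alpha> \<Longrightarrow> euler_shift f \<gamma> x \<in> V_newton \<alpha>"
  unfolding euler_shift_def
  by (intro forms.subspace_add[OF V_newton_subspace] forms.subspace_scale[OF V_newton_subspace] deriv_V_newton)

lemma below_V_newton: "below V_newton \<alpha> = V_newton (of_int (\<lceil>\<alpha> * den\<rceil> - 1) / real den)"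
proof
  let ?\<beta> = "of_int (\<lceil>\<alpha> * den\<rceil> - 1) / real den"
  have "?\<beta> < \<alpha>" using den_pos by (simp add: divide_less_eq) linarith
  then show "V_newton ?\<beta> \<subseteq> below V_newton \<alpha>" by (auto simp: below_def)
  have "V_newton \<gamma> \<subseteq> V_newton ?\<beta>" if "\<gamma> < \<alpha>" for \<gamma>
  proof -
    have "\<gamma> * den < \<alpha> * den" using that den_pos by simp
    then have "\<lfloor>\<gamma> * den\<rfloor> \<le> \<lceil>\<alpha> * den\<rceil> - 1" by linarith
    then have "of_int \<lfloor>\<gamma> * den\<rfloor> / real den \<le> ?\<beta>" by (intro divide_right_mono) auto
    then show ?thesis using V_newton_discrete[of \<gamma>] V_newton_mono by simp
  qed
  then show "below V_newton \<alpha> \<subseteq> V_newton ?\<beta>" by (auto simp: below_def)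
qed

lemma below_V_newton_subspace: "forms.subspace (below V_newton \<alpha>)"
  unfolding below_V_newton by (rule V_newton_subspace)

lemma monomial_form_below: "of_int k + n c < \<alpha> \<Longrightarrow> monomial_form k c \<in> below V_newton \<alpha>"
  using monomial_form_filt[of k c "of_int k + n c"] form_filt_V_newton by (auto simp: below_def)

text \<open>The facets whose cone contains \<open>c\<close>; their number is the measure that drops
  in \<open>shift_monomial\<close>.\<close>

definition active_facets :: "int \<times> int \<Rightarrow> ((int \<times> int) \<times> (int \<times> int) \<times> real \<times> real) set" where
  "active_facets c = {(p, q, m). facet p q m \<and> m \<bullet> lp c = n c}"

lemma finite_active: "finite (active_facets c)"
  by (rule finite_subset[OF _ finite_facets]) (auto simp: active_facets_def)

text \<open>
  In the top degree the nilpotent operator \<open>\<tau>\<partial>\<^sub>\<tau> + \<alpha>\<close> replaces a monomial by monomials that lie in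
  fewer facet cones: subtract the relation that the functional of one of these facets gives.
\<close>

lemma shift_monomial:
  assumes k: "of_int k + n c = \<alpha>"
  shows "euler_shift f \<alpha> (monomial_form k c) \<in> forms.span (below V_newton \<alpha> \<union>
    {monomial_form i b | i b. of_int i + n b = \<alpha> \<and> card (active_facets b) < card (active_facets c)})"
    (is "_ \<in> forms.span ?S")
proof -
  obtain p q m where F: "facet p q m" "c \<in> sector p q" by (rule facet_cover_lattice)
  have mc: "m \<bullet> lp c = n c" using sector_iff[OF F(1)] F(2) by simp
  define L1 L2 :: complex where "L1 = of_real (fst m)" and "L2 = of_real (snd m)"
  have L: "L1 * of_int (fst a) + L2 * of_int (snd a) = of_real (m \<bullet> lp a)" for a
    by (simp add: L1_def L2_def inner_prod_def lattice_point_def)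
  \<comment> \<open>The derivative of \<open>f\<close> along the facet functional, minus
    \<open>f\<close>: each coefficient is multiplied by \<open>m \<bullet> lp a - 1\<close>, so the
    terms on the facet disappear.\<close>
  define q' :: laurent where "q' = scale_laurent L1 (euler1 f) + scale_laurent L2 (euler2 f) - f"
  have lq: "lookup q' a = of_real (m \<bullet> lp a - 1) * lookup f a" for a
  proof -
    have "lookup q' a = (L1 * of_int (fst a) + L2 * of_int (snd a)) * lookup f a - lookup f a"
      by (simp add: q'_def lookup_minus lookup_add lookup_scale_laurent lookup_euler1 lookup_euler2 algebra_simps)
    then show ?thesis unfolding L by (simp add: algebra_simps)
  qed
  define u where "u = Poly_Mapping.single c (1 :: complex)"
  \<comment> \<open>The relation of a form whose wedge with \<open>df\<close> is the derivative of
    \<open>f\<close> along \<open>m\<close>, times \<open>u\<close>; modulo it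
    \<open>- f * u\<close> is traded for \<open>q' * u\<close>.\<close>
  define r where "r = gm_map f (Poly_Mapping.single (k - 1) (- scale_laurent L2 u)) (Poly_Mapping.single (k - 1) (scale_laurent L1 u))"
  have eq: "euler_shift f \<alpha> (monomial_form k c) = r + Poly_Mapping.single (k - 1) (q' * u)"
  proof (rule poly_mapping_eqI)
    fix i
    have e: "euler1 (scale_laurent L1 u) + euler2 (scale_laurent L2 u) = Poly_Mapping.single c (of_real (n c))"
      unfolding u_def single_scale_laurent euler_single single_add[symmetric] using L[of c] mc by (simp add: mult.commute)
    have s: "Poly_Mapping.single 0 (of_real \<alpha>) * u = of_int k * u + Poly_Mapping.single c (of_real (n c))"
    proof -
      have "of_int k * u = Poly_Mapping.single 0 (of_int k) * u" by simp
      also have "\<dots> = Poly_Mapping.single c (of_int k)" unfolding u_def mult_single by simp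
      finally have "of_int k * u = Poly_Mapping.single c (of_int k)" .
      moreover have "Poly_Mapping.single 0 (of_real \<alpha>) * u = Poly_Mapping.single c (of_real \<alpha>)"
        unfolding u_def mult_single by simp
      ultimately show ?thesis unfolding k[symmetric] by (simp add: single_add)
    qed
    have w: "euler1 f * scale_laurent L1 u + euler2 f * scale_laurent L2 u = (q' + f) * u"
      by (simp add: q'_def scale_laurent_def algebra_simps)
    consider "i = k" | "i = k - 1" | "i \<noteq> k" "i \<noteq> k - 1" by blast
    then show "lookup (euler_shift f \<alpha> (monomial_form k c)) i = lookup (r + Poly_Mapping.single (k - 1) (q' * u)) i"
    proof cases
      case 1
      have "lookup (r + Poly_Mapping.single (k - 1) (q' * u)) i = euler1 (scale_laurent L1 u) + euler2 (scale_laurent L2 u)"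
        using 1 by (simp add: r_def lookup_add lookup_gm_map lookup_single when_def)
      moreover have "lookup (euler_shift f \<alpha> (monomial_form k c)) i = of_int (- k) * u + Poly_Mapping.single 0 (of_real \<alpha>) * u"
        using 1 by (simp add: euler_shift_def lookup_add lookup_tau_deriv_tau lookup_scale_forms lookup_single when_def u_def)
      ultimately show ?thesis unfolding e s by simp
    next
      case 2
      have "lookup (r + Poly_Mapping.single (k - 1) (q' * u)) i = q' * u - (euler1 f * scale_laurent L1 u + euler2 f * scale_laurent L2 u)"
        using 2 by (simp add: r_def lookup_add lookup_gm_map lookup_single when_def)
      moreover have "lookup (euler_shift f \<alpha> (monomial_form k c)) i = - (f * u)"
        using 2 by (simp add: euler_shift_def lookup_add lookup_tau_deriv_tau lookup_scale_forms lookup_single when_def u_def)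
      ultimately show ?thesis unfolding w by (simp add: algebra_simps)
    next
      case 3
      then show ?thesis
        by (auto simp: euler_shift_def r_def lookup_add lookup_tau_deriv_tau lookup_scale_forms lookup_gm_map lookup_single when_def)
    qed
  qed
  have "r \<in> below V_newton \<alpha>" unfolding below_V_newton r_def using gm_relations_V_newton gm_map_in by blast
  then have "r \<in> forms.span ?S" by (intro forms.span_base) simp
  moreover have "Poly_Mapping.single (k - 1) (q' * u) \<in> forms.span ?S"
  proof (rule single_form_in_subspace[OF forms.subspace_span])
    fix b assume "lookup (q' * u) b \<noteq> 0"
    then have "lookup q' (b - c) \<noteq> 0" by (simp add: u_def mult.commute[of q'] lookup_single_times)
    then have a: "lookup f (b - c) \<noteq> 0" "m \<bullet> lp (b - c) \<noteq> 1" by (auto simp: lq)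
    then have ak: "b - c \<in> keys f" by (simp add: in_keys_iff)
    have a1: "m \<bullet> lp (b - c) < 1" using facet_le_keys[OF F(1) ak] a(2) by simp
    have n1: "n (b - c) \<le> 1" by (rule n_keys[OF ak])
    have nb: "n b \<le> n (b - c) + n c" using n_add[of "b - c" c] by simp
    show "monomial_form (k - 1) b \<in> forms.span ?S"
    proof (cases "of_int (k - 1) + n b < \<alpha>")
      case True
      then show ?thesis using monomial_form_below by (intro forms.span_base) blast
    next
      case False
      then have b: "n b = n c + 1" using nb n1 k by simp
      have sub: "active_facets b \<subseteq> active_facets c"
      proof
        fix t assume "t \<in> active_facets b"
        then obtain p' q' m' where t: "t = (p', q', m')" "facet p' q' m'" "m' \<bullet> lp b = n b" by (auto simp: active_facets_def)
        have "m' \<bullet> lp b = m' \<bullet> lp (b - c) + m' \<bullet> lp c" by (simp add: lp_diff inner_diff_right)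
        then have "m' \<bullet> lp c = n c" using t(3) b facet_le_keys[OF t(2) ak] facet_le[OF t(2), of c] by linarith
        then show "t \<in> active_facets c" using t by (simp add: active_facets_def)
      qed
      have "(p, q, m) \<in> active_facets c" using F mc by (simp add: active_facets_def)
      moreover have "(p, q, m) \<notin> active_facets b"
      proof -
        have "m \<bullet> lp b = m \<bullet> lp (b - c) + m \<bullet> lp c" by (simp add: lp_diff inner_diff_right)
        then show ?thesis using a1 mc b by (simp add: active_facets_def)
      qed
      ultimately have "card (active_facets b) < card (active_facets c)"
        using sub by (intro psubset_card_mono[OF finite_active]) blast
      moreover have "of_int (k - 1) + n b = \<alpha>" using b k by simp
      ultimately show ?thesis by (intro forms.span_base) blast
    qed
  qed
  ultimately show ?thesis unfolding eq by (rule forms.span_add)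
qed

text \<open>By \<open>shift_monomial\<close> each application lowers the number of facet cones
  through the monomials of top degree. This number is positive and at most the number of facets,
  which bounds the exponent.\<close>

lemma V_newton_nilpotent: "\<exists>j. \<forall>x\<in>V_newton \<alpha>. (euler_shift f \<alpha> ^^ j) x \<in> below V_newton \<alpha>"
proof -
  define Y where "Y = (\<lambda>j. forms.span (below V_newton \<alpha> \<union> {monomial_form i b | i b. of_int i + n b = \<alpha> \<and> card (active_facets b) \<le> j}))"
  have pos: "card (active_facets b) > 0" for b
  proof -
    obtain p q m where F: "facet p q m" "b \<in> sector p q" by (rule facet_cover_lattice)
    then have "(p, q, m) \<in> active_facets b" using sector_iff[OF F(1)] by (simp add: active_facets_def)
    then show ?thesis using finite_active[of b] by (auto simp: card_gt_0_iff)
  qed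
  have Y0: "Y 0 = below V_newton \<alpha>"
  proof -
    have "{monomial_form i b | i b. of_int i + n b = \<alpha> \<and> card (active_facets b) \<le> 0} = {}"
    proof -
      have "\<not> card (active_facets b) \<le> 0" for b using pos[of b] by simp
      then show ?thesis by blast
    qed
    then have "Y 0 = forms.span (below V_newton \<alpha>)" by (simp only: Y_def Un_empty_right)
    then show ?thesis using forms.span_eq_iff[of "below V_newton \<alpha>"] below_V_newton_subspace by simp
  qed
  have step: "euler_shift f \<alpha> x \<in> Y j" if "x \<in> Y (Suc j)" for x j
  proof -
    have base: "euler_shift f \<alpha> x \<in> Y j" if "x \<in> below V_newton \<alpha> \<union> {monomial_form i b | i b. of_int i + n b = \<alpha> \<and> card (active_facets b) \<le> Suc j}" for x
      using that
    proof
      assume "x \<in> below V_newton \<alpha>"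
      then have "euler_shift f \<alpha> x \<in> below V_newton \<alpha>" unfolding below_V_newton by (rule shift_V_newton)
      then show ?thesis unfolding Y_def by (intro forms.span_base) blast
    next
      assume "x \<in> {monomial_form i b | i b. of_int i + n b = \<alpha> \<and> card (active_facets b) \<le> Suc j}"
      then obtain i b where x: "x = monomial_form i b" "of_int i + n b = \<alpha>" "card (active_facets b) \<le> Suc j" by blast
      have "forms.span (below V_newton \<alpha> \<union> {monomial_form i' b' | i' b'. of_int i' + n b' = \<alpha> \<and> card (active_facets b') < card (active_facets b)}) \<subseteq> Y j"
        unfolding Y_def by (rule forms.span_mono) (use x(3) in force)
      then show ?thesis using shift_monomial[OF x(2)] x(1) by blast
    qed
    have "x \<in> forms.span (below V_newton \<alpha> \<union> {monomial_form i b | i b. of_int i + n b = \<alpha> \<and> card (active_facets b) \<le> Suc j})"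
      using that unfolding Y_def .
    then show ?thesis
    proof (induction rule: forms.span_induct_alt)
      case base
      have "euler_shift f \<alpha> 0 = 0" using euler_shift_scale[of f \<alpha> 0 0] by simp
      then show ?case by (simp add: Y_def forms.span_zero)
    next
      case (step c x y)
      have "scale_forms c (euler_shift f \<alpha> x) + euler_shift f \<alpha> y \<in> Y j"
        using base[OF step(1)] step(2) unfolding Y_def by (intro forms.span_add forms.span_scale)
      then show ?case by (simp add: euler_shift_add euler_shift_scale)
    qed
  qed
  have iter: "x \<in> Y j \<Longrightarrow> (euler_shift f \<alpha> ^^ j) x \<in> Y 0" for x j
  proof (induction j arbitrary: x)
    case (Suc j)
    then have "(euler_shift f \<alpha> ^^ j) (euler_shift f \<alpha> x) \<in> Y 0" using step by blast
    then show ?case by (simp add: funpow_swap1)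
  qed simp
  define J where "J = card {(p, q, m). facet p q m}"
  have "V_newton \<alpha> \<subseteq> Y J"
  proof (rule V_newton_subset)
    show "forms.subspace (Y J)" unfolding Y_def by (rule forms.subspace_span)
    have "gm_relations f \<subseteq> below V_newton \<alpha>" unfolding below_V_newton by (rule gm_relations_V_newton)
    then show "gm_relations f \<subseteq> Y J" unfolding Y_def using forms.span_superset by blast
    fix k c assume le: "of_int k + n c \<le> \<alpha>"
    show "monomial_form k c \<in> Y J"
    proof (cases "of_int k + n c < \<alpha>")
      case True
      then show ?thesis unfolding Y_def using monomial_form_below by (intro forms.span_base) blast
    next
      case False
      have "card (active_facets c) \<le> J" unfolding J_def
        by (rule card_mono[OF finite_facets]) (auto simp: active_facets_def)
      moreover have "of_int k + n c = \<alpha>" using False le by linarith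
      ultimately show ?thesis unfolding Y_def by (intro forms.span_base) blast
    qed
  qed
  then show ?thesis using iter[of _ J] Y0 by blast
qed

text \<open>A monomial of degree above \<open>R\<close> is the top part of a wedge, and modulo the
  relations a wedge is a differential of smaller Newton degree with one more \<theta>. Repeating
  this leads to the finitely many monomials of degree at most \<open>R\<close>.\<close>

lemma V_newton_finitely_generated:
  assumes top: "\<And>\<gamma>. \<gamma> > R \<Longrightarrow> jacobian_part \<gamma> = homog \<gamma>"
  shows "\<exists>S. finite S \<and> V_newton \<alpha> = forms.span ({tau ^ k * x | k x. x \<in> S} \<union> gm_relations f)"
proof -
  \<comment> \<open>The floor is the largest power of \<theta> for which the monomial still has
    total degree at most \<open>\<alpha>\<close>; lower powers are reached by \<tau>.\<close>
  define S where "S = (\<lambda>c. monomial_form \<lfloor>\<alpha> - n c\<rfloor> c) ` {c. n c \<le> R}"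
  let ?X = "forms.span ({tau ^ k * x | k x. x \<in> S} \<union> gm_relations f)"
  have X: "forms.subspace ?X" by (rule forms.subspace_span)
  have BX: "gm_relations f \<subseteq> ?X" using forms.span_superset by blast
  have "?X \<subseteq> V_newton \<alpha>"
  proof (rule forms.span_minimal[OF _ V_newton_subspace])
    have "tau ^ k * x \<in> V_newton \<alpha>" if x: "x \<in> S" for k x
    proof -
      obtain c where c: "x = monomial_form \<lfloor>\<alpha> - n c\<rfloor> c" using x by (auto simp: S_def)
      have "of_int (\<lfloor>\<alpha> - n c\<rfloor> - int k) + n c \<le> \<alpha>" using of_int_floor_le[of "\<alpha> - n c"] unfolding of_int_diff of_int_of_nat_eq by linarith
      then show ?thesis unfolding c tau_monomial_form using monomial_form_filt form_filt_V_newton by blast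
    qed
    then show "{tau ^ k * x | k x. x \<in> S} \<union> gm_relations f \<subseteq> V_newton \<alpha>" using gm_relations_V_newton by blast
  qed
  moreover have mono_X: "of_int k + n c \<le> \<alpha> \<Longrightarrow> monomial_form k c \<in> ?X" for k c
  proof (induction "nat \<lfloor>n c * den\<rfloor>" arbitrary: k c rule: less_induct)
    case less
    show ?case
    proof (cases "n c \<le> R")
      case True
      define j where "j = nat (\<lfloor>\<alpha> - n c\<rfloor> - k)"
      have "k \<le> \<lfloor>\<alpha> - n c\<rfloor>" using less.prems by (simp add: le_floor_iff)
      then have "monomial_form k c = tau ^ j * monomial_form \<lfloor>\<alpha> - n c\<rfloor> c" unfolding tau_monomial_form by (simp add: j_def)
      moreover have "monomial_form \<lfloor>\<alpha> - n c\<rfloor> c \<in> S" using True by (auto simp: S_def)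
      ultimately show ?thesis by (intro forms.span_base) blast
    next
      case False
      define \<gamma> where "\<gamma> = n c"
      have lower: "Poly_Mapping.single i g \<in> ?X" if g: "\<And>b. lookup g b \<noteq> 0 \<Longrightarrow> of_int i + n b \<le> \<alpha> \<and> n b < \<gamma>" for i g
      proof (rule single_form_in_subspace[OF X])
        fix b assume b: "lookup g b \<noteq> 0"
        obtain j1 :: int where j1: "n b = of_int j1 / of_nat den" using n_den by blast
        obtain j2 :: int where j2: "n c = of_int j2 / of_nat den" using n_den by blast
        have "n b * den = of_int j1" "n c * den = of_int j2" using den_pos by (simp_all add: j1 j2)
        moreover have "j1 < j2" "0 \<le> j1"
          using g[OF b] n_nonneg[of b] den_pos by (simp_all add: \<gamma>_def j1 j2 divide_less_cancel zero_le_divide_iff)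
        ultimately have "nat \<lfloor>n b * den\<rfloor> < nat \<lfloor>n c * den\<rfloor>" by simp
        then show "monomial_form i b \<in> ?X" using less.hyps g[OF b] by blast
      qed
      have "Poly_Mapping.single c 1 \<in> homog \<gamma>" by (auto simp: homog_def \<gamma>_def lookup_single when_def split: if_splits)
      then have "Poly_Mapping.single c 1 \<in> jacobian_part \<gamma>" using top[of \<gamma>] False by (simp add: \<gamma>_def)
      then obtain g1 g2 where g: "g1 \<in> homog (\<gamma> - 1)" "g2 \<in> homog (\<gamma> - 1)" "Poly_Mapping.single c 1 = top_part \<gamma> (wedge g1 g2)"
        by (auto simp: jacobian_part_def graded_wedge_def)
      have gf: "g1 \<in> newton_filt (\<gamma> - 1)" "g2 \<in> newton_filt (\<gamma> - 1)" using g homog_newton_filt by blast+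
      have w: "wedge g1 g2 \<in> newton_filt \<gamma>" using wedge_newton_filt[OF gf] by simp
      define l where "l = wedge g1 g2 - top_part \<gamma> (wedge g1 g2)"
      have l: "l \<in> newton_filt_lt \<gamma>" unfolding l_def by (rule minus_top_part[OF w])
      define h where "h = euler1 g2 - euler2 g1"
      have h: "h \<in> newton_filt (\<gamma> - 1)" unfolding h_def using gf by (intro newton_filt_diff newton_filt_euler)
      let ?r = "gm_map f (Poly_Mapping.single k g1) (Poly_Mapping.single k g2)"
      have "monomial_form k c = Poly_Mapping.single (k + 1) h - Poly_Mapping.single k l - ?r"
      proof (rule poly_mapping_eqI)
        fix i
        consider "i = k" | "i = k + 1" | "i \<noteq> k" "i \<noteq> k + 1" by blast
        then show "lookup (monomial_form k c) i = lookup (Poly_Mapping.single (k + 1) h - Poly_Mapping.single k l - ?r) i"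
          by cases (simp_all add: lookup_minus lookup_gm_map lookup_single when_def h_def l_def g(3) wedge_def)
      qed
      moreover have "Poly_Mapping.single (k + 1) h \<in> ?X"
      proof (rule lower)
        fix b assume "lookup h b \<noteq> 0"
        then have "n b \<le> \<gamma> - 1" by (rule newton_filtD[OF h])
        then show "of_int (k + 1) + n b \<le> \<alpha> \<and> n b < \<gamma>" using less.prems by (simp add: \<gamma>_def)
      qed
      moreover have "Poly_Mapping.single k l \<in> ?X"
      proof (rule lower)
        fix b assume "lookup l b \<noteq> 0"
        then have "n b < \<gamma>" by (rule newton_filt_ltD[OF l])
        then show "of_int k + n b \<le> \<alpha> \<and> n b < \<gamma>" using less.prems by (simp add: \<gamma>_def)
      qed
      moreover have "?r \<in> ?X" using BX gm_map_in by blast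
      ultimately show ?thesis by (simp add: forms.subspace_diff[OF X])
    qed
  qed
  then have "V_newton \<alpha> \<subseteq> ?X" by (rule V_newton_subset[OF X BX])
  moreover have "finite S" unfolding S_def using finite_n_le by simp
  ultimately show ?thesis by blast
qed

theorem V_filtration_eq_V_newton:
  assumes top: "\<And>\<gamma>. \<gamma> > R \<Longrightarrow> jacobian_part \<gamma> = homog \<gamma>"
  shows "V_filtration f = V_newton"
proof -
  have is_V: "is_V_filtration f V_newton"
    unfolding is_V_filtration_def
  proof (intro conjI allI ballI)
    fix \<alpha>
    show "forms.subspace (V_newton \<alpha>)" by (rule V_newton_subspace)
    show "gm_relations f \<subseteq> V_newton \<alpha>" by (rule gm_relations_V_newton)
    show "\<exists>S. finite S \<and> V_newton \<alpha> = forms.span ({tau ^ k * x | k x. x \<in> S} \<union> gm_relations f)"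
      by (rule V_newton_finitely_generated[OF top])
    show "mono V_newton" by (rule monoI) (rule V_newton_mono)
    show "(\<Union>\<alpha>. V_newton \<alpha>) = UNIV" by (rule V_newton_UN)
    show "(\<lambda>x. tau * x) ` V_newton \<alpha> = V_newton (\<alpha> - 1)" by (rule tau_V_newton)
    show "V_newton \<alpha> = (\<Inter>\<beta>\<in>{\<alpha><..}. V_newton \<beta>)" by (rule V_newton_right_continuous)
    show "tau * deriv_tau f x \<in> V_newton \<alpha>" if "x \<in> V_newton \<alpha>" for x using that by (rule deriv_V_newton)
    show "\<exists>j. \<forall>x\<in>V_newton \<alpha>. ((\<lambda>y. tau * deriv_tau f y + scale_forms (of_real \<alpha>) y) ^^ j) x \<in> below V_newton \<alpha>"
      using V_newton_nilpotent[of \<alpha>] unfolding euler_shift_def[abs_def] .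
  qed
  have unique: "V = V_newton" if "is_V_filtration f V" for V
  proof (rule V_filtration_unique)
    show "V_filtration_of f V_newton" using is_V by (rule V_filtration_of.intro)
    show "V_filtration_of f V" using that by (rule V_filtration_of.intro)
    show "den > 0" by (rule den_pos)
    show "V_newton \<alpha> = V_newton (of_int \<lfloor>\<alpha> * real den\<rfloor> / real den)" for \<alpha> by (rule V_newton_discrete)
  qed
  show ?thesis unfolding V_filtration_def
  proof (rule the_equality)
    show "is_V_filtration f V_newton" by (rule is_V)
    show "V = V_newton" if "is_V_filtration f V" for V using that by (rule unique)
  qed
qed

theorem spectral_multiplicity_eq:
  assumes top: "\<And>\<gamma>. \<gamma> > R \<Longrightarrow> jacobian_part \<gamma> = homog \<gamma>"
  shows "int (spectral_multiplicity f \<alpha>) =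
    int (card (level \<alpha>)) - 2 * int (card (level (\<alpha> - 1))) + int (card (level (\<alpha> - 2)))"
proof -
  have V: "V_filtration f = V_newton" by (rule V_filtration_eq_V_newton[OF top])
  have "spectral_multiplicity f \<alpha> = card (level \<alpha>) - laurent.dim (jacobian_part \<alpha>)"
    unfolding spectral_multiplicity_def V induced_V_newton induced_below_V_newton
    by (rule quot_dim_omega(1))
  then show ?thesis using quot_dim_omega(2)[of \<alpha>] dim_jacobian_part[of \<alpha>] by linarith
qed

end

section \<open>Moments of the spectrum\<close>

text \<open>After multiplication by \<open>exp t\<close> the factor in front of \<open>L t\<close>
  expands as t^2 + t^4/12. So the exponential sum in \<open>\<gamma> - 1\<close> is
  \<open>A + (A / 12 + C) * t\<^sup>2\<close> up to smaller terms, and also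
  \<open>M0 - M1 * t + M2 * t\<^sup>2 / 2\<close>; the coefficients are compared one after
  another.\<close>

lemma exp_sum_moments:
  fixes m :: "real \<Rightarrow> real" and A C :: real
  assumes G: "finite \<Gamma>"
    and eq: "\<And>t. t > 0 \<Longrightarrow> (\<Sum>\<gamma>\<in>\<Gamma>. m \<gamma> * exp (- t * \<gamma>)) = (1 - exp (- t))\<^sup>2 * L t"
    and L: "((\<lambda>t. L t - (A / t\<^sup>2 + C)) \<longlongrightarrow> 0) (at_right 0)"
  shows "(\<Sum>\<gamma>\<in>\<Gamma>. m \<gamma>) = A" "(\<Sum>\<gamma>\<in>\<Gamma>. m \<gamma> * (\<gamma> - 1)\<^sup>2) = A / 6 + 2 * C"
proof -
  define M0 where "M0 = (\<Sum>\<gamma>\<in>\<Gamma>. m \<gamma>)"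
  define M1 where "M1 = (\<Sum>\<gamma>\<in>\<Gamma>. m \<gamma> * (\<gamma> - 1))"
  define M2 where "M2 = (\<Sum>\<gamma>\<in>\<Gamma>. m \<gamma> * (\<gamma> - 1)\<^sup>2)"
  define S where "S t = (\<Sum>\<gamma>\<in>\<Gamma>. m \<gamma> * exp (- t * (\<gamma> - 1)))" for t
  have S: "S t = exp t * (1 - exp (- t))\<^sup>2 * L t" if "t > 0" for t
  proof -
    have "S t = exp t * (\<Sum>\<gamma>\<in>\<Gamma>. m \<gamma> * exp (- t * \<gamma>))"
      unfolding S_def sum_distrib_left by (rule sum.cong[OF refl]) (simp add: algebra_simps exp_diff exp_add exp_minus field_simps)
    then show ?thesis using eq[OF that] by simp
  qed
  have lhs: "((\<lambda>t. (S t - M0 + t * M1) / t\<^sup>2) \<longlongrightarrow> M2 / 2) (at_right 0)"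
  proof -
    have "((\<lambda>t. \<Sum>\<gamma>\<in>\<Gamma>. m \<gamma> * ((exp (- t * (\<gamma> - 1)) - 1 + t * (\<gamma> - 1)) / t\<^sup>2)) \<longlongrightarrow> (\<Sum>\<gamma>\<in>\<Gamma>. m \<gamma> * ((\<gamma> - 1)\<^sup>2 / 2))) (at_right 0)"
    proof (intro tendsto_sum tendsto_mult tendsto_const)
      fix \<gamma> :: real
      have "((\<lambda>t. (exp (- t * x) - 1 + t * x) / t\<^sup>2) \<longlongrightarrow> x\<^sup>2 / 2) (at_right 0)" for x :: real
        unfolding power2_eq_square by real_asymp
      then show "((\<lambda>t. (exp (- t * (\<gamma> - 1)) - 1 + t * (\<gamma> - 1)) / t\<^sup>2) \<longlongrightarrow> (\<gamma> - 1)\<^sup>2 / 2) (at_right 0)" .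
    qed
    moreover have "(\<Sum>\<gamma>\<in>\<Gamma>. m \<gamma> * ((exp (- t * (\<gamma> - 1)) - 1 + t * (\<gamma> - 1)) / t\<^sup>2)) = (S t - M0 + t * M1) / t\<^sup>2" for t
      unfolding S_def M0_def M1_def sum_distrib_left sum_subtractf[symmetric] sum.distrib[symmetric] sum_divide_distrib
      by (rule sum.cong[OF refl]) (simp add: algebra_simps)
    ultimately show ?thesis by (simp add: M2_def sum_divide_distrib)
  qed
  have rhs: "((\<lambda>t. (S t - A) / t\<^sup>2) \<longlongrightarrow> A / 12 + C) (at_right 0)"
  proof -
    have 1: "((\<lambda>t::real. exp t * (1 - exp (- t))\<^sup>2 / t\<^sup>2) \<longlongrightarrow> 1) (at_right 0)" by real_asymp
    have 2: "((\<lambda>t::real. (exp t * (1 - exp (- t))\<^sup>2 / t\<^sup>2 - 1) / t\<^sup>2) \<longlongrightarrow> 1 / 12) (at_right 0)" by real_asymp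
    have "((\<lambda>t. A * ((exp t * (1 - exp (- t))\<^sup>2 / t\<^sup>2 - 1) / t\<^sup>2) + (exp t * (1 - exp (- t))\<^sup>2 / t\<^sup>2) * (C + (L t - (A / t\<^sup>2 + C))))
        \<longlongrightarrow> A * (1 / 12) + 1 * (C + 0)) (at_right 0)"
      by (intro tendsto_intros 1 2 L)
    moreover have "\<forall>\<^sub>F t in at_right 0. A * ((exp t * (1 - exp (- t))\<^sup>2 / t\<^sup>2 - 1) / t\<^sup>2) + (exp t * (1 - exp (- t))\<^sup>2 / t\<^sup>2) * (C + (L t - (A / t\<^sup>2 + C)))
      = (S t - A) / t\<^sup>2"
      unfolding eventually_at_right_field
    proof (intro exI[of _ 1] conjI allI impI)
      fix t :: real assume t: "t > 0"
      have id: "A * ((E / t\<^sup>2 - 1) / t\<^sup>2) + (E / t\<^sup>2) * (C + (l - (A / t\<^sup>2 + C))) = (E * l - A) / t\<^sup>2" for E l :: real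
        by (simp add: algebra_simps diff_divide_distrib)
      show "A * ((exp t * (1 - exp (- t))\<^sup>2 / t\<^sup>2 - 1) / t\<^sup>2) + (exp t * (1 - exp (- t))\<^sup>2 / t\<^sup>2) * (C + (L t - (A / t\<^sup>2 + C)))
        = (S t - A) / t\<^sup>2"
        unfolding id S[OF t] ..
    qed simp
    ultimately show ?thesis using tendsto_cong by fastforce
  qed
  \<comment> \<open>This quotient converges; multiplied by \<open>t\<^sup>2\<close> it shows
    \<open>M0 = A\<close>, and then multiplied by \<open>t\<close> that
    \<open>M1 = 0\<close>.\<close>
  have diff: "((\<lambda>t. (t * M1 + (A - M0)) / t\<^sup>2) \<longlongrightarrow> M2 / 2 - (A / 12 + C)) (at_right 0)"
    using tendsto_diff[OF lhs rhs] by (simp add: diff_divide_distrib[symmetric] algebra_simps)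
  have pos: "\<forall>\<^sub>F t in at_right (0::real). t > 0" by (rule eventually_at_right_less)
  have M0: "M0 = A"
  proof -
    have "((\<lambda>t. t\<^sup>2 * ((t * M1 + (A - M0)) / t\<^sup>2)) \<longlongrightarrow> 0\<^sup>2 * (M2 / 2 - (A / 12 + C))) (at_right 0)"
      by (intro tendsto_mult tendsto_power diff tendsto_ident_at)
    moreover have "\<forall>\<^sub>F t in at_right 0. t\<^sup>2 * ((t * M1 + (A - M0)) / t\<^sup>2) = t * M1 + (A - M0)"
      using pos by eventually_elim simp
    ultimately have "((\<lambda>t. t * M1 + (A - M0)) \<longlongrightarrow> 0) (at_right 0)" using tendsto_cong by fastforce
    moreover have "((\<lambda>t. t * M1 + (A - M0)) \<longlongrightarrow> 0 * M1 + (A - M0)) (at_right 0)" by (intro tendsto_intros)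
    ultimately have "0 = 0 * M1 + (A - M0)" by (rule tendsto_unique[rotated]) simp
    then show ?thesis by simp
  qed
  have M1: "M1 = 0"
  proof -
    have "((\<lambda>t. t * ((t * M1 + (A - M0)) / t\<^sup>2)) \<longlongrightarrow> 0 * (M2 / 2 - (A / 12 + C))) (at_right 0)"
      by (intro tendsto_mult diff tendsto_ident_at)
    moreover have "\<forall>\<^sub>F t in at_right 0. t * ((t * M1 + (A - M0)) / t\<^sup>2) = M1"
      using pos by eventually_elim (simp add: M0 power2_eq_square)
    ultimately have "((\<lambda>t::real. M1) \<longlongrightarrow> 0) (at_right 0)" using tendsto_cong by fastforce
    then show ?thesis by (simp add: tendsto_const_iff)
  qed
  have "((\<lambda>t::real. 0) \<longlongrightarrow> M2 / 2 - (A / 12 + C)) (at_right 0)" using diff by (simp add: M0 M1)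
  then have "M2 / 2 - (A / 12 + C) = 0" by (simp add: tendsto_const_iff)
  then show "(\<Sum>\<gamma>\<in>\<Gamma>. m \<gamma> * (\<gamma> - 1)\<^sup>2) = A / 6 + 2 * C" by (simp add: M2_def[symmetric])
  show "(\<Sum>\<gamma>\<in>\<Gamma>. m \<gamma>) = A" using M0 by (simp add: M0_def)
qed

text \<open>The sum is regrouped along the fibres of \<open>w\<close>.\<close>

lemma level_sum:
  fixes w :: "'a \<Rightarrow> real"
  assumes levels: "\<And>\<gamma>. finite {p. w p = \<gamma>}"
    and summ: "(\<lambda>p. exp (- t * w p)) summable_on UNIV"
  shows "((\<lambda>\<gamma>. real (card {p. w p = \<gamma>}) * exp (- t * \<gamma>)) has_sum (\<Sum>\<^sub>\<infinity>p. exp (- t * w p))) UNIV"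
proof -
  let ?S = "Sigma UNIV (\<lambda>\<gamma>. {p. w p = \<gamma>})"
  have bij: "bij_betw (\<lambda>p. (w p, p)) UNIV ?S"
    by (rule bij_betw_byWitness[where f' = snd]) auto
  have "((\<lambda>p. exp (- t * w p)) has_sum (\<Sum>\<^sub>\<infinity>p. exp (- t * w p))) UNIV" using summ by (rule has_sum_infsum)
  then have "((\<lambda>q. exp (- t * fst q)) has_sum (\<Sum>\<^sub>\<infinity>p. exp (- t * w p))) ?S"
    using has_sum_reindex_bij_betw[OF bij, of "\<lambda>q. exp (- t * fst q)"] by simp
  then show ?thesis
  proof (rule has_sum_SigmaD)
    fix \<gamma>
    have "((\<lambda>p. exp (- t * \<gamma>)) has_sum (\<Sum>p | w p = \<gamma>. exp (- t * \<gamma>))) {p. w p = \<gamma>}"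
      by (rule has_sum_finite[OF levels])
    then show "((\<lambda>p. exp (- t * fst (\<gamma>, p))) has_sum real (card {p. w p = \<gamma>}) * exp (- t * \<gamma>)) {p. w p = \<gamma>}" by simp
  qed
qed

text \<open>Shifting the level by \<open>c\<close> multiplies the exponential sum by
  \<open>exp (- t * c)\<close>, so the second difference becomes the factor
  \<open>(1 - exp (- t))\<^sup>2\<close>.\<close>

lemma second_difference_sum:
  fixes w :: "'a \<Rightarrow> real" and m :: "real \<Rightarrow> nat"
  assumes levels: "\<And>\<gamma>. finite {p. w p = \<gamma>}"
    and summ: "(\<lambda>p. exp (- t * w p)) summable_on UNIV"
    and m: "\<And>\<gamma>. m \<gamma> + 2 * card {p. w p = \<gamma> - 1} = card {p. w p = \<gamma>} + card {p. w p = \<gamma> - 2}"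
  shows "((\<lambda>\<gamma>. real (m \<gamma>) * exp (- t * \<gamma>)) has_sum (1 - exp (- t))\<^sup>2 * (\<Sum>\<^sub>\<infinity>p. exp (- t * w p))) UNIV"
proof -
  define N where "N \<gamma> = real (card {p. w p = \<gamma>}) * exp (- t * \<gamma>)" for \<gamma>
  let ?L = "\<Sum>\<^sub>\<infinity>p. exp (- t * w p)"
  have N: "(N has_sum ?L) UNIV" unfolding N_def using levels summ by (rule level_sum)
  have bij: "bij_betw (\<lambda>\<gamma>. \<gamma> - c) UNIV (UNIV :: real set)" for c
    by (rule bij_betw_byWitness[where f' = "\<lambda>\<gamma>. \<gamma> + c"]) auto
  have shift: "((\<lambda>\<gamma>. N (\<gamma> - c)) has_sum ?L) UNIV" for c
    using has_sum_reindex_bij_betw[OF bij, of N] N by simp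
  have "((\<lambda>\<gamma>. N \<gamma> + (- 2 * exp (- t)) * N (\<gamma> - 1) + exp (- 2 * t) * N (\<gamma> - 2)) has_sum
      ?L + (- 2 * exp (- t)) * ?L + exp (- 2 * t) * ?L) UNIV"
    by (intro has_sum_add has_sum_cmult_right N shift)
  moreover have "N \<gamma> + (- 2 * exp (- t)) * N (\<gamma> - 1) + exp (- 2 * t) * N (\<gamma> - 2) = real (m \<gamma>) * exp (- t * \<gamma>)" for \<gamma>
  proof -
    have e: "exp (- t) * exp (- t * (\<gamma> - 1)) = exp (- t * \<gamma>)" "exp (- 2 * t) * exp (- t * (\<gamma> - 2)) = exp (- t * \<gamma>)"
      by (simp_all add: exp_add[symmetric] algebra_simps)
    have mr: "real (m \<gamma>) = real (card {p. w p = \<gamma>}) - 2 * real (card {p. w p = \<gamma> - 1}) + real (card {p. w p = \<gamma> - 2})"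
      using arg_cong[OF m[of \<gamma>], of real] by simp
    have "exp (- t) * N (\<gamma> - 1) = real (card {p. w p = \<gamma> - 1}) * exp (- t * \<gamma>)"
      unfolding N_def e(1)[symmetric] by (simp only: mult.left_commute)
    moreover have "exp (- 2 * t) * N (\<gamma> - 2) = real (card {p. w p = \<gamma> - 2}) * exp (- t * \<gamma>)"
      unfolding N_def e(2)[symmetric] by (simp only: mult.left_commute)
    ultimately show ?thesis unfolding mr by (simp add: N_def[of \<gamma>] algebra_simps)
  qed
  moreover have "?L + (- 2 * exp (- t)) * ?L + exp (- 2 * t) * ?L = (1 - exp (- t))\<^sup>2 * ?L"
    by (simp add: power2_eq_square algebra_simps exp_add[symmetric])
  ultimately show ?thesis by simp
qed

text \<open>As the values are natural numbers, a finite set of \<open>\<gamma>\<close> with nonzero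
  \<open>m \<gamma>\<close> contributes at least its cardinality in the limit, while the whole sum
  tends to \<open>A\<close>; so \<open>A\<close> bounds all these cardinalities.\<close>

lemma finite_second_difference:
  fixes w :: "'a \<Rightarrow> real" and m :: "real \<Rightarrow> nat"
  assumes levels: "\<And>\<gamma>. finite {p. w p = \<gamma>}"
    and summ: "\<And>t. t > 0 \<Longrightarrow> (\<lambda>p. exp (- t * w p)) summable_on UNIV"
    and lim: "((\<lambda>t. (\<Sum>\<^sub>\<infinity>p. exp (- t * w p)) - (A / t\<^sup>2 + C)) \<longlongrightarrow> 0) (at_right 0)"
    and m: "\<And>\<gamma>. m \<gamma> + 2 * card {p. w p = \<gamma> - 1} = card {p. w p = \<gamma>} + card {p. w p = \<gamma> - 2}"
  shows "finite {\<gamma>. m \<gamma> \<noteq> 0}"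
proof -
  define L where "L t = (\<Sum>\<^sub>\<infinity>p. exp (- t * w p))" for t
  have lim0: "((\<lambda>t. (1 - exp (- t))\<^sup>2 * L t) \<longlongrightarrow> A) (at_right 0)"
  proof -
    have 1: "((\<lambda>t::real. (1 - exp (- t))\<^sup>2 * (A / t\<^sup>2 + C)) \<longlongrightarrow> A) (at_right 0)" by real_asymp
    have 2: "((\<lambda>t::real. (1 - exp (- t))\<^sup>2) \<longlongrightarrow> 0) (at_right 0)" by real_asymp
    show ?thesis using tendsto_add[OF tendsto_mult[OF 2 lim] 1] by (simp add: L_def algebra_simps)
  qed
  have "card \<Gamma> \<le> nat \<lfloor>A\<rfloor>" if G: "\<Gamma> \<subseteq> {\<gamma>. m \<gamma> \<noteq> 0}" "finite \<Gamma>" for \<Gamma>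
  proof -
    have "real (card \<Gamma>) \<le> A"
    proof (rule tendsto_le[OF _ lim0])
      show "((\<lambda>t. \<Sum>\<gamma>\<in>\<Gamma>. exp (- t * \<gamma>)) \<longlongrightarrow> real (card \<Gamma>)) (at_right 0)"
      proof -
        have "((\<lambda>t. \<Sum>\<gamma>\<in>\<Gamma>. exp (- t * \<gamma>)) \<longlongrightarrow> (\<Sum>\<gamma>\<in>\<Gamma>. exp (- 0 * \<gamma>))) (at_right 0)" by (intro tendsto_intros)
        then show ?thesis by simp
      qed
      show "\<forall>\<^sub>F t in at_right 0. (\<Sum>\<gamma>\<in>\<Gamma>. exp (- t * \<gamma>)) \<le> (1 - exp (- t))\<^sup>2 * L t"
        using eventually_at_right_less[of 0]
      proof eventually_elim
        case (elim t)
        have "exp (- t * \<gamma>) \<le> real (m \<gamma>) * exp (- t * \<gamma>)" if "\<gamma> \<in> \<Gamma>" for \<gamma>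
        proof -
          have "1 \<le> real (m \<gamma>)" using that G(1) by auto
          then show ?thesis using mult_right_mono[of 1 "real (m \<gamma>)" "exp (- t * \<gamma>)"] by simp
        qed
        then have "(\<Sum>\<gamma>\<in>\<Gamma>. exp (- t * \<gamma>)) \<le> (\<Sum>\<gamma>\<in>\<Gamma>. real (m \<gamma>) * exp (- t * \<gamma>))" by (rule sum_mono)
        also have "\<dots> \<le> (1 - exp (- t))\<^sup>2 * L t"
          unfolding L_def
          by (rule finite_sum_le_has_sum[OF second_difference_sum[OF levels summ[OF elim] m] G(2)]) auto
        finally show ?case .
      qed
    qed simp
    then show ?thesis by (simp add: le_nat_floor)
  qed
  then show ?thesis using finite_if_finite_subsets_card_bdd[of "{\<gamma>. m \<gamma> \<noteq> 0}" "nat \<lfloor>A\<rfloor>"] by blast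
qed

theorem second_difference_moments:
  fixes w :: "'a \<Rightarrow> real" and m :: "real \<Rightarrow> nat"
  assumes levels: "\<And>\<gamma>. finite {p. w p = \<gamma>}"
    and summ: "\<And>t. t > 0 \<Longrightarrow> (\<lambda>p. exp (- t * w p)) summable_on UNIV"
    and lim: "((\<lambda>t. (\<Sum>\<^sub>\<infinity>p. exp (- t * w p)) - (A / t\<^sup>2 + C)) \<longlongrightarrow> 0) (at_right 0)"
    and m: "\<And>\<gamma>. m \<gamma> + 2 * card {p. w p = \<gamma> - 1} = card {p. w p = \<gamma>} + card {p. w p = \<gamma> - 2}"
  shows "(\<Sum>\<gamma> | m \<gamma> \<noteq> 0. real (m \<gamma>)) = A"
    and "(\<Sum>\<gamma> | m \<gamma> \<noteq> 0. real (m \<gamma>) * (\<gamma> - 1)\<^sup>2) = A / 6 + 2 * C"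
proof -
  have fin: "finite {\<gamma>. m \<gamma> \<noteq> 0}" by (rule finite_second_difference[OF levels summ lim m])
  have eq: "(\<Sum>\<gamma> | m \<gamma> \<noteq> 0. real (m \<gamma>) * exp (- t * \<gamma>)) = (1 - exp (- t))\<^sup>2 * (\<Sum>\<^sub>\<infinity>p. exp (- t * w p))" if "t > 0" for t
  proof -
    have "((\<lambda>\<gamma>. real (m \<gamma>) * exp (- t * \<gamma>)) has_sum (\<Sum>\<gamma> | m \<gamma> \<noteq> 0. real (m \<gamma>) * exp (- t * \<gamma>))) {\<gamma>. m \<gamma> \<noteq> 0}"
      by (rule has_sum_finite[OF fin])
    then have "((\<lambda>\<gamma>. real (m \<gamma>) * exp (- t * \<gamma>)) has_sum (\<Sum>\<gamma> | m \<gamma> \<noteq> 0. real (m \<gamma>) * exp (- t * \<gamma>))) UNIV"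
      by (subst has_sum_cong_neutral[where S = UNIV and T = "{\<gamma>. m \<gamma> \<noteq> 0}"]) auto
    then show ?thesis using second_difference_sum[OF levels summ[OF that] m] by (rule has_sum_unique)
  qed
  show "(\<Sum>\<gamma> | m \<gamma> \<noteq> 0. real (m \<gamma>)) = A"
    and "(\<Sum>\<gamma> | m \<gamma> \<noteq> 0. real (m \<gamma>) * (\<gamma> - 1)\<^sup>2) = A / 6 + 2 * C"
    using exp_sum_moments[OF fin eq lim] by simp_all
qed

section \<open>Application to Fano Newton polygons\<close>

lemma normalized_volume_pos:
  assumes "compact P" "interior P \<noteq> {}" shows "normalized_volume P > 0"
proof -
  obtain x r where r: "r > 0" "ball x r \<subseteq> P" using assms(2) by (auto simp: mem_interior)
  have "0 < measure lborel (ball x r)" using r(1) by (rule content_ball_pos)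
  also have "\<dots> \<le> measure lborel P"
    using r(2) fmeasurable_compact[OF assms(1)] by (intro measure_mono_fmeasurable) auto
  finally show ?thesis by (simp add: normalized_volume_def)
qed

text \<open>A compact convex set is the hull of its extreme points by Krein, Milman and Minkowski;
  here these are exactly the lattice points of \<open>E\<close>.\<close>

lemma Fano_newton_polygon:
  assumes "nondegenerate f" "convenient f" "fano_polytope (newton_polytope f)"
  defines "E \<equiv> {a. lattice_point a extreme_point_of newton_polytope f}"
  shows "fano_polygon E (newton_polytope f)" "newton_polygon E (newton_polytope f) f"
proof -
  let ?P = "newton_polytope f"
  have extreme: "x \<in> lattice_point ` E" if "x extreme_point_of ?P" for x
    using that extreme_point_of_convex_hull[of x "lattice_point ` keys f"] by (auto simp: E_def newton_polytope_def)
  have compact: "compact ?P" unfolding newton_polytope_def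
    by (intro finite_imp_compact_convex_hull finite_imageI finite_keys)
  have polygon: "polygon E ?P"
  proof
    have "E \<subseteq> keys f"
    proof
      fix a assume "a \<in> E"
      then have "lattice_point a \<in> lattice_point ` keys f"
        using extreme_point_of_convex_hull by (auto simp: E_def newton_polytope_def)
      then show "a \<in> keys f" by auto
    qed
    then show "finite E" by (rule finite_subset) simp
    have "{x. x extreme_point_of ?P} = lattice_point ` E" using extreme by (auto simp: E_def)
    moreover have "convex ?P" by (simp add: newton_polytope_def)
    ultimately show "?P = convex hull (lattice_point ` E)" using Krein_Milman_Minkowski[OF compact] by simp
    show "0 \<in> interior ?P" using assms(2) by (simp add: convenient_def)
    show "lattice_point e extreme_point_of ?P" if "e \<in> E" for e using that by (simp add: E_def)
  qed
  show "newton_polygon E ?P f"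
    using polygon assms(1) by (simp add: newton_polygon_def newton_polygon_axioms_def)
  have "coprime (fst e) (snd e)" if e: "e \<in> E" for e
  proof -
    obtain a where "lattice_point e = lattice_point a" "coprime (fst a) (snd a)"
      using assms(3) e unfolding fano_polytope_def E_def by blast
    then show ?thesis by simp
  qed
  then show "fano_polygon E ?P" using polygon by (simp add: fano_polygon_def fano_polygon_axioms_def)
qed

theorem corollary8p4:
  fixes f :: laurent and \<alpha> :: "nat \<Rightarrow> real"
  assumes "nondegenerate f"
    and "convenient f"
    and "is_spectrum_at_infinity f \<alpha>"
    and "fano_polytope (newton_polytope f)"
  shows "(\<Sum>i = 1..milnor_number f. (\<alpha> i - 1)\<^sup>2) =
           normalized_volume (newton_polytope f) / 6
           + normalized_volume (polar_polytope (newton_polytope f)) / 6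
         \<and> 1 / real (milnor_number f) * (\<Sum>i = 1..milnor_number f. (\<alpha> i - 1)\<^sup>2) \<ge> 1 / 6"
proof -
  let ?P = "newton_polytope f" and ?I = "{1..milnor_number f}"
  define E where "E = {a. lattice_point a extreme_point_of newton_polytope f}"
  interpret newton_polygon E ?P f
    unfolding E_def using assms by (intro Fano_newton_polygon)
  interpret fano: fano_polygon E ?P
    unfolding E_def using assms by (intro Fano_newton_polygon)
  define A where "A = normalized_volume ?P"
  define C where "C = normalized_volume (polar_polytope ?P) / 12"
  define m where "m \<gamma> = card (level \<gamma>) - laurent.dim (jacobian_part \<gamma>)" for \<gamma>
  define w where "w p = nu (lattice_point p)" for p
  have level: "level \<gamma> = {p. w p = \<gamma>}" for \<gamma> by (simp add: level_def w_def)
  have levels: "finite {p. w p = \<gamma>}" for \<gamma> using finite_level[of \<gamma>] by (simp add: level)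
  have summ: "(\<lambda>p. exp (- t * w p)) summable_on UNIV" if "t > 0" for t
    using fano.lattice_sum_expansion(1)[OF that] by (simp add: w_def)
  have lim: "((\<lambda>t. (\<Sum>\<^sub>\<infinity>p. exp (- t * w p)) - (A / t\<^sup>2 + C)) \<longlongrightarrow> 0) (at_right 0)"
    using fano.lattice_sum_expansion(2) by (simp add: w_def A_def C_def)
  have m: "m \<gamma> + 2 * card {p. w p = \<gamma> - 1} = card {p. w p = \<gamma>} + card {p. w p = \<gamma> - 2}" for \<gamma>
    using dim_jacobian_part[of \<gamma>] quot_dim_omega(2)[of \<gamma>] unfolding m_def level by linarith
  have fin: "finite {\<gamma>. m \<gamma> \<noteq> 0}" by (rule finite_second_difference[OF levels summ lim m])
  \<comment> \<open>Finiteness comes from the lattice sum; above \<open>R\<close> the Jacobian part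
    is everything, which gives the finite generation of \<open>V_newton\<close>.\<close>
  then obtain R where R: "\<And>\<gamma>. m \<gamma> \<noteq> 0 \<Longrightarrow> \<gamma> \<le> R"
    using bdd_above_finite[OF fin] unfolding bdd_above_def by blast
  have top: "jacobian_part \<gamma> = homog \<gamma>" if "\<gamma> > R" for \<gamma>
  proof (rule quot_dim_omega(3))
    have "m \<gamma> = 0" using R[of \<gamma>] that by (meson not_le)
    then show "laurent.dim (jacobian_part \<gamma>) = card (level \<gamma>)" using quot_dim_omega(2)[of \<gamma>] by (simp add: m_def)
  qed
  have "int (spectral_multiplicity f \<gamma>) = int (m \<gamma>)" for \<gamma>
    using spectral_multiplicity_eq[where R = R and \<alpha> = \<gamma>, OF top] m[of \<gamma>] unfolding level by linarith
  then have spec: "card {i \<in> ?I. \<alpha> i = \<gamma>} = m \<gamma>" for \<gamma>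
    using assms(3) by (simp add: is_spectrum_at_infinity_def)
  have sub: "\<alpha> ` ?I \<subseteq> {\<gamma>. m \<gamma> \<noteq> 0}"
  proof
    fix \<gamma> assume "\<gamma> \<in> \<alpha> ` ?I"
    then have "{i \<in> ?I. \<alpha> i = \<gamma>} \<noteq> {}" by blast
    then have "card {i \<in> ?I. \<alpha> i = \<gamma>} \<noteq> 0" by simp
    then show "\<gamma> \<in> {\<gamma>. m \<gamma> \<noteq> 0}" unfolding spec by simp
  qed
  have sums: "(\<Sum>i\<in>?I. h (\<alpha> i)) = (\<Sum>\<gamma> | m \<gamma> \<noteq> 0. real (m \<gamma>) * h \<gamma>)" for h
    using sum_fun_comp[OF _ fin sub, of h] unfolding spec by simp
  note moments = second_difference_moments[OF levels summ lim m]
  \<comment> \<open>Summing the constant 1 over the index range gives the sum of the multiplicities,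
    which the zeroth moment identifies with the volume.\<close>
  have mu: "real (milnor_number f) = A" using sums[of "\<lambda>_. 1"] moments(1) by simp
  have first: "(\<Sum>i\<in>?I. (\<alpha> i - 1)\<^sup>2) = A / 6 + 2 * C" using sums[of "\<lambda>\<gamma>. (\<gamma> - 1)\<^sup>2"] moments(2) by simp
  have "A > 0" unfolding A_def using compact_P zero_int by (intro normalized_volume_pos) auto
  moreover have "C \<ge> 0" by (simp add: C_def normalized_volume_def)
  ultimately have "1 / A * (A / 6 + 2 * C) \<ge> 1 / 6" by (simp add: field_simps)
  then show ?thesis unfolding first mu by (simp add: A_def C_def)
qed

end
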